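(* Let $N\ge 0$, $K=\{k_0,\dots,k_N\}$ and $L=\{k_0,\dots,k_N,k_{N+1}\}$. Consider the Hurwitz--Frobenius manifolds $\mathcal H_{0;K}$ and $\mathcal H_{0;L}$ with flat coordinates $t_{i,\alpha}$ and potentials $\mathcal F^K$, $\mathcal F^L$. (i) The Dubrovin--Frobenius manifold product and pairing of $\mathcal H_{0;L}$ extend to the locus $t_{N+1,1}=\dots=t_{N+1,k_{N+1}}=0$. (ii) Let $k_{N+1}\ge 2$. Then the product over this locus coincides with the open extension of the Hurwitz--Frobenius manifold $\mathcal H_{0;K}$. The respective open WDVV solution is given by the pair $$(F^c,F^o):=\left(\mathcal F^K,\ \left.\frac{\partial\mathcal F^L}{\partial t_{N+1,1}}\right|_{t_{N+1,1}=\dots=t_{N+1,k_{N+1}}=0}\right),$$ where the additional variable of the open WDVV equation is $t_{N+1,0}$.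
   Context: **Hurwitz--Frobenius manifold.** For $K=\{k_0,\dots,k_N\}$ with $k_0\ge2$ and $k_i\ge1$, let $M$ be the space of complex parameters $v_{0,a}$ ($1\le a\le k_0-1$), $v_{i,a}$ ($1\le i\le N$, $0\le a\le k_i$) with $v_{i,k_i}\ne0$ and $v_{i,0}\ne v_{j,0}$ for $i\ne j$. A point corresponds to the rational function $$\lambda(z)=\frac{z^{k_0}}{k_0}+\sum_{a=1}^{k_0-1}v_{0,a}z^{a-1}+\sum_{i=1}^N\sum_{a=1}^{k_i}\frac{v_{i,a}}{(z-v_{i,0})^a}.$$ For a vector field $X$ on $M$ let $X\cdot\lambda$ be the derivative of $\lambda$ along $X$. With $\mathcal R=\{\infty,v_{1,0},\dots,v_{N,0}\}$ set $$\langle X,Y,Z\rangle=-\sum_{p\in\mathcal R}\mathrm{res}_{z=p}\frac{(X\cdot\lambda)(Y\cdot\lambda)(Z\cdot\lambda)}{\partial\lambda/\partial z}dz,\qquad \eta(X,Y)=-\sum_{p\in\mathcal R}\mathrm{res}_{z=p}\frac{(X\cdot\lambda)(Y\cdot\lambda)}{\partial\lambda/\partial z}dz.$$ The pairing $\eta$ is non-degenerate, and the product $\circ$ on the tangent sheaf is defined by $\eta(X\circ Y,Z)=\langle X,Y,Z\rangle$ for all $Z$. This gives the Dubrovin--Frobenius manifold $\mathcal H_{0;K}$. The same definitions with $N+1$ in place of $N$ give $\mathcal H_{0;L}$. **Flat coordinates.** Let $z_0^{k_0}=k_0\lambda$ with $z_0=z+O(z^{-1})$ near $z=\infty$, and $z_i^{k_i}=\lambda$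 near $z=v_{i,0}$. Then $t_{0,\alpha}=-\frac1{k_0-\alpha}\mathrm{res}_{z=\infty}z_0^{k_0-\alpha}dz$ for $1\le\alpha\le k_0-1$, and for $i\ge1$: $t_{i,0}=v_{i,0}$, $t_{i,1}=v_{i,1}$, $t_{i,\alpha}=\frac{k_i}{k_i-\alpha+1}\mathrm{res}_{z=v_{i,0}}z_i^{k_i-\alpha+1}dz$ for $2\le\alpha\le k_i$. In these coordinates $\eta$ is constant. **Potential.** $\mathcal F^K$ is the function of the flat coordinates with $\frac{\partial^3\mathcal F^K}{\partial t_a\partial t_b\partial t_c}=\left\langle\frac{\partial}{\partial t_a},\frac{\partial}{\partial t_b},\frac{\partial}{\partial t_c}\right\rangle$; similarly $\mathcal F^L$. **Open WDVV and open extension.** Let $F^c(t_1,\dots,t_n)$ be the potential of a Dubrovin--Frobenius manifold with inverse pairing matrix $\eta^{\mu\nu}$ in flat coordinates. A function $F^o(t_0,t_1,\dots,t_n)$ of one more variable $t_0$ solves the open WDVV equation if for all $0\le\alpha,\beta,\gamma\le n$ $$\sum_{\mu,\nu=1}^n\frac{\partial^3F^c}{\partial t_\alpha\partial t_\beta\partial t_\mu}\eta^{\mu\nu}\frac{\partial^2F^o}{\partial t_\nu\partial t_\gamma}+\frac{\partial^2F^o}{\partial t_\alpha\partial t_\beta}\frac{\partial^2F^o}{\partial t_0\partial t_\gamma}=\sum_{\mu,\nu=1}^n\frac{\partial^3F^c}{\partial t_\gamma\partial t_\beta\partial t_\mu}\eta^{\mu\nu}\frac{\partial^2F^o}{\partial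 t_\nu\partial t_\alpha}+\frac{\partial^2F^o}{\partial t_\gamma\partial t_\beta}\frac{\partial^2F^o}{\partial t_0\partial t_\alpha}.$$ This is the associativity of the product $$\frac{\partial}{\partial t_\alpha}\circ\frac{\partial}{\partial t_\beta}=\sum_{\gamma,\delta=1}^n\frac{\partial^3F^c}{\partial t_\alpha\partial t_\beta\partial t_\gamma}\eta^{\gamma\delta}\frac{\partial}{\partial t_\delta}+\frac{\partial^2F^o}{\partial t_\alpha\partial t_\beta}\frac{\partial}{\partial t_0},\qquad 0\le\alpha,\beta\le n,$$ called an open extension of the Dubrovin--Frobenius manifold given by $F^c$ (derivatives of $F^c$ in $t_0$ are zero).
   Formalization: In (i) the product extends when one factor is tangent to the locus (two transversal factors give poles, e.g. 1/t_{N+1,1}); in (ii) the restriction of the singular ∂F^L/∂t_{N+1,1} means setting t_{N+1,a}=0 for a<k_{N+1}, then letting t_{N+1,k_{N+1}}→0, for local branches of the potentials. *)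

theory Defs
  imports "HOL-Complex_Analysis.Complex_Analysis" "HOL-Library.Landau_Symbols"
begin

section \<open>Functions of several complex variables\<close>

text \<open>
  The number of coordinates depends on \<open>N\<close> and \<open>k\<close>, so a point of a coordinate space is a
  total function on pairs of naturals of which only the entries in a finite index set matter.
  The topology on such functions is the product topology.
\<close>

type_synonym point = "nat \<times> nat \<Rightarrow> complex"

definition pd :: "nat \<times> nat \<Rightarrow> (point \<Rightarrow> complex) \<Rightarrow> point \<Rightarrow> complex" where
  "pd x f t = deriv (\<lambda>s. f (t(x := s))) (t x)"

text \<open>Continuous and separately holomorphic in the variables of \<open>I\<close>; by Osgood's lemma this is
  holomorphy, for functions of finitely many variables \<open>I\<close>.\<close>

definition holo_wrt :: "(nat \<times> nat) set \<Rightarrow> point set \<Rightarrow> (point \<Rightarrow> complex) \<Rightarrow> bool" where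
  "holo_wrt I U f \<longleftrightarrow> continuous_on U f \<and>
     (\<forall>t\<in>U. \<forall>x\<in>I. (\<lambda>s. f (t(x := s))) field_differentiable at (t x))"

definition residue_inf :: "(complex \<Rightarrow> complex) \<Rightarrow> complex" where
  "residue_inf f = - residue (\<lambda>w. f (1 / w) / w\<^sup>2) 0"

section \<open>Hurwitz--Frobenius manifolds\<close>

text \<open>The multiset \<open>{k\<^sub>0, \<dots>, k\<^sub>N}\<close> is given by \<open>N\<close> and \<open>k\<close>; only
  \<open>k 0, \<dots>, k N\<close> are used.\<close>

definition idx :: "nat \<Rightarrow> (nat \<Rightarrow> nat) \<Rightarrow> (nat \<times> nat) set" where
  "idx N k = {(0, a) | a. 1 \<le> a \<and> a < k 0} \<union> {(i, a) | i a. 1 \<le> i \<and> i \<le> N \<and> a \<le> k i}"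

definition hurwitz :: "nat \<Rightarrow> (nat \<Rightarrow> nat) \<Rightarrow> point set" where
  "hurwitz N k = {v. (\<forall>x. x \<notin> idx N k \<longrightarrow> v x = 0) \<and>
     (\<forall>i\<in>{1..N}. v (i, k i) \<noteq> 0) \<and> inj_on (\<lambda>i. v (i, 0)) {1..N}}"

definition lam :: "nat \<Rightarrow> (nat \<Rightarrow> nat) \<Rightarrow> point \<Rightarrow> complex \<Rightarrow> complex" where
  "lam N k v z = z ^ k 0 / of_nat (k 0) + (\<Sum>a = 1..<k 0. v (0, a) * z ^ (a - 1))
     + (\<Sum>i = 1..N. \<Sum>a = 1..k i. v (i, a) / (z - v (i, 0)) ^ a)"

text \<open>A tangent vector \<open>X\<close> at \<open>v\<close> is given by its components with respect to the
  coordinates \<open>v\<^sub>i\<^sub>,\<^sub>a\<close>.\<close>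

definition along :: "nat \<Rightarrow> (nat \<Rightarrow> nat) \<Rightarrow> point \<Rightarrow> point \<Rightarrow> complex \<Rightarrow> complex" where
  "along N k v X z = deriv (\<lambda>s. lam N k (\<lambda>x. v x + s * X x) z) 0"

definition residue_sum :: "nat \<Rightarrow> point \<Rightarrow> (complex \<Rightarrow> complex) \<Rightarrow> complex" where
  "residue_sum N v f = residue_inf f + (\<Sum>i = 1..N. residue f (v (i, 0)))"

definition triple :: "nat \<Rightarrow> (nat \<Rightarrow> nat) \<Rightarrow> point \<Rightarrow> point \<Rightarrow> point \<Rightarrow> point \<Rightarrow> complex" where
  "triple N k v X Y Z = - residue_sum N v
     (\<lambda>z. along N k v X z * along N k v Y z * along N k v Z z / deriv (lam N k v) z)"

definition pairing :: "nat \<Rightarrow> (nat \<Rightarrow> nat) \<Rightarrow> point \<Rightarrow> point \<Rightarrow> point \<Rightarrow> complex" where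
  "pairing N k v X Y = - residue_sum N v
     (\<lambda>z. along N k v X z * along N k v Y z / deriv (lam N k v) z)"

definition hf_prod :: "nat \<Rightarrow> (nat \<Rightarrow> nat) \<Rightarrow> point \<Rightarrow> point \<Rightarrow> point \<Rightarrow> point" where
  "hf_prod N k v X Y = (THE W. (\<forall>x. x \<notin> idx N k \<longrightarrow> W x = 0) \<and>
     (\<forall>Z. pairing N k v W Z = triple N k v X Y Z))"

section \<open>Flat coordinates and potentials\<close>

text \<open>
  The flat coordinates depend on the choice of the roots \<open>z\<^sub>i\<close>, so they are multivalued on the
  space of parameters: \<open>flat_coords N k v t\<close> says that \<open>t\<close> is one of the values at \<open>v\<close>.
  Conversely, \<open>v\<close> is determined by \<open>t\<close>.
\<close>

definition flat_coords :: "nat \<Rightarrow> (nat \<Rightarrow> nat) \<Rightarrow> point \<Rightarrow> point \<Rightarrow> bool" where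
  "flat_coords N k v t \<longleftrightarrow>
     (\<exists>\<zeta> R. \<zeta> holomorphic_on {z. norm z > R} \<and>
        (\<forall>z. norm z > R \<longrightarrow> \<zeta> z ^ k 0 = of_nat (k 0) * lam N k v z) \<and>
        (\<lambda>z. \<zeta> z - z) \<in> O[at_infinity](\<lambda>z. 1 / z) \<and>
        (\<forall>\<alpha>\<in>{1..<k 0}. t (0, \<alpha>) = - 1 / of_nat (k 0 - \<alpha>) * residue_inf (\<lambda>z. \<zeta> z ^ (k 0 - \<alpha>)))) \<and>
     (\<forall>i\<in>{1..N}. t (i, 0) = v (i, 0) \<and> t (i, 1) = v (i, 1) \<and>
        (\<exists>\<zeta> r. r > 0 \<and> \<zeta> holomorphic_on (ball (v (i, 0)) r - {v (i, 0)}) \<and>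
           (\<forall>z\<in>ball (v (i, 0)) r - {v (i, 0)}. \<zeta> z ^ k i = lam N k v z) \<and>
           (\<forall>\<alpha>\<in>{2..k i}. t (i, \<alpha>) = of_nat (k i) / of_nat (k i - \<alpha> + 1) *
              residue (\<lambda>z. \<zeta> z ^ (k i - \<alpha> + 1)) (v (i, 0)))))"

definition flat_dom :: "nat \<Rightarrow> (nat \<Rightarrow> nat) \<Rightarrow> point set" where
  "flat_dom N k = {t. \<exists>v\<in>hurwitz N k. flat_coords N k v t}"

definition flat_pt :: "nat \<Rightarrow> (nat \<Rightarrow> nat) \<Rightarrow> point \<Rightarrow> point" where
  "flat_pt N k t = (THE v. v \<in> hurwitz N k \<and> flat_coords N k v t)"

text \<open>The vector field \<open>\<partial>/\<partial>t\<^sub>a\<close>, as a tangent vector at \<open>flat_pt N k t\<close>.\<close>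

definition flat_vec :: "nat \<Rightarrow> (nat \<Rightarrow> nat) \<Rightarrow> nat \<times> nat \<Rightarrow> point \<Rightarrow> point" where
  "flat_vec N k a t = (\<lambda>x. pd a (\<lambda>t. flat_pt N k t x) t)"

definition flat_eta :: "nat \<Rightarrow> (nat \<Rightarrow> nat) \<Rightarrow> nat \<times> nat \<Rightarrow> nat \<times> nat \<Rightarrow> point \<Rightarrow> complex" where
  "flat_eta N k a b t = pairing N k (flat_pt N k t) (flat_vec N k a t) (flat_vec N k b t)"

text \<open>The inverse \<open>\<eta>\<^sup>\<mu>\<^sup>\<nu>\<close> of the matrix of the pairing in flat coordinates
  (it does not depend on \<open>t\<close>).\<close>

definition eta_inv :: "nat \<Rightarrow> (nat \<Rightarrow> nat) \<Rightarrow> point \<Rightarrow> nat \<times> nat \<Rightarrow> nat \<times> nat \<Rightarrow> complex" where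
  "eta_inv N k t = (THE h. (\<forall>a b. a \<notin> idx N k \<or> b \<notin> idx N k \<longrightarrow> h a b = 0) \<and>
     (\<forall>a\<in>idx N k. \<forall>b\<in>idx N k.
        (\<Sum>c\<in>idx N k. h a c * flat_eta N k c b t) = (if a = b then 1 else 0)))"

text \<open>
  Potentials have logarithmic monodromy, and they are determined by their third derivatives
  only up to quadratic polynomials.  A potential on an open set \<open>U\<close> is any single-valued
  branch there, for any choice of the quadratic terms.
\<close>

definition is_potential :: "nat \<Rightarrow> (nat \<Rightarrow> nat) \<Rightarrow> point set \<Rightarrow> (point \<Rightarrow> complex) \<Rightarrow> bool" where
  "is_potential N k U F \<longleftrightarrow> open U \<and> U \<subseteq> flat_dom N k \<and>
     (\<forall>t t'. (\<forall>x\<in>idx N k. t x = t' x) \<longrightarrow> F t = F t') \<and>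
     holo_wrt (idx N k) U F \<and>
     (\<forall>t\<in>U. \<forall>a\<in>idx N k. \<forall>b\<in>idx N k. \<forall>c\<in>idx N k.
        pd a (pd b (pd c F)) t =
        triple N k (flat_pt N k t) (flat_vec N k a t) (flat_vec N k b t) (flat_vec N k c t))"

section \<open>Open extensions\<close>

text \<open>Here \<open>I\<close> indexes the variables of \<open>Fc\<close>, \<open>e\<close> is the additional variable, and
  \<open>h t\<close> is the inverse pairing.\<close>

definition open_wdvv :: "(nat \<times> nat) set \<Rightarrow> nat \<times> nat \<Rightarrow> (point \<Rightarrow> nat \<times> nat \<Rightarrow> nat \<times> nat \<Rightarrow> complex)
    \<Rightarrow> point set \<Rightarrow> (point \<Rightarrow> complex) \<Rightarrow> (point \<Rightarrow> complex) \<Rightarrow> bool" where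
  "open_wdvv I e h U Fc Fo \<longleftrightarrow>
     (\<forall>t\<in>U. \<forall>\<alpha>\<in>insert e I. \<forall>\<beta>\<in>insert e I. \<forall>\<gamma>\<in>insert e I.
        (\<Sum>\<mu>\<in>I. \<Sum>\<nu>\<in>I. pd \<alpha> (pd \<beta> (pd \<mu> Fc)) t * h t \<mu> \<nu> * pd \<nu> (pd \<gamma> Fo) t)
          + pd \<alpha> (pd \<beta> Fo) t * pd e (pd \<gamma> Fo) t =
        (\<Sum>\<mu>\<in>I. \<Sum>\<nu>\<in>I. pd \<gamma> (pd \<beta> (pd \<mu> Fc)) t * h t \<mu> \<nu> * pd \<nu> (pd \<alpha> Fo) t)
          + pd \<gamma> (pd \<beta> Fo) t * pd e (pd \<alpha> Fo) t)"

text \<open>The coefficient of \<open>\<partial>/\<partial>t\<^sub>\<delta>\<close> in the product of \<open>\<partial>/\<partial>t\<^sub>\<alpha>\<close> and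
  \<open>\<partial>/\<partial>t\<^sub>\<beta>\<close> of the open extension.\<close>

definition open_prod :: "(nat \<times> nat) set \<Rightarrow> nat \<times> nat \<Rightarrow> (point \<Rightarrow> nat \<times> nat \<Rightarrow> nat \<times> nat \<Rightarrow> complex)
    \<Rightarrow> (point \<Rightarrow> complex) \<Rightarrow> (point \<Rightarrow> complex)
    \<Rightarrow> nat \<times> nat \<Rightarrow> nat \<times> nat \<Rightarrow> nat \<times> nat \<Rightarrow> point \<Rightarrow> complex" where
  "open_prod I e h Fc Fo \<alpha> \<beta> \<delta> t =
     (if \<delta> = e then pd \<alpha> (pd \<beta> Fo) t
      else (\<Sum>\<gamma>\<in>I. pd \<alpha> (pd \<beta> (pd \<gamma> Fc)) t * h t \<gamma> \<delta>))"

section \<open>The locus at the boundary of the larger manifold\<close>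

text \<open>
  With \<open>L = {k 0, \<dots>, k (N+1)}\<close>, the locus consists of boundary points of \<open>flat_dom (N+1) k\<close>:
  there all \<open>v\<^sub>N\<^sub>+\<^sub>1\<^sub>,\<^sub>a\<close> with \<open>a \<ge> 1\<close> vanish, whereas the remaining conditions on the
  parameters are kept.  The coordinates along the locus are those of \<open>K\<close> and \<open>t\<^sub>N\<^sub>+\<^sub>1\<^sub>,\<^sub>0\<close>.
\<close>

definition locus :: "nat \<Rightarrow> (nat \<Rightarrow> nat) \<Rightarrow> point set" where
  "locus N k = {t \<in> flat_dom N k. (\<forall>i\<in>{1..N}. t (Suc N, 0) \<noteq> t (i, 0)) \<and>
     (\<forall>\<alpha>\<in>{1..k (Suc N)}. t (Suc N, \<alpha>) = 0)}"

definition locus_idx :: "nat \<Rightarrow> (nat \<Rightarrow> nat) \<Rightarrow> (nat \<times> nat) set" where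
  "locus_idx N k = insert (Suc N, 0) (idx N k)"

text \<open>
  \<open>g\<close> and \<open>c\<close> are holomorphic extensions to a neighbourhood \<open>U\<close> of the locus of the pairing and of
  the structure constants of the product in the flat frame; the extended product of vectors
  tangent to the locus is again tangent to it.  The product of two flat fields that are both
  transversal to the locus can have poles there (for \<open>k (N+1) = 1\<close> the potential contains
  \<open>t\<^sup>2 log t / 2\<close> with \<open>t = t\<^sub>N\<^sub>+\<^sub>1\<^sub>,\<^sub>1\<close>), so one factor is tangent to the locus.
\<close>

definition locus_extension :: "nat \<Rightarrow> (nat \<Rightarrow> nat) \<Rightarrow> point set
    \<Rightarrow> (nat \<times> nat \<Rightarrow> nat \<times> nat \<Rightarrow> point \<Rightarrow> complex)
    \<Rightarrow> (nat \<times> nat \<Rightarrow> nat \<times> nat \<Rightarrow> nat \<times> nat \<Rightarrow> point \<Rightarrow> complex) \<Rightarrow> bool" where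
  "locus_extension N k U g c \<longleftrightarrow>
     open U \<and> locus N k \<subseteq> U \<and> locus N k \<subseteq> closure (flat_dom (Suc N) k) \<and>
     (\<forall>a\<in>idx (Suc N) k. \<forall>b\<in>idx (Suc N) k.
        holo_wrt (idx (Suc N) k) U (g a b) \<and>
        (\<forall>t\<in>U \<inter> flat_dom (Suc N) k. g a b t = flat_eta (Suc N) k a b t)) \<and>
     (\<forall>a\<in>locus_idx N k. \<forall>b\<in>idx (Suc N) k.
        (\<forall>d\<in>idx (Suc N) k. holo_wrt (idx (Suc N) k) U (c a b d)) \<and>
        (\<forall>t\<in>U \<inter> flat_dom (Suc N) k.
           hf_prod (Suc N) k (flat_pt (Suc N) k t) (flat_vec (Suc N) k a t) (flat_vec (Suc N) k b t)
           = (\<lambda>x. \<Sum>d\<in>idx (Suc N) k. c a b d t * flat_vec (Suc N) k d t x))) \<and>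
     (\<forall>a\<in>locus_idx N k. \<forall>b\<in>locus_idx N k. \<forall>d\<in>idx (Suc N) k - locus_idx N k.
        \<forall>t\<in>locus N k. c a b d t = 0)"

text \<open>
  \<open>Fo\<close> is the restriction to \<open>V \<subseteq> locus N k\<close> of \<open>\<partial>FL/\<partial>t\<^sub>N\<^sub>+\<^sub>1\<^sub>,\<^sub>1\<close>.  As this derivative is singular at
  the locus, one first puts \<open>t\<^sub>N\<^sub>+\<^sub>1\<^sub>,\<^sub>\<alpha> = 0\<close> for \<open>\<alpha> < k (N+1)\<close>, which for \<open>k (N+1) \<ge> 2\<close>
  does not leave \<open>flat_dom (N+1) k\<close>, and then lets \<open>s = t\<^sub>N\<^sub>+\<^sub>1\<^sub>,\<^sub>\<alpha>\<close> with \<open>\<alpha> = k (N+1)\<close> tend to \<open>0\<close>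
  inside \<open>S\<close>.
\<close>

definition restricts_to :: "nat \<Rightarrow> (nat \<Rightarrow> nat) \<Rightarrow> complex set \<Rightarrow> point set
    \<Rightarrow> (point \<Rightarrow> complex) \<Rightarrow> (point \<Rightarrow> complex) \<Rightarrow> bool" where
  "restricts_to N k S V FL Fo \<longleftrightarrow>
     (\<forall>t\<in>V. ((\<lambda>s. pd (Suc N, 1) FL (t((Suc N, k (Suc N)) := s))) \<longlongrightarrow> Fo t) (at 0 within S))"

end

theory Submission
  imports Defs
begin

text \<open>
  In flat coordinates everything is explicit: near a pole of \<open>\<lambda>\<close> the parameter \<open>z\<close> is a
  polynomial in \<open>w = 1 / z\<^sub>i\<close> with coefficients \<open>t\<^sub>i\<^sub>,\<^sub>\<alpha>\<close> up to terms that do not matter, hence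
  \<open>\<partial>\<lambda>/\<partial>t\<^sub>i\<^sub>,\<^sub>\<alpha>\<close> is a rational function of \<open>z\<close> whose coefficients are polynomials in \<open>t\<close>, and in \<open>w\<close>
  it has the principal part of a monomial. All residues become coefficients of formal Laurent series.
  In the triple residue at \<open>p = t\<^sub>N\<^sub>+\<^sub>1\<^sub>,\<^sub>0\<close> the denominator cancels if one factor is tangent to the
  locus, so the structure constants extend holomorphically; on the locus they are values at \<open>p\<close>
  and residues of \<open>\<phi>\<^sub>a \<phi>\<^sub>b / ((z - p) \<lambda>')\<close>, where \<open>\<phi>\<^sub>a = \<partial>\<lambda>/\<partial>t\<^sub>a\<close>. The open WDVV equation follows
  from the fact that \<open>(\<phi>\<^sub>a - \<phi>\<^sub>a(p)) / (z - p)\<close> and \<open>(\<lambda>' - \<lambda>'(p)) / (z - p)\<close> are again tangent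
  vectors of the smaller manifold. Finally, if the other \<open>t\<^sub>N\<^sub>+\<^sub>1\<^sub>,\<^sub>\<alpha>\<close> with \<open>\<alpha> \<ge> 1\<close> vanish, then
  \<open>\<partial>F/\<partial>t\<^sub>N\<^sub>+\<^sub>1\<^sub>,\<^sub>1\<close> is affine in \<open>s = t\<^sub>N\<^sub>+\<^sub>1\<^sub>,\<^sub>k\<close>, which gives its restriction to \<open>s = 0\<close>.
\<close>

text \<open>The monomials come from the thermodynamic identity. Where \<open>\<lambda>\<close> is a
  constant times \<open>w^(-k)\<close>, comparing the derivative of \<open>\<lambda>\<close> at
  fixed \<open>z\<close> with that of \<open>z\<close> at fixed \<open>w\<close> gives
  \<open>(d\<lambda>/dt) dz = - (dz/dt) d\<lambda>\<close>, and \<open>z\<close> is affine in the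
  flat coordinates up to terms too small to matter. The obstacle at the locus is one number: the
  leading coefficient of \<open>\<lambda>'\<close> at the new pole is a power of the last coordinate
  up to a constant, and vanishes there. So nothing may be divided by it, whereas the leading
  coefficients at the old poles stay nonzero and their residues are holomorphic for that reason. A
  second obstacle is that the open potential must be differentiated twice along the locus, where
  \<open>FL\<close> is undefined, and pointwise limits do not commute with derivatives. As an affine
  function is determined by two values, the limit is a fixed combination of the values at two points
  \<open>s0\<close>, \<open>s1\<close> of \<open>S\<close>, which can be differentiated. Its second
  derivatives do not change when the second point moves, and are computed by letting it tend to
  \<open>0\<close>.\<close>

unbundle fps_syntax
unbundle Formal_Power_Series.fps_syntax
unbundle no vec_syntax

section \<open>Formal Laurent series\<close>

text \<open>Stated through coefficients because \<open>fls_subdegree 0 = 0\<close>: a bound on the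
  subdegree would exclude the zero series for positive \<open>n\<close>, and would not be closed
  under sums.\<close>

definition ord_ge :: "int \<Rightarrow> 'a::zero fls \<Rightarrow> bool" where
  "ord_ge n F \<longleftrightarrow> (\<forall>m<n. F $$ m = 0)"

lemma ord_ge_nth: "ord_ge n F \<Longrightarrow> m < n \<Longrightarrow> F $$ m = 0"
  by (simp add: ord_ge_def)

lemma ord_ge_iff: "ord_ge n F \<longleftrightarrow> F = 0 \<or> n \<le> fls_subdegree F"
proof (cases "F = 0")
  case False
  then show ?thesis
    unfolding ord_ge_def
    by (metis fls_eq0_below_subdegree fls_subdegree_geI linorder_not_less nth_fls_subdegree_nonzero
        order_less_le_trans)
qed (simp add: ord_ge_def)

lemma ord_ge_mono: "ord_ge n F \<Longrightarrow> m \<le> n \<Longrightarrow> ord_ge m F"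
  by (simp add: ord_ge_def)

lemma ord_ge_0 [simp]: "ord_ge n 0"
  by (simp add: ord_ge_def)

lemma ord_ge_add: "ord_ge n F \<Longrightarrow> ord_ge n G \<Longrightarrow> ord_ge n (F + G :: 'a::monoid_add fls)"
  by (simp add: ord_ge_def)

lemma ord_ge_diff: "ord_ge n F \<Longrightarrow> ord_ge n G \<Longrightarrow> ord_ge n (F - G :: 'a::group_add fls)"
  by (simp add: ord_ge_def)

lemma ord_ge_uminus [simp]: "ord_ge n (- F) \<longleftrightarrow> ord_ge n (F :: 'a::group_add fls)"
  by (simp add: ord_ge_def)

lemma ord_ge_sum: "(\<And>i. i \<in> I \<Longrightarrow> ord_ge n (F i)) \<Longrightarrow> ord_ge n (\<Sum>i\<in>I. F i :: 'a::comm_monoid_add fls)"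
  by (simp add: ord_ge_def fls_nth_sum)

lemma ord_ge_mult:
  fixes F G :: "'a::field fls"
  shows "ord_ge a F \<Longrightarrow> ord_ge b G \<Longrightarrow> n \<le> a + b \<Longrightarrow> ord_ge n (F * G)"
  by (cases "F = 0 \<or> G = 0") (auto simp: ord_ge_iff)

lemma ord_ge_const [simp]: "n \<le> 0 \<Longrightarrow> ord_ge n (fls_const c)"
  by (simp add: ord_ge_def)

lemma ord_ge_const_mult: "ord_ge n F \<Longrightarrow> ord_ge n (fls_const c * F :: 'a::field fls)"
  by (simp add: ord_ge_def)

lemma ord_ge_fps [simp]: "n \<le> 0 \<Longrightarrow> ord_ge n (fps_to_fls F)"
  by (simp add: ord_ge_def)

lemma ord_ge_intpow: "n \<le> m \<Longrightarrow> ord_ge n (fls_X_intpow m)"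
  by (simp add: ord_ge_def)

lemma ord_ge_power:
  fixes F :: "'a::field fls"
  assumes "ord_ge a F"
  shows "n \<le> int m * a \<Longrightarrow> ord_ge n (F ^ m)"
proof (induction m arbitrary: n)
  case 0 then show ?case by (simp add: ord_ge_def)
next
  case (Suc m)
  from Suc.IH[OF order_refl] assms Suc.prems show ?case
    by (auto intro!: ord_ge_mult[of a _ "int m * a"] simp: algebra_simps)
qed

lemma ord_ge_divide:
  fixes F G :: "'a::field fls"
  assumes "ord_ge a F" "n + fls_subdegree G \<le> a"
  shows "ord_ge n (F / G)"
proof (cases "F = 0 \<or> G = 0")
  case False
  then show ?thesis
    using assms by (auto simp: ord_ge_iff fls_divide_subdegree divide_inverse)
qed auto

lemma ord_ge_deriv: "ord_ge a F \<Longrightarrow> n < a \<Longrightarrow> ord_ge n (fls_deriv F :: 'a::field fls)"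
  by (simp add: ord_ge_def)

lemma ord_ge_deriv0: "ord_ge 0 F \<Longrightarrow> ord_ge 0 (fls_deriv F :: 'a::field fls)"
  unfolding ord_ge_def
proof (intro allI impI)
  fix m :: int assume "\<forall>m<0. F $$ m = 0" "m < 0"
  then show "fls_deriv F $$ m = 0" by (cases "m = -1") auto
qed

lemma ord_ge_regpart: "ord_ge 0 F \<Longrightarrow> fps_to_fls (fls_regpart F) = F"
  by (intro fls_eqI) (auto simp: ord_ge_def)

lemma fls_subdegree_add_ord_ge:
  fixes F R :: "'a::field fls"
  assumes "F \<noteq> 0" "fls_subdegree F = d" "ord_ge (d + 1) R"
  shows "F + R \<noteq> 0" "fls_subdegree (F + R) = d"
proof -
  have 1: "(F + R) $$ d \<noteq> 0" using assms by (auto simp: ord_ge_def)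
  then show "F + R \<noteq> 0" by (metis fls_zero_nth)
  show "fls_subdegree (F + R) = d"
    using 1 assms by (intro fls_subdegree_eqI) (auto simp: ord_ge_def)
qed

section \<open>Residues of quotients and changes of the local parameter\<close>

lemma residue_quotient:
  fixes f A B \<rho>\<^sub>A \<rho>\<^sub>B \<kappa> \<rho> :: "complex fls"
  assumes \<kappa>: "\<kappa> \<noteq> 0" "fls_subdegree \<kappa> = d" and \<rho>: "ord_ge (d + 1) \<rho>"
    and o1: "ord_ge d (f * A * \<rho>\<^sub>B)" and o2: "ord_ge d (f * B * \<rho>\<^sub>A)"
    and o3: "ord_ge d (f * \<rho>\<^sub>A * \<rho>\<^sub>B)" and o4: "ord_ge (2 * d) (f * A * B * \<rho>)"
  shows "(f * (A + \<rho>\<^sub>A) * (B + \<rho>\<^sub>B) / (\<rho> - \<kappa>)) $$ (-1) = - (f * A * B / \<kappa>) $$ (-1)"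
proof -
  have nz: "\<rho> - \<kappa> \<noteq> 0" and deg: "fls_subdegree (\<rho> - \<kappa>) = d"
    using fls_subdegree_add_ord_ge[of "-\<kappa>" d \<rho>] \<kappa> \<rho> by (auto simp: algebra_simps)
  have deg2: "fls_subdegree (\<kappa> * (\<rho> - \<kappa>)) = 2 * d"
    using nz deg \<kappa> by (subst fls_subdegree_mult) auto
  \<comment> \<open>Replacing all factors by their leading parts changes the quotient by a fraction
    whose numerator has order at least \<open>2 * d\<close>, the order of its denominator, hence by
    a regular series.\<close>
  have "f * (A + \<rho>\<^sub>A) * (B + \<rho>\<^sub>B) / (\<rho> - \<kappa>) + f * A * B / \<kappa>
    = (\<kappa> * (f * A * \<rho>\<^sub>B + f * B * \<rho>\<^sub>A + f * \<rho>\<^sub>A * \<rho>\<^sub>B) + f * A * B * \<rho>) / (\<kappa> * (\<rho> - \<kappa>))"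
    using nz \<kappa> by (simp add: divide_simps) (simp add: algebra_simps)
  moreover have "ord_ge 0 \<dots>"
  proof (rule ord_ge_divide)
    show "ord_ge (2 * d) (\<kappa> * (f * A * \<rho>\<^sub>B + f * B * \<rho>\<^sub>A + f * \<rho>\<^sub>A * \<rho>\<^sub>B) + f * A * B * \<rho>)"
      using o1 o2 o3 o4 \<kappa> by (intro ord_ge_add ord_ge_mult[of d \<kappa> d]) (auto simp: ord_ge_iff[of d \<kappa>])
  qed (simp add: deg2)
  ultimately have "(f * (A + \<rho>\<^sub>A) * (B + \<rho>\<^sub>B) / (\<rho> - \<kappa>) + f * A * B / \<kappa>) $$ (-1) = 0"
    by (simp only:) (erule ord_ge_nth, simp)
  then show ?thesis by (simp add: eq_neg_iff_add_eq_0)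
qed

lemma subdegree_eq_1: "c $ 0 = 0 \<Longrightarrow> c $ 1 \<noteq> 0 \<Longrightarrow> subdegree c = 1"
  by (intro subdegreeI) auto

lemma subdegree_fls_eq_1: "c $ 0 = 0 \<Longrightarrow> c $ 1 \<noteq> 0 \<Longrightarrow> fls_subdegree (fps_to_fls c) = 1"
  by (simp add: fls_subdegree_fls_to_fps subdegree_eq_1)

lemma fls_deriv_power_int:
  fixes F :: "complex fls"
  assumes "F \<noteq> 0"
  shows "fls_deriv (F powi n) = of_int n * F powi (n - 1) * fls_deriv F"
proof (cases "n \<ge> 0")
  case True
  then obtain m where n: "n = int m" by (metis nonneg_int_cases)
  show ?thesis
  proof (cases m)
    case (Suc j)
    then have "F powi (n - 1) = F ^ j" using n by (simp add: power_int_def)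
    moreover have "F powi n = F ^ Suc j" using n Suc by (simp only: power_int_of_nat)
    ultimately show ?thesis using n Suc by (simp add: fls_deriv_power del: power_Suc)
  qed (simp add: n)
next
  case False
  define m where "m = nat (- n)"
  have n: "n = - int m" "m > 0" using False by (auto simp: m_def)
  have a: "F powi n = inverse (F ^ m)" using n by (simp add: power_int_minus)
  have b: "F powi (n - 1) = inverse (F ^ Suc m)"
    using n by (simp add: power_int_def nat_add_distrib del: power_Suc) (simp add: power_inverse nat_add_distrib)
  obtain j where j: "m = Suc j" using n(2) by (cases m) auto
  have c: "F ^ m \<noteq> 0" using assms by simp
  have d: "fls_deriv (F ^ m) = of_nat m * F ^ j * fls_deriv F"
    by (subst fls_deriv_power) (simp_all add: j)
  have "fls_deriv (F powi n) = - fls_deriv (F ^ m) * inverse (F ^ m) ^ 2"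
    unfolding a using c by (subst fls_inverse_deriv) auto
  also have "\<dots> = - of_nat m * F ^ j * fls_deriv F * inverse (F ^ m) ^ 2"
    using d by simp
  also have "\<dots> = - of_nat m * inverse (F ^ Suc m) * fls_deriv F"
    using assms by (simp add: j field_simps power2_eq_square)
  also have "\<dots> = of_int n * F powi (n - 1) * fls_deriv F"
    unfolding b by (simp add: n(1))
  finally show ?thesis .
qed

text \<open>For \<open>n \<noteq> -1\<close> the series is a derivative up to the factor
  \<open>n + 1\<close>, and derivatives have no residue. For \<open>n = -1\<close> it is a
  logarithmic derivative, whose residue is the order \<open>1\<close> of \<open>c\<close>.\<close>

lemma residue_power_int_deriv:
  fixes c :: "complex fps"
  assumes "c $ 0 = 0" "c $ 1 \<noteq> 0"
  shows "(fps_to_fls c powi n * fls_deriv (fps_to_fls c)) $$ (-1) = (if n = -1 then 1 else 0)"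
proof -
  have nz: "fps_to_fls c \<noteq> 0" using assms by auto
  show ?thesis
  proof (cases "n = -1")
    case True
    then show ?thesis
      using fls_residue_deriv_times_inverse_eq_subdegree(2)[of "fps_to_fls c"] assms
      by (simp add: subdegree_fls_eq_1 power_int_minus)
  next
    case False
    have "of_int (n + 1) * (fps_to_fls c powi n * fls_deriv (fps_to_fls c)) = fls_deriv (fps_to_fls c powi (n + 1))"
      by (subst fls_deriv_power_int[OF nz]) (simp add: mult.assoc)
    then have "of_int (n + 1) * (fps_to_fls c powi n * fls_deriv (fps_to_fls c)) $$ (-1) = 0"
      by (metis fls_deriv_residue fls_mult_of_int_nth(1))
    then show ?thesis using False
      by (metis mult_eq_0_iff of_int_eq_0_iff eq_neg_iff_add_eq_0)
  qed
qed

lemma fls_principal_part_decomp: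
  fixes F :: "'a::field fls"
  assumes "ord_ge (- int M) F"
  shows "F = (\<Sum>j=1..M. fls_const (F $$ (- int j)) * inverse (fls_X ^ j)) + fps_to_fls (fls_regpart F)"
proof (rule fls_eqI)
  fix n
  have "(\<Sum>j=1..M. F $$ (- int j) * (if n = - int j then 1 else 0)) = (if n < 0 then F $$ n else 0)"
  proof (cases "n < 0")
    case True
    have "(\<Sum>j=1..M. F $$ (- int j) * (if n = - int j then 1 else 0)) =
          (\<Sum>j=1..M. if nat (-n) = j then F $$ n else 0)"
      using True by (intro sum.cong) auto
    also have "\<dots> = (if nat (-n) \<in> {1..M} then F $$ n else 0)" by (simp add: sum.delta)
    also have "\<dots> = F $$ n" using True assms by (auto simp: ord_ge_def)
    finally show ?thesis using True by simp
  qed (auto intro!: sum.neutral)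
  then show "F $$ n = ((\<Sum>j=1..M. fls_const (F $$ (- int j)) * inverse (fls_X ^ j)) + fps_to_fls (fls_regpart F)) $$ n"
    by (simp add: fls_nth_sum fls_inverse_X_power)
qed

lemma fls_compose_fps_sum:
  fixes H :: "'a::field fps"
  assumes "H \<noteq> 0" "fps_nth H 0 = 0"
  shows "fls_compose_fps (\<Sum>i\<in>I. F i) H = (\<Sum>i\<in>I. fls_compose_fps (F i) H)"
  by (induction I rule: infinite_finite_induct) (auto simp: fls_compose_fps_add assms)

text \<open>Invariance of the residue under a change of parameter: the regular part contributes
  nothing, and \<open>C^(-j) C'\<close> has a residue only for \<open>j = 1\<close>.\<close>

lemma residue_compose:
  fixes F :: "complex fls"
  assumes c: "c $ 0 = 0" "c $ 1 \<noteq> 0"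
  shows "(fls_compose_fps F c * fls_deriv (fps_to_fls c)) $$ (-1) = F $$ (-1)"
proof -
  have [simp]: "c \<noteq> 0" using c by auto
  note hom = fls_compose_fps_add fls_compose_fps_mult fls_compose_fps_inverse fls_compose_fps_power
    fls_compose_fps_sum
  define M where "M = Suc (nat (- fls_subdegree F))"
  have o: "ord_ge (- int M) F" unfolding ord_ge_iff M_def by auto
  let ?C = "fps_to_fls c"
  have reg: "(fps_to_fls (G oo c) * fls_deriv ?C) $$ (-1) = 0" for G
    by (rule ord_ge_nth[of 0]) (auto simp: fls_deriv_fps_to_fls intro!: ord_ge_mult[of 0 _ 0])
  have pw: "(inverse ?C ^ j * fls_deriv ?C) $$ (-1) = (if j = 1 then 1 else 0)" for j
    using residue_power_int_deriv[OF c, of "- int j"] by (simp add: power_int_minus power_inverse split: if_splits)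
  have "fls_compose_fps F c = (\<Sum>j=1..M. fls_const (F $$ (- int j)) * inverse ?C ^ j) + fps_to_fls (fls_regpart F oo c)"
    by (subst fls_principal_part_decomp[OF o]) (simp add: hom c power_inverse)
  then have "(fls_compose_fps F c * fls_deriv ?C) $$ (-1) =
     (\<Sum>j=1..M. F $$ (- int j) * (inverse ?C ^ j * fls_deriv ?C) $$ (-1))"
    by (simp add: distrib_right sum_distrib_right fls_nth_sum reg mult.assoc)
  also have "\<dots> = (\<Sum>j=1..M. if j = 1 then F $$ (-1) else 0)"
    unfolding pw by (intro sum.cong) auto
  also have "\<dots> = F $$ (-1)" by (simp add: M_def)
  finally show ?thesis .
qed

text \<open>The coefficients of an expansion in powers of \<open>1 / C\<close> are residues. If the
  difference had a pole of order \<open>r\<close>, multiplying it by \<open>C^(r-1) C'\<close> would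
  leave a simple pole with nonzero residue, but the coefficients are chosen such that this residue
  is \<open>0\<close>.\<close>

lemma principal_part_in_parameter:
  fixes c :: "complex fps" and G :: "complex fls"
  assumes c: "c $ 0 = 0" "c $ 1 \<noteq> 0" and G: "ord_ge (- int M) G"
  defines "C \<equiv> fps_to_fls c"
  shows "ord_ge 0 (G - (\<Sum>a=1..M. fls_const ((C ^ (a - 1) * fls_deriv C * G) $$ (-1)) * inverse (C ^ a)))"
    (is "ord_ge 0 ?H")
proof (rule ccontr)
  assume n: "\<not> ord_ge 0 ?H"
  have C: "C \<noteq> 0" "fls_subdegree C = 1" using c by (auto simp: C_def subdegree_fls_eq_1)
  have C': "fls_subdegree (fls_deriv C) = 0" "fls_deriv C \<noteq> 0"
    using fls_subdegree_deriv[of C] C by (auto simp: fls_deriv_eq_0_iff)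
  have inv: "ord_ge (- int M) (inverse (C ^ a))" if "a \<le> M" for a
    using that C by (auto simp: ord_ge_iff fls_subdegree_pow)
  have "ord_ge (- int M) ?H"
    using G inv by (intro ord_ge_diff ord_ge_sum ord_ge_const_mult) auto
  then obtain r where r: "1 \<le> r" "r \<le> M" "fls_subdegree ?H = - int r" and H: "?H \<noteq> 0"
    using n that[of "nat (- fls_subdegree ?H)"] by (auto simp: ord_ge_iff)
  let ?g = "\<lambda>a. (C ^ (a - 1) * fls_deriv C * G) $$ (-1)"
  have pw: "C ^ (r - 1) * fls_deriv C * inverse (C ^ a) = C powi (int r - 1 - int a) * fls_deriv C" for a
  proof -
    have "C ^ (r - 1) = C powi (int r - 1)" using r by (simp add: power_int_def nat_diff_distrib)
    moreover have "inverse (C ^ a) = C powi (- int a)" by (simp add: power_int_minus)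
    moreover have "C powi (int r - 1 - int a) = C powi (int r - 1) * C powi (- int a)"
      using C(1) by (subst power_int_add[symmetric]) auto
    ultimately show ?thesis by (simp only: mult_ac)
  qed
  have "(C ^ (r - 1) * fls_deriv C * ?H) $$ (-1) =
     ?g r - (\<Sum>a=1..M. ?g a * (C ^ (r - 1) * fls_deriv C * inverse (C ^ a)) $$ (-1))"
    by (simp add: right_diff_distrib sum_distrib_left fls_nth_sum mult.left_commute[of _ "fls_const _"])
  also have "(\<Sum>a=1..M. ?g a * (C ^ (r - 1) * fls_deriv C * inverse (C ^ a)) $$ (-1)) = (\<Sum>a=1..M. if a = r then ?g r else 0)"
    unfolding pw using residue_power_int_deriv[OF c] by (intro sum.cong) (auto simp: C_def)
  also have "\<dots> = ?g r" using r by simp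
  finally have z: "(C ^ (r - 1) * fls_deriv C * ?H) $$ (-1) = 0" by simp
  have sd: "fls_subdegree (C ^ (r - 1) * fls_deriv C * ?H) = -1"
    using H C C' r by (subst fls_subdegree_mult) (auto simp: fls_subdegree_pow)
  have "C ^ (r - 1) * fls_deriv C * ?H \<noteq> 0" using H C C' by simp
  from nth_fls_subdegree_nonzero[OF this] show False unfolding sd using z by contradiction
qed

text \<open>\<open>Q^k - 1\<close> is \<open>Q - 1\<close> times a series with constant term
  \<open>k\<close>, a unit. This carries the precision known for \<open>\<lambda>\<close> over to
  its root, from which the flat coordinates are read off.\<close>

lemma ord_ge_of_power:
  fixes Q :: "complex fls"
  assumes Q: "ord_ge 0 Q" "Q $$ 0 = 1" and k: "k \<ge> 1" and o: "ord_ge n (Q ^ k - 1)"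
  shows "ord_ge n (Q - 1)"
proof -
  have e: "Q ^ k - 1 = (Q - 1) * (\<Sum>i<k. Q ^ i)"
    using power_diff_1_eq[of Q k] by simp
  define S where "S = (\<Sum>i<k. Q ^ i)"
  define q where "q = fls_regpart Q"
  have q: "Q = fps_to_fls q" "q $ 0 = 1" using Q ord_ge_regpart[OF Q(1)] by (auto simp: q_def)
  have "S $$ 0 = (\<Sum>i<k. (q ^ i) $ 0)"
    by (simp add: S_def q fls_nth_sum flip: fps_to_fls_power)
  also have "\<dots> = of_nat k" by (simp add: fps_power_zeroth q)
  finally have S0: "S $$ 0 \<noteq> 0" using k by simp
  then have S: "S \<noteq> 0" by auto
  have deg: "fls_subdegree S \<le> 0" using S0 by (rule fls_subdegree_leI)
  have "Q - 1 = (Q ^ k - 1) / S" using e S by (simp add: S_def)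
  also have "ord_ge n \<dots>" using o deg by (intro ord_ge_divide) auto
  finally show ?thesis .
qed

section \<open>Holomorphic functions of finitely many variables\<close>

lemma continuous_on_coord: "continuous_on U (\<lambda>t::point. t x)"
  by (rule continuous_on_subset[OF continuous_on_product_coordinates]) auto

lemma continuous_on_upd:
  fixes f :: "'a::topological_space \<Rightarrow> point"
  assumes "continuous_on U f" "continuous_on U g"
  shows "continuous_on U (\<lambda>u. (f u)(x := g u))"
proof (rule continuous_on_coordinatewise_then_product)
  fix i
  have "continuous_on U (\<lambda>u. f u i)"
    by (rule continuous_on_compose2[OF continuous_on_product_coordinates assms(1)]) auto
  then show "continuous_on U (\<lambda>u. ((f u)(x := g u)) i)"
    using assms(2) by (cases "i = x") auto
qed

lemma open_upd:
  fixes t :: point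
  assumes "open U"
  shows "open {s. t(x := s) \<in> U}"
proof -
  have "continuous_on UNIV (\<lambda>s. t(x := s))"
    by (intro continuous_on_upd continuous_intros)
  from open_vimage[OF assms this] show ?thesis by (simp add: vimage_def)
qed

lemma eventually_upd:
  fixes t :: point
  assumes "open U" "t \<in> U"
  shows "\<forall>\<^sub>F s in nhds (t x). t(x := s) \<in> U"
  using open_upd[OF assms(1), of t x] assms(2) unfolding eventually_nhds
  by (intro exI[of _ "{s. t(x := s) \<in> U}"]) auto

lemma field_differentiable_eventually_cong:
  assumes "f field_differentiable at x" "\<forall>\<^sub>F s in nhds x. f s = g s"
  shows "g field_differentiable at x"
  using assms DERIV_cong_ev[OF refl assms(2) refl] by (auto simp: field_differentiable_def)

lemma holo_wrt_cong:
  assumes "open U" "\<And>t. t \<in> U \<Longrightarrow> f t = g t"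
  shows "holo_wrt I U f \<longleftrightarrow> holo_wrt I U g"
proof -
  have *: "holo_wrt I U g" if f: "holo_wrt I U f" and eq: "\<And>t. t \<in> U \<Longrightarrow> f t = g t" for f g
    unfolding holo_wrt_def
  proof (intro conjI ballI)
    show "continuous_on U g" using f eq by (auto simp: holo_wrt_def cong: continuous_on_cong)
    fix t x assume t: "t \<in> U" "x \<in> I"
    then have "(\<lambda>s. f (t(x := s))) field_differentiable at (t x)" using f by (auto simp: holo_wrt_def)
    moreover have "\<forall>\<^sub>F s in nhds (t x). f (t(x := s)) = g (t(x := s))"
      using eventually_upd[OF assms(1) t(1)] by eventually_elim (rule eq)
    ultimately show "(\<lambda>s. g (t(x := s))) field_differentiable at (t x)"
      by (rule field_differentiable_eventually_cong)
  qed
  show ?thesis using *[of f g] *[of g f] assms(2) by auto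
qed

lemma holo_wrt_const [intro]: "holo_wrt I U (\<lambda>_. c)"
  by (auto simp: holo_wrt_def)

lemma holo_wrt_coord [intro]: "holo_wrt I U (\<lambda>t. t x)"
proof -
  have "(\<lambda>s. (t(y := s)) x) field_differentiable at (t y)" for t y
    by (cases "x = y") auto
  then show ?thesis unfolding holo_wrt_def using continuous_on_coord by blast
qed

lemma holo_wrt_add: "holo_wrt I U f \<Longrightarrow> holo_wrt I U g \<Longrightarrow> holo_wrt I U (\<lambda>t. f t + g t)"
  unfolding holo_wrt_def by (auto intro!: continuous_intros field_differentiable_add)

lemma holo_wrt_uminus: "holo_wrt I U f \<Longrightarrow> holo_wrt I U (\<lambda>t. - f t)"
  unfolding holo_wrt_def by (auto intro!: continuous_intros field_differentiable_minus)

lemma holo_wrt_diff: "holo_wrt I U f \<Longrightarrow> holo_wrt I U g \<Longrightarrow> holo_wrt I U (\<lambda>t. f t - g t)"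
  unfolding holo_wrt_def by (auto intro!: continuous_intros field_differentiable_diff)

lemma holo_wrt_mult: "holo_wrt I U f \<Longrightarrow> holo_wrt I U g \<Longrightarrow> holo_wrt I U (\<lambda>t. f t * g t)"
  unfolding holo_wrt_def by (auto intro!: continuous_intros field_differentiable_mult)

lemma holo_wrt_divide:
  "holo_wrt I U f \<Longrightarrow> holo_wrt I U g \<Longrightarrow> (\<And>t. t \<in> U \<Longrightarrow> g t \<noteq> 0) \<Longrightarrow> holo_wrt I U (\<lambda>t. f t / g t)"
  unfolding holo_wrt_def by (auto intro!: continuous_intros field_differentiable_divide)

lemma holo_wrt_sum: "(\<And>i. i \<in> A \<Longrightarrow> holo_wrt I U (f i)) \<Longrightarrow> holo_wrt I U (\<lambda>t. \<Sum>i\<in>A. f i t)"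
  by (induction A rule: infinite_finite_induct) (auto intro!: holo_wrt_add)

lemma holo_wrt_if: "holo_wrt I U f \<Longrightarrow> holo_wrt I U g \<Longrightarrow> holo_wrt I U (\<lambda>t. if b then f t else g t)"
  by (cases b) simp_all

section \<open>Partial derivatives by Cauchy's integral formula\<close>

lemma holo_wrt_field_derivative:
  assumes "holo_wrt I U f" "t \<in> U" "x \<in> I"
  shows "((\<lambda>s. f (t(x := s))) has_field_derivative pd x f t) (at (t x))"
  using assms unfolding holo_wrt_def pd_def by (simp add: field_differentiable_derivI)

lemma holo_wrt_field_derivative':
  assumes "holo_wrt I U f" "t(x := s) \<in> U" "x \<in> I"
  shows "((\<lambda>s. f (t(x := s))) has_field_derivative pd x f (t(x := s))) (at s)"
  using holo_wrt_field_derivative[OF assms] by simp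

lemma pd_upd: "pd x f (t(x := s)) = deriv (\<lambda>s. f (t(x := s))) s"
  by (simp add: pd_def)

lemma holo_wrt_holomorphic_on:
  assumes "holo_wrt I U f" "x \<in> I" "\<And>s. s \<in> S \<Longrightarrow> t(x := s) \<in> U"
  shows "(\<lambda>s. f (t(x := s))) holomorphic_on S"
  using holo_wrt_field_derivative'[OF assms(1) assms(3) assms(2)]
  by (meson DERIV_subset field_differentiable_def holomorphic_on_def subset_UNIV)

text \<open>Cauchy's formula with one circle that serves all points near \<open>t0\<close>. It is an
  integral over \<open>[0, 1]\<close>, with the derivative of the path over \<open>2 pi i\<close> in
  the kernel \<open>K\<close>, so that the theorems on parameter integrals apply.\<close>

lemma pd_integral_representation:
  assumes U: "open U" and f: "holo_wrt I U f" and x: "x \<in> I" and t0: "t0 \<in> U"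
  obtains N K \<gamma> where "open N" "t0 \<in> N" "N \<subseteq> U" "continuous_on (cbox 0 (1::real)) \<gamma>"
     "\<And>t \<theta>. t \<in> N \<Longrightarrow> \<theta> \<in> cbox 0 1 \<Longrightarrow> t(x := \<gamma> \<theta>) \<in> U"
     "\<And>t \<theta>. t \<in> N \<Longrightarrow> \<theta> \<in> cbox 0 1 \<Longrightarrow> \<gamma> \<theta> \<noteq> t x"
     "continuous_on (cbox 0 1) K"
     "\<And>t. t \<in> N \<Longrightarrow> pd x f t = integral (cbox 0 1) (\<lambda>\<theta>. f (t(x := \<gamma> \<theta>)) / (\<gamma> \<theta> - t x)\<^sup>2 * K \<theta>)"
proof -
  have "continuous_on UNIV (\<lambda>(t::point,s). t(x := s))"
    unfolding split_beta by (intro continuous_on_upd continuous_intros)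
  then have "open ((\<lambda>(t::point,s). t(x := s)) -` U)"
    using U by (rule open_vimage[rotated])
  moreover have "(t0, t0 x) \<in> (\<lambda>(t::point,s). t(x := s)) -` U" using t0 by simp
  ultimately obtain A B where AB: "open A" "open B" "(t0, t0 x) \<in> A \<times> B"
      "A \<times> B \<subseteq> (\<lambda>(t::point,s). t(x := s)) -` U"
    by (rule open_prod_elim)
  then obtain r where r: "r > 0" "cball (t0 x) r \<subseteq> B" by (meson mem_Sigma_iff open_contains_cball)
  define N where "N = A \<inter> U \<inter> {t. t x \<in> ball (t0 x) r}"
  have "open {t::point. t x \<in> ball (t0 x) r}"
    using open_vimage[OF open_ball continuous_on_coord[of UNIV x]] by (simp add: vimage_def)
  then have N: "open N" "t0 \<in> N" "N \<subseteq> U" using AB U t0 r by (auto simp: N_def)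
  define \<gamma> where "\<gamma> = circlepath (t0 x) r"
  define K where "K = (\<lambda>\<theta>. vector_derivative \<gamma> (at \<theta>) / (2 * pi * \<i>))"
  have \<gamma>r: "dist (t0 x) (\<gamma> \<theta>) = r" for \<theta>
    using r by (simp add: \<gamma>_def circlepath dist_norm norm_mult)
  have inU: "t(x := \<gamma> \<theta>) \<in> U" if "t \<in> N" for t \<theta>
    using that AB(4) r(2) \<gamma>r[of \<theta>] by (auto simp: N_def subset_iff)
  have ne: "\<gamma> \<theta> \<noteq> t x" if "t \<in> N" for t \<theta>
    using that \<gamma>r[of \<theta>] by (auto simp: N_def)
  have rep: "pd x f t = integral (cbox 0 1) (\<lambda>\<theta>. f (t(x := \<gamma> \<theta>)) / (\<gamma> \<theta> - t x)\<^sup>2 * K \<theta>)" if t: "t \<in> N" for t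
  proof -
    define g where "g = (\<lambda>s. f (t(x := s)))"
    have g: "g holomorphic_on cball (t0 x) r"
      unfolding g_def using t AB(4) r(2) by (intro holo_wrt_holomorphic_on[OF f x]) (auto simp: N_def subset_iff)
    have c: "contour_integral \<gamma> (\<lambda>u. g u / (u - t x) ^ Suc 1) = (2 * pi) * \<i> * (deriv ^^ 1) g (t x) / fact 1"
      unfolding \<gamma>_def using g t
      by (intro Cauchy_contour_integral_circlepath)
         (auto simp: N_def holomorphic_on_imp_continuous_on intro: holomorphic_on_subset)
    have "pd x f t = deriv g (t x)" by (simp add: pd_def g_def)
    also have "\<dots> = contour_integral \<gamma> (\<lambda>u. g u / (u - t x)\<^sup>2) / (2 * pi * \<i>)"
      using c by (simp add: power2_eq_square)
    also have "\<dots> = integral (cbox 0 1) (\<lambda>\<theta>. g (\<gamma> \<theta>) / (\<gamma> \<theta> - t x)\<^sup>2 * vector_derivative \<gamma> (at \<theta>) * (1 / (2 * pi * \<i>)))"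
      by (subst integral_mult_left) (simp add: contour_integral_integral)
    finally show ?thesis by (simp add: K_def g_def)
  qed
  have "continuous_on (cbox 0 1) \<gamma>" "continuous_on (cbox 0 1) K"
    unfolding K_def \<gamma>_def vector_derivative_circlepath
    by (auto simp: circlepath intro!: continuous_intros)
  with N inU ne rep show ?thesis by (intro that[of N \<gamma> K]) auto
qed

lemma continuous_on_pd:
  assumes U: "open U" and f: "holo_wrt I U f" and x: "x \<in> I"
  shows "continuous_on U (pd x f)"
proof (rule continuous_on_subset[OF continuous_on_open_Union[of "{N. open N \<and> N \<subseteq> U \<and> continuous_on N (pd x f)}"]])
  show "U \<subseteq> \<Union> {N. open N \<and> N \<subseteq> U \<and> continuous_on N (pd x f)}"
  proof
    fix t0 assume t0: "t0 \<in> U"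
    obtain N K \<gamma> where N: "open N" "t0 \<in> N" "N \<subseteq> U"
      and c: "continuous_on (cbox 0 (1::real)) \<gamma>"
      and i: "\<And>t \<theta>. t \<in> N \<Longrightarrow> \<theta> \<in> cbox 0 1 \<Longrightarrow> t(x := \<gamma> \<theta>) \<in> U"
      and n: "\<And>t \<theta>. t \<in> N \<Longrightarrow> \<theta> \<in> cbox 0 1 \<Longrightarrow> \<gamma> \<theta> \<noteq> t x"
      and K: "continuous_on (cbox 0 1) K"
      and r: "\<And>t. t \<in> N \<Longrightarrow> pd x f t = integral (cbox 0 1) (\<lambda>\<theta>. f (t(x := \<gamma> \<theta>)) / (\<gamma> \<theta> - t x)\<^sup>2 * K \<theta>)"
      by (rule pd_integral_representation[OF U f x t0]) blast
    have cf: "continuous_on U f" using f by (simp add: holo_wrt_def)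
    have "continuous_on (N \<times> cbox 0 1) (\<lambda>(t, \<theta>). f (t(x := \<gamma> \<theta>)) / (\<gamma> \<theta> - t x)\<^sup>2 * K \<theta>)"
      (is "continuous_on ?S _")
    proof -
      have 1: "continuous_on ?S (\<lambda>z. \<gamma> (snd z))"
        by (rule continuous_on_compose2[OF c continuous_on_snd[OF continuous_on_id]]) auto
      have 2: "continuous_on ?S (\<lambda>z. K (snd z))"
        by (rule continuous_on_compose2[OF K continuous_on_snd[OF continuous_on_id]]) auto
      have 3: "continuous_on ?S (\<lambda>z. f ((fst z)(x := \<gamma> (snd z))))"
        by (rule continuous_on_compose2[OF cf continuous_on_upd[OF continuous_on_fst[OF continuous_on_id] 1]])
          (use i in auto)
      have 4: "continuous_on ?S (\<lambda>z. fst z x)"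
        by (rule continuous_on_compose2[OF continuous_on_product_coordinates[of x] continuous_on_fst[OF continuous_on_id]]) auto
      show ?thesis
        unfolding split_beta
        by (intro continuous_on_mult continuous_on_divide continuous_on_power continuous_on_diff 1 2 3 4) (use n in auto)
    qed
    then have "continuous_on N (\<lambda>t. integral (cbox 0 1) (\<lambda>\<theta>. f (t(x := \<gamma> \<theta>)) / (\<gamma> \<theta> - t x)\<^sup>2 * K \<theta>))"
      by (rule integral_continuous_on_param)
    then have "continuous_on N (pd x f)" using r by (simp cong: continuous_on_cong)
    with N show "t0 \<in> \<Union> {N. open N \<and> N \<subseteq> U \<and> continuous_on N (pd x f)}" by auto
  qed
qed auto

text \<open>Makes repeated differentiation of potentials legitimate. In the direction
  \<open>x\<close> this is one-variable theory; in another direction \<open>y\<close> the integral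
  representation is differentiated under the integral sign, for which the continuity of
  \<open>pd y f\<close> is essential.\<close>

lemma holo_wrt_pd:
  assumes U: "open U" and f: "holo_wrt I U f" and x: "x \<in> I"
  shows "holo_wrt I U (pd x f)"
  unfolding holo_wrt_def
proof (intro conjI ballI)
  show "continuous_on U (pd x f)" by (rule continuous_on_pd[OF assms])
  fix t0 y assume t0: "t0 \<in> U" and y: "y \<in> I"
  show "(\<lambda>s. pd x f (t0(y := s))) field_differentiable at (t0 y)"
  proof (cases "y = x")
    case True
    have "deriv (\<lambda>s. f (t0(x := s))) holomorphic_on {s. t0(x := s) \<in> U}"
      by (intro holomorphic_deriv open_upd U holo_wrt_holomorphic_on[OF f x]) auto
    then show ?thesis
      unfolding True pd_upd using t0 open_upd[OF U, of t0 x]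
      by (auto simp: holomorphic_on_open field_differentiable_def)
  next
    case False
    obtain N K \<gamma> where N: "open N" "t0 \<in> N" "N \<subseteq> U"
      and c: "continuous_on (cbox 0 (1::real)) \<gamma>"
      and i: "\<And>t \<theta>. t \<in> N \<Longrightarrow> \<theta> \<in> cbox 0 1 \<Longrightarrow> t(x := \<gamma> \<theta>) \<in> U"
      and n: "\<And>t \<theta>. t \<in> N \<Longrightarrow> \<theta> \<in> cbox 0 1 \<Longrightarrow> \<gamma> \<theta> \<noteq> t x"
      and K: "continuous_on (cbox 0 1) K"
      and r: "\<And>t. t \<in> N \<Longrightarrow> pd x f t = integral (cbox 0 1) (\<lambda>\<theta>. f (t(x := \<gamma> \<theta>)) / (\<gamma> \<theta> - t x)\<^sup>2 * K \<theta>)"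
      by (rule pd_integral_representation[OF U f x t0]) blast
    have "t0 y \<in> {s. t0(y := s) \<in> N}" using N(2) by simp
    then obtain e where e0: "e > 0" "ball (t0 y) e \<subseteq> {s. t0(y := s) \<in> N}"
      using open_upd[OF N(1), of t0 y] open_contains_ball_eq by blast
    then have e: "e > 0" "\<And>s. s \<in> ball (t0 y) e \<Longrightarrow> t0(y := s) \<in> N" by blast+
    have cf: "continuous_on U f" using f by (simp add: holo_wrt_def)
    note cp = continuous_on_pd[OF U f y]
    let ?k = "\<lambda>s \<theta>. f (t0(y := s, x := \<gamma> \<theta>)) / (\<gamma> \<theta> - t0 x)\<^sup>2 * K \<theta>"
    have tw: "t0(y := s, x := u) = t0(x := u, y := s)" for s u using False by (rule fun_upd_twist)
    have n0: "\<gamma> \<theta> \<noteq> t0 x" if "\<theta> \<in> cbox 0 1" for \<theta> using n[OF N(2) that] .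
    have "(\<lambda>s. integral (cbox 0 1) (?k s)) field_differentiable at (t0 y) within ball (t0 y) e"
    proof (rule leibniz_rule_field_differentiable)
      show "((\<lambda>s. ?k s \<theta>) has_field_derivative pd y f (t0(y := s, x := \<gamma> \<theta>)) / (\<gamma> \<theta> - t0 x)\<^sup>2 * K \<theta>)
          (at s within ball (t0 y) e)" if "s \<in> ball (t0 y) e" "\<theta> \<in> cbox 0 1" for s \<theta>
        using holo_wrt_field_derivative'[OF f _ y, of "t0(x := \<gamma> \<theta>)" s] i[OF e(2)[OF that(1)] that(2)]
        by (intro DERIV_cmult_right DERIV_cdivide) (auto simp: tw intro: DERIV_subset)
      show "?k s integrable_on cbox 0 1" if "s \<in> ball (t0 y) e" for s
      proof (rule integrable_continuous)
        have 3: "continuous_on (cbox 0 1) (\<lambda>\<theta>. f (t0(y := s, x := \<gamma> \<theta>)))"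
          by (rule continuous_on_compose2[OF cf continuous_on_upd[OF continuous_on_const c]])
            (use i[OF e(2)[OF that]] in auto)
        show "continuous_on (cbox 0 1) (?k s)"
          by (intro continuous_on_mult continuous_on_divide continuous_on_power continuous_on_diff c K 3 continuous_on_const)
            (use n0 in auto)
      qed
      show "continuous_on (ball (t0 y) e \<times> cbox 0 1)
         (\<lambda>(s, \<theta>). pd y f (t0(y := s, x := \<gamma> \<theta>)) / (\<gamma> \<theta> - t0 x)\<^sup>2 * K \<theta>)"
        (is "continuous_on ?S _")
      proof -
        have 1: "continuous_on ?S (\<lambda>z. \<gamma> (snd z))"
          by (rule continuous_on_compose2[OF c continuous_on_snd[OF continuous_on_id]]) auto
        have 2: "continuous_on ?S (\<lambda>z. K (snd z))"
          by (rule continuous_on_compose2[OF K continuous_on_snd[OF continuous_on_id]]) auto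
        have 3: "continuous_on ?S (\<lambda>z. pd y f (t0(y := fst z, x := \<gamma> (snd z))))"
          by (rule continuous_on_compose2[OF cp continuous_on_upd[OF continuous_on_upd[OF continuous_on_const
                 continuous_on_fst[OF continuous_on_id]] 1]])
            (use i[OF e(2)] in auto)
        show ?thesis
          unfolding split_beta
          by (intro continuous_on_mult continuous_on_divide continuous_on_power continuous_on_diff 1 2 3 continuous_on_const)
            (use n0 in auto)
      qed
    qed (use e in auto)
    then have "(\<lambda>s. integral (cbox 0 1) (?k s)) field_differentiable at (t0 y)"
      using e(1) by (simp add: field_differentiable_def at_within_open[of "t0 y" "ball (t0 y) e"])
    moreover have "\<forall>\<^sub>F s in nhds (t0 y). integral (cbox 0 1) (?k s) = pd x f (t0(y := s))"
      unfolding eventually_nhds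
      using e r False by (intro exI[of _ "ball (t0 y) e"]) auto
    ultimately show ?thesis
      by (rule field_differentiable_eventually_cong)
  qed
qed

lemma pd_eventually_cong:
  assumes "\<forall>\<^sub>F s in nhds (t x). f (t(x := s)) = g (t(x := s))"
  shows "pd x f t = pd x g t"
  unfolding pd_def using assms by (rule deriv_cong_ev) simp

lemma pd_cong:
  assumes "open U" "t \<in> U" "\<And>t. t \<in> U \<Longrightarrow> f t = g t"
  shows "pd x f t = pd x g t"
  using eventually_upd[OF assms(1,2), of x] by (intro pd_eventually_cong) (auto elim!: eventually_mono assms(3))

lemma pd_zero [simp]: "pd x (\<lambda>t. c) t = 0"
  by (simp add: pd_def)

section \<open>Power series and Laurent series with holomorphic coefficients\<close>

definition holo_fps :: "(nat \<times> nat) set \<Rightarrow> point set \<Rightarrow> (point \<Rightarrow> complex fps) \<Rightarrow> bool" where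
  "holo_fps I U F \<longleftrightarrow> (\<forall>n. holo_wrt I U (\<lambda>t. F t $ n))"

text \<open>The lower bound \<open>d\<close> for the order is uniform in \<open>t\<close>, which
  makes the coefficients of a product finite sums over a range independent of
  \<open>t\<close>.\<close>

definition holo_fls :: "(nat \<times> nat) set \<Rightarrow> point set \<Rightarrow> int \<Rightarrow> (point \<Rightarrow> complex fls) \<Rightarrow> bool" where
  "holo_fls I U d F \<longleftrightarrow> (\<forall>t\<in>U. ord_ge d (F t)) \<and> (\<forall>n. holo_wrt I U (\<lambda>t. F t $$ n))"

lemma holo_fpsD: "holo_fps I U F \<Longrightarrow> holo_wrt I U (\<lambda>t. F t $ n)"
  by (simp add: holo_fps_def)

lemma holo_fps_const: "holo_fps I U (\<lambda>_. F)"
  by (auto simp: holo_fps_def)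

lemma holo_fps_mult: "holo_fps I U F \<Longrightarrow> holo_fps I U G \<Longrightarrow> holo_fps I U (\<lambda>t. F t * G t)"
  by (auto simp: holo_fps_def fps_mult_nth intro!: holo_wrt_sum holo_wrt_mult)

lemma holo_fps_power: "holo_fps I U F \<Longrightarrow> holo_fps I U (\<lambda>t. F t ^ n)"
  by (induction n) (auto intro: holo_fps_mult holo_fps_const)

text \<open>The coefficients of the inverse satisfy a recursion whose only denominator is the
  constant term of \<open>F t\<close>.\<close>

lemma holo_fps_inverse:
  assumes F: "holo_fps I U F" and nz: "\<And>t. t \<in> U \<Longrightarrow> F t $ 0 \<noteq> 0" and U: "open U"
  shows "holo_fps I U (\<lambda>t. inverse (F t))"
proof -
  have "holo_wrt I U (\<lambda>t. inverse (F t) $ n)" for n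
  proof (induction n rule: less_induct)
    case (less n)
    have "holo_wrt I U (\<lambda>t. ((if n = 0 then 1 else 0) - (\<Sum>i=1..n. F t $ i * inverse (F t) $ (n - i))) / F t $ 0)"
      using less nz F unfolding holo_fps_def
      by (intro holo_wrt_divide holo_wrt_diff holo_wrt_sum holo_wrt_mult holo_wrt_const) auto
    also have "?this \<longleftrightarrow> ?case"
    proof (rule holo_wrt_cong[OF U])
      fix t assume t: "t \<in> U"
      have "(F t * inverse (F t)) $ n = (if n = 0 then 1 else 0)"
        using nz[OF t] by (simp add: inverse_mult_eq_1')
      then have "F t $ 0 * inverse (F t) $ n + (\<Sum>i=1..n. F t $ i * inverse (F t) $ (n - i)) = (if n = 0 then 1 else 0)"
        unfolding fps_mult_nth by (simp add: sum.atLeast_Suc_atMost)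
      then show "((if n = 0 then 1 else 0) - (\<Sum>i=1..n. F t $ i * inverse (F t) $ (n - i))) / F t $ 0 = inverse (F t) $ n"
        using nz[OF t] by (simp add: field_simps)
    qed
    finally show ?case .
  qed
  then show ?thesis by (simp add: holo_fps_def)
qed

lemma holo_flsD: "holo_fls I U d F \<Longrightarrow> holo_wrt I U (\<lambda>t. F t $$ n)"
  by (simp add: holo_fls_def)

lemma holo_fls_ord: "holo_fls I U d F \<Longrightarrow> t \<in> U \<Longrightarrow> ord_ge d (F t)"
  by (simp add: holo_fls_def)

lemma holo_fls_mono: "holo_fls I U d F \<Longrightarrow> e \<le> d \<Longrightarrow> holo_fls I U e F"
  by (auto simp: holo_fls_def intro: ord_ge_mono)

lemma holo_fls_fixed: "ord_ge d F \<Longrightarrow> holo_fls I U d (\<lambda>_. F)"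
  by (auto simp: holo_fls_def)

lemma holo_fls_const: "holo_wrt I U f \<Longrightarrow> holo_fls I U 0 (\<lambda>t. fls_const (f t))"
  by (auto simp: holo_fls_def intro: holo_wrt_const holo_wrt_if)

lemma holo_fls_fps: "holo_fps I U F \<Longrightarrow> holo_fls I U 0 (\<lambda>t. fps_to_fls (F t))"
  by (auto simp: holo_fls_def holo_fps_def intro: holo_wrt_const holo_wrt_if)

lemma holo_fls_add: "holo_fls I U d F \<Longrightarrow> holo_fls I U d G \<Longrightarrow> holo_fls I U d (\<lambda>t. F t + G t)"
  by (auto simp: holo_fls_def intro: ord_ge_add holo_wrt_add)

lemma holo_fls_diff: "holo_fls I U d F \<Longrightarrow> holo_fls I U d G \<Longrightarrow> holo_fls I U d (\<lambda>t. F t - G t)"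
  by (auto simp: holo_fls_def intro: ord_ge_diff holo_wrt_diff)

lemma fls_times_nth_ord_ge:
  fixes F G :: "'a::field fls"
  assumes "ord_ge a F" "ord_ge b G"
  shows "(F * G) $$ n = (\<Sum>i=a..n - b. F $$ i * G $$ (n - i))"
proof (cases "F = 0 \<or> G = 0")
  case False
  then have d: "a \<le> fls_subdegree F" "b \<le> fls_subdegree G" using assms by (auto simp: ord_ge_iff)
  have "(F * G) $$ n = (\<Sum>i=fls_subdegree F..n - fls_subdegree G. F $$ i * G $$ (n - i))"
    by (rule fls_times_nth(2))
  also have "\<dots> = (\<Sum>i=a..n - b. F $$ i * G $$ (n - i))"
    using d by (intro sum.mono_neutral_left) auto
  finally show ?thesis .
qed auto

lemma holo_fls_mult:
  assumes "holo_fls I U a F" "holo_fls I U b G" "open U"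
  shows "holo_fls I U (a + b) (\<lambda>t. F t * G t)"
  unfolding holo_fls_def
proof (intro conjI ballI allI)
  show "ord_ge (a + b) (F t * G t)" if "t \<in> U" for t
    using that assms by (auto simp: holo_fls_def intro: ord_ge_mult[of a _ b])
  fix n
  have "holo_wrt I U (\<lambda>t. \<Sum>i=a..n - b. F t $$ i * G t $$ (n - i))"
    using assms by (auto simp: holo_fls_def intro!: holo_wrt_sum holo_wrt_mult)
  also have "?this \<longleftrightarrow> holo_wrt I U (\<lambda>t. (F t * G t) $$ n)"
    using assms by (intro holo_wrt_cong) (auto simp: holo_fls_def fls_times_nth_ord_ge[of a _ b])
  finally show "holo_wrt I U (\<lambda>t. (F t * G t) $$ n)" .
qed

lemma holo_fls_power:
  assumes "holo_fls I U a F" "open U"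
  shows "holo_fls I U (int n * a) (\<lambda>t. F t ^ n)"
proof (induction n)
  case 0
  then show ?case using holo_fls_fixed[of 0 1] by (simp add: ord_ge_def)
next
  case (Suc n)
  from holo_fls_mult[OF assms(1) Suc assms(2)] show ?case by (simp add: algebra_simps)
qed

lemma holo_fls_cong:
  assumes "open U" "\<And>t. t \<in> U \<Longrightarrow> F t = G t"
  shows "holo_fls I U d F \<longleftrightarrow> holo_fls I U d G"
proof -
  have "holo_wrt I U (\<lambda>t. F t $$ n) \<longleftrightarrow> holo_wrt I U (\<lambda>t. G t $$ n)" for n
    using assms by (intro holo_wrt_cong) auto
  then show ?thesis using assms(2) by (auto simp: holo_fls_def)
qed

text \<open>Since the coefficient at the fixed position \<open>d\<close> is nowhere zero, the order
  is constant on \<open>U\<close>, and a shift by \<open>d\<close> reduces the claim to power series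
  with invertible constant term.\<close>

lemma holo_fls_inverse:
  assumes F: "holo_fls I U d F" and nz: "\<And>t. t \<in> U \<Longrightarrow> F t $$ d \<noteq> 0" and U: "open U"
  shows "holo_fls I U (- d) (\<lambda>t. inverse (F t))"
proof -
  define G where "G = (\<lambda>t. fls_regpart (fls_shift d (F t)))"
  have "holo_fps I U G" using F by (auto simp: G_def holo_fps_def holo_fls_def)
  then have 1: "holo_fps I U (\<lambda>t. inverse (G t))"
    by (rule holo_fps_inverse) (use nz U in \<open>auto simp: G_def\<close>)
  have "holo_fls I U (- d) (\<lambda>t. fls_X_intpow (- d) * fps_to_fls (inverse (G t)))"
    using holo_fls_mult[OF holo_fls_fixed[OF ord_ge_intpow[OF order_refl]] holo_fls_fps[OF 1] U, of "- d"] by simp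
  also have "?this \<longleftrightarrow> ?thesis"
  proof (rule holo_fls_cong[OF U])
    fix t assume t: "t \<in> U"
    have "ord_ge 0 (fls_shift d (F t))" using holo_fls_ord[OF F t] by (auto simp: ord_ge_def)
    then have "fps_to_fls (G t) = fls_shift d (F t)" unfolding G_def by (rule ord_ge_regpart)
    then have Ft: "F t = fls_X_intpow d * fps_to_fls (G t)" by (simp add: fls_X_intpow_times_conv_shift)
    have g0: "G t $ 0 \<noteq> 0" using nz[OF t] by (simp add: G_def)
    have "fps_to_fls (inverse (G t)) = inverse (fps_to_fls (G t))"
      using g0 by (simp add: fls_inverse_fps_to_fls)
    then show "fls_X_intpow (- d) * fps_to_fls (inverse (G t)) = inverse (F t)"
      unfolding Ft by (simp add: fls_inverse_X_intpow)
  qed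
  finally show ?thesis .
qed

section \<open>The superpotential in flat coordinates\<close>

text \<open>
  Near \<open>z = v\<^sub>i\<^sub>,\<^sub>0\<close> put \<open>w = 1 / z\<^sub>i\<close>, and near infinity \<open>w = 1 / z\<^sub>0\<close>. In terms of \<open>w\<close> the flat
  coordinates are the leading coefficients of \<open>z = v\<^sub>i\<^sub>,\<^sub>0 + cser k t i + O(w\<^bsup>k\<^sub>i + 1\<^esup>)\<close> and of
  \<open>z = dser k t / w + O(w\<^bsup>k\<^sub>0\<^esup>)\<close>.
\<close>

definition cser :: "(nat \<Rightarrow> nat) \<Rightarrow> point \<Rightarrow> nat \<Rightarrow> complex fps" where
  "cser k t i = Abs_fps (\<lambda>m. if 1 \<le> m \<and> m \<le> k i then t (i, k i + 1 - m) / of_nat (k i) else 0)"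

definition dser :: "(nat \<Rightarrow> nat) \<Rightarrow> point \<Rightarrow> complex fps" where
  "dser k t = Abs_fps (\<lambda>m. if m = 0 then 1 else if 2 \<le> m \<and> m \<le> k 0 then - t (0, k 0 + 1 - m) else 0)"

abbreviation gser :: "(nat \<Rightarrow> nat) \<Rightarrow> point \<Rightarrow> complex fps" where
  "gser k t \<equiv> inverse (dser k t)"

text \<open>The coefficient of \<open>1 / (z - t (i, 0))^a\<close>, and at infinity of
  \<open>z^(a-1)\<close>. At a finite pole it is the residue of
  \<open>(z - t (i, 0))^(a-1) w^(-\<alpha>) dw\<close>, with \<open>k i * w^(-k i - 1)\<close> in
  place of \<open>w^(-\<alpha>)\<close> if \<open>\<alpha> = 0\<close>; at infinity it is that of
  \<open>z^(-a) w^(-\<alpha>-1) dw\<close>. There \<open>\<alpha> = k 0\<close> is used as well: it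
  gives the polynomial part of the derivative of \<open>\<lambda>\<close> in
  \<open>z\<close>.\<close>

definition pcoef :: "(nat \<Rightarrow> nat) \<Rightarrow> point \<Rightarrow> nat \<Rightarrow> nat \<Rightarrow> nat \<Rightarrow> complex" where
  "pcoef k t i \<alpha> a =
     (if i = 0 then if a \<le> \<alpha> then (gser k t ^ a) $ (\<alpha> - a) else 0
      else if \<alpha> = 0 then of_nat (k i) * (cser k t i ^ (a - 1)) $ (k i)
      else (cser k t i ^ (a - 1)) $ (\<alpha> - 1))"

text \<open>
  \<open>Phi \<iota> k t (i, \<alpha>)\<close> is \<open>\<partial>\<lambda>/\<partial>t\<^sub>i\<^sub>,\<^sub>\<alpha>\<close>. It is evaluated in a field extension \<open>\<iota>\<close> of the complex
  numbers, so that the expansion at a pole is the value at a Laurent series.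
\<close>

definition Phi :: "(complex \<Rightarrow> 'f::field) \<Rightarrow> (nat \<Rightarrow> nat) \<Rightarrow> point \<Rightarrow> nat \<times> nat \<Rightarrow> 'f \<Rightarrow> 'f" where
  "Phi \<iota> k t x z = (case x of (i, \<alpha>) \<Rightarrow>
     if i = 0 then \<Sum>a=1..\<alpha>. \<iota> (pcoef k t 0 \<alpha> a) * z ^ (a - 1)
     else \<Sum>a=1..k i + 1. \<iota> (pcoef k t i \<alpha> a) * inverse ((z - \<iota> (t (i, 0))) ^ a))"

text \<open>The derivative of \<open>\<lambda>\<close> with respect to \<open>z\<close>.\<close>

definition Lamz :: "(complex \<Rightarrow> 'f::field) \<Rightarrow> nat \<Rightarrow> (nat \<Rightarrow> nat) \<Rightarrow> point \<Rightarrow> 'f \<Rightarrow> 'f" where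
  "Lamz \<iota> N k t z = Phi \<iota> k t (0, k 0) z - (\<Sum>i=1..N. Phi \<iota> k t (i, 0) z)"

lemma Phi_0: "Phi \<iota> k t (0, \<alpha>) z = (\<Sum>a=1..\<alpha>. \<iota> (pcoef k t 0 \<alpha> a) * z ^ (a - 1))"
  by (simp add: Phi_def)

lemma Phi_pos: "i \<noteq> 0 \<Longrightarrow> Phi \<iota> k t (i, \<alpha>) z =
    (\<Sum>a=1..k i + 1. \<iota> (pcoef k t i \<alpha> a) * inverse ((z - \<iota> (t (i, 0))) ^ a))"
  by (simp add: Phi_def)

abbreviation cls :: "(nat \<Rightarrow> nat) \<Rightarrow> point \<Rightarrow> nat \<Rightarrow> complex fls" where
  "cls k t i \<equiv> fps_to_fls (cser k t i)"

lemma cser_nth_0 [simp]: "cser k t i $ 0 = 0"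
  by (simp add: cser_def)

lemma cser_nth_1: "k i \<ge> 1 \<Longrightarrow> cser k t i $ 1 = t (i, k i) / of_nat (k i)"
  by (simp add: cser_def)

lemma dser_nth_0 [simp]: "dser k t $ 0 = 1"
  by (simp add: dser_def)

lemma gser_nth_0 [simp]: "gser k t $ 0 = 1"
  by simp

lemma gser_pow_nth_0 [simp]: "(gser k t ^ a) $ 0 = 1"
  by (simp add: fps_power_zeroth)

lemma Phi_laurent:
  assumes "g has_laurent_expansion Z"
  shows "(\<lambda>w. Phi (\<lambda>x. x) k t x (g w)) has_laurent_expansion Phi fls_const k t x Z"
  by (cases x) (auto simp: Phi_def intro!: laurent_expansion_intros assms)

lemma Lamz_laurent:
  assumes "g has_laurent_expansion Z"
  shows "(\<lambda>w. Lamz (\<lambda>x. x) N k t (g w)) has_laurent_expansion Lamz fls_const N k t Z"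
  unfolding Lamz_def by (intro laurent_expansion_intros Phi_laurent assms)

lemma Phi_compose:
  assumes "c \<noteq> 0" "c $ 0 = 0"
  shows "fls_compose_fps (Phi fls_const k t x Z) c = Phi fls_const k t x (fls_compose_fps Z c)"
  using assms by (cases x) (simp add: Phi_def fls_compose_fps_sum fls_compose_fps_mult fls_compose_fps_inverse
      fls_compose_fps_power fls_compose_fps_diff del: sum.cl_ivl_Suc power_Suc)

lemma Lamz_compose:
  assumes "c \<noteq> 0" "c $ 0 = 0"
  shows "fls_compose_fps (Lamz fls_const N k t Z) c = Lamz fls_const N k t (fls_compose_fps Z c)"
  using assms by (simp add: Lamz_def Phi_compose fls_compose_fps_sum fls_compose_fps_diff)

text \<open>\<open>z\<close> as a series in the local parameter \<open>1 / z\<close> or \<open>z - t\<^sub>i\<^sub>,\<^sub>0\<close>.\<close>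

definition zpar :: "point \<Rightarrow> nat \<Rightarrow> complex fls" where
  "zpar t i = (if i = 0 then fls_X_inv else fls_const (t (i, 0)) + fls_X)"

lemma zpar_0 [simp]: "zpar t 0 = fls_X_inv" by (simp add: zpar_def)

lemma zpar_pos: "i \<noteq> 0 \<Longrightarrow> zpar t i = fls_const (t (i, 0)) + fls_X" by (simp add: zpar_def)

lemma fls_deriv_zpar: "i \<noteq> 0 \<Longrightarrow> fls_deriv (zpar t i) = 1"
  by (simp add: zpar_pos)

text \<open>\<open>1 / z\<close> near infinity as a series in the parameter \<open>w\<close>, from
  \<open>z = dser k t / w\<close>.\<close>

definition infser :: "(nat \<Rightarrow> nat) \<Rightarrow> point \<Rightarrow> complex fps" where
  "infser k t = fps_X * gser k t"

abbreviation infls :: "(nat \<Rightarrow> nat) \<Rightarrow> point \<Rightarrow> complex fls" where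
  "infls k t \<equiv> fps_to_fls (infser k t)"

lemma infser_nth [simp]: "infser k t $ 0 = 0" "infser k t $ Suc 0 = 1"
  by (simp_all add: infser_def)

lemma infser_nz [simp]: "infser k t \<noteq> 0"
  using infser_nth(2)[of k t] by (auto simp del: infser_nth)

lemma cser_nz: "k i \<ge> 1 \<Longrightarrow> t (i, k i) \<noteq> 0 \<Longrightarrow> cser k t i \<noteq> 0" "k i \<ge> 1 \<Longrightarrow> t (i, k i) \<noteq> 0 \<Longrightarrow> cser k t i $ 1 \<noteq> 0"
  using cser_nth_1[of k i t] by auto

lemma residue_cls:
  assumes "i \<noteq> 0" "k i \<ge> 1" "t (i, k i) \<noteq> 0"
  shows "F $$ (-1) = (fls_compose_fps F (cser k t i) * fls_deriv (cls k t i)) $$ (-1)"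
  using residue_compose[of "cser k t i" F] cser_nz(2)[of k i t] assms by simp

lemma compose_zpar:
  assumes "i \<noteq> 0" "k i \<ge> 1" "t (i, k i) \<noteq> 0"
  shows "fls_compose_fps (zpar t i) (cser k t i) = fls_const (t (i, 0)) + cls k t i"
  using cser_nz[of k i t] assms by (simp add: zpar_def fls_compose_fps_add)

text \<open>A form at infinity is \<open>F dz\<close> with \<open>F\<close> a series in
  \<open>1 / z\<close>, hence the factor \<open>fls_deriv fls_X_inv\<close>; the substitution
  \<open>1 / z = c\<close> turns \<open>dz\<close> into the derivative of
  \<open>1 / c\<close>.\<close>

lemma residue_compose_inf:
  fixes F :: "complex fls"
  assumes c: "c $ 0 = 0" "c $ 1 \<noteq> 0"
  shows "(F * fls_deriv fls_X_inv) $$ (-1) = (fls_compose_fps F c * fls_deriv (inverse (fps_to_fls c))) $$ (-1)"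
proof -
  have [simp]: "c \<noteq> 0" using c by auto
  have "fls_compose_fps (F * fls_deriv fls_X_inv) c * fls_deriv (fps_to_fls c) =
      fls_compose_fps F c * fls_deriv (inverse (fps_to_fls c))"
    using c by (simp add: fls_compose_fps_mult fls_compose_fps_power fls_inverse_deriv
        fls_compose_fps_inverse power_inverse flip: fls_inverse_X)
  then show ?thesis using residue_compose[OF c, of "F * fls_deriv fls_X_inv"] by simp
qed

lemma residue_infls:
  "(F * fls_deriv fls_X_inv) $$ (-1) = (fls_compose_fps F (infser k t) * fls_deriv (inverse (infls k t))) $$ (-1)"
  by (rule residue_compose_inf) auto

lemma compose_zpar_0: "fls_compose_fps fls_X_inv (infser k t) = inverse (infls k t)"
  by (simp add: fls_compose_fps_inverse flip: fls_inverse_X)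

text \<open>In \<open>w\<close> the form \<open>\<partial>\<lambda>/\<partial>t\<^sub>i\<^sub>,\<^sub>\<alpha> dz\<close> has the principal part of \<open>kap (k i) * lead (k i) \<alpha>\<close>.\<close>

definition kap :: "nat \<Rightarrow> complex fls" where
  "kap m = of_nat m * fls_X_inv ^ (m + 1)"

definition lead :: "nat \<Rightarrow> nat \<Rightarrow> complex fls" where
  "lead m \<alpha> = (if \<alpha> = 0 then 1 else fls_const (1 / of_nat m) * fls_X ^ (m + 1 - \<alpha>))"

lemma kap_nz: "m \<ge> 1 \<Longrightarrow> kap m \<noteq> 0" "fls_subdegree (kap m) = (if m = 0 then 0 else - int (m + 1))"
  by (auto simp: kap_def fls_subdegree_mult)

lemma ord_lead [simp]: "ord_ge 0 (lead m \<alpha>)"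
  by (auto simp: lead_def ord_ge_def)

lemma kap_lead:
  assumes "m \<ge> 1" "\<alpha> \<le> m"
  shows "kap m * lead m \<alpha> = (if \<alpha> = 0 then kap m else fls_X_inv ^ \<alpha>)"
proof (cases "\<alpha> = 0")
  case False
  have "kap m * lead m \<alpha> = (of_nat m * fls_const (1 / of_nat m)) * (fls_X_inv ^ (m + 1) * fls_X ^ (m + 1 - \<alpha>))"
    using False by (simp add: kap_def lead_def mult_ac)
  also have "of_nat m * fls_const (1 / of_nat m :: complex) = 1"
    using assms by (simp add: fls_of_nat)
  also have "fls_X_inv ^ (m + 1) * fls_X ^ (m + 1 - \<alpha>) = (fls_X_inv :: complex fls) ^ \<alpha>"
  proof -
    have "fls_X_inv ^ (m + 1) = (fls_X_inv :: complex fls) ^ \<alpha> * fls_X_inv ^ (m + 1 - \<alpha>)"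
      using assms by (simp flip: power_add)
    moreover have "fls_X_inv ^ (m + 1 - \<alpha>) * fls_X ^ (m + 1 - \<alpha>) = (1 :: complex fls)"
      by (simp flip: fls_inverse_X_power)
    ultimately show ?thesis by (simp add: mult.assoc)
  qed
  finally show ?thesis using False by simp
qed (simp add: lead_def)

text \<open>The function \<open>G\<close> with
  \<open>G dz = kap (k i) * lead (k i) \<alpha> dw\<close> has exactly the numbers
  \<open>pcoef\<close> as residue coefficients, so \<open>Phi\<close> is its polar part in powers of
  \<open>1 / (z - t (i, 0))\<close>.\<close>

lemma Phi_principal:
  assumes i: "i \<noteq> 0" "k i \<ge> 1" "t (i, k i) \<noteq> 0" and \<alpha>: "\<alpha> \<le> k i"
  shows "ord_ge 0 (Phi fls_const k t (i, \<alpha>) (fls_const (t (i, 0)) + cls k t i) * fls_deriv (cls k t i)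
            - kap (k i) * lead (k i) \<alpha>)"
proof -
  let ?C = "cls k t i" and ?M = "k i + 1"
  note c = cser_nth_0 cser_nz(2)[of k i t, OF i(2,3)]
  have C: "?C \<noteq> 0" "fls_deriv ?C \<noteq> 0" "fls_subdegree (fls_deriv ?C) = 0"
    using subdegree_fls_eq_1[OF c] fls_subdegree_deriv[of ?C] by (auto simp: fls_deriv_eq_0_iff)
  define G where "G = kap (k i) * lead (k i) \<alpha> / fls_deriv ?C"
  have "ord_ge (- int ?M) (kap (k i) * lead (k i) \<alpha>)"
    using kap_nz[of "k i"] i by (intro ord_ge_mult[of "- int ?M" _ 0]) (auto simp: ord_ge_iff[of _ "kap _"])
  then have G: "ord_ge (- int ?M) G"
    unfolding G_def by (rule ord_ge_divide) (simp add: C)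
  have "(?C ^ (a - 1) * fls_deriv ?C * G) $$ (-1) = pcoef k t i \<alpha> a" if "a \<in> {1..?M}" for a
  proof -
    have "?C ^ (a - 1) * fls_deriv ?C * G = ?C ^ (a - 1) * (if \<alpha> = 0 then kap (k i) else fls_X_inv ^ \<alpha>)"
      using C by (simp add: G_def kap_lead[OF i(2) \<alpha>, symmetric])
    moreover have "(?C ^ (a - 1) * (if \<alpha> = 0 then kap (k i) else fls_X_inv ^ \<alpha>)) $$ (-1) = pcoef k t i \<alpha> a"
    proof -
      have pw: "(?C ^ (a - 1)) $$ int n = (cser k t i ^ (a - 1)) $ n" for n
        by (simp flip: fps_to_fls_power)
      have A: "(?C ^ (a - 1) * fls_X_inv ^ Suc n) $$ (-1) = (cser k t i ^ (a - 1)) $ n" for n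
        unfolding pw[symmetric] by (simp add: fls_X_inv_power_times_conv_shift del: power_Suc)
      show ?thesis
      proof (cases "\<alpha> = 0")
        case True
        have "?C ^ (a - 1) * kap (k i) = of_nat (k i) * (?C ^ (a - 1) * fls_X_inv ^ Suc (k i))"
          by (simp only: kap_def Suc_eq_plus1 mult_ac)
        also have "\<dots> $$ (-1) = of_nat (k i) * (cser k t i ^ (a - 1)) $ k i"
          by (simp only: fls_mult_of_nat_nth A)
        finally show ?thesis using i(1) True by (simp add: pcoef_def)
      next
        case False
        then show ?thesis using i(1) A[of "\<alpha> - 1"] by (simp add: pcoef_def del: power_Suc)
      qed
    qed
    ultimately show ?thesis by (simp only:)
  qed
  then have "(\<Sum>a=1..?M. fls_const ((?C ^ (a - 1) * fls_deriv ?C * G) $$ (-1)) * inverse (?C ^ a)) =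
     Phi fls_const k t (i, \<alpha>) (fls_const (t (i, 0)) + ?C)"
    unfolding Phi_pos[OF i(1)] by (intro sum.cong) auto
  with principal_part_in_parameter[OF c G] have "ord_ge 0 (G - Phi fls_const k t (i, \<alpha>) (fls_const (t (i, 0)) + ?C))"
    by simp
  then have "ord_ge 0 ((G - Phi fls_const k t (i, \<alpha>) (fls_const (t (i, 0)) + ?C)) * fls_deriv ?C)"
    using C by (intro ord_ge_mult[of 0 _ 0]) (auto simp: ord_ge_iff[of _ "fls_deriv _"])
  also have "\<dots> = kap (k i) * lead (k i) \<alpha> - Phi fls_const k t (i, \<alpha>) (fls_const (t (i, 0)) + ?C) * fls_deriv ?C"
    using C by (simp add: G_def left_diff_distrib)
  finally show ?thesis by (subst ord_ge_uminus[symmetric]) simp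
qed

text \<open>As at a finite pole, except that \<open>Phi\<close> is a polynomial in
  \<open>z = 1 / C\<close> starting with \<open>z^0\<close>, that is, \<open>C\<close> times a sum
  \<open>S\<close> of powers \<open>C^(-a)\<close> with \<open>a \<ge> 1\<close>. For this reason
  \<open>G\<close> carries a factor \<open>C\<close>, and the error may have a simple pole.\<close>

lemma Phi_principal_inf:
  "ord_ge (-1) (Phi fls_const k t (0, \<alpha>) (inverse (infls k t)) * fls_deriv (inverse (infls k t)) + fls_X_inv ^ (\<alpha> + 1))"
proof -
  let ?C = "infls k t"
  note c = infser_nth[of k t]
  have C: "?C \<noteq> 0" "fls_deriv ?C \<noteq> 0" "fls_subdegree ?C = 1" "fls_subdegree (fls_deriv ?C) = 0"
    using subdegree_fls_eq_1[of "infser k t"] fls_subdegree_deriv[of ?C] c(2) by (auto simp: fls_deriv_eq_0_iff)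
  define G where "G = fls_X_inv ^ (\<alpha> + 1) * (?C / fls_deriv ?C)"
  have G: "ord_ge (- int \<alpha>) G"
    unfolding G_def using C
    by (intro ord_ge_mult[of "- int (\<alpha> + 1)" _ 1] ord_ge_divide[of 1]) (auto simp: ord_ge_iff[of _ ?C] ord_ge_def)
  have g: "(?C ^ (a - 1) * fls_deriv ?C * G) $$ (-1) = pcoef k t 0 \<alpha> a" if a: "a \<in> {1..\<alpha>}" for a
  proof -
    have "?C ^ (a - 1) * fls_deriv ?C * G = fls_X_inv ^ (\<alpha> + 1) * ?C ^ a"
      using a C by (cases a) (auto simp: G_def)
    also have "\<dots> $$ (-1) = (infser k t ^ a) $ \<alpha>"
      by (simp add: fls_X_inv_power_times_conv_shift flip: fps_to_fls_power del: power_Suc)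
    also have "\<dots> = (fps_X ^ a * gser k t ^ a) $ \<alpha>" by (simp add: infser_def power_mult_distrib)
    also have "\<dots> = pcoef k t 0 \<alpha> a" using a by (simp add: fps_X_power_mult_nth pcoef_def)
    finally show ?thesis .
  qed
  define S where "S = (\<Sum>a=1..\<alpha>. fls_const (pcoef k t 0 \<alpha> a) * inverse (?C ^ a))"
  have "ord_ge 0 (G - S)"
  proof -
    have "S = (\<Sum>a=1..\<alpha>. fls_const ((?C ^ (a - 1) * fls_deriv ?C * G) $$ (-1)) * inverse (?C ^ a))"
      unfolding S_def by (intro sum.cong refl) (simp only: g)
    then show ?thesis using principal_part_in_parameter[OF c(1) _ G] by simp
  qed
  then have o: "ord_ge (-1) (fls_deriv ?C / ?C * (G - S))"
    using C by (intro ord_ge_mult[of "-1" _ 0] ord_ge_divide[of 0]) (auto simp: ord_ge_iff[of _ "fls_deriv _"])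
  have P: "Phi fls_const k t (0, \<alpha>) (inverse ?C) = ?C * S"
    unfolding Phi_0 S_def sum_distrib_left
  proof (rule sum.cong)
    fix a assume "a \<in> {1..\<alpha>}"
    then show "fls_const (pcoef k t 0 \<alpha> a) * inverse ?C ^ (a - 1) = ?C * (fls_const (pcoef k t 0 \<alpha> a) * inverse (?C ^ a))"
      using C by (cases a) (auto simp: power_inverse field_simps)
  qed auto
  have "Phi fls_const k t (0, \<alpha>) (inverse ?C) * fls_deriv (inverse ?C) + fls_X_inv ^ (\<alpha> + 1) =
     fls_deriv ?C / ?C * (G - S)"
    unfolding P fls_inverse_deriv[of ?C] using C by (simp add: G_def field_simps power2_eq_square)
  then show ?thesis using o by simp
qed

section \<open>Orders of tangent vectors away from their own pole\<close>

lemma ord_ge_inverse_unit: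
  fixes F :: "'a::field fls"
  assumes "ord_ge 0 F" "F $$ 0 \<noteq> 0"
  shows "ord_ge 0 (inverse F)"
proof -
  have "fls_subdegree F \<le> 0" using assms(2) by (rule fls_subdegree_leI)
  then show ?thesis by (auto simp: ord_ge_iff)
qed

lemma ord_ge_inverse_regular:
  fixes p q :: "'a::field"
  assumes "ord_ge 0 R" "R $$ 0 = 0" "p \<noteq> q"
  shows "ord_ge 0 (inverse ((fls_const p + R - fls_const q) ^ a))"
  unfolding power_inverse[symmetric] using assms
  by (intro ord_ge_power[of 0] ord_ge_inverse_unit) (auto intro!: ord_ge_add ord_ge_diff)

lemma ord_ge_inverse_at_inf:
  fixes c :: "complex fps"
  assumes "c $ 0 = 0" "c $ 1 \<noteq> 0" "a \<ge> 1"
  shows "ord_ge 1 (inverse ((inverse (fps_to_fls c) - fls_const p) ^ a))"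
proof -
  let ?c = "fps_to_fls c"
  have c: "fls_subdegree ?c = 1" "?c \<noteq> 0" using subdegree_fls_eq_1 assms by auto
  have "inverse ?c - fls_const p = (1 - fls_const p * ?c) / ?c" using c by (simp add: field_simps)
  then have "inverse (inverse ?c - fls_const p) = ?c / (1 - fls_const p * ?c)" by (simp add: inverse_divide)
  moreover have "ord_ge 1 (?c / (1 - fls_const p * ?c))"
  proof (rule ord_ge_divide)
    show "ord_ge 1 ?c" using c by (simp add: ord_ge_iff)
    show "1 + fls_subdegree (1 - fls_const p * ?c) \<le> 1"
      using assms(1) by (simp add: fls_subdegree_leI)
  qed
  ultimately have "ord_ge 1 (inverse (inverse ?c - fls_const p))" by simp
  then show ?thesis unfolding power_inverse[symmetric] using assms(3) by (intro ord_ge_power[of 1]) auto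
qed

lemma Phi_regular:
  assumes R: "ord_ge 0 R" "R $$ 0 = 0" and p: "i \<noteq> 0 \<Longrightarrow> p \<noteq> t (i, 0)"
  shows "ord_ge 0 (Phi fls_const k t (i, \<alpha>) (fls_const p + R))"
proof (cases "i = 0")
  case True
  have "ord_ge 0 (fls_const p + R)" using R by (intro ord_ge_add) auto
  then show ?thesis unfolding True Phi_0
    by (intro ord_ge_sum ord_ge_const_mult ord_ge_power[of 0]) auto
next
  case False
  then show ?thesis unfolding Phi_pos[OF False]
    by (intro ord_ge_sum ord_ge_const_mult ord_ge_inverse_regular R p)
qed

lemma Phi_regular_inf:
  assumes "i \<noteq> 0" "c $ 0 = 0" "c $ 1 \<noteq> 0"
  shows "ord_ge 1 (Phi fls_const k t (i, \<alpha>) (inverse (fps_to_fls c)))"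
  unfolding Phi_pos[OF assms(1)]
  by (intro ord_ge_sum ord_ge_const_mult ord_ge_inverse_at_inf assms) auto

section \<open>Residues in flat coordinates\<close>

definition polar :: "nat \<Rightarrow> (nat \<Rightarrow> nat) \<Rightarrow> point \<Rightarrow> nat \<Rightarrow> bool" where
  "polar M k t i \<longleftrightarrow> i \<in> {1..M} \<and> k i \<ge> 1 \<and> t (i, k i) \<noteq> 0 \<and> (\<forall>j\<in>{1..M} - {i}. t (j, 0) \<noteq> t (i, 0))"

text \<open>Of all summands of \<open>Lamz\<close> only \<open>- Phi\<close> of index
  \<open>(i, 0)\<close> has a pole at \<open>t (i, 0)\<close>, and its principal part in
  \<open>w\<close> is that of \<open>- kap (k i)\<close>.\<close>

lemma Lamz_principal:
  assumes "polar M k t i"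
  shows "\<exists>\<rho>. ord_ge 0 \<rho> \<and> Lamz fls_const M k t (fls_const (t (i, 0)) + cls k t i) * fls_deriv (cls k t i) = \<rho> - kap (k i)"
proof -
  have i: "i \<in> {1..M}" "i \<noteq> 0" "k i \<ge> 1" "t (i, k i) \<noteq> 0" using assms by (auto simp: polar_def)
  let ?Z = "fls_const (t (i, 0)) + cls k t i"
  define R where "R = Phi fls_const k t (0, k 0) ?Z - (\<Sum>j\<in>{1..M} - {i}. Phi fls_const k t (j, 0) ?Z)"
  have "ord_ge 0 R"
    unfolding R_def using assms by (intro ord_ge_diff ord_ge_sum Phi_regular) (auto simp: polar_def)
  then have R: "ord_ge 0 (R * fls_deriv (cls k t i))"
    by (intro ord_ge_mult[of 0 _ 0] ord_ge_deriv0) auto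
  have e: "Lamz fls_const M k t ?Z = R - Phi fls_const k t (i, 0) ?Z"
    unfolding Lamz_def R_def by (subst sum.remove[OF _ i(1)]) simp_all
  have "ord_ge 0 (Phi fls_const k t (i, 0) ?Z * fls_deriv (cls k t i) - kap (k i))"
    using Phi_principal[of i k t 0] i by (simp add: lead_def)
  with R have "ord_ge 0 (R * fls_deriv (cls k t i) - (Phi fls_const k t (i, 0) ?Z * fls_deriv (cls k t i) - kap (k i)))"
    by (rule ord_ge_diff)
  then show ?thesis
    unfolding e by (intro exI[of _ "R * fls_deriv (cls k t i) - (Phi fls_const k t (i, 0) ?Z * fls_deriv (cls k t i) - kap (k i))"])
       (auto simp: algebra_simps)
qed

lemma Lamz_principal_inf:
  "\<exists>\<rho>. ord_ge (-1) \<rho> \<and> Lamz fls_const M k t (inverse (infls k t)) * fls_deriv (inverse (infls k t)) = \<rho> - fls_X_inv ^ (k 0 + 1)"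
proof -
  let ?Z = "inverse (infls k t)"
  define R where "R = (\<Sum>j\<in>{1..M}. Phi fls_const k t (j, 0) ?Z)"
  have "ord_ge 1 R"
    unfolding R_def by (intro ord_ge_sum Phi_regular_inf) auto
  moreover have "ord_ge (-2) (fls_deriv ?Z)"
    by (rule ord_ge_deriv[of "-1"]) (use subdegree_fls_eq_1[of "infser k t"] in \<open>auto simp: ord_ge_iff\<close>)
  ultimately have R: "ord_ge (-1) (R * fls_deriv ?Z)"
    by (intro ord_ge_mult[of 1 _ "-2"]) auto
  have "ord_ge (-1) (Phi fls_const k t (0, k 0) ?Z * fls_deriv ?Z + fls_X_inv ^ (k 0 + 1) - R * fls_deriv ?Z)"
    by (rule ord_ge_diff[OF Phi_principal_inf R])
  then show ?thesis
    by (intro exI[of _ "Phi fls_const k t (0, k 0) ?Z * fls_deriv ?Z + fls_X_inv ^ (k 0 + 1) - R * fls_deriv ?Z"])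
       (auto simp: R_def Lamz_def algebra_simps)
qed

text \<open>In the parameter \<open>w\<close> both tangent vectors and \<open>\<lambda>'\<close> are
  monomials up to regular terms, so \<open>residue_quotient\<close> leaves the residue of
  \<open>f * kap * lead * lead\<close> up to sign. The factor \<open>f\<close> is \<open>1\<close>
  for the pairing, and the regular third factor for the structure constants at the new pole.\<close>

lemma residue_block:
  assumes p: "polar M k t i" and \<alpha>: "\<alpha> \<le> k i" "\<beta> \<le> k i" and f: "ord_ge 0 f"
  shows "(f * Phi fls_const k t (i, \<alpha>) (zpar t i) * Phi fls_const k t (i, \<beta>) (zpar t i) / Lamz fls_const M k t (zpar t i)) $$ (-1)
     = - of_nat (k i) * (fls_compose_fps f (cser k t i) * lead (k i) \<alpha> * lead (k i) \<beta>) $$ int (k i)"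
proof -
  have i: "i \<in> {1..M}" "i \<noteq> 0" "k i \<ge> 1" "t (i, k i) \<noteq> 0" using p by (auto simp: polar_def)
  let ?C = "cls k t i" and ?c = "cser k t i"
  let ?Z = "fls_const (t (i, 0)) + ?C"
  note c = cser_nz[of k i t, OF i(3,4)] cser_nth_0[of k t i]
  define g where "g = fls_compose_fps f ?c"
  have g: "ord_ge 0 g"
  proof (cases "f = 0")
    case False
    then have "fls_subdegree f \<ge> 0" using f by (auto simp: ord_ge_iff)
    then show ?thesis unfolding g_def ord_ge_iff using c by (simp add: subdegree_eq_1)
  qed (simp add: g_def)
  obtain \<rho> where \<rho>: "ord_ge 0 \<rho>" "Lamz fls_const M k t ?Z * fls_deriv ?C = \<rho> - kap (k i)"
    using Lamz_principal[OF p] by blast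
  have C': "fls_deriv ?C \<noteq> 0" using subdegree_fls_eq_1[of ?c] c by (auto simp: fls_deriv_eq_0_iff)
  define r where "r = (\<lambda>\<alpha>. Phi fls_const k t (i, \<alpha>) ?Z * fls_deriv ?C - kap (k i) * lead (k i) \<alpha>)"
  have r: "ord_ge 0 (r \<alpha>)" if "\<alpha> \<le> k i" for \<alpha>
    unfolding r_def using Phi_principal[of i k t \<alpha>] i that by simp
  have P: "Phi fls_const k t (i, \<alpha>) ?Z * fls_deriv ?C = kap (k i) * lead (k i) \<alpha> + r \<alpha>" for \<alpha>
    by (simp add: r_def)
  let ?d = "- int (k i + 1)"
  have kap: "ord_ge ?d (kap (k i))" "ord_ge ?d (kap (k i) * lead (k i) \<alpha>)" for \<alpha>
  proof -
    show "ord_ge ?d (kap (k i))" using kap_nz(2)[of "k i"] i by (auto simp: ord_ge_iff)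
    then show "ord_ge ?d (kap (k i) * lead (k i) \<alpha>)" by (rule ord_ge_mult[of _ _ 0]) auto
  qed
  have "(f * Phi fls_const k t (i, \<alpha>) (zpar t i) * Phi fls_const k t (i, \<beta>) (zpar t i) / Lamz fls_const M k t (zpar t i)) $$ (-1)
     = (g * Phi fls_const k t (i, \<alpha>) ?Z * Phi fls_const k t (i, \<beta>) ?Z / Lamz fls_const M k t ?Z * fls_deriv ?C) $$ (-1)"
    using c by (subst residue_cls[of i k t, OF i(2,3,4)])
      (simp add: fls_compose_fps_mult fls_compose_fps_divide Phi_compose Lamz_compose compose_zpar[of i k t, OF i(2,3,4)] g_def)
  also have "g * Phi fls_const k t (i, \<alpha>) ?Z * Phi fls_const k t (i, \<beta>) ?Z / Lamz fls_const M k t ?Z * fls_deriv ?C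
     = g * (kap (k i) * lead (k i) \<alpha> + r \<alpha>) * (kap (k i) * lead (k i) \<beta> + r \<beta>) / (\<rho> - kap (k i))"
    unfolding P[symmetric] \<rho>(2)[symmetric] using C' by simp
  also have "\<dots> $$ (-1) = - (g * (kap (k i) * lead (k i) \<alpha>) * (kap (k i) * lead (k i) \<beta>) / kap (k i)) $$ (-1)"
  proof (rule residue_quotient)
    show "kap (k i) \<noteq> 0" "fls_subdegree (kap (k i)) = ?d" using kap_nz[of "k i"] i by auto
    show "ord_ge (?d + 1) \<rho>" using \<rho>(1) by (rule ord_ge_mono) auto
    have o: "ord_ge ?d (g * (kap (k i) * lead (k i) \<alpha>))" for \<alpha>
      by (rule ord_ge_mult[OF g kap(2)]) auto
    show "ord_ge ?d (g * (kap (k i) * lead (k i) \<alpha>) * r \<beta>)" by (rule ord_ge_mult[OF o r[OF \<alpha>(2)]]) auto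
    show "ord_ge ?d (g * (kap (k i) * lead (k i) \<beta>) * r \<alpha>)" by (rule ord_ge_mult[OF o r[OF \<alpha>(1)]]) auto
    show "ord_ge ?d (g * r \<alpha> * r \<beta>)"
      by (rule ord_ge_mult[OF ord_ge_mult[OF g r[OF \<alpha>(1)], of 0] r[OF \<alpha>(2)]]) auto
    show "ord_ge (2 * ?d) (g * (kap (k i) * lead (k i) \<alpha>) * (kap (k i) * lead (k i) \<beta>) * \<rho>)"
      by (rule ord_ge_mult[OF ord_ge_mult[OF o kap(2) order_refl] \<rho>(1)]) auto
  qed
  also have "g * (kap (k i) * lead (k i) \<alpha>) * (kap (k i) * lead (k i) \<beta>) / kap (k i)
     = of_nat (k i) * (fls_X_inv ^ (k i + 1) * (g * lead (k i) \<alpha> * lead (k i) \<beta>))"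
  proof -
    have "g * (K * l) * (K * l') / K = K * (g * l * l')" if "K \<noteq> 0" for K l l' :: "complex fls"
      using that by simp
    from this[OF kap_nz(1)[OF i(3)]] show ?thesis by (simp only: kap_def mult.assoc)
  qed
  finally show ?thesis
    by (simp only: fls_uminus_nth fls_mult_of_nat_nth fls_X_inv_power_times_conv_shift fls_shift_nth g_def) simp
qed

lemma residue_block_inf:
  assumes \<alpha>: "\<alpha> \<in> {1..<k 0}" "\<beta> \<in> {1..<k 0}"
  shows "(Phi fls_const k t (0, \<alpha>) fls_X_inv * Phi fls_const k t (0, \<beta>) fls_X_inv / Lamz fls_const M k t fls_X_inv * fls_deriv fls_X_inv) $$ (-1)
     = (if \<alpha> + \<beta> = k 0 then -1 else 0)"
proof -
  let ?Z = "inverse (infls k t)"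
  obtain \<rho> where \<rho>: "ord_ge (-1) \<rho>" "Lamz fls_const M k t ?Z * fls_deriv ?Z = \<rho> - fls_X_inv ^ (k 0 + 1)"
    using Lamz_principal_inf by blast
  have Z': "fls_deriv ?Z \<noteq> 0"
    using subdegree_fls_eq_1[of "infser k t"] by (auto simp: fls_deriv_eq_0_iff dest: arg_cong[of _ _ fls_subdegree])
  define r where "r = (\<lambda>\<alpha>. Phi fls_const k t (0, \<alpha>) ?Z * fls_deriv ?Z + fls_X_inv ^ (\<alpha> + 1))"
  have r: "ord_ge (-1) (r \<alpha>)" for \<alpha>
    unfolding r_def by (rule Phi_principal_inf)
  have P: "Phi fls_const k t (0, \<alpha>) ?Z * fls_deriv ?Z = - (fls_X_inv ^ (\<alpha> + 1)) + r \<alpha>" for \<alpha>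
    by (simp add: r_def)
  let ?d = "- int (k 0 + 1)"
  have X: "ord_ge (- int n) (- (fls_X_inv ^ n) :: complex fls)" for n by (simp add: ord_ge_def)
  have "(Phi fls_const k t (0, \<alpha>) fls_X_inv * Phi fls_const k t (0, \<beta>) fls_X_inv / Lamz fls_const M k t fls_X_inv * fls_deriv fls_X_inv) $$ (-1)
    = (Phi fls_const k t (0, \<alpha>) ?Z * Phi fls_const k t (0, \<beta>) ?Z / Lamz fls_const M k t ?Z * fls_deriv ?Z) $$ (-1)"
    by (subst residue_infls[of _ k t]) (simp add: fls_compose_fps_mult fls_compose_fps_divide Phi_compose Lamz_compose compose_zpar_0)
  also have "Phi fls_const k t (0, \<alpha>) ?Z * Phi fls_const k t (0, \<beta>) ?Z / Lamz fls_const M k t ?Z * fls_deriv ?Z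
    = 1 * (- (fls_X_inv ^ (\<alpha> + 1)) + r \<alpha>) * (- (fls_X_inv ^ (\<beta> + 1)) + r \<beta>) / (\<rho> - fls_X_inv ^ (k 0 + 1))"
    unfolding P[symmetric] \<rho>(2)[symmetric] using Z' by simp
  also have "\<dots> $$ (-1) = - (1 * (- (fls_X_inv ^ (\<alpha> + 1))) * (- (fls_X_inv ^ (\<beta> + 1))) / fls_X_inv ^ (k 0 + 1)) $$ (-1)"
  proof (rule residue_quotient)
    show "fls_X_inv ^ (k 0 + 1) \<noteq> (0::complex fls)" "fls_subdegree (fls_X_inv ^ (k 0 + 1) :: complex fls) = ?d"
      by (simp_all del: power_Suc)
    show "ord_ge (?d + 1) \<rho>" using \<rho>(1) by (rule ord_ge_mono) (use \<alpha> in auto)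
    show "ord_ge ?d (1 * (- (fls_X_inv ^ (\<alpha> + 1))) * r \<beta>)"
      using ord_ge_mult[OF X r, of ?d "\<alpha> + 1" \<beta>] \<alpha> by (simp del: power_Suc)
    show "ord_ge ?d (1 * (- (fls_X_inv ^ (\<beta> + 1))) * r \<alpha>)"
      using ord_ge_mult[OF X r, of ?d "\<beta> + 1" \<alpha>] \<alpha> by (simp del: power_Suc)
    show "ord_ge ?d (1 * r \<alpha> * r \<beta>)"
      using ord_ge_mult[OF r r, of ?d \<alpha> \<beta>] \<alpha> by simp
    show "ord_ge (2 * ?d) (1 * (- (fls_X_inv ^ (\<alpha> + 1))) * (- (fls_X_inv ^ (\<beta> + 1))) * \<rho>)"
      using ord_ge_mult[OF ord_ge_mult[OF X X order_refl] \<rho>(1), of "2 * ?d" "\<alpha> + 1" "\<beta> + 1"] \<alpha>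
      by (simp del: power_Suc)
  qed
  also have "1 * (- (fls_X_inv ^ (\<alpha> + 1))) * (- (fls_X_inv ^ (\<beta> + 1))) / fls_X_inv ^ (k 0 + 1)
     = (fls_X_intpow (int (k 0) - int \<alpha> - int \<beta> - 1) :: complex fls)"
    unfolding mult_1_left minus_mult_minus fls_X_inv_power_conv_shift_1
    using fls_X_intpow_times_fls_X_intpow[of "- int (\<alpha> + 1)" "- int (\<beta> + 1)", where 'a=complex]
      fls_X_intpow_div_fls_X_intpow[of "- int (\<alpha> + 1) - int (\<beta> + 1)" "- int (k 0 + 1)", where 'a=complex]
    by (simp add: algebra_simps)
  finally show ?thesis by (auto simp: algebra_simps)
qed

lemma zpar_minus: "i \<noteq> 0 \<Longrightarrow> zpar t i - fls_const (t (i, 0)) = fls_X"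
  by (simp add: zpar_pos)

lemma ord_Phi_own:
  assumes "i \<noteq> 0" shows "ord_ge (- int (k i + 1)) (Phi fls_const k t (i, \<alpha>) (zpar t i))"
  unfolding Phi_pos[OF assms] zpar_minus[OF assms]
  by (intro ord_ge_sum ord_ge_const_mult) (auto simp: ord_ge_def fls_inverse_X_power)

lemma ord_Phi_other:
  assumes "i \<noteq> 0" "j \<noteq> 0 \<Longrightarrow> t (j, 0) \<noteq> t (i, 0)"
  shows "ord_ge 0 (Phi fls_const k t (j, \<alpha>) (zpar t i))"
  unfolding zpar_pos[OF assms(1)] using assms(2) by (intro Phi_regular) (auto simp: ord_ge_def)

lemma ord_Phi_inf:
  shows "ord_ge (1 - int \<alpha>) (Phi fls_const k t (0, \<alpha>) fls_X_inv)"
  unfolding Phi_0 by (intro ord_ge_sum ord_ge_const_mult) (auto simp: ord_ge_def)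

lemma ord_Phi_inf_pos:
  assumes "i \<noteq> 0" shows "ord_ge 1 (Phi fls_const k t (i, \<alpha>) fls_X_inv)"
  using Phi_regular_inf[of i "fps_X" k t \<alpha>] assms by (simp add: fls_inverse_X)

text \<open>Only the last fraction in \<open>Phi\<close> of index \<open>(i, 0)\<close> reaches this
  order. Its coefficient is the quantity that degenerates where \<open>t (i, k i)\<close>
  vanishes.\<close>

lemma Lamz_own_coeff:
  assumes "i \<in> {1..M}" "\<forall>j\<in>{1..M} - {i}. t (j, 0) \<noteq> t (i, 0)"
  shows "ord_ge (- int (k i + 1)) (Lamz fls_const M k t (zpar t i))"
    "Lamz fls_const M k t (zpar t i) $$ (- int (k i + 1)) = - of_nat (k i) * (cser k t i $ 1) ^ k i"
proof -
  have i: "i \<noteq> 0" using assms by auto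
  define R where "R = Phi fls_const k t (0, k 0) (zpar t i) - (\<Sum>j\<in>{1..M} - {i}. Phi fls_const k t (j, 0) (zpar t i))"
  have R: "ord_ge 0 R"
    unfolding R_def using assms i by (intro ord_ge_diff ord_ge_sum ord_Phi_other) auto
  have e: "Lamz fls_const M k t (zpar t i) = R - Phi fls_const k t (i, 0) (zpar t i)"
    unfolding Lamz_def R_def by (subst sum.remove[OF _ assms(1)]) simp_all
  show "ord_ge (- int (k i + 1)) (Lamz fls_const M k t (zpar t i))"
    unfolding e by (intro ord_ge_diff ord_Phi_own i ord_ge_mono[OF R]) auto
  have "Phi fls_const k t (i, 0) (zpar t i) $$ (- int (k i + 1)) =
      (\<Sum>a=1..k i + 1. if a = k i + 1 then pcoef k t i 0 a else 0)"
    unfolding Phi_pos[OF i] zpar_minus[OF i] fls_nth_sum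
    by (intro sum.cong) (auto simp: fls_inverse_X_power simp del: power_Suc)
  also have "\<dots> = pcoef k t i 0 (k i + 1)" by (simp add: sum.delta del: sum.cl_ivl_Suc)
  also have "\<dots> = of_nat (k i) * (cser k t i $ 1) ^ k i"
    using i by (simp add: pcoef_def startsby_zero_power_nth_same)
  finally show "Lamz fls_const M k t (zpar t i) $$ (- int (k i + 1)) = - of_nat (k i) * (cser k t i $ 1) ^ k i"
    unfolding e using R by (simp add: ord_ge_def)
qed

lemma Lamz_subdegree:
  assumes "polar M k t i"
  shows "Lamz fls_const M k t (zpar t i) \<noteq> 0" "fls_subdegree (Lamz fls_const M k t (zpar t i)) = - int (k i + 1)"
proof -
  have nz: "Lamz fls_const M k t (zpar t i) $$ (- int (k i + 1)) \<noteq> 0"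
    using assms cser_nz(2)[of k i t] by (subst Lamz_own_coeff) (auto simp: polar_def)
  then show "Lamz fls_const M k t (zpar t i) \<noteq> 0" by auto
  show "fls_subdegree (Lamz fls_const M k t (zpar t i)) = - int (k i + 1)"
    using nz Lamz_own_coeff(1)[of i M t k] assms by (intro fls_subdegree_eqI) (auto simp: polar_def ord_ge_def)
qed

lemma Lamz_inf_coeff:
  assumes "k 0 \<ge> 2"
  shows "ord_ge (1 - int (k 0)) (Lamz fls_const M k t fls_X_inv)"
    "Lamz fls_const M k t fls_X_inv $$ (1 - int (k 0)) = 1"
proof -
  have S: "ord_ge 1 (\<Sum>j=1..M. Phi fls_const k t (j, 0) fls_X_inv)"
    by (intro ord_ge_sum ord_Phi_inf_pos) auto
  show "ord_ge (1 - int (k 0)) (Lamz fls_const M k t fls_X_inv)"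
    unfolding Lamz_def using assms by (intro ord_ge_diff ord_Phi_inf ord_ge_mono[OF S]) auto
  have "Phi fls_const k t (0, k 0) fls_X_inv $$ (1 - int (k 0)) =
      (\<Sum>a=1..k 0. if a = k 0 then pcoef k t 0 (k 0) a else 0)"
    unfolding Phi_0 fls_nth_sum by (intro sum.cong) (auto simp: of_nat_diff)
  also have "\<dots> = pcoef k t 0 (k 0) (k 0)" using assms by simp
  also have "\<dots> = 1" by (simp add: pcoef_def)
  finally show "Lamz fls_const M k t fls_X_inv $$ (1 - int (k 0)) = 1"
    unfolding Lamz_def using S assms by (simp add: ord_ge_def)
qed

lemma Lamz_inf_subdegree:
  assumes "k 0 \<ge> 2"
  shows "Lamz fls_const M k t fls_X_inv \<noteq> 0" "fls_subdegree (Lamz fls_const M k t fls_X_inv) = 1 - int (k 0)"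
proof -
  show "Lamz fls_const M k t fls_X_inv \<noteq> 0"
    using Lamz_inf_coeff(2)[of k M t, OF assms] by auto
  show "fls_subdegree (Lamz fls_const M k t fls_X_inv) = 1 - int (k 0)"
    using Lamz_inf_coeff[of k M t, OF assms] by (intro fls_subdegree_eqI) (auto simp: ord_ge_def)
qed

lemma residue_vanish:
  assumes "polar M k t i" "ord_ge 0 F" "ord_ge (- int (k i + 1)) G"
  shows "(F * G / Lamz fls_const M k t (zpar t i)) $$ (-1) = 0"
proof (rule ord_ge_nth)
  show "ord_ge 0 (F * G / Lamz fls_const M k t (zpar t i))"
    using Lamz_subdegree[OF assms(1)] by (intro ord_ge_divide[OF ord_ge_mult[OF assms(2,3) order_refl]]) auto
qed simp

lemma ord_deriv_X_inv: "ord_ge (-2) (fls_deriv fls_X_inv :: complex fls)"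
  by (simp add: ord_ge_def)

text \<open>\<open>\<lambda>'\<close> grows like \<open>z^(k 0 - 1)\<close> and \<open>dz\<close>
  has a double pole in \<open>1 / z\<close>; together they give the bound
  \<open>3 - k 0\<close>.\<close>

lemma residue_vanish_inf:
  assumes "k 0 \<ge> 2" "ord_ge a F" "a \<ge> 3 - int (k 0)"
  shows "(F / Lamz fls_const M k t fls_X_inv * fls_deriv fls_X_inv) $$ (-1) = 0"
proof (rule ord_ge_nth)
  have "ord_ge 2 (F / Lamz fls_const M k t fls_X_inv)"
    using Lamz_inf_subdegree[of k M t, OF assms(1)] assms(3) by (intro ord_ge_divide[OF assms(2)]) auto
  from ord_ge_mult[OF this ord_deriv_X_inv] show "ord_ge 0 (F / Lamz fls_const M k t fls_X_inv * fls_deriv fls_X_inv)"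
    by simp
qed simp

section \<open>The pairing in flat coordinates\<close>

definition hdom :: "nat \<Rightarrow> (nat \<Rightarrow> nat) \<Rightarrow> point set" where
  "hdom M k = {t. (\<forall>i\<in>{1..M}. t (i, k i) \<noteq> 0) \<and> inj_on (\<lambda>i. t (i, 0)) {1..M}}"

lemma hdom_polar:
  assumes "t \<in> hdom M k" "i \<in> {1..M}" "\<forall>i\<in>{1..M}. k i \<ge> 1"
  shows "polar M k t i"
  unfolding polar_def
proof (intro conjI ballI)
  fix j assume "j \<in> {1..M} - {i}"
  then show "t (j, 0) \<noteq> t (i, 0)" using assms inj_onD[of "\<lambda>i. t (i, 0)" "{1..M}" j i] by (auto simp: hdom_def)
qed (use assms in \<open>auto simp: hdom_def\<close>)

lemma idx_iff: "(i, \<alpha>) \<in> idx M k \<longleftrightarrow> (if i = 0 then 1 \<le> \<alpha> \<and> \<alpha> < k 0 else i \<le> M \<and> \<alpha> \<le> k i)"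
  by (auto simp: idx_def)

lemma finite_idx [simp]: "finite (idx N k)"
proof (rule finite_subset)
  show "idx N k \<subseteq> Sigma {0..N} (\<lambda>i. {0..k i})" by (auto simp: idx_def)
qed auto

definition eta0 :: "(nat \<Rightarrow> nat) \<Rightarrow> nat \<times> nat \<Rightarrow> nat \<times> nat \<Rightarrow> complex" where
  "eta0 k x y = (case x of (i, \<alpha>) \<Rightarrow> case y of (j, \<beta>) \<Rightarrow>
     if i \<noteq> j then 0
     else if i = 0 then (if \<alpha> + \<beta> = k 0 then 1 else 0)
     else if (\<alpha> = 0 \<and> \<beta> = 1) \<or> (\<alpha> = 1 \<and> \<beta> = 0) then 1
     else if 2 \<le> \<alpha> \<and> 2 \<le> \<beta> \<and> \<alpha> + \<beta> = k i + 2 then 1 / of_nat (k i) else 0)"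

text \<open>Every row of \<open>eta0\<close> has a single nonzero entry, in the column
  \<open>dual k x\<close>, so that the inverse matrix can be written down entry by entry.\<close>

definition dual :: "(nat \<Rightarrow> nat) \<Rightarrow> nat \<times> nat \<Rightarrow> nat \<times> nat" where
  "dual k x = (case x of (i, \<alpha>) \<Rightarrow>
     if i = 0 then (0, k 0 - \<alpha>) else if \<alpha> = 0 then (i, 1) else if \<alpha> = 1 then (i, 0) else (i, k i + 2 - \<alpha>))"

definition ieta :: "(nat \<Rightarrow> nat) \<Rightarrow> nat \<times> nat \<Rightarrow> nat \<times> nat \<Rightarrow> complex" where
  "ieta k x y = (if y = dual k x then 1 / eta0 k x (dual k x) else 0)"

definition pairf :: "nat \<Rightarrow> (nat \<Rightarrow> nat) \<Rightarrow> point \<Rightarrow> nat \<times> nat \<Rightarrow> nat \<times> nat \<Rightarrow> complex" where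
  "pairf M k t x y = - (\<Sum>i=0..M. (Phi fls_const k t x (zpar t i) * Phi fls_const k t y (zpar t i)
      / Lamz fls_const M k t (zpar t i) * fls_deriv (zpar t i)) $$ (-1))"

definition tripf :: "nat \<Rightarrow> (nat \<Rightarrow> nat) \<Rightarrow> point \<Rightarrow> nat \<times> nat \<Rightarrow> nat \<times> nat \<Rightarrow> nat \<times> nat \<Rightarrow> complex" where
  "tripf M k t x y z = - (\<Sum>i=0..M. (Phi fls_const k t x (zpar t i) * Phi fls_const k t y (zpar t i)
      * Phi fls_const k t z (zpar t i) / Lamz fls_const M k t (zpar t i) * fls_deriv (zpar t i)) $$ (-1))"

lemma lead_lead_nth:
  assumes "m \<ge> 1" "\<alpha> \<le> m" "\<beta> \<le> m"
  shows "(lead m \<alpha> * lead m \<beta>) $$ int m =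
    (if (\<alpha> = 0 \<and> \<beta> = 1) \<or> (\<alpha> = 1 \<and> \<beta> = 0) then 1 / of_nat m
     else if 2 \<le> \<alpha> \<and> 2 \<le> \<beta> \<and> \<alpha> + \<beta> = m + 2 then 1 / of_nat m ^ 2 else 0)"
proof -
  define u where "u = (\<lambda>\<alpha>::nat. if \<alpha> = 0 then 1 else 1 / of_nat m :: complex)"
  define e where "e = (\<lambda>\<alpha>::nat. if \<alpha> = 0 then 0 else m + 1 - \<alpha>)"
  have l: "lead m \<alpha> = fls_const (u \<alpha>) * fls_X ^ e \<alpha>" for \<alpha> by (simp add: lead_def u_def e_def)
  have "lead m \<alpha> * lead m \<beta> = fls_const (u \<alpha> * u \<beta>) * fls_X ^ (e \<alpha> + e \<beta>)"
    unfolding l by (simp add: power_add fls_const_mult_const[symmetric] mult_ac del: fls_const_mult_const)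
  then have "(lead m \<alpha> * lead m \<beta>) $$ int m = u \<alpha> * u \<beta> * (if e \<alpha> + e \<beta> = m then 1 else 0)"
    by (simp add: eq_commute[of "int m"] del: of_nat_add)
  moreover have "e \<alpha> + e \<beta> = m \<longleftrightarrow> (\<alpha> = 0 \<and> \<beta> = 1) \<or> (\<alpha> = 1 \<and> \<beta> = 0) \<or> (2 \<le> \<alpha> \<and> 2 \<le> \<beta> \<and> \<alpha> + \<beta> = m + 2)"
    using assms unfolding e_def by (cases "\<alpha> = 0"; cases "\<beta> = 0") auto
  moreover have "u 0 = 1" "a \<noteq> 0 \<Longrightarrow> u a = 1 / of_nat m" for a by (simp_all add: u_def)
  ultimately show ?thesis by (simp add: power2_eq_square)
qed

context
  fixes k :: "nat \<Rightarrow> nat" and M :: nat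
  assumes k0: "k 0 \<ge> 2" and ki: "\<forall>i\<in>{1..M}. k i \<ge> 1"
begin

lemma dual_idx_dual:
  assumes "x \<in> idx M k"
  shows "dual k x \<in> idx M k \<and> dual k (dual k x) = x"
proof -
  obtain i \<alpha> where x: "x = (i, \<alpha>)" by (cases x)
  have xi: "(i, \<alpha>) \<in> idx M k" using assms by (simp add: x)
  show ?thesis
  proof (cases "i = 0")
    case True
    then show ?thesis using xi by (auto simp: x dual_def idx_iff)
  next
    case False
    have "k i \<ge> 1" using ki xi False by (auto simp: idx_iff)
    consider "\<alpha> = 0" | "\<alpha> = 1" | "\<alpha> \<ge> 2" by linarith
    then show ?thesis
      using xi False \<open>k i \<ge> 1\<close> by cases (auto simp: x dual_def idx_iff)
  qed
qed

lemmas dual_idx = dual_idx_dual[THEN conjunct1]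

lemmas dual_dual = dual_idx_dual[THEN conjunct2]

lemma eta0_dual: "x \<in> idx M k \<Longrightarrow> y \<in> idx M k \<Longrightarrow> eta0 k x y \<noteq> 0 \<longleftrightarrow> y = dual k x"
proof -
  assume "x \<in> idx M k" "y \<in> idx M k"
  moreover obtain i \<alpha> j \<beta> where xy: "x = (i, \<alpha>)" "y = (j, \<beta>)" by (cases x; cases y)
  ultimately have xi: "(i, \<alpha>) \<in> idx M k" "(j, \<beta>) \<in> idx M k" by auto
  show ?thesis
  proof (cases "i = j")
    case False
    then show ?thesis by (auto simp: xy eta0_def dual_def)
  next
    case ij: True
    show ?thesis
    proof (cases "i = 0")
      case True
      then show ?thesis using xi ij by (auto simp: xy eta0_def dual_def idx_iff)
    next
      case False
      have "k i \<ge> 1" using ki xi False by (auto simp: idx_iff)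
      consider "\<alpha> = 0" | "\<alpha> = 1" | "\<alpha> \<ge> 2" by linarith
      then show ?thesis
        using xi ij False \<open>k i \<ge> 1\<close> by cases (auto simp: xy eta0_def dual_def idx_iff)
    qed
  qed
qed

lemma eta0_sym: "eta0 k x y = eta0 k y x"
proof -
  obtain i \<alpha> j \<beta> where xy: "x = (i, \<alpha>)" "y = (j, \<beta>)" by (cases x; cases y)
  show ?thesis
  proof (cases "i = j")
    case True
    then show ?thesis unfolding xy eta0_def prod.case by (simp add: add.commute[of \<alpha> \<beta>])
  qed (simp add: xy eta0_def)
qed

lemma ieta_eta0:
  assumes "x \<in> idx M k" "y \<in> idx M k"
  shows "(\<Sum>c\<in>idx M k. ieta k x c * eta0 k c y) = (if x = y then 1 else 0)"
proof -
  have "(\<Sum>c\<in>idx M k. ieta k x c * eta0 k c y) =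
        (\<Sum>c\<in>idx M k. if c = dual k x then eta0 k (dual k x) y / eta0 k x (dual k x) else 0)"
    by (intro sum.cong) (auto simp: ieta_def)
  also have "\<dots> = eta0 k (dual k x) y / eta0 k x (dual k x)" using dual_idx[OF assms(1)] by simp
  also have "\<dots> = (if x = y then 1 else 0)"
  proof (cases "x = y")
    case True
    have "eta0 k x (dual k x) \<noteq> 0" using eta0_dual assms dual_idx by blast
    then show ?thesis using True eta0_sym[of "dual k x" x] by simp
  next
    case False
    then have "y \<noteq> dual k (dual k x)" using dual_dual[OF assms(1)] by simp
    then show ?thesis using False eta0_dual[OF dual_idx[OF assms(1)] assms(2)] by auto
  qed
  finally show ?thesis .
qed

text \<open>Identifies the matrix chosen by \<open>THE\<close> in \<open>eta_inv\<close>: testing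
  against the column \<open>dual k b\<close> isolates the single entry \<open>h a b\<close>.\<close>

lemma ieta_unique:
  assumes h: "\<And>a b. a \<notin> idx M k \<or> b \<notin> idx M k \<Longrightarrow> h a b = 0"
    and e: "\<And>a b. a \<in> idx M k \<Longrightarrow> b \<in> idx M k \<Longrightarrow> (\<Sum>c\<in>idx M k. h a c * eta0 k c b) = (if a = b then 1 else 0)"
  shows "h = (\<lambda>a b. if a \<in> idx M k \<and> b \<in> idx M k then ieta k a b else 0)"
proof (intro ext)
  fix a b
  show "h a b = (if a \<in> idx M k \<and> b \<in> idx M k then ieta k a b else 0)"
  proof (cases "a \<in> idx M k \<and> b \<in> idx M k")
    case True
    have "(\<Sum>c\<in>idx M k. h a c * eta0 k c (dual k b)) = (\<Sum>c\<in>idx M k. if c = b then h a b * eta0 k b (dual k b) else 0)"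
    proof (intro sum.cong refl)
      fix c assume c: "c \<in> idx M k"
      show "h a c * eta0 k c (dual k b) = (if c = b then h a b * eta0 k b (dual k b) else 0)"
      proof (cases "c = b")
        case False
        then have "dual k b \<noteq> dual k c" using dual_dual[OF c] dual_dual[of b] True by metis
        then show ?thesis using eta0_dual[OF c dual_idx, of b] True False by auto
      qed simp
    qed
    also have "\<dots> = h a b * eta0 k b (dual k b)" using True by simp
    finally have 1: "h a b * eta0 k b (dual k b) = (if a = dual k b then 1 else 0)"
      using e[of a "dual k b"] True dual_idx by simp
    have nz: "eta0 k b (dual k b) \<noteq> 0" using eta0_dual True dual_idx by blast
    show ?thesis
    proof (cases "a = dual k b")
      case a: True
      then have "b = dual k a" using dual_dual True by simp
      then show ?thesis using 1 nz a True eta0_sym by (simp add: ieta_def field_simps)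
    next
      case False
      then have "b \<noteq> dual k a" using dual_dual[of a] True by auto
      then show ?thesis using 1 nz False True by (simp add: ieta_def)
    qed
  qed (use h in auto)
qed

text \<open>A field of another block is regular at the pole \<open>l\<close>, and
  \<open>\<lambda>'\<close> absorbs the pole of the other factor; at infinity this is a count of
  orders. If both fields belong to block \<open>l\<close>, the residue is one coefficient of a
  product of two \<open>lead\<close> series.\<close>

lemma residue_pair:
  assumes t: "t \<in> hdom M k" and x: "(i, \<alpha>) \<in> idx M k" and y: "(j, \<beta>) \<in> idx M k" and l: "l \<le> M"
  shows "(Phi fls_const k t (i, \<alpha>) (zpar t l) * Phi fls_const k t (j, \<beta>) (zpar t l)
      / Lamz fls_const M k t (zpar t l) * fls_deriv (zpar t l)) $$ (-1) = (if i = l \<and> j = l then - eta0 k (i, \<alpha>) (j, \<beta>) else 0)"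
proof (cases "l = 0")
  case l0: True
  show ?thesis
  proof (cases "i = 0 \<and> j = 0")
    case True
    then show ?thesis using residue_block_inf[of \<alpha> k \<beta> t M] x y l0 by (auto simp: idx_iff eta0_def)
  next
    case False
    have o: "ord_ge (if i = 0 then 1 - int \<alpha> else 1) (Phi fls_const k t (i, \<alpha>) fls_X_inv)" for i \<alpha>
      using ord_Phi_inf[of \<alpha> k t] ord_Phi_inf_pos[of i k t \<alpha>] by auto
    have "(Phi fls_const k t (i, \<alpha>) fls_X_inv * Phi fls_const k t (j, \<beta>) fls_X_inv
      / Lamz fls_const M k t fls_X_inv * fls_deriv fls_X_inv) $$ (-1) = 0"
      using x y False k0
      by (intro residue_vanish_inf[OF _ ord_ge_mult[OF o o order_refl]]) (auto simp: idx_iff split: if_splits)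
    then show ?thesis using l0 False by auto
  qed
next
  case False
  have p: "polar M k t l" using hdom_polar[OF t _ ki] l False by auto
  have oth: "ord_ge 0 (Phi fls_const k t (i, \<alpha>) (zpar t l))" if "i \<noteq> l" "(i, \<alpha>) \<in> idx M k" for i \<alpha>
    using p that by (intro ord_Phi_other) (auto simp: polar_def idx_iff)
  have any: "ord_ge (- int (k l + 1)) (Phi fls_const k t (i, \<alpha>) (zpar t l))" if "(i, \<alpha>) \<in> idx M k" for i \<alpha>
    using oth[OF _ that] ord_Phi_own[OF False, of k t \<alpha>] by (cases "i = l") (auto intro: ord_ge_mono)
  show ?thesis
  proof (cases "i = l \<and> j = l")
    case True
    have kl: "k l \<ge> 1" using p by (simp add: polar_def)
    have "(lead (k l) \<alpha> * lead (k l) \<beta>) $$ int (k l) * of_nat (k l) = eta0 k (l, \<alpha>) (l, \<beta>)"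
      using x y True False kl by (subst lead_lead_nth) (auto simp: eta0_def idx_iff power2_eq_square)
    moreover have "(1 * Phi fls_const k t (l, \<alpha>) (zpar t l) * Phi fls_const k t (l, \<beta>) (zpar t l) / Lamz fls_const M k t (zpar t l)) $$ (-1)
       = - of_nat (k l) * (fls_compose_fps 1 (cser k t l) * lead (k l) \<alpha> * lead (k l) \<beta>) $$ int (k l)"
      by (rule residue_block[OF p]) (use x y True False in \<open>auto simp: idx_iff ord_ge_def\<close>)
    ultimately show ?thesis
      using True by (simp only: fls_deriv_zpar[OF False] fls_compose_fps_1 mult_1_left mult_1_right if_True simp_thms
          mult_minus_left mult.commute[of "of_nat _"])
  next
    case F: False
    then consider "i \<noteq> l" | "j \<noteq> l" by blast
    then have "(Phi fls_const k t (i, \<alpha>) (zpar t l) * Phi fls_const k t (j, \<beta>) (zpar t l) / Lamz fls_const M k t (zpar t l)) $$ (-1) = 0"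
    proof cases
      case 1 then show ?thesis using residue_vanish[OF p oth[OF 1 x] any[OF y]] by simp
    next
      case 2 then show ?thesis using residue_vanish[OF p oth[OF 2 y] any[OF x]] by (simp add: mult.commute)
    qed
    then show ?thesis using F False by (auto simp: fls_deriv_zpar)
  qed
qed

lemma pairf_eq_eta0:
  assumes "t \<in> hdom M k" "x \<in> idx M k" "y \<in> idx M k"
  shows "pairf M k t x y = eta0 k x y"
proof -
  obtain i \<alpha> j \<beta> where xy: "x = (i, \<alpha>)" "y = (j, \<beta>)" by (cases x; cases y)
  have "pairf M k t x y = - (\<Sum>l=0..M. if i = l \<and> j = l then - eta0 k x y else 0)"
    unfolding pairf_def xy using assms
    by (intro arg_cong[of _ _ uminus] sum.cong refl, subst residue_pair) (auto simp: xy)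
  also have "(\<Sum>l=0..M. if i = l \<and> j = l then - eta0 k x y else 0) = (\<Sum>l=0..M. if l = i then - eta0 k x y else 0)"
    by (intro sum.cong) (auto simp: eta0_def xy)
  also have "\<dots> = - eta0 k x y" using assms(2) by (auto simp: xy idx_iff split: if_splits)
  finally show ?thesis by simp
qed

end

section \<open>Extension of the structure constants to the locus\<close>

text \<open>
  In the pole part at \<open>z = v\<^sub>N\<^sub>+\<^sub>1\<^sub>,\<^sub>0\<close> of the triple residue the form \<open>Phi (Suc N, 0)\<close> is written as
  \<open>Lamz N - Lamz (Suc N)\<close>; the second summand cancels the denominator, and the first one is regular.
\<close>

definition regf :: "nat \<Rightarrow> (nat \<Rightarrow> nat) \<Rightarrow> point \<Rightarrow> nat \<times> nat \<Rightarrow> complex fls \<Rightarrow> complex fls" where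
  "regf N k t a Z = (if a = (Suc N, 0) then Lamz fls_const N k t Z else Phi fls_const k t a Z)"

text \<open>The residue at the new pole in a form that makes sense on the locus: the first summand
  is \<open>residue_block\<close> with \<open>f = regf\<close>, the second one arises where
  \<open>Lamz (Suc N)\<close> is divided by itself. No coefficient of the new block is left in a
  denominator.\<close>

definition newpole :: "nat \<Rightarrow> (nat \<Rightarrow> nat) \<Rightarrow> point \<Rightarrow> nat \<times> nat \<Rightarrow> nat \<times> nat \<Rightarrow> nat \<times> nat \<Rightarrow> complex" where
  "newpole N k t a b e =
     (if fst b = Suc N \<and> fst e = Suc N
      then - of_nat (k (Suc N)) * (regf N k t a (fls_const (t (Suc N, 0)) + cls k t (Suc N))
             * lead (k (Suc N)) (snd b) * lead (k (Suc N)) (snd e)) $$ int (k (Suc N)) else 0)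
     - (if a = (Suc N, 0)
        then (Phi fls_const k t b (zpar t (Suc N)) * Phi fls_const k t e (zpar t (Suc N))) $$ (-1) else 0)"

definition trip_ext :: "nat \<Rightarrow> (nat \<Rightarrow> nat) \<Rightarrow> point \<Rightarrow> nat \<times> nat \<Rightarrow> nat \<times> nat \<Rightarrow> nat \<times> nat \<Rightarrow> complex" where
  "trip_ext N k t a b e = - (\<Sum>i=0..N. (Phi fls_const k t a (zpar t i) * Phi fls_const k t b (zpar t i)
      * Phi fls_const k t e (zpar t i) / Lamz fls_const (Suc N) k t (zpar t i) * fls_deriv (zpar t i)) $$ (-1))
     - newpole N k t a b e"

lemma locus_idx_cases:
  assumes "a \<in> locus_idx N k"
  obtains "a = (Suc N, 0)" | i \<alpha> where "a = (i, \<alpha>)" "i \<le> N" "a \<noteq> (Suc N, 0)" "a \<in> idx N k"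
  using assms by (cases a) (auto simp: locus_idx_def idx_iff split: if_splits)

lemma Lamz_Suc: "Lamz \<iota> (Suc N) k t z = Lamz \<iota> N k t z - Phi \<iota> k t (Suc N, 0) z"
  by (simp add: Lamz_def)

lemma Lamz_regular:
  assumes "ord_ge 0 R" "R $$ 0 = 0" "\<And>i. i \<in> {1..N} \<Longrightarrow> p \<noteq> t (i, 0)"
  shows "ord_ge 0 (Lamz fls_const N k t (fls_const p + R))"
  unfolding Lamz_def using assms by (intro ord_ge_diff ord_ge_sum Phi_regular) auto

lemma regf_regular:
  assumes "a \<in> locus_idx N k" "ord_ge 0 R" "R $$ 0 = 0" "\<And>i. i \<in> {1..N} \<Longrightarrow> p \<noteq> t (i, 0)"
  shows "ord_ge 0 (regf N k t a (fls_const p + R))"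
  using assms(1)
proof (cases rule: locus_idx_cases)
  case 1
  then show ?thesis using Lamz_regular assms by (simp add: regf_def)
next
  case (2 i \<alpha>)
  have "p \<noteq> t (i, 0)" if "i \<noteq> 0" using assms(4)[of i] that 2(2) by auto
  then have "ord_ge 0 (Phi fls_const k t (i, \<alpha>) (fls_const p + R))" by (rule Phi_regular[OF assms(2,3)])
  then show ?thesis using 2 by (simp add: regf_def)
qed

lemma tripf_eq_trip_ext:
  assumes k0: "k 0 \<ge> 2" and ki: "\<forall>i\<in>{1..Suc N}. k i \<ge> 1"
    and t: "t \<in> hdom (Suc N) k" and a: "a \<in> locus_idx N k" and b: "b \<in> idx (Suc N) k" and e: "e \<in> idx (Suc N) k"
  shows "tripf (Suc N) k t a b e = trip_ext N k t a b e"
proof -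
  let ?n = "Suc N"
  let ?P = "\<lambda>x. Phi fls_const k t x (zpar t ?n)"
  let ?L = "Lamz fls_const ?n k t (zpar t ?n)"
  have p: "polar ?n k t ?n" using hdom_polar[OF t _ ki] by auto
  have n: "k ?n \<ge> 1" "t (?n, k ?n) \<noteq> 0" and ne: "\<And>i. i \<in> {1..N} \<Longrightarrow> t (?n, 0) \<noteq> t (i, 0)"
    using p by (fastforce simp: polar_def)+
  have oth: "ord_ge 0 (?P x)" if "fst x \<noteq> ?n" "x \<in> idx ?n k" for x
    using p that by (cases x) (auto intro!: ord_Phi_other simp: polar_def idx_iff)
  have any: "ord_ge (- int (k ?n + 1)) (?P x)" if "x \<in> idx ?n k" for x
    using oth[OF _ that] ord_Phi_own[of ?n k t "snd x"]
    by (cases x; cases "fst x = ?n") (auto intro: ord_ge_mono)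
  define f where "f = regf N k t a (zpar t ?n)"
  have f: "ord_ge 0 f"
    unfolding f_def zpar_pos[OF nat.distinct(2)] by (rule regf_regular[OF a]) (use ne in \<open>auto simp: ord_ge_def\<close>)
  have fc: "fls_compose_fps f (cser k t ?n) = regf N k t a (fls_const (t (?n, 0)) + cls k t ?n)"
    using cser_nz[of k ?n t] n compose_zpar[of ?n k t]
    by (simp add: f_def regf_def Lamz_compose Phi_compose)
  have main: "(f * ?P b * ?P e / ?L) $$ (-1) = (if fst b = ?n \<and> fst e = ?n
      then - of_nat (k ?n) * (regf N k t a (fls_const (t (?n, 0)) + cls k t ?n)
             * lead (k ?n) (snd b) * lead (k ?n) (snd e)) $$ int (k ?n) else 0)"
  proof (cases "fst b = ?n \<and> fst e = ?n")
    case True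
    then obtain \<beta> \<epsilon> where be: "b = (?n, \<beta>)" "e = (?n, \<epsilon>)" by (cases b; cases e) auto
    show ?thesis
      using residue_block[OF p _ _ f, of \<beta> \<epsilon>] b e by (simp add: be idx_iff fc)
  next
    case False
    then consider "fst b \<noteq> ?n" | "fst e \<noteq> ?n" by blast
    then show ?thesis
    proof cases
      case 1
      have "(f * ?P b * ?P e / ?L) $$ (-1) = 0"
        by (rule residue_vanish[OF p ord_ge_mult[OF f oth[OF 1 b]] any[OF e]]) simp
      then show ?thesis using False by auto
    next
      case 2
      have "(f * ?P e * ?P b / ?L) $$ (-1) = 0"
        by (rule residue_vanish[OF p ord_ge_mult[OF f oth[OF 2 e]] any[OF b]]) simp
      then show ?thesis using False by (simp only: mult_ac if_False)
    qed
  qed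
  have L: "?L \<noteq> 0" by (rule Lamz_subdegree(1)[OF p])
  have "?P a * ?P b * ?P e / ?L = f * ?P b * ?P e / ?L - (if a = (?n, 0) then ?P b * ?P e else 0)"
    using L by (auto simp: f_def regf_def Lamz_Suc[of _ N] field_simps)
  then have "(?P a * ?P b * ?P e / ?L) $$ (-1) = newpole N k t a b e"
    unfolding newpole_def main[symmetric] by auto
  then show ?thesis
    by (simp add: tripf_def trip_ext_def fls_deriv_zpar del: fls_residue_def)
qed

section \<open>Holomorphic dependence of the residues on the flat coordinates\<close>

definition holo_fls_ex :: "(nat \<times> nat) set \<Rightarrow> point set \<Rightarrow> (point \<Rightarrow> complex fls) \<Rightarrow> bool" where
  "holo_fls_ex I U F \<longleftrightarrow> (\<exists>d. holo_fls I U d F)"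

lemma holo_fls_exI: "holo_fls I U d F \<Longrightarrow> holo_fls_ex I U F"
  by (auto simp: holo_fls_ex_def)

lemma holo_fls_exD: "holo_fls_ex I U F \<Longrightarrow> holo_wrt I U (\<lambda>t. F t $$ n)"
  by (auto simp: holo_fls_ex_def intro: holo_flsD)

lemma holo_fls_ex_add:
  assumes "holo_fls_ex I U F" "holo_fls_ex I U G"
  shows "holo_fls_ex I U (\<lambda>t. F t + G t)"
proof -
  obtain a b where "holo_fls I U a F" "holo_fls I U b G" using assms by (auto simp: holo_fls_ex_def)
  then have "holo_fls I U (min a b) (\<lambda>t. F t + G t)"
    by (intro holo_fls_add) (auto intro: holo_fls_mono)
  then show ?thesis by (rule holo_fls_exI)
qed

lemma holo_fls_ex_diff:
  assumes "holo_fls_ex I U F" "holo_fls_ex I U G"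
  shows "holo_fls_ex I U (\<lambda>t. F t - G t)"
proof -
  obtain a b where "holo_fls I U a F" "holo_fls I U b G" using assms by (auto simp: holo_fls_ex_def)
  then have "holo_fls I U (min a b) (\<lambda>t. F t - G t)"
    by (intro holo_fls_diff) (auto intro: holo_fls_mono)
  then show ?thesis by (rule holo_fls_exI)
qed

lemma holo_fls_ex_fixed: "holo_fls_ex I U (\<lambda>_. F)"
  by (rule holo_fls_exI[OF holo_fls_fixed[of "fls_subdegree F"]]) (auto simp: ord_ge_iff)

lemma holo_fls_ex_sum: "(\<And>i. i \<in> A \<Longrightarrow> holo_fls_ex I U (F i)) \<Longrightarrow> holo_fls_ex I U (\<lambda>t. \<Sum>i\<in>A. F i t)"
  by (induction A rule: infinite_finite_induct) (auto intro: holo_fls_ex_add holo_fls_ex_fixed)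

lemma holo_fls_ex_mult:
  "holo_fls_ex I U F \<Longrightarrow> holo_fls_ex I U G \<Longrightarrow> open U \<Longrightarrow> holo_fls_ex I U (\<lambda>t. F t * G t)"
  by (auto simp: holo_fls_ex_def intro: holo_fls_mult)

lemma holo_fls_ex_power: "holo_fls_ex I U F \<Longrightarrow> open U \<Longrightarrow> holo_fls_ex I U (\<lambda>t. F t ^ n)"
  by (auto simp: holo_fls_ex_def intro: holo_fls_power)

lemma holo_fls_ex_const: "holo_wrt I U f \<Longrightarrow> holo_fls_ex I U (\<lambda>t. fls_const (f t))"
  by (rule holo_fls_exI[OF holo_fls_const])

text \<open>A lowest coefficient at a fixed position without zeros: the condition under which a
  family of Laurent series can be inverted holomorphically.\<close>

definition holo_unit :: "(nat \<times> nat) set \<Rightarrow> point set \<Rightarrow> (point \<Rightarrow> complex fls) \<Rightarrow> bool" where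
  "holo_unit I U F \<longleftrightarrow> (\<exists>d. holo_fls I U d F \<and> (\<forall>t\<in>U. F t $$ d \<noteq> 0))"

lemma holo_unitI: "holo_fls_ex I U F \<Longrightarrow> (\<And>t. t \<in> U \<Longrightarrow> ord_ge d (F t)) \<Longrightarrow> (\<And>t. t \<in> U \<Longrightarrow> F t $$ d \<noteq> 0) \<Longrightarrow> holo_unit I U F"
  by (auto simp: holo_unit_def holo_fls_ex_def holo_fls_def)

lemma holo_unit_inverse: "holo_unit I U F \<Longrightarrow> open U \<Longrightarrow> holo_fls_ex I U (\<lambda>t. inverse (F t))"
  by (auto simp: holo_unit_def holo_fls_ex_def intro: holo_fls_inverse)

lemma holo_fls_ex_divide:
  "holo_fls_ex I U F \<Longrightarrow> holo_unit I U G \<Longrightarrow> open U \<Longrightarrow> holo_fls_ex I U (\<lambda>t. F t / G t)"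
  unfolding divide_inverse by (intro holo_fls_ex_mult holo_unit_inverse)

lemma holo_cser: "holo_fps I U (\<lambda>t. cser k t i)"
  unfolding holo_fps_def cser_def divide_inverse
  by (auto intro!: holo_wrt_mult holo_wrt_const holo_wrt_if holo_wrt_coord)

lemma holo_gser: "open U \<Longrightarrow> holo_fps I U (\<lambda>t. gser k t)"
proof (rule holo_fps_inverse)
  have "holo_wrt I U (\<lambda>t. if n = 0 then 1 else if 2 \<le> n \<and> n \<le> k 0 then - t (0, k 0 + 1 - n) else 0)" for n
    by (intro holo_wrt_if holo_wrt_const holo_wrt_uminus holo_wrt_coord)
  then show "holo_fps I U (dser k)" by (simp add: holo_fps_def dser_def)
qed auto

lemma holo_pcoef: "open U \<Longrightarrow> holo_wrt I U (\<lambda>t. pcoef k t i \<alpha> a)"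
  unfolding pcoef_def
  by (intro holo_wrt_if holo_wrt_mult holo_wrt_const holo_fpsD[OF holo_fps_power[OF holo_cser]]
      holo_fpsD[OF holo_fps_power[OF holo_gser]])

lemma holo_Phi:
  assumes U: "open U" and Z: "holo_fls_ex I U Z"
    and u: "fst x \<noteq> 0 \<Longrightarrow> holo_unit I U (\<lambda>t. Z t - fls_const (t (fst x, 0)))"
  shows "holo_fls_ex I U (\<lambda>t. Phi fls_const k t x (Z t))"
proof -
  obtain i \<alpha> where x: "x = (i, \<alpha>)" by (cases x)
  show ?thesis
  proof (cases "i = 0")
    case True
    then show ?thesis unfolding x True Phi_0
      by (intro holo_fls_ex_sum holo_fls_ex_mult holo_fls_ex_const holo_pcoef holo_fls_ex_power Z U)
  next
    case False
    then show ?thesis unfolding x Phi_pos[OF False] power_inverse[symmetric] using u False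
      by (intro holo_fls_ex_sum holo_fls_ex_mult holo_fls_ex_const holo_pcoef holo_fls_ex_power holo_unit_inverse U)
        (auto simp: x)
  qed
qed

lemma holo_Lamz:
  assumes U: "open U" and Z: "holo_fls_ex I U Z"
    and u: "\<And>i. i \<in> {1..M} \<Longrightarrow> holo_unit I U (\<lambda>t. Z t - fls_const (t (i, 0)))"
  shows "holo_fls_ex I U (\<lambda>t. Lamz fls_const M k t (Z t))"
  unfolding Lamz_def using u by (intro holo_fls_ex_diff holo_fls_ex_sum holo_Phi U Z) auto

text \<open>The domain of the flat coordinates of \<open>L\<close> without the condition on
  \<open>t (Suc N, k (Suc N))\<close>: an open set that contains the locus and carries the
  extension.\<close>

definition nbhd :: "nat \<Rightarrow> (nat \<Rightarrow> nat) \<Rightarrow> point set" where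
  "nbhd N k = {t. (\<forall>i\<in>{1..N}. t (i, k i) \<noteq> 0) \<and> inj_on (\<lambda>i. t (i, 0)) {1..Suc N}}"

lemma open_coord_neq: "open {t::point. t x \<noteq> t y}"
  by (intro open_Collect_neq continuous_on_coord)

lemma open_nbhd: "open (nbhd N k)"
proof -
  have "nbhd N k = (\<Inter>i\<in>{1..N}. {t. t (i, k i) \<noteq> 0}) \<inter>
     (\<Inter>(i,j)\<in>{(i,j). i \<in> {1..Suc N} \<and> j \<in> {1..Suc N} \<and> i \<noteq> j}. {t. t (i, 0) \<noteq> t (j, 0)})"
    by (auto simp: nbhd_def inj_on_def)
  moreover have "finite {(i,j). i \<in> {1..Suc N} \<and> j \<in> {1..Suc N} \<and> i \<noteq> j}"
    by (rule finite_subset[of _ "{1..Suc N} \<times> {1..Suc N}"]) auto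
  moreover have "open {t::point. t x \<noteq> 0}" for x
    by (intro open_Collect_neq continuous_on_coord continuous_on_const)
  ultimately show ?thesis by (auto intro!: open_Int open_INT open_coord_neq simp: split_beta)
qed

lemma nbhd_neq: "t \<in> nbhd N k \<Longrightarrow> i \<in> {1..Suc N} \<Longrightarrow> j \<in> {1..Suc N} \<Longrightarrow> i \<noteq> j \<Longrightarrow> t (i, 0) \<noteq> t (j, 0)"
  unfolding nbhd_def inj_on_def by blast

lemma holo_zpar: "holo_fls_ex I U (\<lambda>t. zpar t i)"
  by (cases "i = 0") (auto simp: zpar_pos intro!: holo_fls_ex_add holo_fls_ex_fixed holo_fls_ex_const)

lemma unit_zpar:
  assumes "i \<le> Suc N" "j \<in> {1..Suc N}" "U \<subseteq> nbhd N k"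
  shows "holo_unit I U (\<lambda>t. zpar t i - fls_const (t (j, 0)))"
proof (rule holo_unitI[where d="if i = 0 then -1 else if i = j then 1 else 0"])
  show "holo_fls_ex I U (\<lambda>t. zpar t i - fls_const (t (j, 0)))"
    by (intro holo_fls_ex_diff holo_zpar holo_fls_ex_const holo_wrt_coord)
  show "ord_ge (if i = 0 then -1 else if i = j then 1 else 0) (zpar t i - fls_const (t (j, 0)))" for t
    by (auto simp: zpar_pos ord_ge_def)
  show "(zpar t i - fls_const (t (j, 0))) $$ (if i = 0 then -1 else if i = j then 1 else 0) \<noteq> 0" if "t \<in> U" for t
    using nbhd_neq[of t N k i j] that assms by (auto simp: zpar_pos)
qed

lemma holo_Phi_zpar:
  assumes "x \<in> idx (Suc N) k" "i \<le> Suc N" "U \<subseteq> nbhd N k" "open U"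
  shows "holo_fls_ex I U (\<lambda>t. Phi fls_const k t x (zpar t i))"
  using assms by (intro holo_Phi holo_zpar unit_zpar[of _ N _ _ k]) (auto simp: idx_def)

text \<open>Only old poles occur here. The leading coefficient is \<open>1\<close> at infinity and a
  constant times a power of \<open>t (i, k i)\<close> at a finite pole, nonzero on
  \<open>nbhd\<close>; at the new pole it would vanish on the locus.\<close>

lemma unit_Lamz_zpar:
  assumes k0: "k 0 \<ge> 2" and ki: "\<forall>i\<in>{1..N}. k i \<ge> 1" and i: "i \<le> N" and U: "U \<subseteq> nbhd N k" "open U"
    and M: "M = N \<or> M = Suc N"
  shows "holo_unit I U (\<lambda>t. Lamz fls_const M k t (zpar t i))"
proof (rule holo_unitI)
  show "holo_fls_ex I U (\<lambda>t. Lamz fls_const M k t (zpar t i))"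
    using i U M by (intro holo_Lamz holo_zpar unit_zpar[of _ N _ _ k]) auto
  let ?d = "if i = 0 then 1 - int (k 0) else - int (k i + 1)"
  have o: "ord_ge ?d (Lamz fls_const M k t (zpar t i)) \<and> Lamz fls_const M k t (zpar t i) $$ ?d \<noteq> 0" if t: "t \<in> U" for t
  proof (cases "i = 0")
    case True
    then show ?thesis using Lamz_inf_coeff[of k M t, OF k0] by simp
  next
    case False
    have kk: "k i \<ge> 1" using ki i False by auto
    then have c: "cser k t i $ 1 \<noteq> 0" using t U i False cser_nth_1[of k i t] by (auto simp: nbhd_def)
    have "\<forall>j\<in>{1..M} - {i}. t (j, 0) \<noteq> t (i, 0)" using nbhd_neq[of t N k _ i] t U i M False by fastforce
    then show ?thesis
      using Lamz_own_coeff[of i M t k] i M False c kk by auto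
  qed
  show "ord_ge ?d (Lamz fls_const M k t (zpar t i))" "Lamz fls_const M k t (zpar t i) $$ ?d \<noteq> 0" if "t \<in> U" for t
    using o[OF that] by auto
qed

lemma holo_deriv_zpar: "holo_fls_ex I U (\<lambda>t. fls_deriv (zpar t i))"
  by (cases "i = 0") (simp_all add: fls_deriv_zpar holo_fls_ex_fixed)

lemma holo_trip_ext:
  assumes k0: "k 0 \<ge> 2" and ki: "\<forall>i\<in>{1..Suc N}. k i \<ge> 1"
    and a: "a \<in> locus_idx N k" and b: "b \<in> idx (Suc N) k" and e: "e \<in> idx (Suc N) k"
  shows "holo_wrt I (nbhd N k) (\<lambda>t. trip_ext N k t a b e)"
proof -
  let ?U = "nbhd N k"
  note U = open_nbhd[of N k]
  have a': "a \<in> idx (Suc N) k" using a by (auto simp: locus_idx_def idx_def)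
  have W: "holo_fls_ex I ?U (\<lambda>t. fls_const (t (Suc N, 0)) + cls k t (Suc N))"
    by (intro holo_fls_ex_add holo_fls_ex_const holo_wrt_coord holo_fls_exI[OF holo_fls_fps[OF holo_cser]])
  have Wu: "holo_unit I ?U (\<lambda>t. fls_const (t (Suc N, 0)) + cls k t (Suc N) - fls_const (t (i, 0)))" if "i \<in> {1..N}" for i
  proof (rule holo_unitI[where d=0])
    show "holo_fls_ex I ?U (\<lambda>t. fls_const (t (Suc N, 0)) + cls k t (Suc N) - fls_const (t (i, 0)))"
      by (intro holo_fls_ex_diff W holo_fls_ex_const holo_wrt_coord)
    show "ord_ge 0 (fls_const (t (Suc N, 0)) + cls k t (Suc N) - fls_const (t (i, 0)))" for t
      by (auto intro!: ord_ge_add ord_ge_diff)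
    show "(fls_const (t (Suc N, 0)) + cls k t (Suc N) - fls_const (t (i, 0))) $$ 0 \<noteq> 0" if "t \<in> ?U" for t
      using nbhd_neq[OF that, of "Suc N" i] \<open>i \<in> {1..N}\<close> by auto
  qed
  have R: "holo_fls_ex I ?U (\<lambda>t. regf N k t a (fls_const (t (Suc N, 0)) + cls k t (Suc N)))"
    using a
  proof (cases rule: locus_idx_cases)
    case 1
    then show ?thesis unfolding regf_def using holo_Lamz[OF U W Wu] by simp
  next
    case (2 i \<alpha>)
    then show ?thesis unfolding regf_def using Wu[of i] by (auto intro!: holo_Phi[OF U W])
  qed
  have neg: "holo_wrt I ?U (\<lambda>t. - of_nat (k (Suc N)) * (regf N k t a (fls_const (t (Suc N, 0)) + cls k t (Suc N))
             * lead (k (Suc N)) (snd b) * lead (k (Suc N)) (snd e)) $$ int (k (Suc N)))"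
    by (intro holo_wrt_mult holo_wrt_const holo_fls_exD holo_fls_ex_mult R U holo_fls_ex_fixed)
  show ?thesis
    unfolding trip_ext_def newpole_def
    using ki by (intro holo_wrt_diff holo_wrt_uminus holo_wrt_sum holo_wrt_if neg holo_wrt_const holo_fls_exD
        holo_fls_ex_mult holo_fls_ex_divide holo_deriv_zpar U
        holo_Phi_zpar[of _ N k] a' b e unit_Lamz_zpar[of k N] k0) auto
qed

section \<open>Values of the extended structure constants on the locus\<close>

lemma nth_0_mult:
  fixes F G :: "'a::field fls"
  shows "ord_ge 0 F \<Longrightarrow> ord_ge 0 G \<Longrightarrow> (F * G) $$ 0 = F $$ 0 * G $$ 0"
  by (subst fls_times_nth_ord_ge[of 0 _ 0]) auto

lemma nth_0_power:
  fixes F :: "'a::field fls"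
  assumes "ord_ge 0 F"
  shows "(F ^ n) $$ 0 = (F $$ 0) ^ n"
proof (induction n)
  case (Suc n)
  have "ord_ge 0 (F ^ n)" using ord_ge_power[OF assms, of 0 n] by simp
  then show ?case using Suc nth_0_mult[OF assms] by simp
qed simp

lemma nth_0_inverse:
  fixes F :: "'a::field fls"
  assumes "ord_ge 0 F" "F $$ 0 \<noteq> 0"
  shows "(inverse F) $$ 0 = inverse (F $$ 0)"
proof -
  have "F \<noteq> 0" using assms by auto
  then have "F $$ 0 * (inverse F) $$ 0 = 1"
    using nth_0_mult[OF assms(1) ord_ge_inverse_unit[OF assms]] by simp
  then show ?thesis using assms(2) by (simp add: field_simps)
qed

lemma Phi_nth_0:
  assumes R: "ord_ge 0 R" "R $$ 0 = 0" and p: "i \<noteq> 0 \<Longrightarrow> p \<noteq> t (i, 0)"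
  shows "Phi fls_const k t (i, \<alpha>) (fls_const p + R) $$ 0 = Phi (\<lambda>x. x) k t (i, \<alpha>) p"
proof (cases "i = 0")
  case True
  have "ord_ge 0 (fls_const p + R)" using R by (intro ord_ge_add) auto
  then show ?thesis unfolding True Phi_0 using R
    by (simp add: fls_nth_sum nth_0_power)
next
  case False
  have o: "ord_ge 0 (fls_const p + R - fls_const (t (i, 0)))"
    using R by (intro ord_ge_add ord_ge_diff) auto
  have e: "(fls_const p + R - fls_const (t (i, 0))) $$ 0 = p - t (i, 0)" using R by simp
  have o2: "ord_ge 0 ((fls_const p + R - fls_const (t (i, 0))) ^ a)" for a
    using ord_ge_power[OF o, of 0 a] by simp
  have "inverse ((fls_const p + R - fls_const (t (i, 0))) ^ a) $$ 0 = inverse ((p - t (i, 0)) ^ a)" for a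
    using p[OF False] by (subst nth_0_inverse[OF o2]) (simp_all only: nth_0_power[OF o] e power_not_zero right_minus_eq not_False_eq_True)
  then show ?thesis unfolding Phi_pos[OF False] by (simp add: fls_nth_sum del: sum.cl_ivl_Suc)
qed

lemma fls_const_diff: "fls_const (a - b) = fls_const a - fls_const (b :: 'a::group_add)"
  by (simp add: fls_minus_const)

lemma fls_const_sum: "fls_const (\<Sum>i\<in>A. f i) = (\<Sum>i\<in>A. fls_const (f i :: 'a::comm_monoid_add))"
  by (induction A rule: infinite_finite_induct) (auto simp flip: fls_plus_const)

lemma Phi_at_const: "Phi fls_const k t x (fls_const p) = fls_const (Phi (\<lambda>x. x) k t x p :: complex)"
  by (cases x) (simp add: Phi_def fls_const_sum fls_const_power fls_inverse_const fls_const_diff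
      fls_inverse_const[symmetric] flip: fls_const_mult_const del: sum.cl_ivl_Suc power_Suc)

lemma Lamz_at_const: "Lamz fls_const N k t (fls_const p) = fls_const (Lamz (\<lambda>x. x) N k t p :: complex)"
  by (simp add: Lamz_def Phi_at_const fls_const_sum fls_const_diff)

definition degen :: "nat \<Rightarrow> (nat \<Rightarrow> nat) \<Rightarrow> point set" where
  "degen N k = {t \<in> nbhd N k. \<forall>\<alpha>\<in>{1..k (Suc N)}. t (Suc N, \<alpha>) = 0}"

lemma degen_cser: "t \<in> degen N k \<Longrightarrow> cser k t (Suc N) = 0"
proof (rule fps_ext)
  fix m assume t: "t \<in> degen N k"
  show "cser k t (Suc N) $ m = 0 $ m"
  proof (cases "1 \<le> m \<and> m \<le> k (Suc N)")
    case True
    then have "k (Suc N) + 1 - m \<in> {1..k (Suc N)}" by auto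
    then have "t (Suc N, k (Suc N) + 1 - m) = 0" using t unfolding degen_def by blast
    then show ?thesis by (simp add: cser_def)
  qed (auto simp: cser_def)
qed

text \<open>With \<open>cser = 0\<close> only the zeroth power survives. Of the new block only the
  field of index \<open>(Suc N, 1)\<close> is left, and it becomes the simple fraction
  \<open>1 / (z - p)\<close> with \<open>p = t (Suc N, 0)\<close>.\<close>

lemma degen_pcoef:
  assumes "t \<in> degen N k" "k (Suc N) \<ge> 1" "a \<ge> 1"
  shows "pcoef k t (Suc N) \<alpha> a = (if \<alpha> = 1 \<and> a = 1 then 1 else 0)"
proof (cases "a = 1")
  case False
  then have "(0 :: complex fps) ^ (a - 1) = 0" using assms by (simp add: power_0_left)
  then have "(cser k t (Suc N) ^ (a - 1)) $ m = 0" for m by (simp only: degen_cser[OF assms(1)] fps_zero_nth)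
  then show ?thesis using False by (simp add: pcoef_def)
qed (use assms in \<open>auto simp: pcoef_def\<close>)

lemma degen_Phi:
  fixes \<iota> :: "complex \<Rightarrow> 'f::field"
  assumes "t \<in> degen N k" "k (Suc N) \<ge> 1" and \<iota>: "\<iota> 0 = 0"
  shows "Phi \<iota> k t (Suc N, \<alpha>) z = (if \<alpha> = 1 then \<iota> 1 * inverse (z - \<iota> (t (Suc N, 0))) else (\<Sum>a=1..k (Suc N) + 1. \<iota> 0 * inverse ((z - \<iota> (t (Suc N, 0))) ^ a)))"
proof -
  have "(\<Sum>a=1..k (Suc N) + 1. \<iota> (pcoef k t (Suc N) \<alpha> a) * inverse ((z - \<iota> (t (Suc N, 0))) ^ a)) =
    (\<Sum>a=1..k (Suc N) + 1. if a = 1 then (if \<alpha> = 1 then \<iota> 1 * inverse (z - \<iota> (t (Suc N, 0))) else 0) else 0)"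
    using \<iota> by (intro sum.cong) (auto simp: degen_pcoef[OF assms(1,2)] simp del: power_Suc)
  also have "\<dots> = (if \<alpha> = 1 then \<iota> 1 * inverse (z - \<iota> (t (Suc N, 0))) else 0)"
    by (simp add: sum.delta del: sum.cl_ivl_Suc)
  finally show ?thesis using \<iota> by (simp add: Phi_def)
qed

lemma degen_Phi_fls:
  assumes "t \<in> degen N k" "k (Suc N) \<ge> 1"
  shows "Phi fls_const k t (Suc N, \<alpha>) z = (if \<alpha> = 1 then inverse (z - fls_const (t (Suc N, 0))) else 0)"
  using degen_Phi[OF assms, of fls_const] by (simp del: sum.cl_ivl_Suc)

lemma degen_Lamz:
  assumes "t \<in> degen N k" "k (Suc N) \<ge> 1"
  shows "Lamz fls_const (Suc N) k t z = Lamz fls_const N k t z"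
  by (simp add: Lamz_Suc[of _ N] degen_Phi_fls[OF assms])

text \<open>The extended triple of two tangent fields and the field of index
  \<open>(Suc N, 1)\<close>. The latter is dual to \<open>(Suc N, 0)\<close>, so this is the
  component of the product along the additional variable, and in the end the second derivative of
  \<open>Fo\<close>.\<close>

definition open_trip :: "nat \<Rightarrow> (nat \<Rightarrow> nat) \<Rightarrow> point \<Rightarrow> nat \<times> nat \<Rightarrow> nat \<times> nat \<Rightarrow> complex" where
  "open_trip N k t a b = (
     if a = (Suc N, 0) then if b = (Suc N, 0) then Lamz (\<lambda>x. x) N k t (t (Suc N, 0)) else Phi (\<lambda>x. x) k t b (t (Suc N, 0))
     else if b = (Suc N, 0) then Phi (\<lambda>x. x) k t a (t (Suc N, 0))
     else - (\<Sum>i=0..N. (Phi fls_const k t a (zpar t i) * Phi fls_const k t b (zpar t i)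
      * inverse (zpar t i - fls_const (t (Suc N, 0))) / Lamz fls_const N k t (zpar t i) * fls_deriv (zpar t i)) $$ (-1)))"

lemma nth_const_X_pow: "(fls_const x * (fls_const u * fls_X ^ m)) $$ int n = (if m = n then x * u else 0)"
  by auto

lemma trip_ext_degen:
  assumes t: "t \<in> degen N k" and kn: "k (Suc N) \<ge> 1"
    and a: "a \<in> locus_idx N k" and b: "b \<in> locus_idx N k" and e: "e \<in> idx (Suc N) k"
  shows "trip_ext N k t a b e =
    (if fst e = Suc N then if snd e = 1 then open_trip N k t a b else 0
     else if a = (Suc N, 0) \<or> b = (Suc N, 0) then 0 else tripf N k t a b e)"
proof -
  let ?n = "Suc N"
  have tn: "t \<in> nbhd N k" using t by (simp add: degen_def)
  have ne: "\<And>i. i \<in> {1..N} \<Longrightarrow> t (?n, 0) \<noteq> t (i, 0)" using nbhd_neq[OF tn] by fastforce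
  have Pn: "Phi fls_const k t (?n, \<alpha>) z = (if \<alpha> = 1 then inverse (z - fls_const (t (?n, 0))) else 0)" for \<alpha> z
    by (rule degen_Phi_fls[OF t kn])
  have reg: "ord_ge 0 (Phi fls_const k t x (zpar t ?n))" if "x \<in> idx N k" for x
  proof -
    obtain i \<alpha> where x: "x = (i, \<alpha>)" by (cases x)
    have "i \<noteq> 0 \<Longrightarrow> t (i, 0) \<noteq> t (?n, 0)" using ne[of i] that by (auto simp: x idx_iff)
    then show ?thesis unfolding x by (intro ord_Phi_other) auto
  qed
  have val: "Phi fls_const k t x (zpar t ?n) $$ 0 = Phi (\<lambda>x. x) k t x (t (?n, 0))" if "x \<in> idx N k" for x
  proof -
    obtain i \<alpha> where x: "x = (i, \<alpha>)" by (cases x)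
    have "i \<noteq> 0 \<Longrightarrow> t (?n, 0) \<noteq> t (i, 0)" using ne[of i] that by (auto simp: x idx_iff)
    then show ?thesis unfolding x zpar_pos[OF nat.distinct(2)] by (intro Phi_nth_0) (auto simp: ord_ge_def)
  qed
  have R: "regf N k t a (fls_const (t (?n, 0)) + cls k t ?n) =
      fls_const (if a = (?n, 0) then Lamz (\<lambda>x. x) N k t (t (?n, 0)) else Phi (\<lambda>x. x) k t a (t (?n, 0)))"
    by (simp add: degen_cser[OF t] regf_def Phi_at_const Lamz_at_const)
  define x0 where "x0 = (if a = (?n, 0) then Lamz (\<lambda>x. x) N k t (t (?n, 0)) else Phi (\<lambda>x. x) k t a (t (?n, 0)))"
  \<comment> \<open>As \<open>lead (k ?n) 0 = 1\<close>, the coefficient of \<open>w^k\<close> asks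
    for \<open>k + 1 - \<epsilon> = k\<close>, that is \<open>\<epsilon> = 1\<close>; for
    \<open>\<epsilon> = 0\<close> the series is constant and \<open>k \<ge> 1\<close>.\<close>
  have blk: "(fls_const x0 * lead (k ?n) 0 * lead (k ?n) \<epsilon>) $$ int (k ?n) * of_nat (k ?n) = (if \<epsilon> = 1 then x0 else 0)"
    if "\<epsilon> \<le> k ?n" for \<epsilon>
    using that kn nth_const_X_pow[of x0 "1 / of_nat (k ?n)" "k ?n + 1 - \<epsilon>" "k ?n"] by (auto simp: lead_def)
  have ab: "(x = (?n, 0) \<or> x \<in> idx N k)" if "x \<in> locus_idx N k" for x using that by (auto simp: locus_idx_def)
  have idxn: "x \<in> idx N k \<Longrightarrow> fst x \<noteq> ?n" for x by (auto simp: idx_def)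
  have np: "newpole N k t a b e = (if fst e = ?n \<and> snd e = 1 then
      if b = (?n, 0) then - x0 else if a = (?n, 0) then - Phi (\<lambda>x. x) k t b (t (?n, 0)) else 0 else 0)"
  proof (cases "fst e = ?n")
    case True
    then obtain \<epsilon> where e': "e = (?n, \<epsilon>)" "\<epsilon> \<le> k ?n" using e by (cases e) (auto simp: idx_iff)
    show ?thesis
    proof (cases "b = (?n, 0)")
      case bn: True
      then show ?thesis using blk[OF e'(2)]
        by (simp add: newpole_def R x0_def[symmetric] e' Pn mult.commute[of "of_nat _"])
    next
      case False
      then have bi: "b \<in> idx N k" using ab[OF b] by auto
      have "(Phi fls_const k t b (zpar t ?n) * inverse fls_X) $$ (-1) = Phi fls_const k t b (zpar t ?n) $$ 0"
        by (simp add: fls_inverse_X fls_X_inv_times_conv_shift)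
      then show ?thesis using False idxn[OF bi] val[OF bi]
        by (auto simp: newpole_def e' Pn zpar_minus)
    qed
  next
    case False
    then have ei: "e \<in> idx N k" using e by (cases e) (auto simp: idx_iff split: if_splits)
    have "(Phi fls_const k t b (zpar t ?n) * Phi fls_const k t e (zpar t ?n)) $$ (-1) = 0"
    proof (cases "b = (?n, 0)")
      case True then show ?thesis by (simp add: Pn)
    next
      case b': False
      then have "b \<in> idx N k" using ab[OF b] by auto
      from ord_ge_nth[OF ord_ge_mult[OF reg[OF this] reg[OF ei], of 0]] show ?thesis by simp
    qed
    then show ?thesis using False by (simp add: newpole_def)
  qed
  show ?thesis
  proof (cases "fst e = ?n")
    case True
    then obtain \<epsilon> where e': "e = (?n, \<epsilon>)" by (cases e) auto
    show ?thesis
      unfolding trip_ext_def np by (auto simp: e' Pn degen_Lamz[OF t kn] open_trip_def x0_def)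
  next
    case False
    then show ?thesis
      unfolding trip_ext_def np by (auto simp: Pn degen_Lamz[OF t kn] tripf_def)
  qed
qed

section \<open>Flat coordinates\<close>

subsection \<open>Roots of functions at a pole\<close>

lemma has_fps_expansion_ball:
  fixes u :: "complex \<Rightarrow> complex"
  assumes "u has_fps_expansion U" "U $ 0 \<noteq> 0"
  obtains \<rho> where "\<rho> > 0" "u holomorphic_on ball 0 \<rho>" "\<And>x. x \<in> ball 0 \<rho> \<Longrightarrow> u x \<noteq> 0"
proof -
  obtain r where r: "r > 0" "u holomorphic_on ball 0 r"
    using has_fps_expansion_imp_analytic_0[OF assms(1)] by (auto simp: analytic_on_def)
  have "u 0 \<noteq> 0" using has_fps_expansion_imp_0_eq_fps_nth_0[OF assms(1)] assms(2) by simp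
  moreover have "isCont u 0"
    using r holomorphic_on_imp_continuous_on[OF r(2)] by (auto simp: continuous_on_eq_continuous_at)
  ultimately obtain e where e: "e > 0" "\<And>x. dist 0 x < e \<Longrightarrow> u x \<noteq> 0"
    using continuous_at_avoid[of 0 u 0] by auto
  show ?thesis
    by (rule that[of "min r e"]) (use r e in \<open>auto intro: holomorphic_on_subset\<close>)
qed

text \<open>A holomorphic function without zeros on a ball has a logarithm \<open>g\<close>;
  subtracting \<open>g 0\<close> before exponentiating makes the prescribed root \<open>r0\<close>
  the constant term.\<close>

lemma local_root:
  fixes u :: "complex \<Rightarrow> complex"
  assumes u: "u has_fps_expansion U" "U $ 0 \<noteq> 0" and k: "k \<ge> 1" and r0: "r0 ^ k = U $ 0"
  obtains \<phi> P \<rho> where "\<rho> > 0" "\<phi> holomorphic_on ball 0 \<rho>" "\<And>x. x \<in> ball 0 \<rho> \<Longrightarrow> \<phi> x ^ k = u x"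
    "\<And>x. x \<in> ball 0 \<rho> \<Longrightarrow> \<phi> x \<noteq> 0" "\<phi> has_fps_expansion P" "P $ 0 = r0" "P ^ k = U"
proof -
  obtain \<rho> where \<rho>: "\<rho> > 0" "u holomorphic_on ball 0 \<rho>" "\<And>x. x \<in> ball 0 \<rho> \<Longrightarrow> u x \<noteq> 0"
    by (rule has_fps_expansion_ball[OF u]) blast
  obtain g where g: "g holomorphic_on ball 0 \<rho>" "\<And>z. z \<in> ball 0 \<rho> \<Longrightarrow> u z = exp (g z)"
    using contractible_imp_holomorphic_log[OF \<rho>(2) convex_imp_contractible[OF convex_ball]] \<rho>(3) by metis
  define \<phi> where "\<phi> = (\<lambda>x. r0 * exp ((g x - g 0) / of_nat k))"
  have u0: "u 0 = U $ 0" using has_fps_expansion_imp_0_eq_fps_nth_0[OF u(1)] by simp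
  have hol: "\<phi> holomorphic_on ball 0 \<rho>"
    unfolding \<phi>_def using g(1) k by (intro holomorphic_intros) auto
  have pw: "\<phi> x ^ k = u x" if "x \<in> ball 0 \<rho>" for x
  proof -
    have "\<phi> x ^ k = u 0 * exp (g x - g 0)"
      using k by (simp add: \<phi>_def power_mult_distrib r0 u0 flip: exp_of_nat_mult)
    also have "u 0 = exp (g 0)" using g(2)[of 0] \<rho>(1) by simp
    finally show ?thesis using g(2)[OF that] by (simp flip: exp_add)
  qed
  have nz: "\<phi> x \<noteq> 0" if "x \<in> ball 0 \<rho>" for x
    using pw[OF that] \<rho>(3)[OF that] k by (auto simp: power_0_left)
  define P where "P = fps_expansion \<phi> 0"
  have P: "\<phi> has_fps_expansion P"
    unfolding P_def using hol \<rho>(1) by (intro analytic_at_imp_has_fps_expansion_0) (auto simp: analytic_on_def)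
  have "(\<lambda>x. \<phi> x ^ k) has_fps_expansion P ^ k" by (intro fps_expansion_intros P)
  also have "?this \<longleftrightarrow> u has_fps_expansion P ^ k"
    using \<rho>(1) pw by (intro has_fps_expansion_cong) (auto simp: eventually_nhds intro!: exI[of _ "ball 0 \<rho>"])
  finally have "P ^ k = U" using fps_expansion_unique_complex[OF _ u(1)] by blast
  moreover have "P $ 0 = r0"
    using has_fps_expansion_imp_0_eq_fps_nth_0[OF P] by (simp add: \<phi>_def)
  ultimately show ?thesis using that[OF \<rho>(1) hol pw nz P] by blast
qed

text \<open>The quotient of \<open>x * \<zeta> x\<close> by the root constructed above is continuous
  on a connected punctured disc and takes values among the \<open>k\<close>-th roots of unity, hence
  is constant. So a merely continuous root already has a Laurent expansion with a simple
  pole.\<close>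

lemma local_root_unique:
  fixes u :: "complex \<Rightarrow> complex"
  assumes u: "u has_fps_expansion U" "U $ 0 \<noteq> 0" and k: "k \<ge> 1" and r: "r > 0"
    and \<zeta>: "continuous_on (ball 0 r - {0}) \<zeta>" "\<And>x. x \<in> ball 0 r - {0} \<Longrightarrow> (x * \<zeta> x) ^ k = u x"
  obtains P where "P ^ k = U" "\<zeta> has_laurent_expansion (fps_to_fls P / fls_X)"
proof -
  obtain r0 where r0: "r0 ^ k = U $ 0"
  proof
    show "exp (Ln (U $ 0) / of_nat k) ^ k = U $ 0" using k u(2) by (simp flip: exp_of_nat_mult)
  qed
  obtain \<phi> P \<rho> where \<phi>: "\<rho> > 0" "\<phi> holomorphic_on ball 0 \<rho>" "\<And>x. x \<in> ball 0 \<rho> \<Longrightarrow> \<phi> x ^ k = u x"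
    "\<And>x. x \<in> ball 0 \<rho> \<Longrightarrow> \<phi> x \<noteq> 0" "\<phi> has_fps_expansion P" "P $ 0 = r0" "P ^ k = U"
    by (rule local_root[OF u k r0]) blast
  define S where "S = ball (0::complex) (min r \<rho>) - {0}"
  define q where "q = (\<lambda>x. x * \<zeta> x / \<phi> x)"
  have q1: "q x ^ k = 1" if "x \<in> S" for x
    using \<zeta>(2)[of x] \<phi>(3)[of x] \<phi>(4)[of x] that by (auto simp: S_def q_def power_divide)
  have "q constant_on S"
  proof (rule continuous_finite_range_constant)
    show "connected S"
      unfolding S_def by (intro connected_punctured_convex) (use r \<phi>(1) in \<open>auto simp: aff_dim_open\<close>)
    show "continuous_on S q"
      unfolding q_def using \<zeta>(1) \<phi>(2,4)
      by (intro continuous_intros) (auto simp: S_def intro: continuous_on_subset holomorphic_on_imp_continuous_on)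
    have "q ` S \<subseteq> {z. z ^ k = 1}" using q1 by auto
    then show "finite (q ` S)" using finite_roots_unity[OF k] finite_subset by blast
  qed
  then obtain \<omega> where \<omega>: "\<And>x. x \<in> S \<Longrightarrow> q x = \<omega>" by (auto simp: constant_on_def)
  have "of_real (min r \<rho> / 2) \<in> S" using r \<phi>(1) by (auto simp: S_def)
  then have \<omega>1: "\<omega> ^ k = 1" using q1 \<omega> by metis
  have "(\<lambda>x. \<omega> * \<phi> x / x) has_laurent_expansion (fls_const \<omega> * fps_to_fls P / fls_X)"
    by (intro laurent_expansion_intros has_laurent_expansion_fps \<phi>)
  also have "?this \<longleftrightarrow> \<zeta> has_laurent_expansion (fps_to_fls (fps_const \<omega> * P) / fls_X)"
  proof (rule has_laurent_expansion_cong)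
    have "\<omega> * \<phi> x / x = \<zeta> x" if "x \<in> S" for x
      using \<omega>[OF that] \<phi>(4)[of x] that by (auto simp: S_def q_def field_simps)
    moreover have "\<forall>\<^sub>F x in at 0. x \<in> S"
      using r \<phi>(1) unfolding S_def by (intro eventually_at_in_open) auto
    ultimately show "\<forall>\<^sub>F x in at 0. \<omega> * \<phi> x / x = \<zeta> x" by (auto elim: eventually_mono)
  qed (simp add: fls_times_fps_to_fls)
  finally have \<zeta>P: "\<zeta> has_laurent_expansion (fps_to_fls (fps_const \<omega> * P) / fls_X)" .
  have "(fps_const \<omega> * P) ^ k = fps_const (\<omega> ^ k) * P ^ k" by (simp only: power_mult_distrib fps_const_power)
  then have "(fps_const \<omega> * P) ^ k = U" using \<omega>1 \<phi>(7) by simp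
  then show ?thesis using that \<zeta>P by blast
qed

subsection \<open>Formal inversion\<close>

text \<open>Congruence modulo \<open>X^(n+1)\<close>: the flat coordinates fix only an initial
  segment of a series, and the parameters depend only on that segment.\<close>

definition agree :: "nat \<Rightarrow> complex fps \<Rightarrow> complex fps \<Rightarrow> bool" where
  "agree n f g \<longleftrightarrow> (\<forall>j\<le>n. f $ j = g $ j)"

lemma agree_mult: "agree n f g \<Longrightarrow> agree n f' g' \<Longrightarrow> agree n (f * f') (g * g')"
  by (auto simp: agree_def fps_mult_nth intro!: sum.cong)

lemma agree_power: "agree n f g \<Longrightarrow> agree n (f ^ a) (g ^ a)"
  by (induction a) (auto intro: agree_mult simp: agree_def[of n 1])

lemma agree_diff: "agree n f g \<Longrightarrow> agree n f' g' \<Longrightarrow> agree n (f - f') (g - g')"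
  by (auto simp: agree_def)

lemma agree_X_deriv: "agree n f g \<Longrightarrow> agree n (fps_X * fps_deriv f) (fps_X * fps_deriv g)"
  by (auto simp: agree_def)

lemma agree_inverse:
  assumes "agree n f g" "f $ 0 \<noteq> 0"
  shows "agree n (inverse f) (inverse g)"
proof -
  have g: "g $ 0 \<noteq> 0" using assms by (auto simp: agree_def)
  have "inverse f - inverse g = inverse f * inverse g * (g - f)"
    using assms(2) g by (simp add: right_diff_distrib inverse_mult_eq_1' mult.assoc mult.left_commute[of _ "inverse g"] inverse_mult_eq_1)
  moreover have "agree n (inverse f * inverse g * (g - f)) (inverse f * inverse g * 0)"
    using assms(1) by (intro agree_mult) (auto simp: agree_def)
  ultimately show ?thesis by (simp add: agree_def) (metis eq_iff_diff_eq_0 fps_sub_nth)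
qed

text \<open>With \<open>F = P / X\<close> the root of \<open>\<lambda>\<close> as a series in the
  local parameter, \<open>c\<close> is the compositional inverse of \<open>1 / F\<close>, that is,
  the local parameter as a series in \<open>w\<close>. The value of \<open>c $ 2\<close> expresses
  the normalisation of the root at infinity.\<close>

lemma root_parameter:
  fixes P :: "complex fps"
  assumes "P $ 0 \<noteq> 0"
  obtains c where "c $ 0 = 0" "c $ 1 \<noteq> 0" "c $ 1 = P $ 0" "c $ 2 = P $ 0 * P $ 1"
     "fls_compose_fps (fps_to_fls P / fls_X) c = fls_X_inv"
proof -
  define W where "W = fps_X * inverse P"
  have W: "W $ 0 = 0" "W $ 1 \<noteq> 0" using assms by (auto simp: W_def)
  define c where "c = fps_inv W"
  have Wc: "W oo c = fps_X" using fps_inv_right[OF W] by (simp add: c_def)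
  have c0: "c $ 0 = 0" by (simp add: c_def fps_inv_def)
  have c1: "c $ 1 \<noteq> 0" using W by (simp add: c_def fps_inv_def)
  have cnz: "c \<noteq> 0" using c1 by auto
  have Pc: "(P oo c) * fps_X = c"
  proof -
    have "P * W = fps_X" using assms by (simp add: W_def mult.left_commute[of P] inverse_mult_eq_1')
    then have "(P oo c) * (W oo c) = fps_X oo c" using fps_compose_mult_distrib[OF c0, of P W] by simp
    then show ?thesis using Wc c0 by simp
  qed
  have Pc_nth: "(P oo c) $ n = c $ Suc n" for n
    using arg_cong[OF Pc, of "\<lambda>f. f $ Suc n"] by simp
  have "fls_compose_fps (fps_to_fls P / fls_X) c = fps_to_fls (P oo c) / fps_to_fls c"
    by (subst fls_compose_fps_divide) (use cnz c0 in auto)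
  also have "fps_to_fls c = fps_to_fls (P oo c) * fls_X"
    using arg_cong[OF Pc, of fps_to_fls] by (simp add: fls_times_fps_to_fls)
  also have "fps_to_fls (P oo c) / (fps_to_fls (P oo c) * fls_X) = fls_X_inv"
  proof -
    have "P oo c \<noteq> 0" using Pc cnz by auto
    then show ?thesis by (simp add: field_simps flip: fls_inverse_X)
  qed
  finally have F: "fls_compose_fps (fps_to_fls P / fls_X) c = fls_X_inv" .
  have "c $ 1 = P $ 0" using Pc_nth[of 0] by simp
  moreover have "c $ 2 = P $ 0 * P $ 1"
    using Pc_nth[of 1] calculation by (simp add: fps_compose_nth c0 numeral_2_eq_2 mult.commute)
  ultimately show ?thesis using that[OF c0 c1] F by simp
qed

lemma X_inv_deriv_nth:
  "m \<ge> 1 \<Longrightarrow> (fls_X_inv ^ m * fls_deriv F) $$ (-1) = of_nat m * (F :: complex fls) $$ int m"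
  by (simp add: fls_X_inv_power_times_conv_shift)

text \<open>Lagrange inversion: in the parameter \<open>w\<close> the form \<open>F^m dx\<close>
  becomes \<open>w^(-m) dc\<close>.\<close>

lemma root_residue:
  assumes c: "c $ 0 = 0" "c $ 1 \<noteq> 0" "fls_compose_fps F c = fls_X_inv" and m: "m \<ge> 1"
  shows "(F ^ m) $$ (-1) = of_nat m * (c :: complex fps) $ m"
proof -
  have [simp]: "c \<noteq> 0" using c(2) by auto
  have "(F ^ m) $$ (-1) = (fls_X_inv ^ m * fls_deriv (fps_to_fls c)) $$ (-1)"
    using c by (subst residue_compose[OF c(1,2), symmetric]) (auto simp: fls_compose_fps_power)
  then show ?thesis using X_inv_deriv_nth[OF m] by simp
qed

lemma root_residue_inf:
  assumes c: "c $ 0 = 0" "c $ 1 \<noteq> 0" "fls_compose_fps F c = fls_X_inv" and m: "m \<ge> 1"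
  shows "(F ^ m * fls_deriv fls_X_inv) $$ (-1) = of_nat m * inverse (fps_to_fls (c :: complex fps)) $$ int m"
proof -
  have [simp]: "c \<noteq> 0" using c(2) by auto
  have "(F ^ m * fls_deriv fls_X_inv) $$ (-1) = (fls_X_inv ^ m * fls_deriv (inverse (fps_to_fls c))) $$ (-1)"
    using c by (subst residue_compose_inf[OF c(1,2)]) (auto simp: fls_compose_fps_power)
  then show ?thesis using X_inv_deriv_nth[OF m] by simp
qed

lemma power_deriv_nth:
  fixes c :: "complex fps"
  assumes "k \<ge> 1" "a \<ge> 1"
  shows "(fps_to_fls c ^ (a - 1) * fls_X_inv ^ k * fls_deriv (fps_to_fls c)) $$ (-1) = of_nat k / of_nat a * (c ^ a) $ k"
proof -
  have "fps_to_fls c ^ (a - 1) * fls_X_inv ^ k * fls_deriv (fps_to_fls c) = fls_X_inv ^ k * fps_to_fls (c ^ (a - 1) * fps_deriv c)"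
    by (simp add: fls_deriv_fps_to_fls fls_times_fps_to_fls fps_to_fls_power mult_ac)
  also have "\<dots> $$ (-1) = (c ^ (a - 1) * fps_deriv c) $ (k - 1)"
    using assms by (simp add: fls_X_inv_power_times_conv_shift nat_diff_distrib)
  also have "\<dots> = of_nat k / of_nat a * (c ^ a) $ k"
  proof -
    have "fps_deriv (c ^ a) = of_nat a * (c ^ (a - 1) * fps_deriv c)" by (simp add: fps_deriv_power fps_of_nat mult_ac)
    then have "of_nat a * (c ^ (a - 1) * fps_deriv c) $ (k - 1) = of_nat k * (c ^ a) $ k"
      using arg_cong[of _ _ "\<lambda>f. f $ (k - 1)"] assms by (metis Suc_diff_1 Suc_eq_plus1 fps_deriv_nth fps_mult_of_nat_nth(1) less_eq_Suc_le One_nat_def)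
    then show ?thesis using assms by (simp add: field_simps)
  qed
  finally show ?thesis .
qed

text \<open>Lagrange inversion for the polar coefficients of \<open>\<lambda> = F^k\<close>, which
  are the parameters of the pole.\<close>

lemma root_coeff:
  assumes c: "c $ 0 = 0" "c $ 1 \<noteq> 0" "fls_compose_fps F c = fls_X_inv" and k: "k \<ge> 1" and a: "a \<ge> 1"
  shows "(F ^ k) $$ (- int a) = of_nat k / of_nat a * ((c :: complex fps) ^ a) $ k"
proof -
  have [simp]: "c \<noteq> 0" using c(2) by auto
  have "(F ^ k) $$ (- int a) = (fls_X ^ (a - 1) * F ^ k) $$ (-1)"
    using a by (simp add: fls_X_power_times_conv_shift of_nat_diff)
  also have "\<dots> = (fps_to_fls c ^ (a - 1) * fls_X_inv ^ k * fls_deriv (fps_to_fls c)) $$ (-1)"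
    using c by (subst residue_compose[OF c(1,2), symmetric]) (auto simp: fls_compose_fps_power fls_compose_fps_mult)
  also have "\<dots> = of_nat k / of_nat a * (c ^ a) $ k" by (rule power_deriv_nth[OF k a])
  finally show ?thesis .
qed

text \<open>The coefficients of \<open>\<lambda>\<close> at infinity in terms of \<open>D = w z\<close>.\<close>

definition infcoef :: "complex fps \<Rightarrow> nat \<Rightarrow> nat \<Rightarrow> complex" where
  "infcoef D k a = (inverse D ^ a * (D - fps_X * fps_deriv D)) $ (k + 1 - a)"

lemma infcoef_agree: "agree k D E \<Longrightarrow> D $ 0 \<noteq> 0 \<Longrightarrow> a \<ge> 1 \<Longrightarrow> infcoef D k a = infcoef E k a"
proof -
  assume "agree k D E" "D $ 0 \<noteq> 0" "a \<ge> 1"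
  then have "agree k (inverse D ^ a * (D - fps_X * fps_deriv D)) (inverse E ^ a * (E - fps_X * fps_deriv E))"
    by (intro agree_mult agree_power agree_inverse agree_diff agree_X_deriv)
  then show ?thesis using \<open>a \<ge> 1\<close> by (simp add: agree_def infcoef_def)
qed

text \<open>From \<open>z = D / w\<close> follows \<open>dz = - (D - w D') / w^2 dw\<close>; this is
  the origin of the combination in \<open>infcoef\<close>.\<close>

lemma inf_residue:
  fixes c D :: "complex fps"
  assumes D: "inverse (fps_to_fls c) = fls_X_inv * fps_to_fls D" "D $ 0 \<noteq> 0" and a: "a \<le> k + 1"
  shows "(fps_to_fls c ^ a * fls_X_inv ^ k * fls_deriv (inverse (fps_to_fls c))) $$ (-1) = - infcoef D k a"
proof -
  have c: "fps_to_fls c = fls_X * fps_to_fls (inverse D)"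
  proof -
    have "fps_to_fls c = inverse (fls_X_inv * fps_to_fls D)" using D(1) by (metis inverse_inverse_eq)
    also have "\<dots> = fls_X * fps_to_fls (inverse D)"
      using D(2) by (simp add: fls_inverse_X_inv fls_inverse_fps_to_fls)
    finally show ?thesis .
  qed
  have d: "fls_deriv (inverse (fps_to_fls c)) = - (fls_X_inv ^ 2 * fps_to_fls (D - fps_X * fps_deriv D))"
  proof -
    have "fls_X_inv * fls_X = (1 :: complex fls)" by (simp flip: fls_inverse_X)
    then have x: "fls_X_inv ^ 2 * (fls_X * G) = fls_X_inv * G" for G :: "complex fls"
      by (simp add: power2_eq_square mult.assoc)
    have "fps_to_fls (D - fps_X * fps_deriv D) = fps_to_fls D - fls_X * fls_deriv (fps_to_fls D)"
      by (simp add: fls_times_fps_to_fls fls_deriv_fps_to_fls)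
    then show ?thesis unfolding D(1) by (simp add: right_diff_distrib x)
  qed
  have "fps_to_fls c ^ a * fls_X_inv ^ k * fls_deriv (inverse (fps_to_fls c)) =
      - (fls_X ^ a * fls_X_inv ^ (k + 2) * fps_to_fls (inverse D ^ a * (D - fps_X * fps_deriv D)))"
    unfolding d unfolding c by (simp add: power_mult_distrib fls_times_fps_to_fls fps_to_fls_power power_add power2_eq_square mult_ac)
  also have "fls_X ^ a * fls_X_inv ^ (k + 2) = (fls_X_inv ^ (k + 2 - a) :: complex fls)"
  proof -
    have "fls_X ^ a * fls_X_inv ^ a = (1 :: complex fls)" by (simp flip: fls_inverse_X_power)
    moreover have "fls_X_inv ^ (k + 2) = (fls_X_inv ^ a * fls_X_inv ^ (k + 2 - a) :: complex fls)"
      using a by (simp flip: power_add)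
    ultimately show ?thesis by (simp add: mult.assoc[symmetric])
  qed
  moreover have "nat (1 + (int k - int a)) = Suc k - a" using a by linarith
  ultimately show ?thesis
    using a by (simp add: fls_X_inv_power_times_conv_shift infcoef_def of_nat_diff)
qed

lemma root_coeff_inf:
  fixes c D :: "complex fps"
  assumes c: "c $ 0 = 0" "c $ 1 \<noteq> 0" "fls_compose_fps F c = fls_X_inv"
    and D: "inverse (fps_to_fls c) = fls_X_inv * fps_to_fls D" "D $ 0 \<noteq> 0" and a: "a \<le> k + 1"
  shows "(F ^ k) $$ (1 - int a) = infcoef D k a"
proof -
  have [simp]: "c \<noteq> 0" using c(2) by auto
  have "(F ^ k) $$ (1 - int a) = - ((fls_X ^ a * F ^ k * fls_deriv fls_X_inv) $$ (-1))"
    by (simp add: fls_X_power_times_conv_shift fls_X_inv_power_times_conv_shift)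
  also have "(fls_X ^ a * F ^ k * fls_deriv fls_X_inv) $$ (-1) =
      (fps_to_fls c ^ a * fls_X_inv ^ k * fls_deriv (inverse (fps_to_fls c))) $$ (-1)"
    using c by (subst residue_compose_inf[OF c(1,2)]) (auto simp: fls_compose_fps_power fls_compose_fps_mult)
  finally show ?thesis by (simp add: inf_residue[OF D a])
qed

declare fls_divide_X [simp del] fls_divide_X_power [simp del]

subsection \<open>The parameters as functions of the flat coordinates\<close>

text \<open>The closed form that Lagrange inversion gives for the inverse of the flat coordinate
  map. It is single-valued, although the flat coordinates are not.\<close>

definition vcoord :: "(nat \<Rightarrow> nat) \<Rightarrow> point \<Rightarrow> nat \<times> nat \<Rightarrow> complex" where
  "vcoord k t x = (case x of (i, a) \<Rightarrow>
     if i = 0 then infcoef (dser k t) (k 0) a / of_nat (k 0)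
     else if a = 0 then t (i, 0) else of_nat (k i) / of_nat a * (cser k t i ^ a) $ k i)"

definition hpoint :: "nat \<Rightarrow> (nat \<Rightarrow> nat) \<Rightarrow> point \<Rightarrow> point" where
  "hpoint N k t x = (if x \<in> idx N k then vcoord k t x else 0)"

definition Lamf :: "(complex \<Rightarrow> 'f::field) \<Rightarrow> nat \<Rightarrow> (nat \<Rightarrow> nat) \<Rightarrow> point \<Rightarrow> 'f \<Rightarrow> 'f" where
  "Lamf \<iota> N k v z = \<iota> (1 / of_nat (k 0)) * z ^ k 0 + (\<Sum>a = 1..<k 0. \<iota> (v (0, a)) * z ^ (a - 1))
     + (\<Sum>i = 1..N. \<Sum>a = 1..k i. \<iota> (v (i, a)) * inverse ((z - \<iota> (v (i, 0))) ^ a))"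

lemma lam_eq_Lamf: "lam N k v z = Lamf (\<lambda>x. x) N k v z"
  by (simp add: lam_def Lamf_def divide_inverse mult.commute)

lemma lam_laurent:
  assumes "g has_laurent_expansion Z"
  shows "(\<lambda>w. lam N k v (g w)) has_laurent_expansion Lamf fls_const N k v Z"
  unfolding lam_eq_Lamf Lamf_def by (intro laurent_expansion_intros assms)

lemma hurwitz_neq: "v \<in> hurwitz N k \<Longrightarrow> i \<in> {1..N} \<Longrightarrow> j \<in> {1..N} \<Longrightarrow> i \<noteq> j \<Longrightarrow> v (i, 0) \<noteq> v (j, 0)"
  unfolding hurwitz_def inj_on_def by blast

lemma Lamf_near:
  assumes v: "v \<in> hurwitz N k" and i: "i \<in> {1..N}" and R: "ord_ge 0 R" "R $$ 0 = 0"
  shows "ord_ge 0 (Lamf fls_const N k v (fls_const (v (i, 0)) + R) - (\<Sum>a=1..k i. fls_const (v (i, a)) * inverse (R ^ a)))"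
proof -
  let ?Z = "fls_const (v (i, 0)) + R"
  have Z: "ord_ge 0 ?Z" using R by (intro ord_ge_add) auto
  define T where "T = (\<lambda>j. \<Sum>a = 1..k j. fls_const (v (j, a)) * inverse ((?Z - fls_const (v (j, 0))) ^ a))"
  have "Lamf fls_const N k v ?Z - T i = fls_const (1 / of_nat (k 0)) * ?Z ^ k 0 +
     (\<Sum>a = 1..<k 0. fls_const (v (0, a)) * ?Z ^ (a - 1)) + (\<Sum>j\<in>{1..N} - {i}. T j)"
    unfolding Lamf_def T_def[symmetric] by (subst sum.remove[OF _ i]) simp_all
  moreover have "ord_ge 0 \<dots>"
  proof (intro ord_ge_add ord_ge_sum ord_ge_const_mult ord_ge_power[OF Z])
    fix j assume j: "j \<in> {1..N} - {i}"
    show "ord_ge 0 (T j)"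
      unfolding T_def using hurwitz_neq[OF v i, of j] j R
      by (intro ord_ge_sum ord_ge_const_mult ord_ge_inverse_regular) auto
  qed auto
  moreover have "T i = (\<Sum>a=1..k i. fls_const (v (i, a)) * inverse (R ^ a))" by (simp add: T_def)
  ultimately show ?thesis by simp
qed

lemma Lamf_inf:
  assumes c: "c $ 0 = 0" "c $ 1 \<noteq> 0"
  defines "Z \<equiv> inverse (fps_to_fls c)"
  shows "ord_ge 1 (Lamf fls_const N k v Z - (fls_const (1 / of_nat (k 0)) * Z ^ k 0 + (\<Sum>a = 1..<k 0. fls_const (v (0, a)) * Z ^ (a - 1))))"
  unfolding Lamf_def Z_def
  by (simp, intro ord_ge_sum ord_ge_const_mult ord_ge_inverse_at_inf c) auto

lemma lam_pole:
  assumes v: "v \<in> hurwitz N k" and i: "i \<in> {1..N}" and k: "k i \<ge> 1" and p: "p = v (i, 0)"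
  obtains U where "fps_to_fls U = fls_X ^ k i * Lamf fls_const N k v (fls_const p + fls_X)"
    "U $ 0 = v (i, k i)" "U $ 0 \<noteq> 0"
    "(\<lambda>x. if x = 0 then U $ 0 else x ^ k i * lam N k v (p + x)) has_fps_expansion U"
    "\<And>a. a \<in> {1..k i} \<Longrightarrow> Lamf fls_const N k v (fls_const p + fls_X) $$ (- int a) = v (i, a)"
proof -
  define F where "F = Lamf fls_const N k v (fls_const p + fls_X)"
  define S where "S = (\<Sum>a=1..k i. fls_const (v (i, a)) * inverse (fls_X ^ a))"
  have R: "ord_ge 0 (F - S)"
    unfolding F_def S_def p by (rule Lamf_near[OF v i]) (auto simp: ord_ge_def)
  have S: "S $$ n = (if - int (k i) \<le> n \<and> n < 0 then v (i, nat (- n)) else 0)" for n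
  proof -
    have "S $$ n = (\<Sum>a=1..k i. if a = nat (- n) \<and> n < 0 then v (i, a) else 0)"
      unfolding S_def fls_nth_sum by (intro sum.cong) (auto simp: fls_inverse_X_power)
    also have "\<dots> = (if n < 0 then (\<Sum>a=1..k i. if a = nat (- n) then v (i, a) else 0) else 0)" by auto
    also have "\<dots> = (if - int (k i) \<le> n \<and> n < 0 then v (i, nat (- n)) else 0)" by auto
    finally show ?thesis .
  qed
  have Fn: "F $$ n = S $$ n" if "n < 0" for n using R that by (simp add: ord_ge_def)
  have o: "ord_ge 0 (fls_X ^ k i * F)"
    using Fn S by (auto simp: ord_ge_def fls_X_power_times_conv_shift)
  define U where "U = fls_regpart (fls_X ^ k i * F)"
  have U: "fps_to_fls U = fls_X ^ k i * F" unfolding U_def by (rule ord_ge_regpart[OF o])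
  have U0: "U $ 0 = v (i, k i)"
    using Fn[of "- int (k i)"] S[of "- int (k i)"] k by (simp add: U_def fls_X_power_times_conv_shift)
  have "(\<lambda>x. x ^ k i * lam N k v (p + x)) has_laurent_expansion fps_to_fls U"
    unfolding U F_def by (intro laurent_expansion_intros lam_laurent)
  from has_fps_expansion_fps_to_fls[OF this]
  have "(\<lambda>x. if x = 0 then U $ 0 else x ^ k i * lam N k v (p + x)) has_fps_expansion U" .
  moreover have "F $$ (- int a) = v (i, a)" if "a \<in> {1..k i}" for a
    using that Fn[of "- int a"] S[of "- int a"] by auto
  ultimately show ?thesis using that[of U] U U0 v i by (auto simp: F_def hurwitz_def)
qed

section \<open>Inverting the flat coordinates: finite poles\<close>

lemma vcoord_pos: "i \<noteq> 0 \<Longrightarrow> a \<noteq> 0 \<Longrightarrow> vcoord k t (i, a) = of_nat (k i) / of_nat a * (cser k t i ^ a) $ k i"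
  by (simp add: vcoord_def)

lemma hpoint_pos: "i \<in> {1..N} \<Longrightarrow> a \<in> {1..k i} \<Longrightarrow> hpoint N k t (i, a) = of_nat (k i) / of_nat a * (cser k t i ^ a) $ k i"
  by (simp add: hpoint_def idx_iff vcoord_pos)

lemma hpoint_pole: "i \<in> {1..N} \<Longrightarrow> hpoint N k t (i, 0) = t (i, 0)"
  by (simp add: hpoint_def idx_iff vcoord_def)

lemma hpoint_inf: "a \<in> {1..<k 0} \<Longrightarrow> hpoint N k t (0, a) = infcoef (dser k t) (k 0) a / of_nat (k 0)"
  by (simp add: hpoint_def idx_iff vcoord_def)

lemma hpoint_hurwitz:
  assumes t: "t \<in> hdom N k" and ki: "\<forall>i\<in>{1..N}. k i \<ge> 1"
  shows "hpoint N k t \<in> hurwitz N k"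
proof -
  have "hpoint N k t (i, k i) \<noteq> 0" if i: "i \<in> {1..N}" for i
  proof -
    have k: "k i \<ge> 1" using ki i by blast
    then have "hpoint N k t (i, k i) = (cser k t i $ 1) ^ k i"
      using i by (subst hpoint_pos) (auto simp: startsby_zero_power_nth_same)
    moreover have "cser k t i $ 1 \<noteq> 0" using cser_nz(2)[of k i t, OF k] t i by (auto simp: hdom_def)
    ultimately show ?thesis by simp
  qed
  moreover have "inj_on (\<lambda>i. hpoint N k t (i, 0)) {1..N} \<longleftrightarrow> inj_on (\<lambda>i. t (i, 0)) {1..N}"
    by (rule inj_on_cong) (rule hpoint_pole)
  then have "inj_on (\<lambda>i. hpoint N k t (i, 0)) {1..N}" using t by (simp add: hdom_def)
  moreover have "hpoint N k t x = 0" if "x \<notin> idx N k" for x using that by (simp add: hpoint_def)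
  ultimately show ?thesis unfolding hurwitz_def by blast
qed

text \<open>\<open>cser\<close> is only a truncation of the true inverse of the root, but along it
  \<open>\<lambda>\<close> and \<open>w^(-k)\<close> have the same principal part. So the root is
  \<open>(1 + O(w^k)) / w\<close>, and the error does not reach the residues that define the flat
  coordinates.\<close>

lemma flat_exists_pole:
  assumes t: "t \<in> hdom N k" and ki: "\<forall>i\<in>{1..N}. k i \<ge> 1" and i: "i \<in> {1..N}"
  shows "\<exists>\<zeta> r. r > 0 \<and> \<zeta> holomorphic_on (ball (t (i, 0)) r - {t (i, 0)}) \<and>
           (\<forall>z\<in>ball (t (i, 0)) r - {t (i, 0)}. \<zeta> z ^ k i = lam N k (hpoint N k t) z) \<and>
           (\<forall>\<alpha>\<in>{2..k i}. t (i, \<alpha>) = of_nat (k i) / of_nat (k i - \<alpha> + 1) *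
              residue (\<lambda>z. \<zeta> z ^ (k i - \<alpha> + 1)) (t (i, 0)))"
proof -
  let ?v = "hpoint N k t" and ?p = "t (i, 0)" and ?c = "cser k t i" and ?C = "cls k t i"
  have k: "k i \<ge> 1" using ki i by blast
  note v = hpoint_hurwitz[OF t ki]
  have c: "?c $ 0 = 0" "?c $ 1 \<noteq> 0" "?c \<noteq> 0" using cser_nz[of k i t] k t i by (auto simp: hdom_def)
  have Cd: "fls_subdegree ?C = 1" "?C \<noteq> 0" using subdegree_fls_eq_1[OF c(1,2)] c(3) by auto
  obtain U where U: "fps_to_fls U = fls_X ^ k i * Lamf fls_const N k ?v (fls_const ?p + fls_X)"
    "U $ 0 = ?v (i, k i)" "U $ 0 \<noteq> 0"
    "(\<lambda>x. if x = 0 then U $ 0 else x ^ k i * lam N k ?v (?p + x)) has_fps_expansion U"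
    by (rule lam_pole[OF v i k, of ?p]) (use hpoint_pole[OF i] in auto)
  \<comment> \<open>Among the \<open>k i\<close> roots the one with leading coefficient
    \<open>cser k t i $ 1\<close> is taken; another root would belong to another value of the
    multivalued flat coordinates.\<close>
  have r0: "(?c $ 1) ^ k i = U $ 0"
    using U(2) i k by (simp add: hpoint_pos startsby_zero_power_nth_same)
  obtain \<phi> P \<rho> where \<phi>: "\<rho> > 0" "\<phi> holomorphic_on ball 0 \<rho>"
    "\<And>x. x \<in> ball 0 \<rho> \<Longrightarrow> \<phi> x ^ k i = (if x = 0 then U $ 0 else x ^ k i * lam N k ?v (?p + x))"
    "\<phi> has_fps_expansion P" "P $ 0 = ?c $ 1" "P ^ k i = U"
    by (rule local_root[OF U(4,3) k r0]) blast
  define \<zeta> where "\<zeta> = (\<lambda>z. \<phi> (z - ?p) / (z - ?p))"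
  have "\<zeta> holomorphic_on (ball ?p \<rho> - {?p})"
    unfolding \<zeta>_def
    by (intro holomorphic_intros holomorphic_on_compose_gen[OF _ \<phi>(2), of "\<lambda>z. z - ?p", unfolded o_def])
       (auto simp: dist_norm norm_minus_commute)
  moreover have "\<zeta> z ^ k i = lam N k ?v z" if "z \<in> ball ?p \<rho> - {?p}" for z
    using \<phi>(3)[of "z - ?p"] that by (simp add: \<zeta>_def power_divide dist_norm norm_minus_commute)
  moreover have "t (i, \<alpha>) = of_nat (k i) / of_nat (k i - \<alpha> + 1) * residue (\<lambda>z. \<zeta> z ^ (k i - \<alpha> + 1)) ?p"
    if \<alpha>: "\<alpha> \<in> {2..k i}" for \<alpha>
  proof -
    define m where "m = k i - \<alpha> + 1"
    have m: "1 \<le> m" "m \<le> k i" "k i + 1 - m = \<alpha>" using \<alpha> by (auto simp: m_def)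
    define F where "F = fps_to_fls P / fls_X"
    have "(\<lambda>x. \<zeta> (?p + x) ^ m) has_laurent_expansion F ^ m"
      unfolding \<zeta>_def F_def by (simp del: fls_divide_X, intro laurent_expansion_intros has_laurent_expansion_fps \<phi>(4))
    then have res: "residue (\<lambda>z. \<zeta> z ^ m) ?p = (F ^ m) $$ (-1)"
      using has_laurent_expansion_residue[of "\<lambda>z. \<zeta> z ^ m" ?p] by simp
    \<comment> \<open>\<open>Q\<close> is \<open>w\<close> times the root, expressed in
      \<open>w\<close>; the aim is \<open>Q = 1 + O(w^k)\<close>.\<close>
    define Q where "Q = fls_compose_fps F ?c * fls_X"
    have FQ: "fls_compose_fps F ?c = Q * fls_X_inv"
      by (simp add: Q_def mult.assoc flip: fls_inverse_X)
    have Fc: "fls_compose_fps F ?c = fps_to_fls (P oo ?c) / ?C"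
      unfolding F_def by (subst fls_compose_fps_divide) (use c in auto)
    define E where "E = Lamf fls_const N k ?v (fls_const ?p + ?C) - fls_X_inv ^ k i"
    have E: "ord_ge 0 E"
    proof -
      have "ord_ge (- int (k i)) (fls_X_inv ^ k i :: complex fls)" by (simp add: ord_ge_def)
      from principal_part_in_parameter[OF c(1,2) this]
      have "ord_ge 0 (fls_X_inv ^ k i - (\<Sum>a=1..k i. fls_const ((?C ^ (a - 1) * fls_deriv ?C * fls_X_inv ^ k i) $$ (-1)) * inverse (?C ^ a)))" .
      also have "(\<Sum>a=1..k i. fls_const ((?C ^ (a - 1) * fls_deriv ?C * fls_X_inv ^ k i) $$ (-1)) * inverse (?C ^ a))
         = (\<Sum>a=1..k i. fls_const (?v (i, a)) * inverse (?C ^ a))"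
      proof (intro sum.cong refl)
        fix a assume a: "a \<in> {1..k i}"
        have eq: "?C ^ (a - 1) * fls_deriv ?C * fls_X_inv ^ k i = ?C ^ (a - 1) * fls_X_inv ^ k i * fls_deriv ?C" by (simp only: mult_ac)
        have "(?C ^ (a - 1) * fls_deriv ?C * fls_X_inv ^ k i) $$ (-1) = ?v (i, a)"
          unfolding eq using power_deriv_nth[OF k, of a ?c] hpoint_pos[of i N a k t, OF i a] a by simp
        then show "fls_const ((?C ^ (a - 1) * fls_deriv ?C * fls_X_inv ^ k i) $$ (-1)) * inverse (?C ^ a) =
          fls_const (?v (i, a)) * inverse (?C ^ a)" by simp
      qed
      finally have 1: "ord_ge 0 (fls_X_inv ^ k i - (\<Sum>a=1..k i. fls_const (?v (i, a)) * inverse (?C ^ a)))" .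
      have 2: "ord_ge 0 (Lamf fls_const N k ?v (fls_const ?p + ?C) - (\<Sum>a=1..k i. fls_const (?v (i, a)) * inverse (?C ^ a)))"
        using Lamf_near[OF v i, of ?C] hpoint_pole[OF i, of k t] by simp
      from ord_ge_diff[OF 2 1] show ?thesis by (simp add: E_def)
    qed
    have Lc: "fls_compose_fps (Lamf fls_const N k ?v (fls_const ?p + fls_X)) ?c = Lamf fls_const N k ?v (fls_const ?p + ?C)"
      using c by (simp add: Lamf_def fls_compose_fps_add fls_compose_fps_mult fls_compose_fps_power fls_compose_fps_sum
          fls_compose_fps_inverse fls_compose_fps_diff)
    have "F ^ k i = Lamf fls_const N k ?v (fls_const ?p + fls_X)"
    proof -
      have "F ^ k i = fps_to_fls U / fls_X ^ k i" by (simp only: F_def power_divide \<phi>(6) fps_to_fls_power[symmetric])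
      then show ?thesis by (simp add: U(1))
    qed
    then have "fls_compose_fps F ?c ^ k i = Lamf fls_const N k ?v (fls_const ?p + ?C)"
      using c Lc by (simp flip: fls_compose_fps_power)
    then have "Q ^ k i = (fls_X_inv ^ k i + E) * fls_X ^ k i"
      by (simp add: Q_def power_mult_distrib E_def)
    also have "\<dots> = 1 + E * fls_X ^ k i" by (simp add: distrib_right flip: fls_inverse_X_power)
    finally have "ord_ge (int (k i)) (Q ^ k i - 1)"
      using ord_ge_mult[OF E, of "int (k i)" "fls_X ^ k i" "int (k i)"] by (simp add: ord_ge_def)
    moreover have Q0: "ord_ge 0 Q \<and> Q $$ 0 = 1"
    proof -
      have "Q * ?C = fps_to_fls (P oo ?c) * fls_X" using Cd by (simp add: Q_def Fc)
      moreover have "?C = fls_X * fps_to_fls (fps_shift 1 ?c)"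
        by (rule fls_eqI) (auto simp: fls_X_times_conv_shift nat_diff_distrib not_less not_le intro!: arg_cong[of _ _ "fps_nth _"])
      ultimately have e: "Q * fps_to_fls (fps_shift 1 ?c) = fps_to_fls (P oo ?c)" by (simp add: mult_ac)
      have s: "fps_shift 1 ?c $ 0 \<noteq> 0" using c by simp
      then have nz: "fps_to_fls (fps_shift 1 ?c) \<noteq> 0" by (metis fps_to_fls_eq_0_iff fps_zero_nth)
      have "Q = Q * fps_to_fls (fps_shift 1 ?c) * inverse (fps_to_fls (fps_shift 1 ?c))" using nz by simp
      also have "\<dots> = fps_to_fls (P oo ?c) * fps_to_fls (inverse (fps_shift 1 ?c))"
        unfolding e using s by (simp add: fls_inverse_fps_to_fls)
      finally have "Q = fps_to_fls (P oo ?c) * fps_to_fls (inverse (fps_shift 1 ?c))" .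
      then have "Q = fps_to_fls ((P oo ?c) * inverse (fps_shift 1 ?c))" by (simp add: fls_times_fps_to_fls)
      then show ?thesis using s \<phi>(5) by (simp add: fps_compose_nth)
    qed
    ultimately have Q: "ord_ge (int (k i)) (Q - 1)" using ord_ge_of_power[of Q "k i"] k by blast
    have "ord_ge (int (k i)) (Q ^ m - 1)"
    proof -
      have "Q ^ m - 1 = (Q - 1) * (\<Sum>j<m. Q ^ j)" using power_diff_1_eq[of Q m] by simp
      moreover have "ord_ge 0 (\<Sum>j<m. Q ^ j)" using Q0 by (intro ord_ge_sum ord_ge_power[of 0]) auto
      ultimately show ?thesis using ord_ge_mult[OF Q, of 0] by simp
    qed
    then have "ord_ge 0 ((Q ^ m - 1) * (fls_X_inv ^ m * fls_deriv ?C))"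
    proof (rule ord_ge_mult)
      show "ord_ge (- int m) (fls_X_inv ^ m * fls_deriv ?C)"
        by (intro ord_ge_mult[of "- int m" _ 0] ord_ge_deriv0) (auto simp: ord_ge_def)
    qed (use m in auto)
    then have z: "((Q ^ m - 1) * (fls_X_inv ^ m * fls_deriv ?C)) $$ (-1) = 0" by (simp add: ord_ge_def)
    have "(F ^ m) $$ (-1) = (Q ^ m * fls_X_inv ^ m * fls_deriv ?C) $$ (-1)"
      using c by (subst residue_compose[OF c(1,2), symmetric]) (simp add: fls_compose_fps_power FQ power_mult_distrib)
    also have "\<dots> = (fls_X_inv ^ m * fls_deriv ?C) $$ (-1)"
      using z by (simp add: left_diff_distrib mult.assoc)
    also have "\<dots> = of_nat m * ?c $ m" using X_inv_deriv_nth[OF m(1), of ?C] by simp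
    finally have "residue (\<lambda>z. \<zeta> z ^ m) ?p = of_nat m * (t (i, \<alpha>) / of_nat (k i))"
      using m by (simp add: res cser_def)
    then show ?thesis using k m unfolding m_def[symmetric] by simp
  qed
  ultimately show ?thesis using \<phi>(1) by blast
qed

text \<open>The inverse \<open>c\<close> of any admissible root agrees with \<open>cser\<close> up
  to order \<open>k i\<close>, because its coefficients are the residues defining \<open>t\<close>;
  Lagrange inversion then returns \<open>v\<close>. The coefficient of order \<open>k i\<close> is
  not given by a residue but by \<open>t (i, 1) = v (i, 1)\<close>.\<close>

lemma flat_unique_pole:
  assumes v: "v \<in> hurwitz N k" and i: "i \<in> {1..N}" and k: "k i \<ge> 1"
    and t01: "t (i, 0) = v (i, 0)" "t (i, 1) = v (i, 1)"
    and \<zeta>: "r > 0" "\<zeta> holomorphic_on (ball (v (i, 0)) r - {v (i, 0)})"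
      "\<And>z. z \<in> ball (v (i, 0)) r - {v (i, 0)} \<Longrightarrow> \<zeta> z ^ k i = lam N k v z"
      "\<And>\<alpha>. \<alpha> \<in> {2..k i} \<Longrightarrow> t (i, \<alpha>) = of_nat (k i) / of_nat (k i - \<alpha> + 1) * residue (\<lambda>z. \<zeta> z ^ (k i - \<alpha> + 1)) (v (i, 0))"
  shows "t (i, k i) \<noteq> 0 \<and> (\<forall>a\<in>{1..k i}. v (i, a) = of_nat (k i) / of_nat a * (cser k t i ^ a) $ k i)"
proof -
  let ?p = "v (i, 0)"
  obtain U where U: "fps_to_fls U = fls_X ^ k i * Lamf fls_const N k v (fls_const ?p + fls_X)"
    "U $ 0 \<noteq> 0" "(\<lambda>x. if x = 0 then U $ 0 else x ^ k i * lam N k v (?p + x)) has_fps_expansion U"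
    "\<And>a. a \<in> {1..k i} \<Longrightarrow> Lamf fls_const N k v (fls_const ?p + fls_X) $$ (- int a) = v (i, a)"
    by (rule lam_pole[OF v i k refl]) blast
  obtain P where P: "P ^ k i = U" "(\<lambda>x. \<zeta> (?p + x)) has_laurent_expansion (fps_to_fls P / fls_X)"
  proof (rule local_root_unique[OF U(3,2) k \<zeta>(1)])
    have "continuous_on (ball ?p r - {?p}) \<zeta>" using \<zeta>(2) by (rule holomorphic_on_imp_continuous_on)
    then show "continuous_on (ball 0 r - {0}) (\<lambda>x. \<zeta> (?p + x))"
      by (rule continuous_on_compose2) (auto intro!: continuous_intros simp: dist_norm)
    show "(x * \<zeta> (?p + x)) ^ k i = (if x = 0 then U $ 0 else x ^ k i * lam N k v (?p + x))" if "x \<in> ball 0 r - {0}" for x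
      using \<zeta>(3)[of "?p + x"] that by (simp add: power_mult_distrib dist_norm)
  qed blast
  have P0: "P $ 0 \<noteq> 0" using P(1) U(2) k by (auto simp: fps_power_zeroth power_0_left)
  define F where "F = fps_to_fls P / fls_X"
  obtain c where c: "c $ 0 = 0" "c $ 1 \<noteq> 0" "fls_compose_fps F c = fls_X_inv"
    unfolding F_def by (rule root_parameter[OF P0]) blast
  have "F ^ k i = Lamf fls_const N k v (fls_const ?p + fls_X)"
  proof -
    have "F ^ k i = fps_to_fls U / fls_X ^ k i" by (simp only: F_def power_divide P(1) fps_to_fls_power[symmetric])
    then show ?thesis by (simp add: U(1))
  qed
  then have va: "v (i, a) = of_nat (k i) / of_nat a * (c ^ a) $ k i" if "a \<in> {1..k i}" for a
    using root_coeff[OF c k, of a] U(4)[OF that] that by simp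
  have tc: "t (i, \<alpha>) = of_nat (k i) * c $ (k i + 1 - \<alpha>)" if \<alpha>: "\<alpha> \<in> {1..k i}" for \<alpha>
  proof (cases "\<alpha> = 1")
    case True
    then show ?thesis using va[of 1] k t01 by simp
  next
    case False
    have "(\<lambda>x. \<zeta> (?p + x) ^ (k i - \<alpha> + 1)) has_laurent_expansion F ^ (k i - \<alpha> + 1)"
      unfolding F_def by (intro laurent_expansion_intros P(2))
    then have "residue (\<lambda>z. \<zeta> z ^ (k i - \<alpha> + 1)) ?p = (F ^ (k i - \<alpha> + 1)) $$ (-1)"
      using has_laurent_expansion_residue[of "\<lambda>z. \<zeta> z ^ (k i - \<alpha> + 1)" ?p] by simp
    also have "\<dots> = of_nat (k i - \<alpha> + 1) * c $ (k i - \<alpha> + 1)"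
      by (rule root_residue[OF c]) simp
    finally show ?thesis using \<zeta>(4)[of \<alpha>] False \<alpha> by (simp del: of_nat_Suc add: Suc_diff_le)
  qed
  have "agree (k i) (cser k t i) c"
    unfolding agree_def
  proof (intro allI impI)
    fix j assume "j \<le> k i"
    then show "cser k t i $ j = c $ j"
    proof (cases "j = 0")
      case False
      then have "k i + 1 - j \<in> {1..k i}" using \<open>j \<le> k i\<close> by auto
      from tc[OF this] show ?thesis using \<open>j \<le> k i\<close> False k by (simp add: cser_def)
    qed (simp add: c(1))
  qed
  then have "(cser k t i ^ a) $ k i = (c ^ a) $ k i" for a
    using agree_power by (simp add: agree_def)
  then show ?thesis using va tc[of "k i"] c(2) k by auto
qed

section \<open>Inverting the flat coordinates: infinity\<close>

lemma residue_inf_laurent: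
  assumes "(\<lambda>w. f (1 / w)) has_laurent_expansion F"
  shows "residue_inf f = (F * fls_deriv fls_X_inv) $$ (-1)"
proof -
  have "(\<lambda>w. f (1 / w) / w\<^sup>2) has_laurent_expansion F / fls_X ^ 2"
    by (intro laurent_expansion_intros assms)
  from has_laurent_expansion_residue_0[OF this] show ?thesis
    by (simp add: residue_inf_def divide_inverse fls_inverse_X_power flip: fls_inverse_X_power)
qed

lemma fps_power_nth_1: "P $ 0 = 1 \<Longrightarrow> (P ^ n) $ 1 = of_nat n * (P :: 'a::comm_ring_1 fps) $ 1"
  by (induction n) (simp_all add: fps_mult_nth_1 fps_power_zeroth algebra_simps)

text \<open>\<open>U $ 1 = 0\<close> holds because \<open>\<lambda>\<close> has no term in
  \<open>z^(k 0 - 1)\<close>; this is what allows a root of the form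
  \<open>z + O(1 / z)\<close>.\<close>

lemma lam_inf:
  assumes k0: "k 0 \<ge> 2"
  obtains U where "fps_to_fls U = fls_const (of_nat (k 0)) * fls_X ^ k 0 * Lamf fls_const N k v fls_X_inv"
    "U $ 0 = 1" "U $ 1 = 0"
    "(\<lambda>w. if w = 0 then 1 else of_nat (k 0) * w ^ k 0 * lam N k v (1 / w)) has_fps_expansion U"
    "\<And>a. a \<in> {1..<k 0} \<Longrightarrow> Lamf fls_const N k v fls_X_inv $$ (1 - int a) = v (0, a)"
proof -
  define F where "F = Lamf fls_const N k v fls_X_inv"
  define S where "S = fls_const (1 / of_nat (k 0)) * fls_X_inv ^ k 0 + (\<Sum>a = 1..<k 0. fls_const (v (0, a)) * fls_X_inv ^ (a - 1))"
  have R: "ord_ge 1 (F - S)"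
    using Lamf_inf[of fps_X N k v] by (simp add: F_def S_def fls_inverse_X)
  have S: "S $$ n = (if n = - int (k 0) then 1 / of_nat (k 0) else 0) + (if n \<le> 0 \<and> n > 1 - int (k 0) then v (0, nat (1 - n)) else 0)" for n
  proof -
    have "(\<Sum>a = 1..<k 0. fls_const (v (0, a)) * fls_X_inv ^ (a - 1)) $$ n = (\<Sum>a=1..<k 0. if a = nat (1 - n) \<and> n \<le> 0 then v (0, a) else 0)"
      unfolding fls_nth_sum by (intro sum.cong) (auto simp: of_nat_diff)
    also have "\<dots> = (if n \<le> 0 then (\<Sum>a=1..<k 0. if a = nat (1 - n) then v (0, a) else 0) else 0)" by auto
    also have "\<dots> = (if n \<le> 0 \<and> n > 1 - int (k 0) then v (0, nat (1 - n)) else 0)" by auto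
    finally show ?thesis unfolding S_def by simp
  qed
  have Fn: "F $$ n = S $$ n" if "n < 1" for n using R that by (simp add: ord_ge_def)
  let ?G = "fls_const (of_nat (k 0)) * fls_X ^ k 0 * F"
  have Gn: "?G $$ n = of_nat (k 0) * F $$ (n - int (k 0))" for n
  proof -
    have "(fls_X ^ k 0 * F) $$ n = F $$ (n - int (k 0))" by (simp add: fls_X_power_times_conv_shift(1))
    then show ?thesis by (simp only: mult.assoc fls_mult_const_nth)
  qed
  have o: "ord_ge 0 ?G"
    unfolding ord_ge_def Gn using Fn S by auto
  define U where "U = fls_regpart ?G"
  have U: "fps_to_fls U = ?G" unfolding U_def by (rule ord_ge_regpart[OF o])
  have Un: "U $ n = of_nat (k 0) * F $$ (int n - int (k 0))" for n
    unfolding U_def fls_regpart_nth Gn ..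
  have U0: "U $ 0 = 1" using k0 by (simp add: Un Fn S)
  have U1: "U $ 1 = 0" using k0 by (simp add: Un Fn S)
  have "(\<lambda>w. of_nat (k 0) * w ^ k 0 * lam N k v (inverse w)) has_laurent_expansion fps_to_fls U"
    unfolding U F_def fls_X_power_conv_shift_1
    by (intro laurent_expansion_intros lam_laurent has_laurent_expansion_fls_X_inv[unfolded fun_eq_iff])
  from has_fps_expansion_fps_to_fls[OF this]
  have "(\<lambda>w. if w = 0 then 1 else of_nat (k 0) * w ^ k 0 * lam N k v (1 / w)) has_fps_expansion U"
    by (simp only: U0 inverse_eq_divide)
  moreover have "F $$ (1 - int a) = v (0, a)" if "a \<in> {1..<k 0}" for a
    using that by (simp add: Fn S)
  ultimately show ?thesis using that[of U] U U0 U1 by (auto simp: F_def)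
qed

lemma inverse_infls: "inverse (infls k t) = fls_X_inv * fps_to_fls (dser k t)"
proof -
  have "infls k t = fls_X * fps_to_fls (gser k t)"
    by (simp add: infser_def fls_times_fps_to_fls)
  moreover have "fps_to_fls (gser k t) = inverse (fps_to_fls (dser k t))" by (simp add: fls_inverse_fps_to_fls)
  ultimately show ?thesis by (simp add: fls_inverse_X)
qed

lemma Lamf_principal_inf:
  assumes k0: "k 0 \<ge> 2"
  shows "ord_ge 1 (Lamf fls_const N k (hpoint N k t) (inverse (infls k t)) - fls_const (1 / of_nat (k 0)) * fls_X_inv ^ k 0)"
proof -
  let ?v = "hpoint N k t" and ?C = "infls k t" and ?\<kappa> = "fls_const (1 / of_nat (k 0)) :: complex fls"
  have C: "?C \<noteq> 0" "fls_subdegree ?C = 1" "ord_ge 1 ?C"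
    using subdegree_fls_eq_1[of "infser k t"] by (auto simp: ord_ge_iff)
  \<comment> \<open>The extra factor \<open>1 / C\<close> shifts the exponents so that the constant
    term of a polynomial in \<open>z = 1 / C\<close> counts as polar; multiplication by
    \<open>C\<close> at the end undoes it.\<close>
  define G where "G = ?\<kappa> * fls_X_inv ^ k 0 * inverse ?C"
  define g where "g = (\<lambda>a. (?C ^ (a - 1) * fls_deriv ?C * G) $$ (-1))"
  have "ord_ge (- int (k 0)) (?\<kappa> * fls_X_inv ^ k 0)" by (simp add: ord_ge_def)
  moreover have "ord_ge (-1) (inverse ?C)" using C by (simp add: ord_ge_iff)
  ultimately have "ord_ge (- int (k 0 + 1)) G" unfolding G_def by (rule ord_ge_mult) simp
  from principal_part_in_parameter[OF _ _ this, of "infser k t"]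
  have 1: "ord_ge 0 (G - (\<Sum>a=1..k 0 + 1. fls_const (g a) * inverse (?C ^ a)))" by (simp add: g_def del: sum.cl_ivl_Suc)
  have gv: "g a = infcoef (dser k t) (k 0) a / of_nat (k 0)" if a: "a \<in> {1..k 0 + 1}" for a
  proof -
    have "?C ^ (a - 1) * fls_deriv ?C * G = - (?\<kappa> * (?C ^ a * fls_X_inv ^ k 0 * fls_deriv (inverse ?C)))"
      using a C by (cases a) (auto simp: G_def fls_inverse_deriv power2_eq_square)
    then show ?thesis
      unfolding g_def using inf_residue[OF inverse_infls, where k="k 0" and a=a] a by simp
  qed
  have "infcoef (dser k t) (k 0) (k 0 + 1) = 1" by (simp add: infcoef_def fps_mult_nth)
  then have g1: "g (k 0 + 1) = 1 / of_nat (k 0)" by (simp add: gv)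
  \<comment> \<open>The missing linear term of \<open>dser\<close> makes the coefficient of
    \<open>z^(k 0 - 1)\<close> vanish, as it does in \<open>\<lambda>\<close>.\<close>
  have "agree 1 (dser k t) 1" by (auto simp: agree_def dser_def)
  then have "agree 1 (inverse (dser k t) ^ k 0 * (dser k t - fps_X * fps_deriv (dser k t))) (inverse 1 ^ k 0 * (1 - fps_X * fps_deriv 1))"
    by (intro agree_mult agree_power agree_inverse agree_diff agree_X_deriv) auto
  from this[unfolded agree_def, rule_format, of 1]
  have "(inverse (dser k t) ^ k 0 * (dser k t - fps_X * fps_deriv (dser k t))) $ 1 = (inverse 1 ^ k 0 * (1 - fps_X * fps_deriv 1)) $ 1"
    by blast
  also have "\<dots> = 0" by simp
  finally have "infcoef (dser k t) (k 0) (k 0) = 0" unfolding infcoef_def add_diff_cancel_left' .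
  then have g0: "g (k 0) = 0" using k0 by (simp add: gv)
  have "(\<Sum>a=1..k 0 + 1. fls_const (g a) * inverse (?C ^ a)) =
     (\<Sum>a\<in>{1..<k 0} \<union> {k 0, k 0 + 1}. fls_const (g a) * inverse (?C ^ a))"
    using k0 by (intro sum.cong) auto
  also have "\<dots> = (\<Sum>a=1..<k 0. fls_const (g a) * inverse (?C ^ a)) + ?\<kappa> * inverse (?C ^ (k 0 + 1))"
    by (subst sum.union_disjoint) (auto simp: g0 g1[unfolded Suc_eq_plus1[symmetric]])
  finally have S: "?C * (\<Sum>a=1..k 0 + 1. fls_const (g a) * inverse (?C ^ a)) =
      (\<Sum>a=1..<k 0. fls_const (?v (0, a)) * inverse ?C ^ (a - 1)) + ?\<kappa> * inverse ?C ^ k 0"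
  proof -
    assume e: "(\<Sum>a=1..k 0 + 1. fls_const (g a) * inverse (?C ^ a)) =
       (\<Sum>a=1..<k 0. fls_const (g a) * inverse (?C ^ a)) + ?\<kappa> * inverse (?C ^ (k 0 + 1))"
    have "?C * (fls_const (g a) * inverse (?C ^ a)) = fls_const (?v (0, a)) * inverse ?C ^ (a - 1)" if "a \<in> {1..<k 0}" for a
      using that C by (cases a) (auto simp: gv hpoint_inf power_inverse)
    moreover have "?C * (?\<kappa> * inverse (?C ^ (k 0 + 1))) = ?\<kappa> * inverse ?C ^ k 0"
      using C by (simp add: power_inverse)
    ultimately show ?thesis unfolding e distrib_left sum_distrib_left by simp
  qed
  have "ord_ge 1 (?C * (G - (\<Sum>a=1..k 0 + 1. fls_const (g a) * inverse (?C ^ a))))"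
    by (rule ord_ge_mult[OF C(3) 1]) simp
  moreover have "?C * G = ?\<kappa> * fls_X_inv ^ k 0" using C by (simp add: G_def)
  ultimately have 2: "ord_ge 1 (?\<kappa> * fls_X_inv ^ k 0 -
      ((\<Sum>a=1..<k 0. fls_const (?v (0, a)) * inverse ?C ^ (a - 1)) + ?\<kappa> * inverse ?C ^ k 0))"
    unfolding right_diff_distrib S by simp
  have 3: "ord_ge 1 (Lamf fls_const N k ?v (inverse ?C) - (?\<kappa> * inverse ?C ^ k 0 + (\<Sum>a = 1..<k 0. fls_const (?v (0, a)) * inverse ?C ^ (a - 1))))"
    by (rule Lamf_inf) auto
  from ord_ge_diff[OF 3 2] show ?thesis by (simp add: algebra_simps)
qed

text \<open>The argument for finite poles, with one more order of precision: \<open>dz\<close> has a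
  double pole in \<open>1 / z\<close>, and in return the error of \<open>\<lambda>\<close> along the
  truncated series is \<open>O(w)\<close> instead of \<open>O(1)\<close>.\<close>

lemma flat_exists_inf:
  assumes k0: "k 0 \<ge> 2"
  shows "\<exists>\<zeta> R. \<zeta> holomorphic_on {z. norm z > R} \<and>
        (\<forall>z. norm z > R \<longrightarrow> \<zeta> z ^ k 0 = of_nat (k 0) * lam N k (hpoint N k t) z) \<and>
        (\<lambda>z. \<zeta> z - z) \<in> O[at_infinity](\<lambda>z. 1 / z) \<and>
        (\<forall>\<alpha>\<in>{1..<k 0}. t (0, \<alpha>) = - 1 / of_nat (k 0 - \<alpha>) * residue_inf (\<lambda>z. \<zeta> z ^ (k 0 - \<alpha>)))"
proof -
  let ?v = "hpoint N k t" and ?c = "infser k t" and ?C = "infls k t"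
  have Cd: "fls_subdegree ?C = 1" "?C \<noteq> 0" using subdegree_fls_eq_1[of ?c] by auto
  have kk: "k 0 \<ge> 1" using k0 by simp
  obtain U where U: "fps_to_fls U = fls_const (of_nat (k 0)) * fls_X ^ k 0 * Lamf fls_const N k ?v fls_X_inv"
    "U $ 0 = 1" "U $ 1 = 0"
    "(\<lambda>w. if w = 0 then 1 else of_nat (k 0) * w ^ k 0 * lam N k ?v (1 / w)) has_fps_expansion U"
    by (rule lam_inf[where k=k and N=N and v="?v", OF k0]) blast
  have U0: "U $ 0 \<noteq> 0" "1 ^ k 0 = U $ 0" using U(2) by auto
  obtain \<phi> P \<rho> where \<phi>: "\<rho> > 0" "\<phi> holomorphic_on ball 0 \<rho>"
    "\<And>x. x \<in> ball 0 \<rho> \<Longrightarrow> \<phi> x ^ k 0 = (if x = 0 then 1 else of_nat (k 0) * x ^ k 0 * lam N k ?v (1 / x))"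
    "\<phi> has_fps_expansion P" "P $ 0 = 1" "P ^ k 0 = U"
    by (rule local_root[OF U(4) U0(1) kk U0(2)]) blast
  have P1: "P $ 1 = 0"
  proof -
    have "(P ^ k 0) $ 1 = of_nat (k 0) * P $ 1" using \<phi>(5) by (rule fps_power_nth_1)
    then show ?thesis using \<phi>(6) U(3) k0 by simp
  qed
  define \<zeta> where "\<zeta> = (\<lambda>z. z * \<phi> (1 / z))"
  define R where "R = 1 / \<rho>"
  have R: "z \<noteq> 0" "1 / z \<in> ball 0 \<rho>" if "norm z > R" for z :: complex
  proof -
    have "norm z > 0" using that \<phi>(1) R_def by (smt (verit) divide_pos_pos)
    then show "z \<noteq> 0" by auto
    show "1 / z \<in> ball 0 \<rho>" using that \<phi>(1) \<open>z \<noteq> 0\<close> by (simp add: R_def norm_divide field_simps)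
  qed
  have "\<zeta> holomorphic_on {z. norm z > R}"
    unfolding \<zeta>_def using R
    by (intro holomorphic_intros holomorphic_on_compose_gen[OF _ \<phi>(2), of "\<lambda>z. 1 / z", unfolded o_def]) auto
  moreover have "\<zeta> z ^ k 0 = of_nat (k 0) * lam N k ?v z" if "norm z > R" for z
    using \<phi>(3)[OF R(2)[OF that]] R(1)[OF that] by (simp add: \<zeta>_def power_mult_distrib field_simps)
  moreover have "(\<lambda>z. \<zeta> z - z) \<in> O[at_infinity](\<lambda>z. 1 / z)"
  proof -
    \<comment> \<open>The difference \<open>\<zeta> z - z\<close> is \<open>h (1 / z) / z\<close>,
      so the required estimate is boundedness of \<open>h\<close> at \<open>0\<close>, which comes
      from \<open>P $ 0 = 1\<close> and \<open>P $ 1 = 0\<close>.\<close>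
    define h where "h = (\<lambda>w. (\<phi> w - 1) / w ^ 2)"
    have hh: "h has_laurent_expansion (fps_to_fls (P - 1) / fls_X ^ 2)"
      unfolding h_def using has_laurent_expansion_diff[OF has_laurent_expansion_fps[OF \<phi>(4)] has_laurent_expansion_1]
      by (intro laurent_expansion_intros) simp
    have "ord_ge 0 (fps_to_fls (P - 1) / fls_X ^ 2)"
    proof (rule ord_ge_divide)
      show "ord_ge 2 (fps_to_fls (P - 1))" unfolding ord_ge_def
      proof (intro allI impI)
        fix m :: int assume "m < 2"
        then consider "m < 0" | "m = 0" | "m = 1" by linarith
        then show "fps_to_fls (P - 1) $$ m = 0" using \<phi>(5) P1 by cases auto
      qed
    qed simp
    then have "0 \<le> fls_subdegree (fps_to_fls (P - 1) / fls_X ^ 2)" by (auto simp: ord_ge_iff)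
    from has_laurent_expansion_imp_tendsto_0[OF hh this]
    obtain L where L: "(h \<longlongrightarrow> L) (at 0)" by blast
    have "filterlim (\<lambda>z::complex. inverse z) (at 0) at_infinity"
      using filterlim_inverse_at_iff[of "\<lambda>z::complex. z" at_infinity] filterlim_ident by blast
    from filterlim_compose[OF L this] have "((\<lambda>z. h (inverse z)) \<longlongrightarrow> L) at_infinity" .
    moreover have "\<forall>\<^sub>F z in at_infinity. h (inverse z) = (\<zeta> z - z) / (1 / z)"
      using eventually_not_equal_at_infinity[of 0]
      by eventually_elim (auto simp: h_def \<zeta>_def field_simps power2_eq_square)
    ultimately have "((\<lambda>z. (\<zeta> z - z) / (1 / z)) \<longlongrightarrow> L) at_infinity"
      by (rule Lim_transform_eventually)
    moreover have "\<forall>\<^sub>F z in at_infinity. 1 / z \<noteq> (0::complex)"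
      using eventually_not_equal_at_infinity[of 0] by eventually_elim auto
    ultimately show ?thesis by (rule bigoI_tendsto)
  qed
  moreover have "t (0, \<alpha>) = - 1 / of_nat (k 0 - \<alpha>) * residue_inf (\<lambda>z. \<zeta> z ^ (k 0 - \<alpha>))"
    if \<alpha>: "\<alpha> \<in> {1..<k 0}" for \<alpha>
  proof -
    define m where "m = k 0 - \<alpha>"
    have m: "1 \<le> m" "m < k 0" "k 0 - m = \<alpha>" using \<alpha> by (auto simp: m_def)
    define F where "F = fps_to_fls P / fls_X"
    have "(\<lambda>w. (\<phi> w / w) ^ m) has_laurent_expansion F ^ m"
      unfolding F_def by (intro laurent_expansion_intros has_laurent_expansion_fps \<phi>(4))
    then have "(\<lambda>w. \<zeta> (1 / w) ^ m) has_laurent_expansion F ^ m" by (simp add: \<zeta>_def)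
    then have res: "residue_inf (\<lambda>z. \<zeta> z ^ m) = (F ^ m * fls_deriv fls_X_inv) $$ (-1)"
      by (rule residue_inf_laurent)
    define Q where "Q = fls_compose_fps F ?c * fls_X"
    have FQ: "fls_compose_fps F ?c = Q * fls_X_inv"
      by (simp add: Q_def mult.assoc flip: fls_inverse_X)
    have Fc: "fls_compose_fps F ?c = fps_to_fls (P oo ?c) / ?C"
      unfolding F_def by (subst fls_compose_fps_divide) auto
    define E where "E = Lamf fls_const N k ?v (inverse ?C) - fls_const (1 / of_nat (k 0)) * fls_X_inv ^ k 0"
    have E: "ord_ge 1 E" unfolding E_def by (rule Lamf_principal_inf[where k=k, OF k0])
    have Lc: "fls_compose_fps (Lamf fls_const N k ?v fls_X_inv) ?c = Lamf fls_const N k ?v (inverse ?C)"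
      by (simp add: Lamf_def fls_compose_fps_add fls_compose_fps_mult fls_compose_fps_power fls_compose_fps_sum
          fls_compose_fps_inverse fls_compose_fps_diff compose_zpar_0)
    have kk0: "fls_const (of_nat (k 0)) * fls_const (1 / of_nat (k 0)) = (1 :: complex fls)" using k0 by simp
    have "F ^ k 0 = fls_const (of_nat (k 0)) * Lamf fls_const N k ?v fls_X_inv"
    proof -
      have "F ^ k 0 = fps_to_fls U / fls_X ^ k 0" by (simp only: F_def power_divide \<phi>(6) fps_to_fls_power[symmetric])
      then show ?thesis by (simp add: U(1))
    qed
    then have "fls_compose_fps (F ^ k 0) ?c = fls_const (of_nat (k 0)) * Lamf fls_const N k ?v (inverse ?C)"
      by (simp add: Lc fls_compose_fps_mult)
    then have "fls_compose_fps F ?c ^ k 0 = fls_const (of_nat (k 0)) * (fls_const (1 / of_nat (k 0)) * fls_X_inv ^ k 0 + E)"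
      by (simp add: fls_compose_fps_power E_def)
    also have "\<dots> = fls_X_inv ^ k 0 + fls_const (of_nat (k 0)) * E"
      unfolding distrib_left mult.assoc[symmetric] kk0 by simp
    finally have "Q ^ k 0 = (fls_X_inv ^ k 0 + fls_const (of_nat (k 0)) * E) * fls_X ^ k 0"
      by (simp add: Q_def power_mult_distrib)
    also have "\<dots> = 1 + fls_const (of_nat (k 0)) * E * fls_X ^ k 0" by (simp add: distrib_right flip: fls_inverse_X_power)
    finally have e: "Q ^ k 0 - 1 = fls_const (of_nat (k 0)) * E * fls_X ^ k 0" by simp
    have "ord_ge (int (k 0) + 1) (Q ^ k 0 - 1)"
      unfolding e by (rule ord_ge_mult[OF ord_ge_const_mult[OF E], of "int (k 0)"]) (auto simp: ord_ge_def)
    moreover have Q0: "ord_ge 0 Q \<and> Q $$ 0 = 1"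
    proof -
      have "Q = fps_to_fls (P oo ?c) * (fls_X * inverse ?C)" by (simp add: Q_def Fc divide_inverse mult_ac)
      also have "fls_X * inverse ?C = fps_to_fls (dser k t)"
        unfolding inverse_infls by (simp add: mult.assoc[symmetric] flip: fls_inverse_X)
      finally have "Q = fps_to_fls ((P oo ?c) * dser k t)" by (simp add: fls_times_fps_to_fls)
      then show ?thesis using \<phi>(5) by (simp add: fps_compose_nth)
    qed
    ultimately have Q: "ord_ge (int (k 0) + 1) (Q - 1)" using ord_ge_of_power[of Q "k 0"] kk by blast
    have Qm: "ord_ge (int (k 0) + 1) (Q ^ m - 1)"
    proof -
      have "Q ^ m - 1 = (Q - 1) * (\<Sum>j<m. Q ^ j)" using power_diff_1_eq[of Q m] by simp
      moreover have "ord_ge 0 (\<Sum>j<m. Q ^ j)" using Q0 by (intro ord_ge_sum ord_ge_power[of 0]) auto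
      ultimately show ?thesis using ord_ge_mult[OF Q, of 0] by simp
    qed
    have "ord_ge (-2) (fls_deriv (inverse ?C))"
      by (rule ord_ge_deriv[of "-1"]) (use Cd in \<open>auto simp: ord_ge_iff\<close>)
    then have "ord_ge (- int m - 2) (fls_X_inv ^ m * fls_deriv (inverse ?C))"
      by (intro ord_ge_mult[of "- int m" _ "-2"]) (auto simp: ord_ge_def)
    from ord_ge_mult[OF Qm this, of 0] have z: "((Q ^ m - 1) * (fls_X_inv ^ m * fls_deriv (inverse ?C))) $$ (-1) = 0"
      using m by (simp add: ord_ge_def)
    have "(F ^ m * fls_deriv fls_X_inv) $$ (-1) = (Q ^ m * fls_X_inv ^ m * fls_deriv (inverse ?C)) $$ (-1)"
      by (subst residue_infls[of _ k t]) (simp add: fls_compose_fps_power FQ power_mult_distrib)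
    also have "\<dots> = (fls_X_inv ^ m * fls_deriv (inverse ?C)) $$ (-1)"
      using z by (simp add: left_diff_distrib mult.assoc)
    also have "\<dots> = of_nat m * inverse ?C $$ int m" by (rule X_inv_deriv_nth[OF m(1)])
    also have "inverse ?C $$ int m = - t (0, \<alpha>)"
      unfolding inverse_infls using m by (simp add: fls_X_inv_times_conv_shift dser_def nat_add_distrib)
    finally show ?thesis using m unfolding res[symmetric] m_def[symmetric] by (simp add: field_simps)
  qed
  ultimately show ?thesis by blast
qed

lemma flat_unique_inf:
  assumes k0: "k 0 \<ge> 2"
    and \<zeta>: "\<zeta> holomorphic_on {z. norm z > R}"
      "\<And>z. norm z > R \<Longrightarrow> \<zeta> z ^ k 0 = of_nat (k 0) * lam N k v z"
      "(\<lambda>z. \<zeta> z - z) \<in> O[at_infinity](\<lambda>z. 1 / z)"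
      "\<And>\<alpha>. \<alpha> \<in> {1..<k 0} \<Longrightarrow> t (0, \<alpha>) = - 1 / of_nat (k 0 - \<alpha>) * residue_inf (\<lambda>z. \<zeta> z ^ (k 0 - \<alpha>))"
    and a: "a \<in> {1..<k 0}"
  shows "v (0, a) = infcoef (dser k t) (k 0) a / of_nat (k 0)"
proof -
  have kk: "k 0 \<ge> 1" using k0 by simp
  obtain U where U: "fps_to_fls U = fls_const (of_nat (k 0)) * fls_X ^ k 0 * Lamf fls_const N k v fls_X_inv"
    "U $ 0 = 1" "U $ 1 = 0"
    "(\<lambda>w. if w = 0 then 1 else of_nat (k 0) * w ^ k 0 * lam N k v (1 / w)) has_fps_expansion U"
    "\<And>a. a \<in> {1..<k 0} \<Longrightarrow> Lamf fls_const N k v fls_X_inv $$ (1 - int a) = v (0, a)"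
    by (rule lam_inf[where k=k and N=N and v=v, OF k0]) blast
  define r where "r = 1 / (max R 1 :: real)"
  have r: "r > 0" by (simp add: r_def)
  have inR: "norm (1 / x) > R" if "x \<in> ball 0 r - {0}" for x :: complex
  proof -
    have "norm x < 1 / max R 1" "norm x > 0" using that by (auto simp: r_def)
    then have "max R 1 * norm x < 1" by (simp add: field_simps)
    moreover have "R * norm x \<le> max R 1 * norm x" by (intro mult_right_mono) auto
    ultimately have "R * norm x < 1" by linarith
    then show ?thesis using \<open>norm x > 0\<close> by (simp add: norm_divide field_simps)
  qed
  obtain P where P: "P ^ k 0 = U" "(\<lambda>w. \<zeta> (1 / w)) has_laurent_expansion (fps_to_fls P / fls_X)"
  proof (rule local_root_unique[OF U(4) _ kk r])
    show "U $ 0 \<noteq> 0" using U(2) by simp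
    have "continuous_on {z. norm z > R} \<zeta>" using \<zeta>(1) by (rule holomorphic_on_imp_continuous_on)
    then show "continuous_on (ball 0 r - {0}) (\<lambda>w. \<zeta> (1 / w))"
      by (rule continuous_on_compose2) (use inR in \<open>auto intro!: continuous_intros\<close>)
    show "(x * \<zeta> (1 / x)) ^ k 0 = (if x = 0 then 1 else of_nat (k 0) * x ^ k 0 * lam N k v (1 / x))" if "x \<in> ball 0 r - {0}" for x
      using \<zeta>(2)[OF inR[OF that]] that by (simp add: power_mult_distrib)
  qed blast
  define F where "F = fps_to_fls P / fls_X"
  \<comment> \<open>The asymptotic condition singles out one root: the others differ by a root of
    unity and have a different constant term.\<close>
  have P0: "P $ 0 = 1"
  proof -
    have "(\<lambda>w. \<zeta> (1 / w) * w) has_laurent_expansion F * fls_X"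
      unfolding F_def by (intro laurent_expansion_intros P(2))
    also have "F * fls_X = fps_to_fls P" by (simp add: F_def)
    finally have h: "(\<lambda>w. \<zeta> (1 / w) * w) has_laurent_expansion fps_to_fls P" .
    have "0 \<le> fls_subdegree (fps_to_fls P)" by (rule fls_subdegree_fls_to_fps_gt0)
    from has_laurent_expansion_imp_tendsto_0[OF h this]
    have 1: "((\<lambda>w. \<zeta> (1 / w) * w) \<longlongrightarrow> P $ 0) (at 0)" by simp
    obtain B where B: "\<forall>\<^sub>F z in at_infinity. norm (\<zeta> z - z) \<le> B * norm (1 / z)"
      using \<zeta>(3) by (rule landau_o.bigE)
    have inv: "filterlim (\<lambda>z::complex. inverse z) at_infinity (at 0)"
      by (rule filterlim_inverse_at_infinity)
    have "\<forall>\<^sub>F w in at 0. norm (\<zeta> (inverse w) - inverse w) \<le> B * norm (1 / inverse w)"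
      using eventually_compose_filterlim[OF B inv] .
    moreover have "\<forall>\<^sub>F w in at (0::complex). w \<noteq> 0" by (simp add: eventually_at_filter)
    ultimately have "\<forall>\<^sub>F w in at 0. norm (\<zeta> (1 / w) * w - 1) \<le> B * norm w * norm w"
    proof eventually_elim
      case (elim w)
      have "norm (\<zeta> (1 / w) * w - 1) = norm (\<zeta> (inverse w) - inverse w) * norm w"
        using elim(2) by (simp add: norm_mult[symmetric] left_diff_distrib inverse_eq_divide)
      also have "\<dots> \<le> (B * norm w) * norm w" using elim by (intro mult_right_mono) (auto simp: divide_inverse)
      finally show ?case .
    qed
    moreover have "((\<lambda>w::complex. B * norm w * norm w) \<longlongrightarrow> 0) (at 0)"
      by (auto intro!: tendsto_eq_intros)
    ultimately have "((\<lambda>w. \<zeta> (1 / w) * w - 1) \<longlongrightarrow> 0) (at 0)"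
      by (rule Lim_null_comparison)
    then have "((\<lambda>w. \<zeta> (1 / w) * w) \<longlongrightarrow> 1) (at 0)" by (simp add: Lim_null[symmetric] LIM_zero_iff)
    then show ?thesis using 1 by (rule LIM_unique[symmetric])
  qed
  have P1: "P $ 1 = 0"
  proof -
    have "(P ^ k 0) $ 1 = of_nat (k 0) * P $ 1" using P0 by (rule fps_power_nth_1)
    then show ?thesis using P(1) U(3) k0 by simp
  qed
  obtain c where c: "c $ 0 = 0" "c $ 1 \<noteq> 0" "c $ 1 = P $ 0" "c $ 2 = P $ 0 * P $ 1" "fls_compose_fps F c = fls_X_inv"
    unfolding F_def by (rule root_parameter[of P]) (use P0 in auto)
  define D where "D = inverse (fps_shift 1 c)"
  have sc: "fps_shift 1 c $ 0 = 1" "fps_shift 1 c $ 1 = 0" using c P0 P1 by (simp_all add: numeral_2_eq_2)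
  have D0: "D $ 0 = 1" using sc by (simp add: D_def)
  have D1: "D $ 1 = 0"
  proof -
    have "(fps_shift 1 c * D) $ 1 = 0" using sc by (simp add: D_def inverse_mult_eq_1')
    then show ?thesis using sc D0 by (simp add: fps_mult_nth)
  qed
  have cD: "inverse (fps_to_fls c) = fls_X_inv * fps_to_fls D"
  proof -
    have "fps_to_fls c = fls_X * fps_to_fls (fps_shift 1 c)"
      using c(1) by (intro fls_eqI) (auto simp: fls_X_times_conv_shift nat_diff_distrib not_less not_le intro!: arg_cong[of _ _ "fps_nth _"])
    then show ?thesis using sc by (simp add: D_def fls_inverse_X fls_inverse_fps_to_fls)
  qed
  have "F ^ k 0 = fls_const (of_nat (k 0)) * Lamf fls_const N k v fls_X_inv"
  proof -
    have "F ^ k 0 = fps_to_fls U / fls_X ^ k 0" by (simp only: F_def power_divide P(1) fps_to_fls_power[symmetric])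
    then show ?thesis by (simp add: U(1))
  qed
  then have "of_nat (k 0) * v (0, a) = infcoef D (k 0) a"
    using root_coeff_inf[OF c(1,2,5) cD, of a "k 0"] U(5)[OF a] D0 a by simp
  moreover have "infcoef D (k 0) a = infcoef (dser k t) (k 0) a"
  proof (rule infcoef_agree)
    show "agree (k 0) D (dser k t)"
      unfolding agree_def
    proof (intro allI impI)
      fix j assume j: "j \<le> k 0"
      consider "j = 0" | "j = 1" | "j \<ge> 2" by linarith
      then show "D $ j = dser k t $ j"
      proof cases
        case 3
        define m where "m = j - 1"
        have m: "m \<ge> 1" "m < k 0" "j = Suc m" using 3 j by (auto simp: m_def)
        have "(\<lambda>w. \<zeta> (1 / w) ^ m) has_laurent_expansion F ^ m"
          unfolding F_def by (intro laurent_expansion_intros P(2))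
        then have "residue_inf (\<lambda>z. \<zeta> z ^ m) = (F ^ m * fls_deriv fls_X_inv) $$ (-1)"
          by (rule residue_inf_laurent)
        also have "\<dots> = of_nat m * inverse (fps_to_fls c) $$ int m"
          by (rule root_residue_inf[OF c(1,2,5) m(1)])
        also have "inverse (fps_to_fls c) $$ int m = D $ j"
          unfolding cD by (simp add: fls_X_inv_times_conv_shift m nat_add_distrib)
        finally have "t (0, k 0 - m) = - D $ j"
          using \<zeta>(4)[of "k 0 - m"] m by simp
        then show ?thesis using m by (simp add: dser_def)
      qed (use D0 D1 in \<open>auto simp: dser_def\<close>)
    qed
  qed (use D0 a in auto)
  ultimately show ?thesis using k0 by (simp add: field_simps)
qed

lemma flat_coords_hpoint:
  assumes k0: "k 0 \<ge> 2" and ki: "\<forall>i\<in>{1..N}. k i \<ge> 1" and t: "t \<in> hdom N k"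
  shows "flat_coords N k (hpoint N k t) t"
  unfolding flat_coords_def
proof (intro conjI ballI)
  fix i assume i: "i \<in> {1..N}"
  have "k i \<ge> 1" using ki i by blast
  then show "t (i, 0) = hpoint N k t (i, 0)" "t (i, 1) = hpoint N k t (i, 1)"
    using i by (auto simp: hpoint_pole hpoint_pos cser_def)
  then show "\<exists>\<zeta> r. r > 0 \<and> \<zeta> holomorphic_on (ball (hpoint N k t (i, 0)) r - {hpoint N k t (i, 0)}) \<and>
           (\<forall>z\<in>ball (hpoint N k t (i, 0)) r - {hpoint N k t (i, 0)}. \<zeta> z ^ k i = lam N k (hpoint N k t) z) \<and>
           (\<forall>\<alpha>\<in>{2..k i}. t (i, \<alpha>) = of_nat (k i) / of_nat (k i - \<alpha> + 1) *
              residue (\<lambda>z. \<zeta> z ^ (k i - \<alpha> + 1)) (hpoint N k t (i, 0)))"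
    using flat_exists_pole[OF t ki i] by (simp only:)
qed (rule flat_exists_inf[where k=k and N=N and t=t, OF k0])

lemma flat_coords_unique:
  assumes k0: "k 0 \<ge> 2" and ki: "\<forall>i\<in>{1..N}. k i \<ge> 1" and v: "v \<in> hurwitz N k" and f: "flat_coords N k v t"
  shows "t \<in> hdom N k" "v = hpoint N k t"
proof -
  have pole: "t (i, 0) = v (i, 0) \<and> t (i, k i) \<noteq> 0 \<and> (\<forall>a\<in>{1..k i}. v (i, a) = of_nat (k i) / of_nat a * (cser k t i ^ a) $ k i)"
    if i: "i \<in> {1..N}" for i
  proof -
    have "k i \<ge> 1" using ki i by blast
    moreover have t01: "t (i, 0) = v (i, 0)" "t (i, 1) = v (i, 1)" using f i by (auto simp: flat_coords_def)
    moreover obtain \<zeta> r where "r > 0" "\<zeta> holomorphic_on (ball (v (i, 0)) r - {v (i, 0)})"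
      "\<forall>z\<in>ball (v (i, 0)) r - {v (i, 0)}. \<zeta> z ^ k i = lam N k v z"
      "\<forall>\<alpha>\<in>{2..k i}. t (i, \<alpha>) = of_nat (k i) / of_nat (k i - \<alpha> + 1) * residue (\<lambda>z. \<zeta> z ^ (k i - \<alpha> + 1)) (v (i, 0))"
      using f i unfolding flat_coords_def by blast
    ultimately show ?thesis using flat_unique_pole[OF v i, of t r \<zeta>] by blast
  qed
  have "inj_on (\<lambda>i. t (i, 0)) {1..N} \<longleftrightarrow> inj_on (\<lambda>i. v (i, 0)) {1..N}"
    by (rule inj_on_cong) (use pole in blast)
  then show t: "t \<in> hdom N k" using pole v by (auto simp: hdom_def hurwitz_def)
  obtain \<zeta> R where \<zeta>: "\<zeta> holomorphic_on {z. norm z > R}"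
      "\<And>z. norm z > R \<Longrightarrow> \<zeta> z ^ k 0 = of_nat (k 0) * lam N k v z"
      "(\<lambda>z. \<zeta> z - z) \<in> O[at_infinity](\<lambda>z. 1 / z)"
      "\<And>\<alpha>. \<alpha> \<in> {1..<k 0} \<Longrightarrow> t (0, \<alpha>) = - 1 / of_nat (k 0 - \<alpha>) * residue_inf (\<lambda>z. \<zeta> z ^ (k 0 - \<alpha>))"
    using f unfolding flat_coords_def by blast
  show "v = hpoint N k t"
  proof
    fix x :: "nat \<times> nat"
    obtain i a where x: "x = (i, a)" by (cases x)
    show "v x = hpoint N k t x"
    proof (cases "x \<in> idx N k")
      case False
      then show ?thesis using v by (simp add: x hpoint_def hurwitz_def)
    next
      case True
      consider "i = 0" "a \<in> {1..<k 0}" | "i \<in> {1..N}" "a = 0" | "i \<in> {1..N}" "a \<in> {1..k i}"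
        using True x by (cases "a = 0") (auto simp: idx_iff split: if_splits)
      then show ?thesis
      proof cases
        case 1
        then show ?thesis unfolding x using flat_unique_inf[where v=v and t=t and N=N, OF k0 \<zeta>] by (simp add: hpoint_inf)
      next
        case 2
        then show ?thesis unfolding x using pole by (simp add: hpoint_pole)
      next
        case 3
        then show ?thesis unfolding x using pole by (simp add: hpoint_pos)
      qed
    qed
  qed
qed

text \<open>From here on the description by roots of \<open>\<lambda>\<close> is replaced by
  explicit conditions on \<open>t\<close>.\<close>

lemma flat_dom_eq:
  assumes "k 0 \<ge> 2" "\<forall>i\<in>{1..N}. k i \<ge> 1"
  shows "flat_dom N k = hdom N k"
  unfolding flat_dom_def using flat_coords_unique(1)[OF assms] flat_coords_hpoint[OF assms] hpoint_hurwitz[OF _ assms(2)] by blast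

lemma flat_pt_eq:
  assumes "k 0 \<ge> 2" "\<forall>i\<in>{1..N}. k i \<ge> 1" "t \<in> hdom N k"
  shows "flat_pt N k t = hpoint N k t"
  unfolding flat_pt_def
  using flat_coords_unique(2)[OF assms(1,2)] flat_coords_hpoint[OF assms] hpoint_hurwitz[OF assms(3,2)] by blast

subsection \<open>The coordinate vector fields\<close>

definition fps_has_deriv :: "(complex \<Rightarrow> complex fps) \<Rightarrow> complex fps \<Rightarrow> complex \<Rightarrow> bool" where
  "fps_has_deriv F D s \<longleftrightarrow> (\<forall>n. ((\<lambda>s. F s $ n) has_field_derivative D $ n) (at s))"

lemma fps_has_deriv_mult:
  assumes "fps_has_deriv F D s" "fps_has_deriv G E s"
  shows "fps_has_deriv (\<lambda>s. F s * G s) (D * G s + F s * E) s"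
  unfolding fps_has_deriv_def
proof
  fix n
  have "((\<lambda>s. \<Sum>i=0..n. F s $ i * G s $ (n - i)) has_field_derivative
      (\<Sum>i=0..n. D $ i * G s $ (n - i) + E $ (n - i) * F s $ i)) (at s)"
    using assms unfolding fps_has_deriv_def by (intro DERIV_sum DERIV_mult) auto
  then show "((\<lambda>s. (F s * G s) $ n) has_field_derivative (D * G s + F s * E) $ n) (at s)"
    by (simp add: fps_mult_nth sum.distrib mult.commute[of "E $ _"])
qed

lemma fps_has_deriv_power:
  assumes "fps_has_deriv F D s"
  shows "fps_has_deriv (\<lambda>s. F s ^ n) (of_nat n * F s ^ (n - 1) * D) s"
proof (induction n)
  case 0
  then show ?case by (simp add: fps_has_deriv_def)
next
  case (Suc n)
  have "D * F s ^ n + F s * (of_nat n * F s ^ (n - 1) * D) = of_nat (Suc n) * F s ^ n * D"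
    by (cases n) (simp_all add: algebra_simps)
  then show ?case using fps_has_deriv_mult[OF assms Suc] by simp
qed

lemma fps_has_deriv_diff:
  "fps_has_deriv F D s \<Longrightarrow> fps_has_deriv G E s \<Longrightarrow> fps_has_deriv (\<lambda>s. F s - G s) (D - E) s"
  by (auto simp: fps_has_deriv_def intro: DERIV_diff)

lemma fps_has_deriv_X_deriv:
  assumes "fps_has_deriv F D s" shows "fps_has_deriv (\<lambda>s. fps_X * fps_deriv (F s)) (fps_X * fps_deriv D) s"
  unfolding fps_has_deriv_def
proof
  fix n
  show "((\<lambda>s. (fps_X * fps_deriv (F s)) $ n) has_field_derivative (fps_X * fps_deriv D) $ n) (at s)"
    using assms unfolding fps_has_deriv_def by (cases n) (auto intro!: DERIV_cmult)
qed

text \<open>Induction over the recursion for the coefficients of the inverse. The constant term is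
  \<open>1\<close> for every parameter, so \<open>D $ 0 = 0\<close> and the recursion involves no
  division.\<close>

lemma fps_has_deriv_inverse:
  assumes F: "fps_has_deriv F D s" and F0: "\<And>s. F s $ 0 = 1"
  shows "fps_has_deriv (\<lambda>s. inverse (F s)) (- (D * inverse (F s) ^ 2)) s"
  unfolding fps_has_deriv_def
proof
  fix n
  define E where "E = - (D * inverse (F s) ^ 2)"
  have inv: "F s * inverse (F s) = 1" for s by (simp add: inverse_mult_eq_1' F0)
  have D0: "D $ 0 = 0"
  proof -
    have "((\<lambda>s. F s $ 0) has_field_derivative D $ 0) (at s)" using F by (simp add: fps_has_deriv_def)
    then have "((\<lambda>s. 1) has_field_derivative D $ 0) (at s)" by (simp add: F0)
    then show ?thesis by (metis DERIV_const DERIV_unique)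
  qed
  have FE: "F s * E + D * inverse (F s) = 0"
  proof -
    have "F s * E = - (D * inverse (F s) * (F s * inverse (F s)))"
      by (simp add: E_def power2_eq_square mult_ac)
    then show ?thesis by (simp add: inv)
  qed
  show "((\<lambda>s. inverse (F s) $ n) has_field_derivative E $ n) (at s)"
  proof (induction n rule: less_induct)
    case (less n)
    show ?case
    proof (cases "n = 0")
      case True
      then show ?thesis by (simp add: F0 E_def D0)
    next
      case False
      have rec: "inverse (F u) $ n = - (\<Sum>i=1..n. F u $ i * inverse (F u) $ (n - i))" for u
      proof -
        have "(F u * inverse (F u)) $ n = 0" using False by (simp add: inv)
        then have "F u $ 0 * inverse (F u) $ n + (\<Sum>i=1..n. F u $ i * inverse (F u) $ (n - i)) = 0"
          unfolding fps_mult_nth by (simp add: sum.atLeast_Suc_atMost)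
        then show ?thesis by (simp add: F0 eq_neg_iff_add_eq_0)
      qed
      have "((\<lambda>u. - (\<Sum>i=1..n. F u $ i * inverse (F u) $ (n - i))) has_field_derivative
          - (\<Sum>i=1..n. D $ i * inverse (F s) $ (n - i) + E $ (n - i) * F s $ i)) (at s)"
        using F less unfolding fps_has_deriv_def by (intro DERIV_minus DERIV_sum DERIV_mult) auto
      moreover have "- (\<Sum>i=1..n. D $ i * inverse (F s) $ (n - i) + E $ (n - i) * F s $ i) = E $ n"
      proof -
        have "(F s * E + D * inverse (F s)) $ n = 0" by (simp add: FE)
        then have "F s $ 0 * E $ n + (\<Sum>i=1..n. F s $ i * E $ (n - i)) + (D $ 0 * inverse (F s) $ n + (\<Sum>i=1..n. D $ i * inverse (F s) $ (n - i))) = 0"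
          unfolding fps_add_nth fps_mult_nth by (simp add: sum.atLeast_Suc_atMost)
        then have "E $ n + ((\<Sum>i=1..n. D $ i * inverse (F s) $ (n - i)) + (\<Sum>i=1..n. E $ (n - i) * F s $ i)) = 0"
          by (simp add: F0 D0 mult.commute add_ac)
        then have "E $ n = - ((\<Sum>i=1..n. D $ i * inverse (F s) $ (n - i)) + (\<Sum>i=1..n. E $ (n - i) * F s $ i))"
          by (rule eq_neg_iff_add_eq_0[THEN iffD2])
        then show ?thesis by (simp only: sum.distrib)
      qed
      ultimately show ?thesis by (simp add: rec)
    qed
  qed
qed

text \<open>The right-hand side is the Euler operator \<open>a + X d/dX\<close> applied to
  \<open>inverse D ^ a\<close>; the identity turns the numbers \<open>infcoef\<close> into plain
  coefficients of powers of \<open>inverse D\<close>.\<close>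

lemma gser_identity:
  fixes D :: "complex fps"
  assumes "D $ 0 = 1"
  shows "of_nat a * inverse D ^ Suc a * (D - fps_X * fps_deriv D) = of_nat a * inverse D ^ a + fps_X * fps_deriv (inverse D ^ a)"
proof -
  have i: "inverse D * D = 1" using assms by (simp add: inverse_mult_eq_1)
  have "fps_deriv (inverse D ^ a) = - (of_nat a * inverse D ^ Suc a * fps_deriv D)"
  proof (cases a)
    case (Suc b)
    have "fps_deriv (inverse D) = - (fps_deriv D * inverse D ^ 2)"
      using assms by (simp add: fps_inverse_deriv power2_eq_square)
    moreover have "fps_deriv (inverse D ^ Suc b) = of_nat (Suc b) * inverse D ^ b * fps_deriv (inverse D)"
      by (simp only: fps_deriv_power fps_of_nat diff_Suc_1 mult_ac)
    ultimately show ?thesis unfolding Suc by (simp only: power_Suc power2_eq_square mult_minus_right mult_ac)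
  qed simp
  moreover have "of_nat a * inverse D ^ Suc a * D = of_nat a * inverse D ^ a"
  proof -
    have "inverse D ^ Suc a * D = inverse D ^ a * (inverse D * D)" by (simp only: power_Suc mult_ac)
    then show ?thesis by (simp only: i mult_1_right mult.assoc)
  qed
  ultimately show ?thesis by (simp add: right_diff_distrib mult_ac)
qed

text \<open>Relates the coefficients of the polynomial part of \<open>\<lambda>\<close> to those of
  its derivative; this is what \<open>deriv_lam\<close> needs at infinity.\<close>

lemma infcoef_Suc:
  assumes "D $ 0 = 1" "a \<le> k"
  shows "of_nat a * infcoef D k (Suc a) = of_nat k * (inverse D ^ a) $ (k - a)"
proof -
  have "of_nat a * infcoef D k (Suc a) = (of_nat a * inverse D ^ Suc a * (D - fps_X * fps_deriv D)) $ (k - a)"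
    unfolding infcoef_def mult.assoc by (simp only: fps_mult_of_nat_nth Suc_eq_plus1 diff_cancel2)
  also have "\<dots> = of_nat a * (inverse D ^ a) $ (k - a) + of_nat (k - a) * (inverse D ^ a) $ (k - a)"
    unfolding gser_identity[OF assms(1)] fps_add_nth by (cases "k - a") simp_all
  also have "\<dots> = of_nat k * (inverse D ^ a) $ (k - a)"
    using assms(2) by (simp add: of_nat_diff algebra_simps)
  finally show ?thesis .
qed

text \<open>A change of \<open>t (0, \<beta>)\<close> changes \<open>dser\<close> by a multiple of
  \<open>X^m\<close>. By the Euler identity the three resulting terms have the weights
  \<open>a\<close>, \<open>\<beta> - a\<close> and \<open>m - 1\<close>, whose sum
  \<open>k 0\<close> cancels the denominator of \<open>vcoord\<close>.\<close>

lemma deriv_vcoord_inf: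
  assumes \<beta>: "\<beta> \<in> {1..<k 0}" and a: "a \<in> {1..<k 0}"
  shows "((\<lambda>s. vcoord k (t((0, \<beta>) := s)) (0, a)) has_field_derivative pcoef k t 0 \<beta> a) (at (t (0, \<beta>)))"
proof -
  define m where "m = k 0 + 1 - \<beta>"
  have m: "2 \<le> m" "m \<le> k 0" "k 0 + 1 - m = \<beta>" using \<beta> by (auto simp: m_def)
  define F where "F = (\<lambda>s. dser k (t((0, \<beta>) := s)))"
  have Ft: "F (t (0, \<beta>)) = dser k t" by (simp add: F_def)
  have F0: "F s $ 0 = 1" for s by (simp add: F_def)
  have F: "fps_has_deriv F (- (fps_X ^ m)) (t (0, \<beta>))"
    unfolding fps_has_deriv_def
  proof
    fix n
    have "F s $ n = (if n = m then - s else dser k t $ n)" for s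
      using m \<beta> by (auto simp: F_def dser_def)
    then show "((\<lambda>s. F s $ n) has_field_derivative (- (fps_X ^ m)) $ n) (at (t (0, \<beta>)))"
      by (auto intro!: derivative_eq_intros)
  qed
  let ?D = "dser k t" and ?G = "gser k t"
  have G: "fps_has_deriv (\<lambda>s. inverse (F s)) (fps_X ^ m * ?G ^ 2) (t (0, \<beta>))"
    using fps_has_deriv_inverse[OF F F0] by (simp add: Ft)
  have Ga: "fps_has_deriv (\<lambda>s. inverse (F s) ^ a) (of_nat a * fps_X ^ m * ?G ^ Suc a) (t (0, \<beta>))"
  proof -
    have "?G ^ (a - 1) * ?G ^ 2 = ?G ^ Suc a" using a by (simp flip: power_add)
    then have eq: "of_nat a * ?G ^ (a - 1) * (fps_X ^ m * ?G ^ 2) = of_nat a * fps_X ^ m * ?G ^ Suc a"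
      by (metis (no_types, lifting) mult.assoc mult.left_commute)
    show ?thesis using fps_has_deriv_power[OF G, of a] by (simp only: Ft eq)
  qed
  have E: "fps_has_deriv (\<lambda>s. F s - fps_X * fps_deriv (F s)) (of_nat (m - 1) * fps_X ^ m) (t (0, \<beta>))"
  proof -
    have "- (fps_X ^ m) - fps_X * fps_deriv (- (fps_X ^ m)) = of_nat (m - 1) * (fps_X ^ m :: complex fps)"
    proof -
      have "fps_X * fps_deriv (fps_X ^ m) = (of_nat m * fps_X ^ m :: complex fps)"
      proof (rule fps_ext)
        fix n show "(fps_X * fps_deriv (fps_X ^ m)) $ n = (of_nat m * fps_X ^ m :: complex fps) $ n"
          by (cases n) (auto simp del: fps_deriv_power)
      qed
      moreover have "(of_nat m :: complex fps) = of_nat (m - 1) + 1" using m by (simp add: of_nat_diff)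
      ultimately have "fps_X * fps_deriv (fps_X ^ m) = (of_nat (m - 1) + 1) * (fps_X ^ m :: complex fps)" by (simp only:)
      then show ?thesis by (simp only: fps_deriv_neg mult_minus_right distrib_right mult_1_left) simp
    qed
    then show ?thesis using fps_has_deriv_diff[OF F fps_has_deriv_X_deriv[OF F]] by simp
  qed
  have e: "of_nat a * fps_X ^ m * ?G ^ Suc a * (?D - fps_X * fps_deriv ?D) + ?G ^ a * (of_nat (m - 1) * fps_X ^ m)
     = fps_X ^ m * (of_nat a * ?G ^ a + fps_X * fps_deriv (?G ^ a) + of_nat (m - 1) * ?G ^ a)"
    unfolding gser_identity[of ?D a, OF dser_nth_0, symmetric] by (simp only: distrib_left mult_ac)
  have "((\<lambda>s. (inverse (F s) ^ a * (F s - fps_X * fps_deriv (F s))) $ (k 0 + 1 - a)) has_field_derivative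
     (fps_X ^ m * (of_nat a * ?G ^ a + fps_X * fps_deriv (?G ^ a) + of_nat (m - 1) * ?G ^ a)) $ (k 0 + 1 - a)) (at (t (0, \<beta>)))"
    using fps_has_deriv_mult[OF Ga E] unfolding fps_has_deriv_def Ft e by blast
  moreover have "(fps_X ^ m * (of_nat a * ?G ^ a + fps_X * fps_deriv (?G ^ a) + of_nat (m - 1) * ?G ^ a)) $ (k 0 + 1 - a)
     = of_nat (k 0) * pcoef k t 0 \<beta> a"
  proof (cases "a \<le> \<beta>")
    case False
    then show ?thesis using m a by (simp add: fps_X_power_mult_nth pcoef_def)
  next
    case True
    then have q: "k 0 + 1 - a - m = \<beta> - a" "\<not> k 0 + 1 - a < m" using m a by auto
    have X: "(fps_X * fps_deriv (?G ^ a)) $ q = of_nat q * (?G ^ a) $ q" for q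
      by (cases q) (simp_all del: fps_deriv_power)
    have "(of_nat a + of_nat (\<beta> - a) + of_nat (m - 1) :: complex) = of_nat (k 0)"
      using True m \<beta> by (simp flip: of_nat_add add: m_def)
    then show ?thesis
      using True q(2) unfolding fps_X_power_mult_nth q(1) fps_add_nth X fps_mult_of_nat_nth
      by (simp add: pcoef_def flip: distrib_right)
  qed
  ultimately have "((\<lambda>s. infcoef (F s) (k 0) a / of_nat (k 0)) has_field_derivative of_nat (k 0) * pcoef k t 0 \<beta> a / of_nat (k 0)) (at (t (0, \<beta>)))"
    unfolding infcoef_def by (intro DERIV_cdivide) simp
  then show ?thesis using a by (simp add: vcoord_def F_def)
qed

lemma deriv_vcoord_pole:
  assumes i: "i \<noteq> 0" and \<beta>: "\<beta> \<in> {1..k i}" and a: "a \<in> {1..k i}"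
  shows "((\<lambda>s. vcoord k (t((i, \<beta>) := s)) (i, a)) has_field_derivative pcoef k t i \<beta> a) (at (t (i, \<beta>)))"
proof -
  define m where "m = k i + 1 - \<beta>"
  have m: "1 \<le> m" "m \<le> k i" "k i + 1 - m = \<beta>" "k i - m = \<beta> - 1" using \<beta> by (auto simp: m_def)
  define F where "F = (\<lambda>s. cser k (t((i, \<beta>) := s)) i)"
  have Ft: "F (t (i, \<beta>)) = cser k t i" by (simp add: F_def)
  have F: "fps_has_deriv F (fps_const (1 / of_nat (k i)) * fps_X ^ m) (t (i, \<beta>))"
    unfolding fps_has_deriv_def
  proof
    fix n
    have "F s $ n = (if n = m then s / of_nat (k i) else cser k t i $ n)" for s
      using m \<beta> by (auto simp: F_def cser_def)
    then show "((\<lambda>s. F s $ n) has_field_derivative (fps_const (1 / of_nat (k i)) * fps_X ^ m) $ n) (at (t (i, \<beta>)))"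
      using m by (auto intro!: derivative_eq_intros)
  qed
  have "of_nat a * cser k t i ^ (a - 1) * (fps_const (1 / of_nat (k i)) * fps_X ^ m) =
     of_nat a * (fps_const (1 / of_nat (k i)) * (fps_X ^ m * cser k t i ^ (a - 1)))" by (simp only: mult_ac)
  with fps_has_deriv_power[OF F, of a]
  have A: "((\<lambda>s. (F s ^ a) $ k i) has_field_derivative (of_nat a * (fps_const (1 / of_nat (k i)) * (fps_X ^ m * cser k t i ^ (a - 1)))) $ k i) (at (t (i, \<beta>)))"
    unfolding fps_has_deriv_def Ft by metis
  have B: "(of_nat a * (fps_const (1 / of_nat (k i)) * (fps_X ^ m * cser k t i ^ (a - 1)))) $ k i =
     of_nat a / of_nat (k i) * pcoef k t i \<beta> a"
    using m i \<beta> by (simp only: fps_mult_of_nat_nth fps_mult_left_const_nth fps_X_power_mult_nth) (simp add: pcoef_def)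
  have "((\<lambda>s. of_nat (k i) / of_nat a * (F s ^ a) $ k i) has_field_derivative of_nat (k i) / of_nat a * (of_nat a / of_nat (k i) * pcoef k t i \<beta> a)) (at (t (i, \<beta>)))"
    by (intro DERIV_cmult) (use A in \<open>simp only: B\<close>)
  then show ?thesis using i a \<beta> by (simp add: vcoord_def F_def)
qed

lemma open_hdom: "open (hdom N k)"
proof -
  have "hdom N k = (\<Inter>i\<in>{1..N}. {t. t (i, k i) \<noteq> 0}) \<inter> (\<Inter>i\<in>{1..N}. \<Inter>j\<in>{1..N} - {i}. {t. t (i, 0) \<noteq> t (j, 0)})"
    unfolding hdom_def inj_on_def by blast
  moreover have "open {t::point. t x \<noteq> 0}" for x
    by (intro open_Collect_neq continuous_on_coord continuous_on_const)
  ultimately show ?thesis by (simp add: open_Int open_INT open_coord_neq)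
qed

lemma cser_cong: "(\<And>a. a \<in> {1..k i} \<Longrightarrow> t (i, a) = t' (i, a)) \<Longrightarrow> cser k t i = cser k t' i"
proof (rule fps_ext)
  fix n assume e: "\<And>a. a \<in> {1..k i} \<Longrightarrow> t (i, a) = t' (i, a)"
  show "cser k t i $ n = cser k t' i $ n"
  proof (cases "1 \<le> n \<and> n \<le> k i")
    case True
    then have "k i + 1 - n \<in> {1..k i}" by auto
    from e[OF this] show ?thesis by (simp add: cser_def)
  qed (auto simp: cser_def)
qed

lemma dser_cong: "(\<And>a. a \<in> {1..<k 0} \<Longrightarrow> t (0, a) = t' (0, a)) \<Longrightarrow> dser k t = dser k t'"
proof (rule fps_ext)
  fix n assume e: "\<And>a. a \<in> {1..<k 0} \<Longrightarrow> t (0, a) = t' (0, a)"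
  show "dser k t $ n = dser k t' $ n"
  proof (cases "2 \<le> n \<and> n \<le> k 0")
    case True
    then have "k 0 + 1 - n \<in> {1..<k 0}" by auto
    from e[OF this] show ?thesis by (simp add: dser_def)
  qed (auto simp: dser_def)
qed

text \<open>The components of \<open>\<partial>/\<partial>t\<^sub>b\<close> with respect to the parameters.\<close>

definition jac :: "(nat \<Rightarrow> nat) \<Rightarrow> point \<Rightarrow> nat \<times> nat \<Rightarrow> nat \<times> nat \<Rightarrow> complex" where
  "jac k t b x = (case b of (j, \<beta>) \<Rightarrow> case x of (i, a) \<Rightarrow>
     if i \<noteq> j then 0 else if i = 0 then pcoef k t 0 \<beta> a
     else if \<beta> = 0 then (if a = 0 then 1 else 0) else if a = 0 then 0 else pcoef k t i \<beta> a)"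

lemma pd_const: "(\<And>s. f (t(x := s)) = c) \<Longrightarrow> pd x f t = 0"
  by (simp add: pd_def)

lemma flat_vec_eq:
  assumes k0: "k 0 \<ge> 2" and ki: "\<forall>i\<in>{1..N}. k i \<ge> 1" and t: "t \<in> hdom N k" and b: "b \<in> idx N k"
  shows "flat_vec N k b t x = (if x \<in> idx N k then jac k t b x else 0)"
proof -
  have "flat_vec N k b t x = pd b (\<lambda>t. hpoint N k t x) t"
    unfolding flat_vec_def by (rule pd_cong[OF open_hdom t]) (simp add: flat_pt_eq[OF k0 ki])
  also have "\<dots> = (if x \<in> idx N k then pd b (\<lambda>t. vcoord k t x) t else 0)"
    by (simp add: hpoint_def)
  also have "\<dots> = (if x \<in> idx N k then jac k t b x else 0)"
  proof (cases "x \<in> idx N k")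
    case x: True
    obtain i a j \<beta> where xb: "x = (i, a)" "b = (j, \<beta>)" by (cases x; cases b)
    have "pd b (\<lambda>t. vcoord k t x) t = jac k t b x"
    proof (cases "i = j")
      case False
      have "vcoord k (t(b := s)) x = vcoord k t x" for s
        using cser_cong[of k i "t(b := s)" t] dser_cong[of k "t(b := s)" t] False
        by (auto simp: vcoord_def xb)
      then show ?thesis using pd_const False by (simp add: jac_def xb)
    next
      case ij: True
      show ?thesis
      proof (cases "i = 0")
        case True
        then have "\<beta> \<in> {1..<k 0}" "a \<in> {1..<k 0}" using x b ij by (auto simp: xb idx_iff)
        from deriv_vcoord_inf[of \<beta> k a t, OF this] show ?thesis
          using True ij by (simp add: pd_def xb jac_def DERIV_imp_deriv)
      next
        case i0: False
        show ?thesis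
        proof (cases "a = 0")
          case True
          then show ?thesis using i0 ij by (simp add: pd_def xb jac_def vcoord_def)
        next
          case a0: False
          show ?thesis
          proof (cases "\<beta> = 0")
            case True
            have "vcoord k (t(b := s)) x = vcoord k t x" for s
              using cser_cong[of k i "t(b := s)" t] i0 a0 True by (auto simp: vcoord_def xb)
            then show ?thesis using pd_const True i0 a0 ij by (simp add: jac_def xb)
          next
            case False
            then have "\<beta> \<in> {1..k i}" "a \<in> {1..k i}" using x b ij i0 a0 by (auto simp: xb idx_iff)
            from deriv_vcoord_pole[of i \<beta> k a t, OF i0 this] show ?thesis
              using False i0 a0 ij by (simp add: pd_def xb jac_def DERIV_imp_deriv)
          qed
        qed
      qed
    qed
    then show ?thesis by simp
  qed simp
  finally show ?thesis .
qed

text \<open>The source of triangularity: \<open>cser\<close> has no constant term, so its power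
  \<open>a - 1\<close> starts in degree \<open>a - 1 > \<beta> - 1\<close>.\<close>

lemma pcoef_beyond:
  "i \<noteq> 0 \<Longrightarrow> 1 \<le> \<beta> \<Longrightarrow> \<beta> < a \<Longrightarrow> pcoef k t i \<beta> a = 0"
  "\<beta> < a \<Longrightarrow> pcoef k t 0 \<beta> a = 0"
proof -
  assume "i \<noteq> 0" "1 \<le> \<beta>" "\<beta> < a"
  then have "\<beta> - 1 < a - 1" by auto
  then show "pcoef k t i \<beta> a = 0" using startsby_zero_power_prefix[OF cser_nth_0[of k t i], of "a - 1"] \<open>i \<noteq> 0\<close> \<open>1 \<le> \<beta>\<close>
    by (simp add: pcoef_def)
qed (simp add: pcoef_def)

text \<open>Every tangent vector is a combination of the coordinate fields, because their components form
  triangular matrices.\<close>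

definition in_span :: "nat \<Rightarrow> (nat \<Rightarrow> nat) \<Rightarrow> point \<Rightarrow> point \<Rightarrow> bool" where
  "in_span N k t X \<longleftrightarrow> (\<exists>\<xi>. \<forall>x\<in>idx N k. X x = (\<Sum>b\<in>idx N k. \<xi> b * jac k t b x))"

lemma in_span_add: "in_span N k t X \<Longrightarrow> in_span N k t Y \<Longrightarrow> in_span N k t (\<lambda>x. X x + Y x)"
proof -
  assume "in_span N k t X" "in_span N k t Y"
  then obtain \<xi> \<upsilon> where "\<forall>x\<in>idx N k. X x = (\<Sum>b\<in>idx N k. \<xi> b * jac k t b x)" "\<forall>x\<in>idx N k. Y x = (\<Sum>b\<in>idx N k. \<upsilon> b * jac k t b x)"
    by (auto simp: in_span_def)
  then show ?thesis unfolding in_span_def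
    by (intro exI[of _ "\<lambda>b. \<xi> b + \<upsilon> b"]) (simp add: distrib_right sum.distrib)
qed

lemma in_span_scale: "in_span N k t X \<Longrightarrow> in_span N k t (\<lambda>x. c * X x)"
proof -
  assume "in_span N k t X"
  then obtain \<xi> where "\<forall>x\<in>idx N k. X x = (\<Sum>b\<in>idx N k. \<xi> b * jac k t b x)" by (auto simp: in_span_def)
  then show ?thesis unfolding in_span_def
    by (intro exI[of _ "\<lambda>b. c * \<xi> b"]) (simp add: sum_distrib_left mult.assoc)
qed

lemma in_span_sum: "(\<And>i. i \<in> A \<Longrightarrow> in_span N k t (X i)) \<Longrightarrow> in_span N k t (\<lambda>x. \<Sum>i\<in>A. X i x)"
proof (induction A rule: infinite_finite_induct)
  case (insert a A)
  then show ?case using in_span_add[of N k t "X a" "\<lambda>x. \<Sum>i\<in>A. X i x"] by simp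
qed (auto simp: in_span_def intro!: exI[of _ "\<lambda>_. 0"])

lemma in_span_cong: "in_span N k t X \<Longrightarrow> (\<And>x. x \<in> idx N k \<Longrightarrow> X x = Y x) \<Longrightarrow> in_span N k t Y"
  unfolding in_span_def by metis

lemma in_span_jac: "b \<in> idx N k \<Longrightarrow> in_span N k t (jac k t b)"
  unfolding in_span_def by (intro exI[of _ "\<lambda>c. if c = b then 1 else 0"]) (simp add: if_distrib[of "\<lambda>x. x * _"] cong: if_cong)

lemma in_span_unit:
  assumes ki: "\<forall>i\<in>{1..N}. k i \<ge> 1" and t: "t \<in> hdom N k" and y: "(i, \<beta>) \<in> idx N k"
  shows "in_span N k t (\<lambda>x. if x = (i, \<beta>) then 1 else 0)"
  using y
proof (induction \<beta> rule: less_induct)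
  case (less \<beta>)
  show ?case
  proof (cases "i \<noteq> 0 \<and> \<beta> = 0")
    case True
    then show ?thesis
      by (intro in_span_cong[OF in_span_jac[OF less.prems]]) (auto simp: jac_def split: prod.splits)
  next
    case F: False
    then have \<beta>: "\<beta> \<ge> 1" using less.prems by (cases "i = 0") (auto simp: idx_iff)
    have nz: "pcoef k t i \<beta> \<beta> \<noteq> 0"
    proof (cases "i = 0")
      case False
      then have "i \<in> {1..N}" using less.prems by (auto simp: idx_iff)
      then have "cser k t i $ 1 \<noteq> 0" using cser_nz(2)[of k i t] ki t by (auto simp: hdom_def)
      then show ?thesis using False \<beta> by (simp add: pcoef_def startsby_zero_power_nth_same)
    qed (simp add: pcoef_def)
    \<comment> \<open>Elimination: the entries below the diagonal are removed by unit vectors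
      already in the span, and the rest is divided by the diagonal entry.\<close>
    define X where "X = (\<lambda>x. 1 / pcoef k t i \<beta> \<beta> * (jac k t (i, \<beta>) x
        + (\<Sum>a=1..<\<beta>. - pcoef k t i \<beta> a * (if x = (i, a) then 1 else 0))))"
    have "in_span N k t X"
      unfolding X_def
    proof (intro in_span_scale in_span_add in_span_sum in_span_jac less.prems)
      fix a assume a: "a \<in> {1..<\<beta>}"
      have "(i, a) \<in> idx N k" using a less.prems by (auto simp: idx_iff split: if_splits)
      then show "in_span N k t (\<lambda>x. if x = (i, a) then 1 else 0)" using less.IH[of a] a by simp
    qed
    moreover have "X x = (if x = (i, \<beta>) then 1 else 0)" if x: "x \<in> idx N k" for x
    proof -
      obtain j a where xa: "x = (j, a)" by (cases x)
      have S: "(\<Sum>a'=1..<\<beta>. - pcoef k t i \<beta> a' * (if x = (i, a') then 1 else 0)) = (if j = i \<and> a \<in> {1..<\<beta>} then - pcoef k t i \<beta> a else 0)"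
      proof (cases "j = i")
        case True
        have "(\<Sum>a'=1..<\<beta>. - pcoef k t i \<beta> a' * (if x = (i, a') then 1 else 0)) = (\<Sum>a'=1..<\<beta>. if a' = a then - pcoef k t i \<beta> a else 0)"
          by (intro sum.cong) (auto simp: xa True)
        then show ?thesis using True by simp
      qed (auto simp: xa)
      have J: "jac k t (i, \<beta>) (j, a) = (if j \<noteq> i then 0 else if i \<noteq> 0 \<and> a = 0 then 0 else pcoef k t i \<beta> a)"
        using \<beta> by (auto simp: jac_def)
      have a1: "i = 0 \<Longrightarrow> j = i \<Longrightarrow> a \<ge> 1" using x by (auto simp: xa idx_iff)
      consider "j \<noteq> i" | "j = i" "a = 0" | "j = i" "1 \<le> a" "a < \<beta>" | "j = i" "a = \<beta>" | "j = i" "\<beta> < a" by linarith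
      then show ?thesis
      proof cases
        case 2
        then show ?thesis using a1 \<beta> unfolding X_def S unfolding xa J by auto
      next
        case 5
        then have "pcoef k t i \<beta> a = 0" using pcoef_beyond(1)[of i \<beta> a k t] pcoef_beyond(2)[of \<beta> a k t] \<beta> by (cases "i = 0") auto
        then show ?thesis using 5 \<beta> unfolding X_def S unfolding xa J by auto
      next
        case 1
        then show ?thesis unfolding X_def S unfolding xa J by auto
      next
        case 3
        then show ?thesis using nz \<beta> unfolding X_def S unfolding xa J by auto
      next
        case 4
        then show ?thesis using nz \<beta> unfolding X_def S unfolding xa J by auto
      qed
    qed
    ultimately show ?thesis by (rule in_span_cong)
  qed
qed

text \<open>The product is characterised by testing against all tangent vectors, so each of them
  must be a combination of the flat fields.\<close>

lemma in_span_all: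
  assumes ki: "\<forall>i\<in>{1..N}. k i \<ge> 1" and t: "t \<in> hdom N k"
  shows "in_span N k t X"
proof -
  have "in_span N k t (\<lambda>x. \<Sum>y\<in>idx N k. X y * (if x = y then 1 else 0))"
    by (intro in_span_sum in_span_scale) (metis in_span_unit[OF ki t] surj_pair)
  then show ?thesis
    by (rule in_span_cong) (simp add: if_distrib[of "\<lambda>x. _ * x"] cong: if_cong)
qed

section \<open>Pairing and product in flat coordinates\<close>

definition poles :: "nat \<Rightarrow> point \<Rightarrow> complex set" where
  "poles N v = (\<lambda>i. v (i, 0)) ` {1..N}"

lemma deriv_shifted_pole:
  fixes y A X Y :: complex
  assumes "y \<noteq> 0"
  shows "((\<lambda>s. (A + s * X) / (y - s * Y) ^ a) has_field_derivative
    X * inverse (y ^ a) + of_nat a * A * Y * inverse (y ^ (a + 1))) (at 0)"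
proof -
  have "((\<lambda>s. (A + s * X) * inverse ((y - s * Y) ^ a)) has_field_derivative
     X * inverse (y ^ a) + A * (- (inverse (y ^ a) * (of_nat a * y ^ (a - 1) * (- Y)) * inverse (y ^ a)))) (at 0)"
    using assms by (auto intro!: derivative_eq_intros)
  also have "A * (- (inverse (y ^ a) * (of_nat a * y ^ (a - 1) * (- Y)) * inverse (y ^ a))) = of_nat a * A * Y * inverse (y ^ (a + 1))"
    using assms by (cases a) (simp_all add: divide_simps)
  finally show ?thesis unfolding divide_inverse .
qed

lemma deriv_pole:
  fixes z p c :: complex
  assumes "z \<noteq> p"
  shows "((\<lambda>z. c / (z - p) ^ a) has_field_derivative - (of_nat a * c * inverse ((z - p) ^ (a + 1)))) (at z)"
proof -
  define y where "y = z - p"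
  have y: "y \<noteq> 0" using assms by (simp add: y_def)
  have "((\<lambda>z. c * inverse ((z - p) ^ a)) has_field_derivative
     c * (- (inverse (y ^ a) * (of_nat a * y ^ (a - 1)) * inverse (y ^ a)))) (at z)"
    using assms unfolding y_def by (auto intro!: derivative_eq_intros)
  also have "c * (- (inverse (y ^ a) * (of_nat a * y ^ (a - 1)) * inverse (y ^ a))) = - (of_nat a * c * inverse (y ^ (a + 1)))"
    using y by (cases a) (simp_all add: divide_simps)
  finally show ?thesis unfolding divide_inverse y_def .
qed

lemma Phi_pole_0:
  assumes "i \<noteq> 0" "k i \<ge> 1"
  shows "Phi (\<lambda>x. x) k t (i, 0) z = (\<Sum>a=1..k i. pcoef k t i 0 (Suc a) * inverse ((z - t (i, 0)) ^ Suc a))"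
proof -
  define f where "f = (\<lambda>a. pcoef k t i 0 a * inverse ((z - t (i, 0)) ^ a))"
  have "f 1 = 0" using assms by (simp add: f_def pcoef_def)
  moreover have "Phi (\<lambda>x. x) k t (i, 0) z = (\<Sum>a=1..Suc (k i). f a)"
    using Phi_pos[OF assms(1), of "\<lambda>x. x" k t 0 z] by (simp only: f_def Suc_eq_plus1)
  moreover have "(\<Sum>a=1..Suc (k i). f a) = f 1 + (\<Sum>a=Suc 1..Suc (k i). f a)"
    by (rule sum.atLeast_Suc_atMost) simp
  moreover have "(\<Sum>a=Suc 1..Suc (k i). f a) = (\<Sum>a=1..k i. f (Suc a))"
    by (rule sum.shift_bounds_cl_Suc_ivl)
  ultimately show ?thesis unfolding f_def by simp
qed

lemma eventually_not_finite: "finite (S :: complex set) \<Longrightarrow> \<forall>\<^sub>F w in at 0. w \<notin> S"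
  by (metis islimpt_finite islimpt_iff_eventually)

lemma along_eq:
  assumes z: "z \<notin> poles N v"
  shows "along N k v X z = (\<Sum>a=1..<k 0. X (0, a) * z ^ (a - 1)) +
    (\<Sum>i=1..N. \<Sum>a=1..k i. X (i, a) * inverse ((z - v (i, 0)) ^ a)
        + of_nat a * v (i, a) * X (i, 0) * inverse ((z - v (i, 0)) ^ (a + 1)))"
proof -
  have nz: "z - v (i, 0) \<noteq> 0" if "i \<in> {1..N}" for i using z that by (auto simp: poles_def)
  have d1: "((\<lambda>s. (v (i, a) + s * X (i, a)) / (z - (v (i, 0) + s * X (i, 0))) ^ a) has_field_derivative
      X (i, a) * inverse ((z - v (i, 0)) ^ a) + of_nat a * v (i, a) * X (i, 0) * inverse ((z - v (i, 0)) ^ (a + 1))) (at 0)"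
    if i: "i \<in> {1..N}" and a: "a \<in> {1..k i}" for i a
    using deriv_shifted_pole[OF nz[OF i], of "v (i, a)" "X (i, a)" "X (i, 0)" a] by (simp add: algebra_simps)
  have "((\<lambda>s. z ^ k 0 / of_nat (k 0) + (\<Sum>a = 1..<k 0. (v (0, a) + s * X (0, a)) * z ^ (a - 1))
     + (\<Sum>i = 1..N. \<Sum>a = 1..k i. (v (i, a) + s * X (i, a)) / (z - (v (i, 0) + s * X (i, 0))) ^ a)) has_field_derivative
     0 + (\<Sum>a=1..<k 0. X (0, a) * z ^ (a - 1)) + (\<Sum>i=1..N. \<Sum>a=1..k i. X (i, a) * inverse ((z - v (i, 0)) ^ a)
        + of_nat a * v (i, a) * X (i, 0) * inverse ((z - v (i, 0)) ^ (a + 1)))) (at 0)"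
    by (intro DERIV_add DERIV_sum d1 DERIV_const) (auto intro!: derivative_eq_intros)
  then show ?thesis unfolding along_def lam_def by (simp add: DERIV_imp_deriv)
qed

text \<open>The chain rule that identifies \<open>Phi\<close> with the derivative of
  \<open>\<lambda>\<close> along a flat field. Moving a pole raises the order of each of its
  fractions by one, which explains the order \<open>k i + 1\<close> in the case of index
  \<open>(i, 0)\<close>.\<close>

lemma Phi_eq_jac:
  assumes k: "\<forall>i\<in>{1..N}. k i \<ge> 1" and b: "b \<in> idx N k"
  shows "Phi (\<lambda>x. x) k t b z = (\<Sum>a=1..<k 0. jac k t b (0, a) * z ^ (a - 1)) +
    (\<Sum>i=1..N. \<Sum>a=1..k i. jac k t b (i, a) * inverse ((z - t (i, 0)) ^ a)
        + of_nat a * vcoord k t (i, a) * jac k t b (i, 0) * inverse ((z - t (i, 0)) ^ (a + 1)))"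
proof -
  obtain j \<beta> where b': "b = (j, \<beta>)" by (cases b)
  define T where "T = (\<lambda>i. \<Sum>a=1..k i. jac k t b (i, a) * inverse ((z - t (i, 0)) ^ a)
        + of_nat a * vcoord k t (i, a) * jac k t b (i, 0) * inverse ((z - t (i, 0)) ^ (a + 1)))"
  have T0: "T i = 0" if "i \<noteq> j" for i using that by (simp add: T_def jac_def b')
  show ?thesis
  proof (cases "j = 0")
    case True
    then have \<beta>: "\<beta> \<in> {1..<k 0}" using b by (auto simp: b' idx_iff)
    have "(\<Sum>i=1..N. T i) = 0" using T0 True by (intro sum.neutral) auto
    moreover have "(\<Sum>a=1..<k 0. jac k t b (0, a) * z ^ (a - 1)) = (\<Sum>a=1..\<beta>. pcoef k t 0 \<beta> a * z ^ (a - 1))"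
      using \<beta> True by (intro sum.mono_neutral_cong_right) (auto simp: jac_def b' pcoef_def)
    ultimately show ?thesis unfolding T_def using True by (simp add: b' Phi_0)
  next
    case False
    then have j: "j \<in> {1..N}" "\<beta> \<le> k j" using b by (auto simp: b' idx_iff)
    then have kj: "k j \<ge> 1" using k by blast
    have "(\<Sum>a=1..<k 0. jac k t b (0, a) * z ^ (a - 1)) = 0" using False by (simp add: jac_def b')
    moreover have "(\<Sum>i=1..N. T i) = T j" using T0 j(1) by (subst sum.remove[OF _ j(1)]) (auto intro: sum.neutral)
    moreover have "T j = Phi (\<lambda>x. x) k t b z"
    proof (cases "\<beta> = 0")
      case True
      have "Phi (\<lambda>x. x) k t b z = (\<Sum>a=1..k j. pcoef k t j 0 (Suc a) * inverse ((z - t (j, 0)) ^ Suc a))"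
        unfolding b' True by (rule Phi_pole_0[of j k, OF False kj])
      also have "\<dots> = T j"
        unfolding T_def using False by (intro sum.cong) (auto simp: jac_def b' True pcoef_def vcoord_def simp del: power_Suc)
      finally show ?thesis ..
    next
      case b0: False
      have "Phi (\<lambda>x. x) k t b z = (\<Sum>a=1..k j. pcoef k t j \<beta> a * inverse ((z - t (j, 0)) ^ a))"
        unfolding b' Phi_pos[OF False] using pcoef_beyond(1)[of j \<beta> "Suc (k j)" k t] False b0 j(2) by simp
      then show ?thesis unfolding T_def using False b0 by (simp add: jac_def b')
    qed
    ultimately show ?thesis unfolding T_def by simp
  qed
qed

lemma along_combination:
  assumes ki: "\<forall>i\<in>{1..N}. k i \<ge> 1" and z: "z \<notin> poles N (hpoint N k t)"
    and X: "\<And>x. x \<in> idx N k \<Longrightarrow> X x = (\<Sum>b\<in>idx N k. \<xi> b * jac k t b x)"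
  shows "along N k (hpoint N k t) X z = (\<Sum>b\<in>idx N k. \<xi> b * Phi (\<lambda>x. x) k t b z)"
proof -
  let ?v = "hpoint N k t"
  have X0: "X (0, a) = (\<Sum>b\<in>idx N k. \<xi> b * jac k t b (0, a))" if "a \<in> {1..<k 0}" for a
    using X that by (simp add: idx_iff)
  have Xi: "X (i, a) = (\<Sum>b\<in>idx N k. \<xi> b * jac k t b (i, a))" if "i \<in> {1..N}" "a \<le> k i" for i a
    using X that by (simp add: idx_iff)
  have "along N k ?v X z = (\<Sum>a=1..<k 0. X (0, a) * z ^ (a - 1)) +
    (\<Sum>i=1..N. \<Sum>a=1..k i. X (i, a) * inverse ((z - t (i, 0)) ^ a)
        + of_nat a * vcoord k t (i, a) * X (i, 0) * inverse ((z - t (i, 0)) ^ (a + 1)))"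
    unfolding along_eq[OF z]
    by (intro arg_cong2[of _ _ _ _ "(+)"] sum.cong refl) (auto simp: hpoint_pole hpoint_pos vcoord_pos)
  also have "\<dots> = (\<Sum>a=1..<k 0. \<Sum>b\<in>idx N k. \<xi> b * (jac k t b (0, a) * z ^ (a - 1))) +
    (\<Sum>i=1..N. \<Sum>a=1..k i. \<Sum>b\<in>idx N k. \<xi> b * (jac k t b (i, a) * inverse ((z - t (i, 0)) ^ a)
        + of_nat a * vcoord k t (i, a) * jac k t b (i, 0) * inverse ((z - t (i, 0)) ^ (a + 1))))"
    by (intro arg_cong2[of _ _ _ _ "(+)"] sum.cong refl)
      (auto simp: X0 Xi sum_distrib_left sum_distrib_right distrib_left sum.distrib mult_ac)
  also have "\<dots> = (\<Sum>b\<in>idx N k. \<xi> b * ((\<Sum>a=1..<k 0. jac k t b (0, a) * z ^ (a - 1)) +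
    (\<Sum>i=1..N. \<Sum>a=1..k i. jac k t b (i, a) * inverse ((z - t (i, 0)) ^ a)
        + of_nat a * vcoord k t (i, a) * jac k t b (i, 0) * inverse ((z - t (i, 0)) ^ (a + 1)))))"
  proof -
    have s: "(\<Sum>i=1..N. \<Sum>a=1..k i. \<Sum>b\<in>idx N k. f i a b) = (\<Sum>b\<in>idx N k. \<Sum>i=1..N. \<Sum>a=1..k i. f i a b)" for f :: "nat \<Rightarrow> nat \<Rightarrow> nat \<times> nat \<Rightarrow> complex"
      by (simp add: sum.swap[of _ "idx N k"])
    show ?thesis unfolding s by (subst sum.swap) (simp add: distrib_left sum.distrib sum_distrib_left)
  qed
  also have "\<dots> = (\<Sum>b\<in>idx N k. \<xi> b * Phi (\<lambda>x. x) k t b z)"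
    by (intro sum.cong refl) (simp only: Phi_eq_jac[OF ki])
  finally show ?thesis .
qed

text \<open>Differentiating a fraction in \<open>z\<close> is minus moving its pole, which gives the
  terms of index \<open>(i, 0)\<close>. The polynomial part is the formula for the fields of index
  \<open>(0, \<alpha>)\<close> continued to \<open>\<alpha> = k 0\<close>.\<close>

lemma deriv_lam:
  assumes k0: "k 0 \<ge> 2" and ki: "\<forall>i\<in>{1..N}. k i \<ge> 1" and z: "z \<notin> poles N (hpoint N k t)"
  shows "deriv (lam N k (hpoint N k t)) z = Lamz (\<lambda>x. x) N k t z"
proof -
  let ?v = "hpoint N k t"
  have nz: "z - ?v (i, 0) \<noteq> 0" if "i \<in> {1..N}" for i using z that by (auto simp: poles_def)
  have d1: "((\<lambda>z. ?v (i, a) / (z - ?v (i, 0)) ^ a) has_field_derivative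
      - (of_nat a * ?v (i, a) * inverse ((z - ?v (i, 0)) ^ (a + 1)))) (at z)"
    if i: "i \<in> {1..N}" and a: "a \<in> {1..k i}" for i a
    using nz[OF i] by (intro deriv_pole) auto
  have d0: "((\<lambda>z. ?v (0, a) * z ^ (a - 1)) has_field_derivative ?v (0, a) * (of_nat (a - 1) * z ^ (a - 2))) (at z)" for a
    by (auto intro!: derivative_eq_intros simp: numeral_2_eq_2)
  have dk: "((\<lambda>z. z ^ k 0 / of_nat (k 0)) has_field_derivative z ^ (k 0 - 1)) (at z)"
    using k0 by (auto intro!: derivative_eq_intros)
  have "(lam N k ?v has_field_derivative (z ^ (k 0 - 1) + (\<Sum>a=1..<k 0. ?v (0, a) * (of_nat (a - 1) * z ^ (a - 2)))
      + (\<Sum>i=1..N. \<Sum>a=1..k i. - (of_nat a * ?v (i, a) * inverse ((z - ?v (i, 0)) ^ (a + 1)))))) (at z)"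
    unfolding lam_def by (intro DERIV_add DERIV_sum d0 d1 dk)
  then have D: "deriv (lam N k ?v) z = z ^ (k 0 - 1) + (\<Sum>a=1..<k 0. ?v (0, a) * (of_nat (a - 1) * z ^ (a - 2)))
      + (\<Sum>i=1..N. \<Sum>a=1..k i. - (of_nat a * ?v (i, a) * inverse ((z - ?v (i, 0)) ^ (a + 1))))"
    by (rule DERIV_imp_deriv)
  have P: "Phi (\<lambda>x. x) k t (i, 0) z = (\<Sum>a=1..k i. of_nat a * ?v (i, a) * inverse ((z - ?v (i, 0)) ^ (a + 1)))" if i: "i \<in> {1..N}" for i
  proof -
    have i0: "i \<noteq> 0" and k1: "k i \<ge> 1" using i ki by auto
    have "Phi (\<lambda>x. x) k t (i, 0) z = (\<Sum>a=1..k i. pcoef k t i 0 (Suc a) * inverse ((z - t (i, 0)) ^ Suc a))"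
      by (rule Phi_pole_0[of i k, OF i0 k1])
    also have "\<dots> = (\<Sum>a=1..k i. of_nat a * ?v (i, a) * inverse ((z - ?v (i, 0)) ^ (a + 1)))"
      using i i0 by (intro sum.cong) (auto simp: pcoef_def hpoint_pos hpoint_pole simp del: power_Suc)
    finally show ?thesis .
  qed
  have Q: "Phi (\<lambda>x. x) k t (0, k 0) z = z ^ (k 0 - 1) + (\<Sum>a=1..<k 0. ?v (0, a) * (of_nat (a - 1) * z ^ (a - 2)))"
  proof -
    \<comment> \<open>There is no term in \<open>z^(k 0 - 2)\<close>, since \<open>\<lambda>\<close>
      has none in \<open>z^(k 0 - 1)\<close>.\<close>
    have k1: "pcoef k t 0 (k 0) (k 0 - 1) = 0"
    proof -
      have "agree 1 (dser k t) 1" by (auto simp: agree_def dser_def)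
      then have "agree 1 (gser k t ^ (k 0 - 1)) (inverse 1 ^ (k 0 - 1))"
        by (intro agree_power agree_inverse) auto
      then have "(gser k t ^ (k 0 - 1)) $ 1 = 0" by (simp add: agree_def)
      moreover have "k 0 - (k 0 - 1) = 1" using k0 by simp
      ultimately show ?thesis using k0 by (simp add: pcoef_def)
    qed
    have "Phi (\<lambda>x. x) k t (0, k 0) z = pcoef k t 0 (k 0) (k 0) * z ^ (k 0 - 1) + (\<Sum>a=1..<k 0. pcoef k t 0 (k 0) a * z ^ (a - 1))"
      unfolding Phi_0 using k0 by (simp add: sum.last_plus)
    also have "(\<Sum>a=1..<k 0. pcoef k t 0 (k 0) a * z ^ (a - 1)) = (\<Sum>a=1..<k 0 - 1. pcoef k t 0 (k 0) a * z ^ (a - 1))"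
    proof (intro sum.mono_neutral_right ballI)
      fix a assume "a \<in> {1..<k 0} - {1..<k 0 - 1}"
      then have "a = k 0 - 1" by auto
      then show "pcoef k t 0 (k 0) a * z ^ (a - 1) = 0" using k1 by simp
    qed auto
    also have "\<dots> = (\<Sum>a=1..<k 0 - 1. ?v (0, Suc a) * (of_nat (Suc a - 1) * z ^ (Suc a - 2)))"
    proof (intro sum.cong refl)
      fix a assume a: "a \<in> {1..<k 0 - 1}"
      have ak: "a \<le> k 0" using a by auto
      have "of_nat a * infcoef (dser k t) (k 0) (Suc a) = of_nat (k 0) * (gser k t ^ a) $ (k 0 - a)"
        using a by (intro infcoef_Suc) auto
      moreover have "?v (0, Suc a) = infcoef (dser k t) (k 0) (Suc a) / of_nat (k 0)"
        using a by (intro hpoint_inf) auto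
      ultimately have "of_nat a * ?v (0, Suc a) = pcoef k t 0 (k 0) a"
        using k0 ak by (simp add: pcoef_def)
      then show "pcoef k t 0 (k 0) a * z ^ (a - 1) = ?v (0, Suc a) * (of_nat (Suc a - 1) * z ^ (Suc a - 2))"
        by (simp add: numeral_2_eq_2 mult_ac)
    qed
    also have "\<dots> = (\<Sum>a=2..<k 0. ?v (0, a) * (of_nat (a - 1) * z ^ (a - 2)))"
      using sum.shift_bounds_Suc_ivl[of "\<lambda>a. ?v (0, a) * (of_nat (a - 1) * z ^ (a - 2))" 1 "k 0 - 1"] k0
      by (simp add: numeral_2_eq_2)
    also have "\<dots> = (\<Sum>a=1..<k 0. ?v (0, a) * (of_nat (a - 1) * z ^ (a - 2)))"
      by (intro sum.mono_neutral_left) (auto simp: not_le less_Suc_eq numeral_2_eq_2)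
    finally show ?thesis by (simp add: pcoef_def)
  qed
  show ?thesis unfolding D Lamz_def Q by (simp add: sum_negf P del: sum.cl_ivl_Suc)
qed

lemma eventually_not_pole: "\<forall>\<^sub>F w in at 0. p + w \<notin> poles N v"
proof -
  have "\<forall>\<^sub>F w in at 0. w \<notin> (\<lambda>x. x - p) ` poles N v"
    by (intro eventually_not_finite) (auto simp: poles_def)
  then show ?thesis by eventually_elim (auto simp: image_iff)
qed

lemma eventually_not_pole_inf: "\<forall>\<^sub>F w in at 0. 1 / w \<notin> poles N v"
proof -
  have "\<forall>\<^sub>F w in at 0. w \<notin> (\<lambda>x. 1 / x) ` poles N v"
    by (intro eventually_not_finite) (auto simp: poles_def)
  then show ?thesis by eventually_elim (auto simp: image_iff)
qed

text \<open>Residues see only punctured neighbourhoods, so \<open>f\<close> may be replaced by an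
  explicit \<open>g\<close> that agrees with it off the poles. After this all computations take
  place in Laurent series.\<close>

lemma residue_sum_laurent:
  assumes f: "\<And>z. z \<notin> poles N v \<Longrightarrow> f z = g z" and v: "\<And>i. i \<in> {1..N} \<Longrightarrow> v (i, 0) = t (i, 0)"
    and G: "\<And>h i. i \<le> N \<Longrightarrow> h has_laurent_expansion zpar t i \<Longrightarrow> (\<lambda>w. g (h w)) has_laurent_expansion G i"
  shows "residue_sum N v f = (\<Sum>i=0..N. (G i * fls_deriv (zpar t i)) $$ (-1))"
proof -
  have "(\<lambda>w. g (inverse w)) has_laurent_expansion G 0"
    by (rule G) (auto simp: has_laurent_expansion_fls_X_inv)
  also have "?this \<longleftrightarrow> (\<lambda>w. f (1 / w)) has_laurent_expansion G 0"
    using eventually_not_pole_inf[of N v]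
    by (intro has_laurent_expansion_cong) (auto elim!: eventually_mono simp: f inverse_eq_divide)
  finally have "residue_inf f = (G 0 * fls_deriv fls_X_inv) $$ (-1)" by (rule residue_inf_laurent)
  moreover have "residue f (v (i, 0)) = (G i * fls_deriv (zpar t i)) $$ (-1)" if i: "i \<in> {1..N}" for i
  proof -
    have "(\<lambda>w. g (t (i, 0) + w)) has_laurent_expansion G i"
      using i by (intro G) (auto simp: zpar_pos intro!: laurent_expansion_intros)
    also have "?this \<longleftrightarrow> (\<lambda>w. f (t (i, 0) + w)) has_laurent_expansion G i"
      using eventually_not_pole[of "t (i, 0)" N v]
      by (intro has_laurent_expansion_cong) (auto elim!: eventually_mono simp: f)
    finally show ?thesis using has_laurent_expansion_residue i v[OF i] by (auto simp: fls_deriv_zpar)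
  qed
  ultimately show ?thesis
    unfolding residue_sum_def by (simp add: sum.atLeast_Suc_atMost)
qed

section \<open>Pairing and product expressed by residues of series\<close>

context
  fixes N :: nat and k :: "nat \<Rightarrow> nat" and t :: point
  assumes k0: "k 0 \<ge> 2" and ki: "\<forall>i\<in>{1..N}. k i \<ge> 1" and t: "t \<in> hdom N k"
begin

lemma pairing_combination:
  assumes X: "\<And>x. x \<in> idx N k \<Longrightarrow> X x = (\<Sum>b\<in>idx N k. \<xi> b * jac k t b x)"
    and Y: "\<And>x. x \<in> idx N k \<Longrightarrow> Y x = (\<Sum>b\<in>idx N k. \<upsilon> b * jac k t b x)"
  shows "pairing N k (hpoint N k t) X Y = (\<Sum>a\<in>idx N k. \<Sum>b\<in>idx N k. \<xi> a * \<upsilon> b * pairf N k t a b)"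
proof -
  let ?I = "idx N k"
  define G where "G = (\<lambda>i. (\<Sum>b\<in>?I. fls_const (\<xi> b) * Phi fls_const k t b (zpar t i)) * (\<Sum>b\<in>?I. fls_const (\<upsilon> b) * Phi fls_const k t b (zpar t i))
      / Lamz fls_const N k t (zpar t i))"
  have "residue_sum N (hpoint N k t) (\<lambda>z. along N k (hpoint N k t) X z * along N k (hpoint N k t) Y z / deriv (lam N k (hpoint N k t)) z)
     = (\<Sum>i=0..N. (G i * fls_deriv (zpar t i)) $$ (-1))"
  proof (rule residue_sum_laurent)
    show "along N k (hpoint N k t) X z * along N k (hpoint N k t) Y z / deriv (lam N k (hpoint N k t)) z =
       (\<Sum>b\<in>?I. \<xi> b * Phi (\<lambda>x. x) k t b z) * (\<Sum>b\<in>?I. \<upsilon> b * Phi (\<lambda>x. x) k t b z) / Lamz (\<lambda>x. x) N k t z"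
      if "z \<notin> poles N (hpoint N k t)" for z
      using along_combination[OF ki that, of X \<xi>] along_combination[OF ki that, of Y \<upsilon>] X Y deriv_lam[of k N, OF k0 ki that] by simp
    show "(\<lambda>w. (\<Sum>b\<in>?I. \<xi> b * Phi (\<lambda>x. x) k t b (h w)) * (\<Sum>b\<in>?I. \<upsilon> b * Phi (\<lambda>x. x) k t b (h w)) / Lamz (\<lambda>x. x) N k t (h w))
       has_laurent_expansion G i" if "h has_laurent_expansion zpar t i" for h i
      unfolding G_def by (intro laurent_expansion_intros Phi_laurent Lamz_laurent that)
  qed (simp add: hpoint_pole)
  also have "\<dots> = (\<Sum>i=0..N. \<Sum>a\<in>?I. \<Sum>b\<in>?I. \<xi> a * \<upsilon> b * (Phi fls_const k t a (zpar t i) * Phi fls_const k t b (zpar t i)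
      / Lamz fls_const N k t (zpar t i) * fls_deriv (zpar t i)) $$ (-1))"
  proof (intro sum.cong refl)
    fix i
    have "G i * fls_deriv (zpar t i) = (\<Sum>a\<in>?I. \<Sum>b\<in>?I. fls_const (\<xi> a * \<upsilon> b) * (Phi fls_const k t a (zpar t i) * Phi fls_const k t b (zpar t i)
      / Lamz fls_const N k t (zpar t i) * fls_deriv (zpar t i)))"
      unfolding G_def sum_product unfolding sum_divide_distrib sum_distrib_right
      by (intro sum.cong refl) (simp add: mult_ac flip: fls_const_mult_const)
    then show "(G i * fls_deriv (zpar t i)) $$ (-1) = (\<Sum>a\<in>?I. \<Sum>b\<in>?I. \<xi> a * \<upsilon> b * (Phi fls_const k t a (zpar t i) * Phi fls_const k t b (zpar t i)
      / Lamz fls_const N k t (zpar t i) * fls_deriv (zpar t i)) $$ (-1))"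
      by (simp only: fls_nth_sum fls_mult_const_nth)
  qed
  also have "\<dots> = (\<Sum>a\<in>?I. \<Sum>b\<in>?I. \<xi> a * \<upsilon> b * - pairf N k t a b)"
    unfolding pairf_def minus_minus sum_distrib_left
    by (subst sum.swap, intro sum.cong refl, subst sum.swap, rule refl)
  finally show ?thesis unfolding pairing_def by (simp add: sum_negf)
qed

lemma triple_combination:
  assumes X: "\<And>x. x \<in> idx N k \<Longrightarrow> X x = jac k t a x" and Y: "\<And>x. x \<in> idx N k \<Longrightarrow> Y x = jac k t b x"
    and Z: "\<And>x. x \<in> idx N k \<Longrightarrow> Z x = (\<Sum>b\<in>idx N k. \<zeta> b * jac k t b x)"
    and a: "a \<in> idx N k" and b: "b \<in> idx N k"
  shows "triple N k (hpoint N k t) X Y Z = (\<Sum>c\<in>idx N k. \<zeta> c * tripf N k t a b c)"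
proof -
  let ?I = "idx N k"
  define G where "G = (\<lambda>i. Phi fls_const k t a (zpar t i) * Phi fls_const k t b (zpar t i) * (\<Sum>c\<in>?I. fls_const (\<zeta> c) * Phi fls_const k t c (zpar t i))
      / Lamz fls_const N k t (zpar t i))"
  have one: "along N k (hpoint N k t) X z = Phi (\<lambda>x. x) k t a z" if z: "z \<notin> poles N (hpoint N k t)"
     and X: "\<And>x. x \<in> idx N k \<Longrightarrow> X x = jac k t a x" and a: "a \<in> idx N k" for z X a
    using along_combination[OF ki z, of X "\<lambda>b. if b = a then 1 else 0"] X a
    by (simp add: if_distrib[of "\<lambda>x. x * _"] cong: if_cong)
  have "residue_sum N (hpoint N k t) (\<lambda>z. along N k (hpoint N k t) X z * along N k (hpoint N k t) Y z * along N k (hpoint N k t) Z z / deriv (lam N k (hpoint N k t)) z)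
     = (\<Sum>i=0..N. (G i * fls_deriv (zpar t i)) $$ (-1))"
  proof (rule residue_sum_laurent)
    show "along N k (hpoint N k t) X z * along N k (hpoint N k t) Y z * along N k (hpoint N k t) Z z / deriv (lam N k (hpoint N k t)) z =
       Phi (\<lambda>x. x) k t a z * Phi (\<lambda>x. x) k t b z * (\<Sum>c\<in>?I. \<zeta> c * Phi (\<lambda>x. x) k t c z) / Lamz (\<lambda>x. x) N k t z"
      if "z \<notin> poles N (hpoint N k t)" for z
      using one[OF that X a] one[OF that Y b] along_combination[OF ki that, of Z \<zeta>] Z deriv_lam[of k N, OF k0 ki that] by simp
    show "(\<lambda>w. Phi (\<lambda>x. x) k t a (h w) * Phi (\<lambda>x. x) k t b (h w) * (\<Sum>c\<in>?I. \<zeta> c * Phi (\<lambda>x. x) k t c (h w)) / Lamz (\<lambda>x. x) N k t (h w))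
       has_laurent_expansion G i" if "h has_laurent_expansion zpar t i" for h i
      unfolding G_def by (intro laurent_expansion_intros Phi_laurent Lamz_laurent that)
  qed (simp add: hpoint_pole)
  also have "\<dots> = (\<Sum>i=0..N. \<Sum>c\<in>?I. \<zeta> c * (Phi fls_const k t a (zpar t i) * Phi fls_const k t b (zpar t i) * Phi fls_const k t c (zpar t i)
      / Lamz fls_const N k t (zpar t i) * fls_deriv (zpar t i)) $$ (-1))"
  proof (intro sum.cong refl)
    fix i
    have "G i * fls_deriv (zpar t i) = (\<Sum>c\<in>?I. fls_const (\<zeta> c) * (Phi fls_const k t a (zpar t i) * Phi fls_const k t b (zpar t i) * Phi fls_const k t c (zpar t i)
      / Lamz fls_const N k t (zpar t i) * fls_deriv (zpar t i)))"
      unfolding G_def sum_distrib_left sum_divide_distrib sum_distrib_right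
      by (intro sum.cong refl) (simp add: mult_ac)
    then show "(G i * fls_deriv (zpar t i)) $$ (-1) = (\<Sum>c\<in>?I. \<zeta> c * (Phi fls_const k t a (zpar t i) * Phi fls_const k t b (zpar t i) * Phi fls_const k t c (zpar t i)
      / Lamz fls_const N k t (zpar t i) * fls_deriv (zpar t i)) $$ (-1))"
      by (simp only: fls_nth_sum fls_mult_const_nth)
  qed
  also have "\<dots> = (\<Sum>c\<in>?I. \<zeta> c * - tripf N k t a b c)"
    unfolding tripf_def minus_minus sum_distrib_left by (rule sum.swap)
  finally show ?thesis unfolding triple_def by (simp add: sum_negf)
qed

lemma flat_vec_comb:
  assumes "b \<in> idx N k" "x \<in> idx N k"
  shows "flat_vec N k b t x = (\<Sum>c\<in>idx N k. (if c = b then 1 else 0) * jac k t c x)"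
proof -
  have "(\<Sum>c\<in>idx N k. (if c = b then 1 else 0) * jac k t c x) = (\<Sum>c\<in>idx N k. if c = b then jac k t b x else 0)"
    by (intro sum.cong) auto
  then show ?thesis using assms by (simp add: flat_vec_eq[of k N, OF k0 ki t assms(1)])
qed

lemma flat_eta_eq:
  assumes "a \<in> idx N k" "b \<in> idx N k"
  shows "flat_eta N k a b t = eta0 k a b"
proof -
  have "flat_eta N k a b t = (\<Sum>x\<in>idx N k. \<Sum>y\<in>idx N k. (if x = a then 1 else 0) * (if y = b then 1 else 0) * pairf N k t x y)"
    unfolding flat_eta_def flat_pt_eq[of k N, OF k0 ki t]
    by (rule pairing_combination) (use assms flat_vec_comb in auto)
  also have "\<dots> = (\<Sum>x\<in>idx N k. if x = a then pairf N k t x b else 0)"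
    using assms by (intro sum.cong refl) (simp add: if_distrib[of "\<lambda>x. x * _"] cong: if_cong)
  also have "\<dots> = pairf N k t a b" using assms by simp
  finally show ?thesis using pairf_eq_eta0[of k N, OF k0 ki t assms] by simp
qed

lemma triple_flat:
  assumes "a \<in> idx N k" "b \<in> idx N k" "c \<in> idx N k"
  shows "triple N k (flat_pt N k t) (flat_vec N k a t) (flat_vec N k b t) (flat_vec N k c t) = tripf N k t a b c"
proof -
  have "triple N k (flat_pt N k t) (flat_vec N k a t) (flat_vec N k b t) (flat_vec N k c t) =
      (\<Sum>d\<in>idx N k. (if d = c then 1 else 0) * tripf N k t a b d)"
    unfolding flat_pt_eq[of k N, OF k0 ki t]
    by (rule triple_combination) (use assms flat_vec_eq[of k N, OF k0 ki t] flat_vec_comb in auto)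
  also have "\<dots> = tripf N k t a b c"
    using assms by (simp add: if_distrib[of "\<lambda>x. x * _"] cong: if_cong)
  finally show ?thesis .
qed

lemma eta_inv_eq: "eta_inv N k t = (\<lambda>a b. if a \<in> idx N k \<and> b \<in> idx N k then ieta k a b else 0)"
  unfolding eta_inv_def
proof (rule the_equality)
  have "(\<Sum>c\<in>idx N k. (if a \<in> idx N k \<and> c \<in> idx N k then ieta k a c else 0) * flat_eta N k c b t) = (if a = b then 1 else 0)"
    if "a \<in> idx N k" "b \<in> idx N k" for a b
    using ieta_eta0[of k N, OF k0 ki that] that by (simp add: flat_eta_eq cong: sum.cong)
  then show "(\<forall>a b. a \<notin> idx N k \<or> b \<notin> idx N k \<longrightarrow> (if a \<in> idx N k \<and> b \<in> idx N k then ieta k a b else 0) = 0) \<and>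
    (\<forall>a\<in>idx N k. \<forall>b\<in>idx N k. (\<Sum>c\<in>idx N k. (if a \<in> idx N k \<and> c \<in> idx N k then ieta k a c else 0) * flat_eta N k c b t) = (if a = b then 1 else 0))"
    by auto
  fix h assume h: "(\<forall>a b. a \<notin> idx N k \<or> b \<notin> idx N k \<longrightarrow> h a b = 0) \<and>
    (\<forall>a\<in>idx N k. \<forall>b\<in>idx N k. (\<Sum>c\<in>idx N k. h a c * flat_eta N k c b t) = (if a = b then 1 else 0))"
  show "h = (\<lambda>a b. if a \<in> idx N k \<and> b \<in> idx N k then ieta k a b else 0)"
  proof (rule ieta_unique[of k N, OF k0 ki])
    show "h a b = 0" if "a \<notin> idx N k \<or> b \<notin> idx N k" for a b using h that by blast
    show "(\<Sum>c\<in>idx N k. h a c * eta0 k c b) = (if a = b then 1 else 0)" if "a \<in> idx N k" "b \<in> idx N k" for a b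
    proof -
      have "(\<Sum>c\<in>idx N k. h a c * eta0 k c b) = (\<Sum>c\<in>idx N k. h a c * flat_eta N k c b t)"
        using that by (intro sum.cong) (auto simp: flat_eta_eq)
      then show ?thesis using h that by simp
    qed
  qed
qed

lemma lower_ieta:
  assumes "c \<in> idx N k"
  shows "(\<Sum>d\<in>idx N k. (\<Sum>e\<in>idx N k. T e * ieta k e d) * eta0 k d c) = T c"
proof -
  have "(\<Sum>d\<in>idx N k. (\<Sum>e\<in>idx N k. T e * ieta k e d) * eta0 k d c) = (\<Sum>e\<in>idx N k. T e * (\<Sum>d\<in>idx N k. ieta k e d * eta0 k d c))"
    unfolding sum_distrib_right sum_distrib_left by (subst sum.swap) (simp add: mult.assoc)
  also have "\<dots> = (\<Sum>e\<in>idx N k. if e = c then T c else 0)"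
    using assms by (intro sum.cong refl) (auto simp: ieta_eta0[of k N, OF k0 ki])
  finally show ?thesis using assms by simp
qed

lemma pairing_basis_left:
  assumes X: "\<And>x. x \<in> idx N k \<Longrightarrow> X x = (\<Sum>b\<in>idx N k. \<xi> b * jac k t b x)"
    and Y: "\<And>x. x \<in> idx N k \<Longrightarrow> Y x = (\<Sum>b\<in>idx N k. \<upsilon> b * jac k t b x)"
  shows "pairing N k (hpoint N k t) X Y = (\<Sum>c\<in>idx N k. \<upsilon> c * (\<Sum>d\<in>idx N k. \<xi> d * eta0 k d c))"
proof -
  have "pairing N k (hpoint N k t) X Y = (\<Sum>a\<in>idx N k. \<Sum>b\<in>idx N k. \<xi> a * \<upsilon> b * pairf N k t a b)"
    by (rule pairing_combination[OF X Y])
  also have "\<dots> = (\<Sum>c\<in>idx N k. \<Sum>d\<in>idx N k. \<upsilon> c * (\<xi> d * eta0 k d c))"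
    by (subst sum.swap, intro sum.cong refl) (simp add: pairf_eq_eta0[of k N, OF k0 ki t] mult_ac)
  finally show ?thesis by (simp add: sum_distrib_left)
qed

text \<open>Raising the last index of \<open>tripf\<close> with \<open>ieta\<close> gives a vector
  with the required pairings. A vector with the same pairings has the same coordinates: testing it
  against the field of index \<open>dual k d\<close> isolates the coefficient of index
  \<open>d\<close>.\<close>

lemma hf_prod_eq:
  assumes a: "a \<in> idx N k" and b: "b \<in> idx N k"
  shows "hf_prod N k (flat_pt N k t) (flat_vec N k a t) (flat_vec N k b t) =
     (\<lambda>x. \<Sum>d\<in>idx N k. (\<Sum>e\<in>idx N k. tripf N k t a b e * ieta k e d) * flat_vec N k d t x)"
  unfolding hf_prod_def
proof (rule the_equality)
  let ?I = "idx N k"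
  let ?C = "\<lambda>d. \<Sum>e\<in>?I. tripf N k t a b e * ieta k e d"
  let ?W = "\<lambda>x. \<Sum>d\<in>?I. ?C d * flat_vec N k d t x"
  have W: "?W x = (\<Sum>d\<in>?I. ?C d * jac k t d x)" if "x \<in> ?I" for x
    using that by (intro sum.cong refl) (simp add: flat_vec_eq[of k N, OF k0 ki t])
  have tr: "triple N k (flat_pt N k t) (flat_vec N k a t) (flat_vec N k b t) Z = (\<Sum>c\<in>?I. \<zeta> c * tripf N k t a b c)"
    if "\<And>x. x \<in> ?I \<Longrightarrow> Z x = (\<Sum>b\<in>?I. \<zeta> b * jac k t b x)" for Z \<zeta>
    unfolding flat_pt_eq[of k N, OF k0 ki t]
    by (rule triple_combination) (use a b that flat_vec_eq[of k N, OF k0 ki t] in auto)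
  show "(\<forall>x. x \<notin> ?I \<longrightarrow> ?W x = 0) \<and> (\<forall>Z. pairing N k (flat_pt N k t) ?W Z =
     triple N k (flat_pt N k t) (flat_vec N k a t) (flat_vec N k b t) Z)"
  proof (intro conjI allI impI)
    fix x assume "x \<notin> ?I"
    then show "?W x = 0" by (intro sum.neutral) (simp add: flat_vec_eq[of k N, OF k0 ki t])
  next
    fix Z
    obtain \<zeta> where \<zeta>: "\<And>x. x \<in> ?I \<Longrightarrow> Z x = (\<Sum>b\<in>?I. \<zeta> b * jac k t b x)"
      using in_span_all[OF ki t, of Z] unfolding in_span_def by blast
    have "pairing N k (flat_pt N k t) ?W Z = (\<Sum>c\<in>?I. \<zeta> c * (\<Sum>d\<in>?I. ?C d * eta0 k d c))"
      unfolding flat_pt_eq[of k N, OF k0 ki t] by (rule pairing_basis_left[OF W \<zeta>])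
    also have "\<dots> = (\<Sum>c\<in>?I. \<zeta> c * tripf N k t a b c)"
      by (intro sum.cong refl) (simp add: lower_ieta)
    finally show "pairing N k (flat_pt N k t) ?W Z = triple N k (flat_pt N k t) (flat_vec N k a t) (flat_vec N k b t) Z"
      by (simp add: tr[OF \<zeta>])
  qed
  fix V assume V: "(\<forall>x. x \<notin> ?I \<longrightarrow> V x = 0) \<and> (\<forall>Z. pairing N k (flat_pt N k t) V Z =
     triple N k (flat_pt N k t) (flat_vec N k a t) (flat_vec N k b t) Z)"
  obtain \<xi> where \<xi>: "\<And>x. x \<in> ?I \<Longrightarrow> V x = (\<Sum>b\<in>?I. \<xi> b * jac k t b x)"
    using in_span_all[OF ki t, of V] unfolding in_span_def by blast
  have lo: "(\<Sum>d\<in>?I. \<xi> d * eta0 k d c) = tripf N k t a b c" if c: "c \<in> ?I" for c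
  proof -
    have "pairing N k (flat_pt N k t) V (flat_vec N k c t) = (\<Sum>y\<in>?I. (if y = c then 1 else 0) * (\<Sum>d\<in>?I. \<xi> d * eta0 k d y))"
      unfolding flat_pt_eq[of k N, OF k0 ki t] by (rule pairing_basis_left[OF \<xi> flat_vec_comb[OF c]])
    moreover have "triple N k (flat_pt N k t) (flat_vec N k a t) (flat_vec N k b t) (flat_vec N k c t) = tripf N k t a b c"
      by (rule triple_flat[OF a b c])
    ultimately show ?thesis using V c by (simp add: if_distrib[of "\<lambda>x. x * _"] cong: if_cong)
  qed
  have "\<xi> d = ?C d" if d: "d \<in> ?I" for d
  proof -
    have dd: "dual k d \<in> ?I" "dual k (dual k d) = d" using dual_idx_dual[of k N, OF k0 ki d] by auto
    have nz: "eta0 k d (dual k d) \<noteq> 0" using eta0_dual[of k N, OF k0 ki d dd(1)] by simp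
    have pick: "(\<Sum>x\<in>?I. f x * eta0 k x (dual k d)) = f d * eta0 k d (dual k d)" for f
    proof -
      have "(\<Sum>x\<in>?I. f x * eta0 k x (dual k d)) = (\<Sum>x\<in>?I. if x = d then f d * eta0 k d (dual k d) else 0)"
      proof (intro sum.cong refl)
        fix x assume x: "x \<in> ?I"
        show "f x * eta0 k x (dual k d) = (if x = d then f d * eta0 k d (dual k d) else 0)"
        proof (cases "x = d")
          case False
          have "dual k d \<noteq> dual k x" using False dual_idx_dual[of k N, OF k0 ki x] dd(2) by metis
          then show ?thesis using eta0_dual[of k N, OF k0 ki x dd(1)] False by simp
        qed simp
      qed
      then show ?thesis using d by simp
    qed
    have "\<xi> d * eta0 k d (dual k d) = ?C d * eta0 k d (dual k d)"
      using lo[OF dd(1)] lower_ieta[OF dd(1), of "tripf N k t a b"] unfolding pick by simp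
    then show ?thesis using nz by simp
  qed
  then have eq: "V x = ?W x" if "x \<in> ?I" for x unfolding \<xi>[OF that] W[OF that] by (intro sum.cong) auto
  show "V = ?W"
  proof
    fix x
    show "V x = ?W x"
    proof (cases "x \<in> ?I")
      case False
      then have "?W x = 0" by (intro sum.neutral) (auto simp: flat_vec_eq[of k N, OF k0 ki t])
      moreover have "V x = 0" using V False by blast
      ultimately show ?thesis by simp
    qed (rule eq)
  qed
qed

end

section \<open>The open WDVV equation\<close>

lemma shift_fraction:
  fixes Z y c x :: "'f::field"
  assumes "y * x = 1" "Z = y + c"
  shows "Z ^ Suc m * x ^ Suc b = Z ^ m * x ^ b + c * (Z ^ m * x ^ Suc b)"
proof -
  have "Z ^ Suc m = (y + c) * Z ^ m" using assms(2) by simp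
  then have "Z ^ Suc m * x ^ Suc b = Z ^ m * x ^ b * (y * x) + c * (Z ^ m * x ^ Suc b)" by (simp add: algebra_simps)
  then show ?thesis using assms(1) by simp
qed

lemma partial_fraction_step:
  fixes x y K :: "'f::field"
  assumes "x * y = K * (x - y)"
  shows "x ^ Suc c * y ^ Suc d = K * (x ^ Suc c * y ^ d - x ^ c * y ^ Suc d)"
proof -
  have "x ^ Suc c * y ^ Suc d = (x * y) * (x ^ c * y ^ d)" by (simp add: mult_ac)
  also have "\<dots> = K * (x ^ Suc c * y ^ d - x ^ c * y ^ Suc d)" unfolding assms by (simp add: algebra_simps)
  finally show ?thesis .
qed

lemma inverse_diff_field:
  fixes X Y :: "'f::field"
  shows "X \<noteq> 0 \<Longrightarrow> Y \<noteq> 0 \<Longrightarrow> inverse X - inverse Y = (Y - X) * (inverse X * inverse Y)"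
  by (simp add: field_simps)

lemma inverse_times_square: "A \<noteq> 0 \<Longrightarrow> inverse A * A ^ 2 = (A :: 'f::field)"
  by (simp add: power2_eq_square)

lemma difference_of_fractions:
  fixes x y Z P T :: "'f::field"
  assumes "x * (Z - T) = 1" "y * (P - T) = 1"
  shows "x - y = - (Z - P) * (x * y)"
proof -
  have "x * (y * (P - T)) - y * (x * (Z - T)) = - (Z - P) * (x * y)" by (simp add: algebra_simps)
  then show ?thesis using assms by simp
qed

context
  fixes N :: nat and k :: "nat \<Rightarrow> nat" and t :: point
  assumes k0: "k 0 \<ge> 2" and ki: "\<forall>i\<in>{1..N}. k i \<ge> 1" and t: "t \<in> hdom N k"
    and distinct_new: "\<forall>i\<in>{1..N}. t (Suc N, 0) \<noteq> t (i, 0)"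
begin

abbreviation (input) "PH x j \<equiv> Phi fls_const k t x (zpar t j)"
abbreviation (input) "LM j \<equiv> Lamz fls_const N k t (zpar t j)"
abbreviation (input) "p \<equiv> t (Suc N, 0)"
abbreviation (input) "zp j \<equiv> inverse (zpar t j - fls_const p)"

section \<open>Sums of residues over the poles of the smaller manifold\<close>

definition total_residue :: "(nat \<Rightarrow> complex fls) \<Rightarrow> complex" where
  "total_residue F = (\<Sum>j=0..N. (F j * fls_deriv (zpar t j)) $$ (-1))"

lemma total_residue_add: "total_residue (\<lambda>j. F j + G j) = total_residue F + total_residue G"
  by (simp add: total_residue_def distrib_right sum.distrib)

lemma total_residue_diff: "total_residue (\<lambda>j. F j - G j) = total_residue F - total_residue G"
  by (simp add: total_residue_def left_diff_distrib sum_subtractf)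

lemma total_residue_scale: "total_residue (\<lambda>j. fls_const c * F j) = c * total_residue F"
  by (simp add: total_residue_def mult.assoc sum_distrib_left)

lemma total_residue_sum: "total_residue (\<lambda>j. \<Sum>x\<in>A. F x j) = (\<Sum>x\<in>A. total_residue (F x))"
  unfolding total_residue_def by (simp add: sum_distrib_right fls_nth_sum sum.swap[of _ A])

lemma total_residue_cong: "(\<And>j. j \<le> N \<Longrightarrow> F j = G j) \<Longrightarrow> total_residue F = total_residue G"
  by (simp add: total_residue_def)

lemma zpar_minus_nz: "zpar t j - fls_const c \<noteq> 0"
proof -
  have "(zpar t j - fls_const c) $$ (if j = 0 then -1 else 1) \<noteq> 0" by (auto simp: zpar_def)
  then show ?thesis by (metis fls_zero_nth)
qed

lemma new_pole_neq: "i \<in> {1..N} \<Longrightarrow> t (Suc N, 0) \<noteq> t (i, 0)"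
  using distinct_new by blast

lemma poles_eq_iff: "i \<in> {1..N} \<Longrightarrow> j \<in> {1..N} \<Longrightarrow> t (i, 0) = t (j, 0) \<longleftrightarrow> i = j"
  using t inj_on_eq_iff[of "\<lambda>i. t (i, 0)" "{1..N}" i j] by (simp add: hdom_def)

lemma residue_zpar_power:
  assumes "n \<noteq> -1"
  shows "total_residue (\<lambda>j. (zpar t j - fls_const c) powi n) = 0"
proof -
  have "((zpar t j - fls_const c) powi n * fls_deriv (zpar t j)) $$ (-1) = 0" for j
  proof -
    have "fls_deriv ((zpar t j - fls_const c) powi (n + 1)) = of_int (n + 1) * ((zpar t j - fls_const c) powi n * fls_deriv (zpar t j))"
      by (subst fls_deriv_power_int[OF zpar_minus_nz]) (simp add: mult.assoc)
    then have "of_int (n + 1) * ((zpar t j - fls_const c) powi n * fls_deriv (zpar t j)) $$ (-1) = 0"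
      by (metis fls_deriv_residue fls_mult_of_int_nth(1))
    then show ?thesis using assms
      by (metis mult_eq_0_iff of_int_eq_0_iff eq_neg_iff_add_eq_0)
  qed
  then show ?thesis by (simp add: total_residue_def)
qed

text \<open>The residue at infinity is \<open>-1\<close>, and the one at \<open>c\<close>
  compensates it exactly if \<open>c\<close> is among the poles. For \<open>c = p\<close> the sum
  stays \<open>-1\<close>; every value at \<open>p\<close> below comes from this.\<close>

lemma residue_zpar_inverse:
  "total_residue (\<lambda>j. inverse (zpar t j - fls_const c)) = (if c \<in> (\<lambda>i. t (i, 0)) ` {1..N} then 0 else -1)"
proof -
  have inf: "(inverse (zpar t 0 - fls_const c) * fls_deriv (zpar t 0)) $$ (-1) = -1"
  proof -
    define u where "u = 1 - fls_const c * fls_X"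
    have u: "ord_ge 0 u" "u $$ 0 = 1" by (auto simp: u_def intro!: ord_ge_diff ord_ge_const_mult simp: ord_ge_def)
    then have "u \<noteq> 0" by auto
    have "fls_X_inv - fls_const c = fls_X_inv * u"
    proof -
      have "fls_X_inv * u = fls_X_inv - fls_const c * (fls_X_inv * fls_X)" by (simp add: u_def right_diff_distrib mult.left_commute)
      moreover have "fls_X_inv * fls_X = (1 :: complex fls)" by (simp flip: fls_inverse_X)
      ultimately show ?thesis by simp
    qed
    moreover have "inverse (fls_X_inv * u) * fls_deriv fls_X_inv = - (fls_X_inv * inverse u)"
    proof -
      have "inverse fls_X_inv * (fls_X_inv ^ 2) = (fls_X_inv :: complex fls)"
        by (rule inverse_times_square) auto
      then have "inverse u * (inverse fls_X_inv * fls_X_inv ^ 2) = inverse u * fls_X_inv" by (rule arg_cong)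
      moreover have "fls_deriv fls_X_inv = - (fls_X_inv ^ 2 :: complex fls)" by (rule fls_deriv_X_inv)
      ultimately show ?thesis by (simp only: inverse_mult_distrib mult_minus_right mult_ac)
    qed
    moreover have "(fls_X_inv * inverse u) $$ (-1) = 1"
      using nth_0_inverse[OF u(1)] u(2) by (simp add: fls_X_inv_times_conv_shift)
    ultimately show ?thesis by (simp del: fls_deriv_X_inv inverse_mult_distrib)
  qed
  have fin: "(inverse (zpar t i - fls_const c) * fls_deriv (zpar t i)) $$ (-1) = (if c = t (i, 0) then 1 else 0)" if "i \<in> {1..N}" for i
  proof (cases "c = t (i, 0)")
    case True
    then show ?thesis using that by (simp add: zpar_pos fls_inverse_X)
  next
    case False
    have "ord_ge 0 (inverse ((fls_const (t (i, 0)) + fls_X - fls_const c) ^ 1))"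
      using False by (intro ord_ge_inverse_regular) (auto simp: ord_ge_def)
    then have "inverse (fls_const (t (i, 0)) + fls_X - fls_const c) $$ (-1) = 0" by (simp add: ord_ge_nth)
    then show ?thesis using that False by (simp add: zpar_pos)
  qed
  have "total_residue (\<lambda>j. inverse (zpar t j - fls_const c)) = -1 + (\<Sum>i=1..N. if c = t (i, 0) then 1 else 0)"
    unfolding total_residue_def using inf fin by (simp add: sum.atLeast_Suc_atMost)
  also have "(\<Sum>i=1..N. if c = t (i, 0) then 1 else 0) = (if c \<in> (\<lambda>i. t (i, 0)) ` {1..N} then 1 else (0::complex))"
  proof (cases "c \<in> (\<lambda>i. t (i, 0)) ` {1..N}")
    case True
    then obtain i where i: "i \<in> {1..N}" "c = t (i, 0)" by auto
    have "(\<Sum>j=1..N. if c = t (j, 0) then 1 else 0) = (\<Sum>j=1..N. if j = i then 1 else (0::complex))"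
      using i by (intro sum.cong) (auto simp: poles_eq_iff)
    then show ?thesis using i True by simp
  next
    case False
    then have "c \<noteq> t (i, 0)" if "i \<in> {1..N}" for i using that by blast
    then have "(\<Sum>i=1..N. if c = t (i, 0) then 1 else 0) = (0 :: complex)" by (intro sum.neutral) auto
    then show ?thesis using False by simp
  qed
  finally show ?thesis by simp
qed

text \<open>The sum of the residues of a rational function with poles in \<open>\<infinity>\<close> and the \<open>t\<^sub>i\<^sub>,\<^sub>0\<close> vanishes;
  products of simple fractions are decomposed by
  \<open>1 / ((z - p) (z - q)) = (1 / (z - p) - 1 / (z - q)) / (p - q)\<close>.\<close>

lemma residue_mono: "total_residue (\<lambda>j. zpar t j ^ m) = 0"
  using residue_zpar_power[of "int m" 0] by simp

lemma residue_frac: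
  assumes "i \<in> {1..N}"
  shows "total_residue (\<lambda>j. inverse (zpar t j - fls_const (t (i, 0))) ^ a) = 0"
proof (cases "a = 1")
  case False
  then show ?thesis using residue_zpar_power[of "- int a" "t (i, 0)"] by (simp add: power_int_minus power_inverse)
qed (use residue_zpar_inverse[of "t (i, 0)"] assms in auto)

lemma residue_mono_frac:
  assumes i: "i \<in> {1..N}"
  shows "total_residue (\<lambda>j. zpar t j ^ m * inverse (zpar t j - fls_const (t (i, 0))) ^ a) = 0"
proof (induction m arbitrary: a)
  case (Suc m)
  note IH = Suc
  show ?case
  proof (cases a)
    case (Suc b)
    define y where "y = (\<lambda>j. zpar t j - fls_const (t (i, 0)))"
    have "zpar t j ^ Suc m * inverse (y j) ^ a = zpar t j ^ m * inverse (y j) ^ b + fls_const (t (i, 0)) * (zpar t j ^ m * inverse (y j) ^ a)" for j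
      unfolding Suc by (intro shift_fraction[of "y j"]) (simp_all only: y_def right_inverse[OF zpar_minus_nz] diff_add_cancel)
    then show ?thesis using IH[of b] IH[of a] by (simp add: y_def total_residue_add total_residue_scale)
  qed (use residue_mono[of "Suc m"] in simp)
qed (use residue_frac[OF i] in simp)

lemma residue_frac_frac:
  assumes i: "i \<in> {1..N}" and l: "l \<in> {1..N}"
  shows "total_residue (\<lambda>j. inverse (zpar t j - fls_const (t (i, 0))) ^ a * inverse (zpar t j - fls_const (t (l, 0))) ^ b) = 0"
proof (cases "i = l")
  case True
  then show ?thesis using residue_frac[OF i, of "a + b"] by (simp add: power_add)
next
  case False
  then have nz: "t (i, 0) \<noteq> t (l, 0)" by (simp add: poles_eq_iff[OF i l])
  define x where "x = (\<lambda>j. inverse (zpar t j - fls_const (t (i, 0))))"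
  define y where "y = (\<lambda>j. inverse (zpar t j - fls_const (t (l, 0))))"
  have xy: "x j * y j = fls_const (1 / (t (i, 0) - t (l, 0))) * (x j - y j)" for j
  proof -
    let ?D = "fls_const (t (i, 0) - t (l, 0))"
    have K: "fls_const (1 / (t (i, 0) - t (l, 0))) * ?D = 1" using nz by simp
    have "(zpar t j - fls_const (t (l, 0))) - (zpar t j - fls_const (t (i, 0))) = ?D" by (simp add: fls_const_diff)
    then have "x j - y j = ?D * (x j * y j)"
      using inverse_diff_field[OF zpar_minus_nz[of j "t (i, 0)"] zpar_minus_nz[of j "t (l, 0)"]] by (simp only: x_def y_def)
    then have "fls_const (1 / (t (i, 0) - t (l, 0))) * (x j - y j) = (fls_const (1 / (t (i, 0) - t (l, 0))) * ?D) * (x j * y j)"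
      by (simp only: mult.assoc)
    then show ?thesis unfolding K by simp
  qed
  have "total_residue (\<lambda>j. x j ^ a * y j ^ b) = 0"
  \<comment> \<open>Each partial fraction step lowers \<open>a + b\<close> by one, until one of the
    exponents is \<open>0\<close>.\<close>
  proof (induction "a + b" arbitrary: a b rule: less_induct)
    case less
    show ?case
    proof (cases "a = 0 \<or> b = 0")
      case True
      then show ?thesis using residue_frac[OF i, of a] residue_frac[OF l, of b]
        unfolding x_def y_def by (elim disjE) simp_all
    next
      case F: False
      then obtain c d where ab: "a = Suc c" "b = Suc d" by (cases a; cases b) auto
      have "x j ^ a * y j ^ b = fls_const (1 / (t (i, 0) - t (l, 0))) * (x j ^ a * y j ^ d - x j ^ c * y j ^ b)" for j
        unfolding ab by (rule partial_fraction_step[OF xy])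
      moreover have "total_residue (\<lambda>j. x j ^ a * y j ^ d) = 0" "total_residue (\<lambda>j. x j ^ c * y j ^ b) = 0"
        by (rule less; simp add: ab)+
      ultimately show ?thesis by (simp add: total_residue_scale total_residue_diff)
    qed
  qed
  then show ?thesis by (simp add: x_def y_def)
qed

lemma residue_Phi: "x \<in> idx N k \<Longrightarrow> total_residue (PH x) = 0"
proof (cases x)
  fix i \<alpha> assume x: "x \<in> idx N k" "x = (i, \<alpha>)"
  show ?thesis
  proof (cases "i = 0")
    case True
    then show ?thesis by (simp add: x Phi_0 total_residue_sum total_residue_scale residue_mono)
  next
    case False
    then have "i \<in> {1..N}" using x by (auto simp: idx_iff)
    then show ?thesis using False
      by (simp add: x Phi_pos total_residue_sum total_residue_scale residue_frac power_inverse[symmetric] del: sum.cl_ivl_Suc power_inverse)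
  qed
qed

lemma residue_Phi_Phi:
  assumes "x \<in> idx N k" "y \<in> idx N k"
  shows "total_residue (\<lambda>j. PH x j * PH y j) = 0"
proof -
  obtain i \<alpha> l \<beta> where xy: "x = (i, \<alpha>)" "y = (l, \<beta>)" by (cases x; cases y)
  have il: "i \<noteq> 0 \<Longrightarrow> i \<in> {1..N}" "l \<noteq> 0 \<Longrightarrow> l \<in> {1..N}" using assms by (auto simp: xy idx_iff)
  define m where "m = (\<lambda>i a j. if i = 0 then zpar t j ^ (a - 1) else inverse (zpar t j - fls_const (t (i, 0))) ^ a)"
  have P: "\<exists>n. \<forall>j. PH (i, \<alpha>) j = (\<Sum>a=1..n. fls_const (pcoef k t i \<alpha> a) * m i a j)" for i \<alpha>
    by (cases "i = 0") (auto simp: m_def Phi_0 Phi_pos power_inverse simp del: sum.cl_ivl_Suc)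
  obtain n n' where n: "\<And>j. PH x j = (\<Sum>a=1..n. fls_const (pcoef k t i \<alpha> a) * m i a j)"
    "\<And>j. PH y j = (\<Sum>a=1..n'. fls_const (pcoef k t l \<beta> a) * m l a j)" using P[of i \<alpha>] P[of l \<beta>] unfolding xy by blast
  have mm: "total_residue (\<lambda>j. m i a j * m l b j) = 0" for a b
  proof -
    consider "i = 0" "l = 0" | "i = 0" "l \<noteq> 0" | "i \<noteq> 0" "l = 0" | "i \<noteq> 0" "l \<noteq> 0" by blast
    then show ?thesis
    proof cases
      case 1
      then show ?thesis using residue_mono[of "(a - 1) + (b - 1)"] by (simp add: m_def power_add)
    next
      case 2
      then show ?thesis using residue_mono_frac[OF il(2)] by (simp add: m_def)
    next
      case 3
      then show ?thesis using residue_mono_frac[OF il(1)] by (simp add: m_def mult.commute)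
    next
      case 4
      then show ?thesis using residue_frac_frac[OF il] by (simp add: m_def)
    qed
  qed
  have "PH x j * PH y j = (\<Sum>a=1..n. \<Sum>b=1..n'. fls_const (pcoef k t i \<alpha> a) * (fls_const (pcoef k t l \<beta> b) * (m i a j * m l b j)))" for j
    unfolding n sum_product by (intro sum.cong refl) (simp add: mult_ac)
  then show ?thesis by (simp add: total_residue_sum total_residue_scale mm)
qed

text \<open>The restrictions of tangent vectors to the formal neighbourhoods of the poles.\<close>

definition tspan :: "(nat \<Rightarrow> complex fls) \<Rightarrow> bool" where
  "tspan F \<longleftrightarrow> (\<exists>\<xi>. \<forall>j. F j = (\<Sum>b\<in>idx N k. fls_const (\<xi> b) * PH b j))"

lemma tspan_Phi: "x \<in> idx N k \<Longrightarrow> tspan (PH x)"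
  unfolding tspan_def
proof (intro exI[of _ "\<lambda>b. if b = x then 1 else 0"] allI)
  fix j assume "x \<in> idx N k"
  moreover have "(\<Sum>b\<in>idx N k. fls_const (if b = x then 1 else 0) * PH b j) = (\<Sum>b\<in>idx N k. if b = x then PH b j else 0)"
    by (intro sum.cong) auto
  ultimately show "PH x j = (\<Sum>b\<in>idx N k. fls_const (if b = x then 1 else 0) * PH b j)" by simp
qed

lemma tspan_add: "tspan F \<Longrightarrow> tspan G \<Longrightarrow> tspan (\<lambda>j. F j + G j)"
proof -
  assume "tspan F" "tspan G"
  then obtain \<xi> \<upsilon> where "\<forall>j. F j = (\<Sum>b\<in>idx N k. fls_const (\<xi> b) * PH b j)" "\<forall>j. G j = (\<Sum>b\<in>idx N k. fls_const (\<upsilon> b) * PH b j)"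
    by (auto simp: tspan_def)
  then show ?thesis unfolding tspan_def
    by (intro exI[of _ "\<lambda>b. \<xi> b + \<upsilon> b"]) (simp add: fls_plus_const[symmetric] distrib_right sum.distrib del: fls_plus_const)
qed

lemma tspan_scale: "tspan F \<Longrightarrow> tspan (\<lambda>j. fls_const c * F j)"
proof -
  assume "tspan F"
  then obtain \<xi> where "\<forall>j. F j = (\<Sum>b\<in>idx N k. fls_const (\<xi> b) * PH b j)" by (auto simp: tspan_def)
  then show ?thesis unfolding tspan_def
    by (intro exI[of _ "\<lambda>b. c * \<xi> b"]) (simp add: fls_const_mult_const[symmetric] mult.assoc sum_distrib_left del: fls_const_mult_const)
qed

lemma tspan_zero: "tspan (\<lambda>_. 0)"
  unfolding tspan_def by (intro exI[of _ "\<lambda>_. 0"]) simp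

lemma tspan_sum: "(\<And>i. i \<in> A \<Longrightarrow> tspan (F i)) \<Longrightarrow> tspan (\<lambda>j. \<Sum>i\<in>A. F i j)"
  by (induction A rule: infinite_finite_induct) (simp_all add: tspan_zero tspan_add)

lemma tspan_diff: "tspan F \<Longrightarrow> tspan G \<Longrightarrow> tspan (\<lambda>j. F j - G j)"
proof -
  assume "tspan F" "tspan G"
  moreover have "fls_const (-1) * G j = - G j" for j by (rule fls_eqI) simp
  ultimately show ?thesis using tspan_add[of F "\<lambda>j. - G j"] tspan_scale[of G "-1"] by simp
qed

text \<open>\<open>Phi\<close> of index \<open>(0, a)\<close> is a monic polynomial of degree
  \<open>a - 1\<close>, so the monomials are obtained by triangular elimination.\<close>

lemma tspan_mono:
  assumes "a \<in> {1..<k 0}"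
  shows "tspan (\<lambda>j. zpar t j ^ (a - 1))"
  using assms
proof (induction a rule: less_induct)
  case (less a)
  have "PH (0, a) j = zpar t j ^ (a - 1) + (\<Sum>c=1..<a. fls_const (pcoef k t 0 a c) * zpar t j ^ (c - 1))" for j
  proof -
    have "{1..a} = insert a {1..<a}" using less.prems by auto
    then show ?thesis by (simp add: Phi_0 pcoef_def)
  qed
  then have "zpar t j ^ (a - 1) = PH (0, a) j - (\<Sum>c=1..<a. fls_const (pcoef k t 0 a c) * zpar t j ^ (c - 1))" for j by simp
  moreover have "tspan (\<lambda>j. PH (0, a) j - (\<Sum>c=1..<a. fls_const (pcoef k t 0 a c) * zpar t j ^ (c - 1)))"
    using less by (intro tspan_diff tspan_sum tspan_scale tspan_Phi) (auto simp: idx_iff)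
  ultimately show ?case by simp
qed

text \<open>Fractions up to order \<open>k i\<close> come by elimination from the fields of index
  \<open>(i, a)\<close> with \<open>a \<ge> 1\<close>, with powers of \<open>cser k t i $ 1\<close>
  on the diagonal. Order \<open>k i + 1\<close> is reached only by the field that moves the pole, of
  index \<open>(i, 0)\<close>.\<close>

lemma tspan_frac:
  assumes i: "i \<in> {1..N}" and a: "a \<in> {1..k i + 1}"
  shows "tspan (\<lambda>j. inverse (zpar t j - fls_const (t (i, 0))) ^ a)"
proof -
  define y where "y = (\<lambda>j. inverse (zpar t j - fls_const (t (i, 0))))"
  have i0: "i \<noteq> 0" using i by auto
  have c1: "cser k t i $ 1 \<noteq> 0" using cser_nz(2)[of k i t] ki t i by (auto simp: hdom_def)
  have Ph: "PH (i, \<alpha>) j = (\<Sum>a=1..k i + 1. fls_const (pcoef k t i \<alpha> a) * y j ^ a)" for \<alpha> j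
    using i0 by (simp add: Phi_pos y_def power_inverse del: sum.cl_ivl_Suc)
  have step: "tspan (\<lambda>j. y j ^ a)" if a: "a \<in> {1..k i + 1}" and \<alpha>: "\<alpha> \<le> k i" and nz: "pcoef k t i \<alpha> a \<noteq> 0"
    and z: "\<And>c. c \<in> {1..k i + 1} \<Longrightarrow> a < c \<Longrightarrow> pcoef k t i \<alpha> c = 0"
    and lower: "\<And>c. c \<in> {1..<a} \<Longrightarrow> tspan (\<lambda>j. y j ^ c)" for a \<alpha>
  proof -
    have "PH (i, \<alpha>) j = fls_const (pcoef k t i \<alpha> a) * y j ^ a + (\<Sum>c=1..<a. fls_const (pcoef k t i \<alpha> c) * y j ^ c)" for j
    proof -
      have "PH (i, \<alpha>) j = (\<Sum>c\<in>insert a {1..<a}. fls_const (pcoef k t i \<alpha> c) * y j ^ c)"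
        unfolding Ph
      proof (intro sum.mono_neutral_right ballI)
        fix c assume "c \<in> {1..k i + 1} - insert a {1..<a}"
        then show "fls_const (pcoef k t i \<alpha> c) * y j ^ c = 0" using z[of c] by auto
      qed (use a in auto)
      then show ?thesis by simp
    qed
    then have "fls_const (1 / pcoef k t i \<alpha> a) * (PH (i, \<alpha>) j - (\<Sum>c=1..<a. fls_const (pcoef k t i \<alpha> c) * y j ^ c))
       = fls_const (1 / pcoef k t i \<alpha> a * pcoef k t i \<alpha> a) * y j ^ a" for j
      by (simp only: add_diff_cancel_right' fls_const_mult_const[symmetric] mult.assoc)
    then have "y j ^ a = fls_const (1 / pcoef k t i \<alpha> a) * (PH (i, \<alpha>) j - (\<Sum>c=1..<a. fls_const (pcoef k t i \<alpha> c) * y j ^ c))" for j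
      using nz by simp
    moreover have "tspan (\<lambda>j. fls_const (1 / pcoef k t i \<alpha> a) * (PH (i, \<alpha>) j - (\<Sum>c=1..<a. fls_const (pcoef k t i \<alpha> c) * y j ^ c)))"
      using i i0 \<alpha> lower by (intro tspan_diff tspan_sum tspan_scale tspan_Phi) (auto simp: idx_iff)
    ultimately show ?thesis by simp
  qed
  have low: "tspan (\<lambda>j. y j ^ a)" if "a \<in> {1..k i}" for a
    using that
  proof (induction a rule: less_induct)
    case (less a)
    show ?case
    proof (rule step[of a a])
      show "pcoef k t i a a \<noteq> 0" using i0 c1 less.prems by (simp add: pcoef_def startsby_zero_power_nth_same)
      show "pcoef k t i a c = 0" if "a < c" for c using pcoef_beyond(1)[of i a c] i0 less.prems that by simp
    qed (use less in auto)
  qed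
  have "tspan (\<lambda>j. y j ^ (k i + 1))"
  proof (rule step[of _ 0])
    show "pcoef k t i 0 (k i + 1) \<noteq> 0" using i0 c1 ki i by (fastforce simp: pcoef_def startsby_zero_power_nth_same)
  qed (use low in auto)
  then show ?thesis using low[of a] a unfolding y_def by (cases "a = k i + 1") auto
qed

text \<open>The difference quotient lowers the degree by one, and \<open>k 0 - 2\<close> is the
  highest degree in a tangent vector.\<close>

lemma dd_mono:
  assumes "m < k 0"
  shows "tspan (\<lambda>j. (zpar t j ^ m - fls_const (p ^ m)) * zp j)"
proof -
  have "(zpar t j ^ m - fls_const (p ^ m)) * zp j = (\<Sum>i<m. fls_const (p ^ (m - Suc i)) * zpar t j ^ (Suc i - 1))" for j
  proof -
    have "zpar t j ^ m - fls_const (p ^ m) = (zpar t j - fls_const p) * (\<Sum>i<m. fls_const (p ^ (m - Suc i)) * zpar t j ^ (Suc i - 1))"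
      using power_diff_sumr2[of "zpar t j" m "fls_const p"] by (simp add: fls_const_power)
    then show ?thesis using zpar_minus_nz[of j p] by (simp add: field_simps)
  qed
  moreover have "tspan (\<lambda>j. \<Sum>i<m. fls_const (p ^ (m - Suc i)) * zpar t j ^ (Suc i - 1))"
    using assms by (intro tspan_sum tspan_scale tspan_mono) auto
  ultimately show ?thesis by simp
qed

text \<open>With \<open>q = t (i, 0)\<close>, the difference
  \<open>1 / (z - q) - 1 / (p - q)\<close> is \<open>- (z - p)\<close> times the product of the two
  fractions, so dividing by \<open>z - p\<close> does not raise the order of the pole at
  \<open>q\<close>.\<close>

lemma dd_frac:
  assumes i: "i \<in> {1..N}" and a: "a \<le> k i + 1"
  shows "tspan (\<lambda>j. (inverse (zpar t j - fls_const (t (i, 0))) ^ a - fls_const (inverse (p - t (i, 0)) ^ a)) * zp j)"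
proof -
  define x where "x = (\<lambda>j. inverse (zpar t j - fls_const (t (i, 0))))"
  define y where "y = inverse (p - t (i, 0))"
  have "(x j ^ a - fls_const (y ^ a)) * zp j = (\<Sum>l<a. fls_const (- (y * y ^ (a - Suc l))) * x j ^ Suc l)" for j
  proof -
    have pq: "p - t (i, 0) \<noteq> 0" using new_pole_neq[OF i] by simp
    have "x j - fls_const y = - (zpar t j - fls_const p) * (x j * fls_const y)"
    proof (rule difference_of_fractions)
      show "fls_const y * (fls_const p - fls_const (t (i, 0))) = 1"
        using pq by (simp add: y_def fls_const_diff[symmetric])
      show "x j * (zpar t j - fls_const (t (i, 0))) = 1" unfolding x_def by (rule left_inverse[OF zpar_minus_nz])
    qed
    then have "(x j - fls_const y) * zp j = - (x j * fls_const y)"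
      using zpar_minus_nz[of j p] by (simp only: mult.assoc mult.commute[of _ "zp j"] mult_minus_left mult_minus_right)
        (simp add: mult.assoc[symmetric])
    moreover have "x j ^ a - fls_const (y ^ a) = (x j - fls_const y) * (\<Sum>l<a. fls_const (y ^ (a - Suc l)) * x j ^ l)"
      using power_diff_sumr2[of "x j" a "fls_const y"] by (simp add: fls_const_power)
    ultimately have "(x j ^ a - fls_const (y ^ a)) * zp j = - (x j * fls_const y) * (\<Sum>l<a. fls_const (y ^ (a - Suc l)) * x j ^ l)"
      by (simp only: mult.assoc mult.commute[of _ "zp j"]) (simp only: mult.assoc[symmetric])
    also have "\<dots> = (\<Sum>l<a. fls_const (- (y * y ^ (a - Suc l))) * x j ^ Suc l)"
      unfolding sum_distrib_left by (intro sum.cong refl) (simp add: fls_const_mult_const[symmetric] mult_ac del: fls_const_mult_const)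
    finally show ?thesis .
  qed
  moreover have "tspan (\<lambda>j. \<Sum>l<a. fls_const (- (y * y ^ (a - Suc l))) * x j ^ Suc l)"
    unfolding x_def using a by (intro tspan_sum tspan_scale tspan_frac i) auto
  ultimately show ?thesis by (simp add: x_def y_def)
qed

lemma dd_Phi:
  assumes "x \<in> idx N k \<or> x = (0, k 0)"
  shows "tspan (\<lambda>j. (PH x j - fls_const (Phi (\<lambda>x. x) k t x p)) * zp j)"
proof -
  obtain i \<alpha> where x: "x = (i, \<alpha>)" by (cases x)
  show ?thesis
  proof (cases "i = 0")
    case True
    have "(PH x j - fls_const (Phi (\<lambda>x. x) k t x p)) * zp j = (\<Sum>a=1..\<alpha>. fls_const (pcoef k t 0 \<alpha> a) * ((zpar t j ^ (a - 1) - fls_const (p ^ (a - 1))) * zp j))" for j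
      unfolding x True Phi_0 fls_const_sum sum_subtractf[symmetric] sum_distrib_right
      by (intro sum.cong refl) (simp add: fls_const_mult_const[symmetric] algebra_simps del: fls_const_mult_const)
    moreover have "tspan (\<lambda>j. \<Sum>a=1..\<alpha>. fls_const (pcoef k t 0 \<alpha> a) * ((zpar t j ^ (a - 1) - fls_const (p ^ (a - 1))) * zp j))"
      using assms True k0 by (intro tspan_sum tspan_scale dd_mono) (auto simp: x idx_iff)
    ultimately show ?thesis by simp
  next
    case False
    then have i: "i \<in> {1..N}" using assms by (auto simp: x idx_iff)
    have "(PH x j - fls_const (Phi (\<lambda>x. x) k t x p)) * zp j = (\<Sum>a=1..k i + 1. fls_const (pcoef k t i \<alpha> a) *
       ((inverse (zpar t j - fls_const (t (i, 0))) ^ a - fls_const (inverse (p - t (i, 0)) ^ a)) * zp j))" for j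
      unfolding x Phi_pos[OF False] fls_const_sum sum_subtractf[symmetric] sum_distrib_right
      by (intro sum.cong refl) (simp add: fls_const_mult_const[symmetric] algebra_simps power_inverse del: fls_const_mult_const power_Suc)
    moreover have "tspan (\<lambda>j. \<Sum>a=1..k i + 1. fls_const (pcoef k t i \<alpha> a) *
       ((inverse (zpar t j - fls_const (t (i, 0))) ^ a - fls_const (inverse (p - t (i, 0)) ^ a)) * zp j))"
      by (intro tspan_sum tspan_scale dd_frac i) auto
    ultimately show ?thesis by simp
  qed
qed

lemma dd_Lamz: "tspan (\<lambda>j. (LM j - fls_const (Lamz (\<lambda>x. x) N k t p)) * zp j)"
proof -
  have "(LM j - fls_const (Lamz (\<lambda>x. x) N k t p)) * zp j = (PH (0, k 0) j - fls_const (Phi (\<lambda>x. x) k t (0, k 0) p)) * zp j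
     - (\<Sum>i=1..N. (PH (i, 0) j - fls_const (Phi (\<lambda>x. x) k t (i, 0) p)) * zp j)" for j
    unfolding Lamz_def sum_distrib_right[symmetric] left_diff_distrib[symmetric] sum_subtractf fls_const_diff fls_const_sum
    by (simp add: algebra_simps)
  moreover have "tspan (\<lambda>j. (PH (0, k 0) j - fls_const (Phi (\<lambda>x. x) k t (0, k 0) p)) * zp j
     - (\<Sum>i=1..N. (PH (i, 0) j - fls_const (Phi (\<lambda>x. x) k t (i, 0) p)) * zp j))"
    by (intro tspan_diff tspan_sum dd_Phi) (auto simp: idx_iff)
  ultimately show ?thesis by simp
qed

lemma tspan_orthogonal:
  assumes "\<And>x. x \<in> idx N k \<Longrightarrow> total_residue (\<lambda>j. G j * PH x j) = 0" and "tspan u"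
  shows "total_residue (\<lambda>j. G j * u j) = 0"
proof -
  obtain \<xi> where \<xi>: "\<And>j. u j = (\<Sum>b\<in>idx N k. fls_const (\<xi> b) * PH b j)" using assms(2) by (auto simp: tspan_def)
  have "G j * u j = (\<Sum>b\<in>idx N k. fls_const (\<xi> b) * (G j * PH b j))" for j
    unfolding \<xi> sum_distrib_left by (intro sum.cong refl) (rule mult.left_commute)
  then show ?thesis using assms(1) by (simp add: total_residue_sum total_residue_scale)
qed

lemma tspan_residue_Phi: "x \<in> idx N k \<Longrightarrow> tspan u \<Longrightarrow> total_residue (\<lambda>j. PH x j * u j) = 0"
  by (rule tspan_orthogonal[OF residue_Phi_Phi])

lemma tspan_residue: "tspan u \<Longrightarrow> total_residue u = 0"
  using tspan_orthogonal[of "\<lambda>_. 1" u] residue_Phi by simp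

lemma Phi_over:
  assumes "x \<in> idx N k"
  obtains u where "tspan u" "\<And>j. PH x j * zp j = u j + fls_const (Phi (\<lambda>x. x) k t x p) * zp j"
proof
  show "tspan (\<lambda>j. (PH x j - fls_const (Phi (\<lambda>x. x) k t x p)) * zp j)" using assms by (intro dd_Phi) auto
qed (simp add: left_diff_distrib)

lemma p_not_pole: "p \<notin> (\<lambda>i. t (i, 0)) ` {1..N}"
proof
  assume "p \<in> (\<lambda>i. t (i, 0)) ` {1..N}"
  then obtain i where i: "i \<in> {1..N}" and e: "p = t (i, 0)" by (rule imageE)
  from new_pole_neq[OF i] e show False by (rule notE)
qed

text \<open>The residue theorem for functions with one more pole, in \<open>p\<close>.\<close>

lemma residue_Phi_over:
  assumes "x \<in> idx N k"
  shows "total_residue (\<lambda>j. PH x j * zp j) = - Phi (\<lambda>x. x) k t x p"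
proof -
  obtain u where "tspan u" "\<And>j. PH x j * zp j = u j + fls_const (Phi (\<lambda>x. x) k t x p) * zp j"
    using Phi_over[OF assms] by blast
  then show ?thesis using residue_zpar_inverse[of p] p_not_pole by (simp add: total_residue_add total_residue_scale tspan_residue)
qed

lemma residue_Phi_Phi_over:
  assumes "x \<in> idx N k" "y \<in> idx N k"
  shows "total_residue (\<lambda>j. PH x j * PH y j * zp j) = - (Phi (\<lambda>x. x) k t x p * Phi (\<lambda>x. x) k t y p)"
proof -
  obtain u where u: "tspan u" "\<And>j. PH x j * zp j = u j + fls_const (Phi (\<lambda>x. x) k t x p) * zp j"
    using Phi_over[OF assms(1)] by blast
  have "PH x j * PH y j * zp j = PH y j * u j + fls_const (Phi (\<lambda>x. x) k t x p) * (PH y j * zp j)" for j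
    using arg_cong[OF u(2)[of j], of "\<lambda>F. PH y j * F"] by (simp only: distrib_left mult_ac)
  then show ?thesis
    using residue_Phi_over[OF assms(2)] tspan_residue_Phi[OF assms(2) u(1)] by (simp add: total_residue_add total_residue_scale)
qed

lemma zp_regular: "j \<in> {1..N} \<Longrightarrow> ord_ge 0 (zp j)"
  using ord_ge_inverse_regular[of fls_X "t (j, 0)" p 1] new_pole_neq[of j] by (simp add: zpar_pos ord_ge_def)

lemma LM_nz: "j \<le> N \<Longrightarrow> LM j \<noteq> 0"
  using Lamz_subdegree(1)[OF hdom_polar[OF t _ ki]] Lamz_inf_subdegree(1)[of k N t, OF k0] by (cases "j = 0") auto

text \<open>Every single residue vanishes: at a finite pole \<open>\<lambda>'\<close> has at least
  the pole order of the tangent vector, and at infinity the form is regular by a count of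
  degrees.\<close>

lemma residue_Phi_Lamz_over:
  assumes x: "x \<in> idx N k"
  shows "total_residue (\<lambda>j. PH x j * zp j / LM j) = 0"
proof -
  obtain i \<alpha> where xi: "x = (i, \<alpha>)" by (cases x)
  have "(PH x j * zp j / LM j * fls_deriv (zpar t j)) $$ (-1) = 0" if j: "j \<le> N" for j
  proof (cases "j = 0")
    case True
    have "ord_ge (2 - int (k 0)) (PH x 0)"
    proof (cases "i = 0")
      case True
      then show ?thesis using x ord_ge_mono[OF ord_Phi_inf[of \<alpha> k t], of "2 - int (k 0)"] by (simp add: xi idx_iff)
    next
      case False
      then show ?thesis using ord_ge_mono[OF ord_Phi_inf_pos[of i k t \<alpha>], of "2 - int (k 0)"] k0 by (simp add: xi)
    qed
    moreover have "ord_ge 1 (zp 0)" using ord_ge_inverse_at_inf[of fps_X 1 p] by (simp add: fls_inverse_X)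
    ultimately have "ord_ge (3 - int (k 0)) (PH x 0 * zp 0)" by (rule ord_ge_mult) simp
    from residue_vanish_inf[of k, OF k0 this] show ?thesis by (simp add: True)
  next
    case False
    then have j: "j \<in> {1..N}" using j by auto
    have "ord_ge (- int (k j + 1)) (PH x j)"
    proof (cases "i = j")
      case True
      then show ?thesis using ord_Phi_own[of j k t \<alpha>] False by (simp add: xi)
    next
      case ij: False
      have "i \<noteq> 0 \<Longrightarrow> t (i, 0) \<noteq> t (j, 0)" using x j ij poles_eq_iff[of i j] by (auto simp: xi idx_iff)
      then show ?thesis using ord_ge_mono[OF ord_Phi_other[of j i t k \<alpha>], of "- int (k j + 1)"] False by (simp add: xi)
    qed
    from residue_vanish[OF hdom_polar[OF t j ki] zp_regular[OF j] this] show ?thesis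
      using False by (simp add: fls_deriv_zpar mult.commute)
  qed
  then show ?thesis by (simp add: total_residue_def)
qed

lemma open_trip_total_residue:
  assumes "a \<in> idx N k" "b \<in> idx N k"
  shows "open_trip N k t a b = - total_residue (\<lambda>j. PH a j * PH b j * zp j / LM j)"
proof -
  have "a \<noteq> (Suc N, 0)" "b \<noteq> (Suc N, 0)" using assms by (auto simp: idx_iff)
  then show ?thesis by (simp add: open_trip_def total_residue_def)
qed

lemma diff_over_times:
  fixes X A L c :: "'f::field"
  shows "(X - A) / L * c = X * (c / L) - A * (c / L)"
  by (simp add: divide_inverse algebra_simps)

lemma open_assoc_cases:
  fixes S T O' g F :: complex
  shows "0 = - S - g * 0 - T + g * - O' \<Longrightarrow> S + O' * g = - T"
    and "0 = - S - - F - g * 0 + g * - O' \<Longrightarrow> S + O' * g = F"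
proof -
  assume "0 = - S - g * 0 - T + g * - O'"
  moreover have "S + O' * g - - T = - (- S - g * 0 - T + g * - O')" by (simp add: algebra_simps)
  ultimately have "S + O' * g - - T = 0" by simp
  then show "S + O' * g = - T" by (simp only: right_minus_eq)
next
  assume "0 = - S - - F - g * 0 + g * - O'"
  moreover have "S + O' * g - F = - (- S - - F - g * 0 + g * - O')" by (simp add: algebra_simps)
  ultimately have "S + O' * g - F = 0" by simp
  then show "S + O' * g = F" by (simp only: right_minus_eq)
qed

lemma diff_times_diff_over:
  fixes W A G g z L :: "'f::field"
  shows "(W - A) * ((G - g) * z) / L = W * G * z / L - g * (W * z / L) - A * G * z / L + g * (A * z / L)"
  by (simp add: divide_inverse algebra_simps)

lemma diff_times_diff_cancel:
  fixes W A g z L :: "'f::field"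
  assumes "L \<noteq> 0"
  shows "(W - A) * ((L - g) * z) / L = W * z - A * z - g * (W * z / L) + g * (A * z / L)"
  using assms by (simp add: field_simps)

section \<open>Associativity of the product on the locus\<close>

context
  fixes a b :: "nat \<times> nat"
  assumes a: "a \<in> idx N k" and b: "b \<in> idx N k"
begin

abbreviation (input) "CC \<nu> \<equiv> \<Sum>\<mu>\<in>idx N k. tripf N k t a b \<mu> * ieta k \<mu> \<nu>"
abbreviation (input) "WW j \<equiv> \<Sum>\<nu>\<in>idx N k. fls_const (CC \<nu>) * PH \<nu> j"

lemma total_residue_WW: "total_residue (\<lambda>j. WW j * G j) = (\<Sum>\<nu>\<in>idx N k. CC \<nu> * total_residue (\<lambda>j. PH \<nu> j * G j))"
  unfolding sum_distrib_right mult.assoc total_residue_sum total_residue_scale ..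

text \<open>\<open>WW\<close> represents the product of \<open>\<partial>\<lambda>/\<partial>t\<^sub>a\<close> and \<open>\<partial>\<lambda>/\<partial>t\<^sub>b\<close> in the Jacobi algebra, so that the
  difference is orthogonal to all tangent vectors. It is applied to the difference quotients
  \<open>(u - u(p)) / (z - p)\<close> of \<open>u = \<partial>\<lambda>/\<partial>t\<^sub>g\<close> and of \<open>u = \<partial>\<lambda>/\<partial>z\<close>, which are tangent vectors again.\<close>

lemma orthogonal:
  assumes "tspan u"
  shows "total_residue (\<lambda>j. (WW j - PH a j * PH b j) * u j / LM j) = 0"
proof -
  have "total_residue (\<lambda>j. ((WW j - PH a j * PH b j) / LM j) * PH c j) = 0" if c: "c \<in> idx N k" for c
  proof -
    have "total_residue (\<lambda>j. WW j * (PH c j / LM j)) = (\<Sum>\<nu>\<in>idx N k. CC \<nu> * - pairf N k t \<nu> c)"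
      unfolding total_residue_WW by (simp add: pairf_def total_residue_def)
    also have "\<dots> = - (\<Sum>\<nu>\<in>idx N k. CC \<nu> * eta0 k \<nu> c)"
      using c by (simp add: pairf_eq_eta0[of k N, OF k0 ki t] sum_negf)
    also have "\<dots> = - tripf N k t a b c" by (simp only: lower_ieta[of k N, OF k0 ki t c])
    also have "\<dots> = total_residue (\<lambda>j. PH a j * PH b j * (PH c j / LM j))" by (simp add: tripf_def total_residue_def)
    finally have "total_residue (\<lambda>j. WW j * (PH c j / LM j) - PH a j * PH b j * (PH c j / LM j)) = 0" by (simp add: total_residue_diff)
    then show ?thesis unfolding diff_over_times .
  qed
  from tspan_orthogonal[OF this assms] show ?thesis by simp
qed

text \<open>The right-hand side is symmetric in \<open>a\<close>, \<open>b\<close> and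
  \<open>g\<close>: this is the open WDVV equation for three fields of the smaller manifold.\<close>

lemma open_assoc:
  assumes g: "g \<in> idx N k"
  shows "(\<Sum>\<nu>\<in>idx N k. CC \<nu> * open_trip N k t \<nu> g) + open_trip N k t a b * Phi (\<lambda>x. x) k t g p =
    - total_residue (\<lambda>j. PH a j * PH b j * PH g j * zp j / LM j)"
proof -
  let ?gp = "Phi (\<lambda>x. x) k t g p"
  have "0 = total_residue (\<lambda>j. (WW j - PH a j * PH b j) * ((PH g j - fls_const ?gp) * zp j) / LM j)"
    using orthogonal[OF dd_Phi[of g]] g by simp
  also have "\<dots> = total_residue (\<lambda>j. WW j * PH g j * zp j / LM j) - ?gp * total_residue (\<lambda>j. WW j * zp j / LM j)
     - total_residue (\<lambda>j. PH a j * PH b j * PH g j * zp j / LM j) + ?gp * total_residue (\<lambda>j. PH a j * PH b j * zp j / LM j)"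
    unfolding diff_times_diff_over by (simp only: total_residue_add total_residue_diff total_residue_scale)
  also have "total_residue (\<lambda>j. WW j * PH g j * zp j / LM j) = (\<Sum>\<nu>\<in>idx N k. CC \<nu> * - open_trip N k t \<nu> g)"
    using total_residue_WW[of "\<lambda>j. PH g j * zp j / LM j"] g by (simp add: open_trip_total_residue mult.assoc cong: sum.cong)
  also have "total_residue (\<lambda>j. WW j * zp j / LM j) = 0"
    using total_residue_WW[of "\<lambda>j. zp j / LM j"] residue_Phi_Lamz_over by simp
  also have "total_residue (\<lambda>j. PH a j * PH b j * zp j / LM j) = - open_trip N k t a b"
    by (simp add: open_trip_total_residue[OF a b])
  finally show ?thesis unfolding mult_minus_right[of "CC _"] sum_negf by (rule open_assoc_cases(1))
qed

text \<open>Here \<open>\<lambda>'\<close> cancels the denominator, and what remains are residues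
  with \<open>1 / (z - p)\<close>, hence values at \<open>p\<close>. This covers the case in which
  one outer field belongs to the additional variable.\<close>

lemma open_assoc_new:
  "(\<Sum>\<nu>\<in>idx N k. CC \<nu> * Phi (\<lambda>x. x) k t \<nu> p) + open_trip N k t a b * Lamz (\<lambda>x. x) N k t p =
    Phi (\<lambda>x. x) k t a p * Phi (\<lambda>x. x) k t b p"
proof -
  let ?L = "Lamz (\<lambda>x. x) N k t p"
  have "0 = total_residue (\<lambda>j. (WW j - PH a j * PH b j) * ((LM j - fls_const ?L) * zp j) / LM j)"
    using orthogonal[OF dd_Lamz] by simp
  also have "\<dots> = total_residue (\<lambda>j. WW j * zp j - PH a j * PH b j * zp j - fls_const ?L * (WW j * zp j / LM j) + fls_const ?L * (PH a j * PH b j * zp j / LM j))"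
    by (intro total_residue_cong diff_times_diff_cancel LM_nz)
  also have "\<dots> = total_residue (\<lambda>j. WW j * zp j) - total_residue (\<lambda>j. PH a j * PH b j * zp j)
     - ?L * total_residue (\<lambda>j. WW j * zp j / LM j) + ?L * total_residue (\<lambda>j. PH a j * PH b j * zp j / LM j)"
    by (simp only: total_residue_add total_residue_diff total_residue_scale)
  also have "total_residue (\<lambda>j. WW j * zp j) = (\<Sum>\<nu>\<in>idx N k. CC \<nu> * - Phi (\<lambda>x. x) k t \<nu> p)"
    unfolding total_residue_WW using residue_Phi_over by simp
  also have "total_residue (\<lambda>j. WW j * zp j / LM j) = 0"
    using total_residue_WW[of "\<lambda>j. zp j / LM j"] residue_Phi_Lamz_over by simp
  also have "total_residue (\<lambda>j. PH a j * PH b j * zp j / LM j) = - open_trip N k t a b"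
    by (simp add: open_trip_total_residue[OF a b])
  also have "total_residue (\<lambda>j. PH a j * PH b j * zp j) = - (Phi (\<lambda>x. x) k t a p * Phi (\<lambda>x. x) k t b p)"
    by (rule residue_Phi_Phi_over[OF a b])
  finally show ?thesis unfolding mult_minus_right[of "CC _"] sum_negf by (rule open_assoc_cases(2))
qed

end

lemma open_trip_sym: "open_trip N k t a b = open_trip N k t b a"
  by (simp add: open_trip_def mult.commute)

text \<open>One side of the open WDVV equation with the derivatives of the potentials replaced by
  residues. The equation becomes symmetry under the exchange of \<open>\<alpha>\<close> and
  \<open>\<gamma>\<close>.\<close>

definition wdvv_lhs :: "nat \<times> nat \<Rightarrow> nat \<times> nat \<Rightarrow> nat \<times> nat \<Rightarrow> complex" where
  "wdvv_lhs \<alpha> \<beta> \<gamma> = (\<Sum>\<mu>\<in>idx N k. \<Sum>\<nu>\<in>idx N k. (if \<alpha> = (Suc N, 0) \<or> \<beta> = (Suc N, 0) then 0 else tripf N k t \<alpha> \<beta> \<mu>) * ieta k \<mu> \<nu> * open_trip N k t \<nu> \<gamma>)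
     + open_trip N k t \<alpha> \<beta> * open_trip N k t (Suc N, 0) \<gamma>"

lemma open_wdvv_trip:
  assumes "\<alpha> \<in> locus_idx N k" "\<beta> \<in> locus_idx N k" "\<gamma> \<in> locus_idx N k"
  shows "wdvv_lhs \<alpha> \<beta> \<gamma> = wdvv_lhs \<gamma> \<beta> \<alpha>"
proof -
  let ?e = "(Suc N, 0)"
  have ni: "x \<in> idx N k \<Longrightarrow> x \<noteq> ?e" for x by (auto simp: idx_iff)
  have swap: "wdvv_lhs \<alpha> \<beta> \<gamma> = (\<Sum>\<nu>\<in>idx N k. (\<Sum>\<mu>\<in>idx N k. tripf N k t \<alpha> \<beta> \<mu> * ieta k \<mu> \<nu>) * open_trip N k t \<nu> \<gamma>)
     + open_trip N k t \<alpha> \<beta> * open_trip N k t ?e \<gamma>" if "\<alpha> \<in> idx N k" "\<beta> \<in> idx N k" for \<alpha> \<beta> \<gamma>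
    unfolding wdvv_lhs_def sum_distrib_right using ni that by (subst sum.swap) auto
  have e0: "wdvv_lhs \<alpha> \<beta> \<gamma> = open_trip N k t \<alpha> \<beta> * open_trip N k t ?e \<gamma>" if "\<alpha> = ?e \<or> \<beta> = ?e" for \<alpha> \<beta> \<gamma>
    using that by (auto simp: wdvv_lhs_def)
  have oe: "open_trip N k t ?e x = Phi (\<lambda>x. x) k t x p" "open_trip N k t x ?e = Phi (\<lambda>x. x) k t x p" if "x \<in> idx N k" for x
    using ni[OF that] by (simp_all add: open_trip_def)
  have ee: "open_trip N k t ?e ?e = Lamz (\<lambda>x. x) N k t p" by (simp add: open_trip_def)
  have new: "wdvv_lhs \<alpha> \<beta> ?e = wdvv_lhs ?e \<beta> \<alpha>" if "\<alpha> \<in> idx N k" "\<beta> \<in> idx N k" for \<alpha> \<beta>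
    using open_assoc_new[OF that] that by (simp add: swap e0 oe ee cong: sum.cong)
  have old: "wdvv_lhs \<alpha> \<beta> \<gamma> = - total_residue (\<lambda>j. PH \<alpha> j * PH \<beta> j * PH \<gamma> j * zp j / LM j)"
    if "\<alpha> \<in> idx N k" "\<beta> \<in> idx N k" "\<gamma> \<in> idx N k" for \<alpha> \<beta> \<gamma>
    using open_assoc[OF that] that by (simp add: swap oe)
  show ?thesis
  proof (cases "\<beta> = ?e")
    case True
    then show ?thesis by (simp add: e0 open_trip_sym[of \<gamma>] open_trip_sym[of \<alpha>])
  next
    case False
    then have \<beta>: "\<beta> \<in> idx N k" using assms by (auto simp: locus_idx_def)
    consider "\<alpha> = ?e" "\<gamma> = ?e" | "\<alpha> = ?e" "\<gamma> \<in> idx N k" | "\<alpha> \<in> idx N k" "\<gamma> = ?e" | "\<alpha> \<in> idx N k" "\<gamma> \<in> idx N k"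
      using assms by (auto simp: locus_idx_def)
    then show ?thesis
    proof cases
      case 4
      then show ?thesis using old[OF _ \<beta>] by (simp add: mult_ac)
    qed (use new \<beta> in auto)
  qed
qed

end

section \<open>The potentials\<close>

lemma locus_eq_degen:
  assumes "k 0 \<ge> 2" "\<forall>i\<in>{1..N}. k i \<ge> 1"
  shows "locus N k = degen N k"
proof -
  have "inj_on (\<lambda>i. t (i, 0)) {1..Suc N} \<longleftrightarrow> inj_on (\<lambda>i. t (i, 0)) {1..N} \<and> (\<forall>i\<in>{1..N}. t (Suc N, 0) \<noteq> t (i, 0))" for t :: point
  proof -
    have "{1..Suc N} = insert (Suc N) {1..N}" "{1..N} - {Suc N} = {1..N}" by auto
    then show ?thesis by (auto simp: inj_on_insert)
  qed
  then show ?thesis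
    unfolding locus_def degen_def nbhd_def flat_dom_eq[OF assms] hdom_def by blast
qed

lemma nbhd_hdom: "t \<in> nbhd N k \<Longrightarrow> t \<in> hdom N k"
  by (auto simp: nbhd_def hdom_def inj_on_def)

lemma nbhd_upd:
  assumes "t \<in> nbhd N k" "\<alpha> \<noteq> 0"
  shows "t((Suc N, \<alpha>) := s) \<in> nbhd N k"
proof -
  have "(t((Suc N, \<alpha>) := s)) (i, 0) = t (i, 0)" for i using assms(2) by simp
  moreover have "(t((Suc N, \<alpha>) := s)) (i, k i) = t (i, k i)" if "i \<in> {1..N}" for i using that by simp
  ultimately show ?thesis using assms(1) by (simp add: nbhd_def)
qed

lemma nbhd_upd_hdom:
  assumes "t \<in> nbhd N k" "k (Suc N) \<noteq> 0" "s \<noteq> 0"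
  shows "t((Suc N, k (Suc N)) := s) \<in> hdom (Suc N) k"
proof -
  have "(t((Suc N, k (Suc N)) := s)) (i, k i) \<noteq> 0" if "i \<in> {1..Suc N}" for i
    using assms(1,3) that by (cases "i = Suc N") (auto simp: nbhd_def)
  then show ?thesis using nbhd_upd[OF assms(1,2), of s] by (simp add: nbhd_def hdom_def)
qed

text \<open>Leaving the locus only in the direction of the last coordinate makes \<open>cser\<close>
  linear in \<open>w\<close>, so that every field of the new block is a single fraction on this
  line.\<close>

lemma degen_upd_cser:
  assumes t: "t \<in> degen N k" and m: "k (Suc N) \<ge> 2"
  shows "cser k (t((Suc N, k (Suc N)) := s)) (Suc N) = fps_const (s / of_nat (k (Suc N))) * fps_X"
proof (rule fps_ext)
  fix j
  let ?t = "t((Suc N, k (Suc N)) := s)"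
  consider "j = 0" | "j = 1" | "2 \<le> j" "j \<le> k (Suc N)" | "k (Suc N) < j" by linarith
  then show "cser k ?t (Suc N) $ j = (fps_const (s / of_nat (k (Suc N))) * fps_X) $ j"
  proof cases
    case 3
    then have "k (Suc N) + 1 - j \<in> {1..k (Suc N)}" "k (Suc N) + 1 - j \<noteq> k (Suc N)" by auto
    then have "?t (Suc N, k (Suc N) + 1 - j) = 0" using t unfolding degen_def by simp
    then show ?thesis using 3 by (simp add: cser_def fps_X_def)
  qed (use m in \<open>auto simp: cser_def fps_X_def\<close>)
qed

lemma degen_upd_Phi:
  assumes t: "t \<in> degen N k" and m: "k (Suc N) \<ge> 2" and \<alpha>: "\<alpha> \<le> k (Suc N)"
  shows "Phi fls_const k (t((Suc N, k (Suc N)) := s)) (Suc N, \<alpha>) z =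
    (let a = (if \<alpha> = 0 then k (Suc N) + 1 else \<alpha>) in
     fls_const ((if \<alpha> = 0 then of_nat (k (Suc N)) else 1) * (s / of_nat (k (Suc N))) ^ (a - 1)) * inverse ((z - fls_const (t (Suc N, 0))) ^ a))"
proof -
  let ?t = "t((Suc N, k (Suc N)) := s)"
  let ?c = "s / of_nat (k (Suc N))"
  define b where "b = (if \<alpha> = 0 then k (Suc N) + 1 else \<alpha>)"
  define d where "d = (if \<alpha> = 0 then of_nat (k (Suc N)) else 1 :: complex)"
  have b: "b \<in> {1..k (Suc N) + 1}" using \<alpha> by (auto simp: b_def)
  have pw: "(cser k ?t (Suc N) ^ (a - 1)) $ j = (if j = a - 1 then ?c ^ (a - 1) else 0)" for a j
    unfolding degen_upd_cser[OF t m] power_mult_distrib fps_const_power by (simp add: fps_X_power_nth)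
  have P: "pcoef k ?t (Suc N) \<alpha> a = (if a = b then d * ?c ^ (b - 1) else 0)" if "a \<ge> 1" for a
    using that unfolding pcoef_def pw b_def d_def by auto
  have p: "?t (Suc N, 0) = t (Suc N, 0)" using m by simp
  have "Phi fls_const k ?t (Suc N, \<alpha>) z = (\<Sum>a=1..k (Suc N) + 1. if a = b then fls_const (d * ?c ^ (b - 1)) * inverse ((z - fls_const (t (Suc N, 0))) ^ b) else 0)"
    unfolding Phi_pos[OF nat.distinct(2)] p by (intro sum.cong) (auto simp: P)
  then show ?thesis using b by (simp add: b_def d_def Let_def del: sum.cl_ivl_Suc)
qed

text \<open>Up to a regular series the quotient is a multiple of \<open>X^(-m)\<close>, which has no
  residue for \<open>m \<ge> 2\<close>.\<close>

lemma residue_shifted_geometric: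
  assumes h: "ord_ge 0 h" and D: "D \<noteq> 0" and m: "m \<ge> 2"
  shows "(fls_const C * fls_X_inv ^ (2 * m + 1) / (h - fls_const D * fls_X_inv ^ (m + 1))) $$ (-1) = (0 :: complex)"
proof -
  define L where "L = h - fls_const D * fls_X_inv ^ (m + 1)"
  have "L $$ (- int (m + 1)) \<noteq> 0"
    using ord_ge_nth[OF h, of "- int (m + 1)"] D by (simp add: L_def fls_X_inv_power_conv_shift_1 del: power_Suc)
  moreover have "ord_ge (- int (m + 1)) L"
    unfolding L_def by (intro ord_ge_diff ord_ge_mono[OF h] ord_ge_const_mult) (auto simp: ord_ge_def fls_X_inv_power_conv_shift_1 simp del: power_Suc)
  ultimately have L: "L \<noteq> 0" "fls_subdegree L = - int (m + 1)"
    by (auto intro!: fls_subdegree_eqI simp: ord_ge_def)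
  have "fls_const C * fls_X_inv ^ (2 * m + 1) / L = fls_const (C / D) * fls_X_inv ^ m * h / L - fls_const (C / D) * fls_X_inv ^ m"
  proof -
    have "fls_const C = fls_const (C / D) * fls_const D" using D by simp
    moreover have "(fls_X_inv :: complex fls) ^ (2 * m + 1) = fls_X_inv ^ m * fls_X_inv ^ (m + 1)" by (simp add: mult_2 power_add)
    ultimately have "fls_const C * fls_X_inv ^ (2 * m + 1) = fls_const (C / D) * fls_X_inv ^ m * (h - L)"
      by (simp add: L_def mult_ac)
    then show ?thesis using L(1) by (simp add: right_diff_distrib diff_divide_distrib)
  qed
  moreover have "ord_ge 0 (fls_const (C / D) * fls_X_inv ^ m * h / L)"
  proof -
    have "ord_ge (- int m) (fls_const (C / D) * fls_X_inv ^ m)"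
      by (intro ord_ge_const_mult) (simp add: ord_ge_def fls_X_inv_power_conv_shift_1)
    then have "ord_ge (- int m) (fls_const (C / D) * fls_X_inv ^ m * h)" by (rule ord_ge_mult[OF _ h]) simp
    then show ?thesis by (rule ord_ge_divide) (use L in auto)
  qed
  moreover have "(fls_const (C / D) * fls_X_inv ^ m) $$ (-1) = 0" using m by (simp add: fls_X_inv_power_conv_shift_1)
  ultimately show ?thesis unfolding L_def by (simp add: ord_ge_nth[of 0])
qed

text \<open>This is the second derivative in \<open>s = t\<^sub>N\<^sub>+\<^sub>1\<^sub>,\<^sub>k\<close> of \<open>\<partial>F/\<partial>t\<^sub>N\<^sub>+\<^sub>1\<^sub>,\<^sub>1\<close>, which is therefore affine on the line.\<close>

lemma tripf_line:
  assumes k0: "k 0 \<ge> 2" and ki: "\<forall>i\<in>{1..Suc N}. k i \<ge> 1" and m: "k (Suc N) \<ge> 2" and t: "t \<in> degen N k" and s: "s \<noteq> 0"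
  defines "t' \<equiv> t((Suc N, k (Suc N)) := s)"
  shows "tripf (Suc N) k t' (Suc N, k (Suc N)) (Suc N, k (Suc N)) (Suc N, 1) = 0"
proof -
  let ?n = "Suc N" and ?m = "k (Suc N)"
  let ?c = "s / of_nat ?m"
  have tn: "t \<in> nbhd N k" using t by (simp add: degen_def)
  have t': "t' \<in> nbhd N k" "t' \<in> hdom ?n k"
    unfolding t'_def using nbhd_upd[OF tn] nbhd_upd_hdom[OF tn] m s by auto
  have p: "t' (?n, 0) = t (?n, 0)" using m by (simp add: t'_def)
  have Pm: "Phi fls_const k t' (?n, ?m) z = fls_const (?c ^ (?m - 1)) * inverse ((z - fls_const (t (?n, 0))) ^ ?m)"
    and P1: "Phi fls_const k t' (?n, 1) z = inverse (z - fls_const (t (?n, 0)))"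
    and P0: "Phi fls_const k t' (?n, 0) z = fls_const (of_nat ?m * ?c ^ ?m) * inverse ((z - fls_const (t (?n, 0))) ^ (?m + 1))" for z
    using degen_upd_Phi[OF t m, of ?m s z] degen_upd_Phi[OF t m, of 1 s z] degen_upd_Phi[OF t m, of 0 s z] m
    by (simp_all add: t'_def Let_def)
  let ?T = "\<lambda>i. (Phi fls_const k t' (?n, ?m) (zpar t' i) * Phi fls_const k t' (?n, ?m) (zpar t' i) * Phi fls_const k t' (?n, 1) (zpar t' i)
      / Lamz fls_const ?n k t' (zpar t' i) * fls_deriv (zpar t' i)) $$ (-1)"
  have "?T i = 0" if i: "i \<le> N" for i
  proof (cases "i = 0")
    case True
    have "ord_ge 3 (Phi fls_const k t' (?n, ?m) fls_X_inv * Phi fls_const k t' (?n, ?m) fls_X_inv * Phi fls_const k t' (?n, 1) fls_X_inv)"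
      by (rule ord_ge_mult[OF ord_ge_mult[OF ord_Phi_inf_pos ord_Phi_inf_pos order_refl] ord_Phi_inf_pos]) auto
    from residue_vanish_inf[of k, OF k0 this] k0 show ?thesis by (simp add: True)
  next
    case False
    then have i: "i \<in> {1..N}" using i by auto
    have ne: "t' (?n, 0) \<noteq> t' (i, 0)" using nbhd_neq[OF t'(1), of ?n i] i by auto
    have "ord_ge 0 (Phi fls_const k t' (?n, ?m) (zpar t' i) * Phi fls_const k t' (?n, ?m) (zpar t' i) * Phi fls_const k t' (?n, 1) (zpar t' i))"
      by (rule ord_ge_mult[OF ord_ge_mult[OF ord_Phi_other ord_Phi_other order_refl] ord_Phi_other]) (use ne False in auto)
    from residue_vanish[OF hdom_polar[OF t'(2) _ ki] this, of i 1] show ?thesis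
      using i by (simp add: fls_deriv_zpar ord_ge_def)
  qed
  \<comment> \<open>At the new pole the numerator is an exact multiple of
    \<open>X^(-(2m+1))\<close>, and \<open>\<lambda>'\<close> is a multiple of
    \<open>X^(-(m+1))\<close> plus a regular series.\<close>
  moreover have "?T ?n = 0"
  proof -
    have Z: "zpar t' ?n - fls_const (t (?n, 0)) = fls_X" using zpar_minus[of ?n t'] p by simp
    have h: "ord_ge 0 (Lamz fls_const N k t' (zpar t' ?n))"
      unfolding zpar_pos[OF nat.distinct(2)]
    proof (rule Lamz_regular)
      show "t' (?n, 0) \<noteq> t' (i, 0)" if "i \<in> {1..N}" for i using nbhd_neq[OF t'(1), of ?n i] that by auto
    qed (auto simp: ord_ge_def)
    have "Phi fls_const k t' (?n, ?m) (zpar t' ?n) * Phi fls_const k t' (?n, ?m) (zpar t' ?n) * Phi fls_const k t' (?n, 1) (zpar t' ?n)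
       = fls_const (?c ^ (?m - 1) * ?c ^ (?m - 1)) * fls_X_inv ^ (2 * ?m + 1)"
      unfolding Pm P1 Z by (simp add: fls_inverse_X_power fls_inverse_X power_inverse mult_2 power_add mult_ac flip: fls_const_mult_const)
    moreover have "Lamz fls_const ?n k t' (zpar t' ?n) = Lamz fls_const N k t' (zpar t' ?n) - fls_const (of_nat ?m * ?c ^ ?m) * fls_X_inv ^ (?m + 1)"
      unfolding Lamz_Suc[of _ N] P0 Z by (simp add: fls_inverse_X_power power_inverse[symmetric] fls_inverse_X del: power_Suc)
    ultimately show ?thesis
      using residue_shifted_geometric[OF h _ m, of "of_nat ?m * ?c ^ ?m"] s m by (simp add: fls_deriv_zpar del: power_Suc)
  qed
  ultimately have "?T i = 0" if "i \<le> ?n" for i using that by (auto simp: le_Suc_eq)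
  then show ?thesis unfolding tripf_def by (simp del: sum.cl_ivl_Suc sum.atLeast0_atMost_Suc)
qed

section \<open>Restricting the derivative of the larger potential to the locus\<close>

lemma locally_affine_on_connected:
  fixes G H :: "complex \<Rightarrow> complex"
  assumes \<Omega>: "open \<Omega>" and S: "connected S" "S \<subseteq> \<Omega>"
    and G: "\<And>s. s \<in> \<Omega> \<Longrightarrow> (G has_field_derivative H s) (at s)"
    and H: "\<And>s. s \<in> \<Omega> \<Longrightarrow> (H has_field_derivative 0) (at s)"
  obtains A B where "\<And>s. s \<in> S \<Longrightarrow> G s = A + B * s"
proof (cases "S = {}")
  case False
  then obtain s0 where s0: "s0 \<in> S" by blast
  define C where "C = connected_component_set \<Omega> s0"
  have C: "open C" "connected C" "S \<subseteq> C" "C \<subseteq> \<Omega>" "s0 \<in> C"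
    using \<Omega> S s0 connected_component_maximal[OF s0 S] connected_component_subset[of \<Omega> s0]
    by (auto simp: C_def open_connected_component intro: connected_component_refl)
  have H0: "H s = H s0" if "s \<in> C" for s
    by (rule DERIV_zero_connected_constant[OF C(2,1) finite.emptyI, of H])
      (use C H that in \<open>auto intro!: continuous_at_imp_continuous_on DERIV_isCont\<close>)
  have D: "((\<lambda>s. G s - H s0 * s) has_field_derivative 0) (at s)" if "s \<in> C" for s
    using G[of s] H0[OF that] that C(4) by (auto intro!: derivative_eq_intros)
  have "G s - H s0 * s = G s0 - H s0 * s0" if "s \<in> C" for s
    by (rule DERIV_zero_connected_constant[OF C(2,1) finite.emptyI, of "\<lambda>s. G s - H s0 * s"])
      (use C D that in \<open>auto intro!: continuous_at_imp_continuous_on DERIV_isCont\<close>)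
  then show ?thesis using C(3) by (intro that[of "G s0 - H s0 * s0" "H s0"]) (auto simp: algebra_simps)
qed (use that in auto)

text \<open>For \<open>x \<noteq> l\<close> the substitution for \<open>l\<close> commutes with
  \<open>pd x\<close>. It is applied to the extrapolation from two points of the line in direction
  \<open>l\<close>.\<close>

lemma pd_linear:
  assumes f: "holo_wrt I W f" and g: "holo_wrt I W g" and x: "x \<in> I" "x \<noteq> l" and t: "t(l := s) \<in> W" "t(l := s') \<in> W"
  shows "pd x (\<lambda>t. a * f (t(l := s)) + b * g (t(l := s'))) t = a * pd x f (t(l := s)) + b * pd x g (t(l := s'))"
proof -
  have "((\<lambda>u. f ((t(l := s))(x := u))) has_field_derivative pd x f (t(l := s))) (at ((t(l := s)) x))"
    and "((\<lambda>u. g ((t(l := s'))(x := u))) has_field_derivative pd x g (t(l := s'))) (at ((t(l := s')) x))"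
    using holo_wrt_field_derivative[OF f t(1) x(1)] holo_wrt_field_derivative[OF g t(2) x(1)] by auto
  then have "((\<lambda>u. a * f ((t(x := u))(l := s)) + b * g ((t(x := u))(l := s'))) has_field_derivative
      a * pd x f (t(l := s)) + b * pd x g (t(l := s'))) (at (t x))"
    using x(2) by (auto intro!: derivative_eq_intros simp: fun_upd_twist)
  then show ?thesis unfolding pd_def by (rule DERIV_imp_deriv)
qed

lemma dep_pd:
  assumes "\<And>t t'. (\<forall>y\<in>I. t y = t' y) \<Longrightarrow> f t = f t'" "\<forall>y\<in>I. t y = t' y"
  shows "pd x f t = pd x f t'"
proof (cases "x \<in> I")
  case True
  have "f (t(x := s)) = f (t'(x := s))" for s using assms(2) by (intro assms(1)) auto
  then show ?thesis using True assms(2) by (simp add: pd_def)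
next
  case False
  have "f (t(x := s)) = f t" "f (t'(x := s)) = f t" for s using False assms(2) by (auto intro!: assms(1))
  then show ?thesis by (simp add: pd_def)
qed

lemma dep_pd_zero:
  assumes "\<And>t t'. (\<forall>y\<in>I. t y = t' y) \<Longrightarrow> f t = f t'" "x \<notin> I"
  shows "pd x f t = 0"
proof -
  have "f (t(x := s)) = f t" for s using assms(2) by (intro assms(1)) auto
  then show ?thesis by (simp add: pd_def)
qed

lemma potential_pd:
  assumes k0: "k 0 \<ge> 2" and ki: "\<forall>i\<in>{1..M}. k i \<ge> 1" and F: "is_potential M k U F" and t: "t \<in> U"
    and "a \<in> idx M k" "b \<in> idx M k" "c \<in> idx M k"
  shows "pd a (pd b (pd c F)) t = tripf M k t a b c"
proof -
  have "t \<in> hdom M k" using F t unfolding is_potential_def flat_dom_eq[OF k0 ki] by blast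
  then show ?thesis using assms triple_flat[of k M, OF k0 ki] unfolding is_potential_def by metis
qed

text \<open>A potential depends only on the coordinates of \<open>K\<close>, so its derivatives in
  the additional variable vanish, in agreement with the convention in the open WDVV
  equation.\<close>

lemma potential_pd_new:
  assumes k0: "k 0 \<ge> 2" and ki: "\<forall>i\<in>{1..N}. k i \<ge> 1" and F: "is_potential N k U F" and t: "t \<in> U"
    and "a \<in> locus_idx N k" "b \<in> locus_idx N k" "c \<in> idx N k"
  shows "pd a (pd b (pd c F)) t = (if a = (Suc N, 0) \<or> b = (Suc N, 0) then 0 else tripf N k t a b c)"
proof -
  have d0: "\<And>t t'. (\<forall>x\<in>idx N k. t x = t' x) \<Longrightarrow> F t = F t'" using F unfolding is_potential_def by blast
  have e: "(Suc N, 0) \<notin> idx N k" by (simp add: idx_iff)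
  have d1: "pd x F t = pd x F t'" if "\<forall>y\<in>idx N k. t y = t' y" for x t t' using dep_pd[OF d0 that] .
  have d2: "pd y (pd x F) t = pd y (pd x F) t'" if "\<forall>y\<in>idx N k. t y = t' y" for x y t t' using dep_pd[OF d1 that] .
  have 1: "pd (Suc N, 0) (pd b (pd c F)) t = 0" by (rule dep_pd_zero[OF d2 e])
  have "pd (Suc N, 0) (pd c F) = (\<lambda>_. 0)" by (rule ext, rule dep_pd_zero[OF d1 e])
  then have 2: "pd a (pd (Suc N, 0) (pd c F)) t = 0" by simp
  show ?thesis
    using 1 2 potential_pd[OF k0 ki F t, of a b c] assms(5-) by (auto simp: locus_idx_def)
qed

lemma hdom_last: "t \<in> hdom (Suc N) k \<Longrightarrow> t (Suc N, k (Suc N)) \<noteq> 0"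
  by (simp add: hdom_def)

lemma degen_upd_ev:
  assumes t: "t \<in> degen N k" and \<alpha>: "\<alpha> \<in> locus_idx N k"
  shows "\<forall>\<^sub>F u in nhds (t \<alpha>). t(\<alpha> := u) \<in> degen N k"
proof -
  have "t \<in> nbhd N k" using t by (simp add: degen_def)
  from eventually_upd[OF open_nbhd this, of \<alpha>] show ?thesis
  proof eventually_elim
    case (elim u)
    have neq: "(Suc N, \<beta>) \<noteq> \<alpha>" if "\<beta> \<in> {1..k (Suc N)}" for \<beta>
      using \<alpha> that by (auto simp: locus_idx_def idx_iff)
    then have "(t(\<alpha> := u)) (Suc N, \<beta>) = 0" if "\<beta> \<in> {1..k (Suc N)}" for \<beta>
      using fun_upd_other[OF neq[OF that], of t u] t that by (simp add: degen_def)
    then show ?case using elim unfolding degen_def by blast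
  qed
qed

text \<open>The set \<open>D\<close> is stable under small moves along the locus, so that
  derivatives of \<open>Fo\<close> at a point of \<open>D\<close> only involve points where
  \<open>Fo\<close> is known to be the limit.\<close>

lemma open_potential:
  assumes k0: "k 0 \<ge> 2" and ki: "\<forall>i\<in>{1..Suc N}. k i \<ge> 1" and m: "k (Suc N) \<ge> 2"
    and pot: "is_potential (Suc N) k W FL" and S: "connected S" "0 islimpt S"
    and D: "D \<subseteq> degen N k" and ev: "\<And>t \<alpha>. t \<in> D \<Longrightarrow> \<alpha> \<in> locus_idx N k \<Longrightarrow> \<forall>\<^sub>F u in nhds (t \<alpha>). t(\<alpha> := u) \<in> D"
    and sub: "\<And>t s. t \<in> D \<Longrightarrow> s \<in> S \<Longrightarrow> t((Suc N, k (Suc N)) := s) \<in> W"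
  obtains Fo where "restricts_to N k S D FL Fo" "holo_wrt (locus_idx N k) D Fo"
    "\<And>t \<alpha> \<beta>. t \<in> D \<Longrightarrow> \<alpha> \<in> locus_idx N k \<Longrightarrow> \<beta> \<in> locus_idx N k \<Longrightarrow> pd \<alpha> (pd \<beta> Fo) t = open_trip N k t \<alpha> \<beta>"
proof (cases "D = {}")
  case True
  then show ?thesis by (intro that[of "\<lambda>_. 0"]) (auto simp: restricts_to_def holo_wrt_def)
next
  case False
  let ?l = "(Suc N, k (Suc N))" and ?o = "(Suc N, 1::nat)"
  let ?I = "idx (Suc N) k"
  have lo: "?l \<in> ?I" "?o \<in> ?I" using m by (auto simp: idx_iff)
  have LI: "\<alpha> \<in> ?I" "\<alpha> \<noteq> ?l" "\<alpha> \<noteq> ?o" if "\<alpha> \<in> locus_idx N k" for \<alpha>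
    using that m by (auto simp: locus_idx_def idx_def)
  have W: "open W" "W \<subseteq> hdom (Suc N) k" and FL: "holo_wrt ?I W FL"
    using pot unfolding is_potential_def flat_dom_eq[OF k0 ki] by blast+
  define g where "g = pd ?o FL"
  have g: "holo_wrt ?I W g" unfolding g_def by (rule holo_wrt_pd[OF W(1) FL lo(2)])
  \<comment> \<open>For \<open>s = 0\<close> a point of the line would lie in the domain of
    \<open>FL\<close>, where the last coordinate is nonzero. A point of \<open>D\<close> is needed
    to say so, hence the separate case \<open>D = {}\<close>.\<close>
  have S0: "0 \<notin> S"
  proof
    assume "0 \<in> S"
    moreover obtain t where "t \<in> D" using False by blast
    ultimately have "t(?l := 0) \<in> hdom (Suc N) k" using sub W(2) by blast
    then show False using hdom_last by fastforce
  qed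
  \<comment> \<open>The second derivative in \<open>s\<close> is the triple computed in
    \<open>tripf_line\<close>, which is zero.\<close>
  have line: "\<exists>A B. \<forall>s\<in>S. g (t(?l := s)) = A + B * s" if t: "t \<in> D" for t
  proof -
    have pl: "holo_wrt ?I W (pd ?l g)" by (rule holo_wrt_pd[OF W(1) g lo(1)])
    have "pd ?l (pd ?l g) (t(?l := s)) = 0" if s: "t(?l := s) \<in> W" for s
    proof -
      have "s \<noteq> 0" using hdom_last[of "t(?l := s)" N k] s W(2) by auto
      then show ?thesis
        unfolding g_def using potential_pd[OF k0 ki pot s lo(1,1,2)] tripf_line[OF k0 ki m, of t s] t D by auto
    qed
    then have H: "((\<lambda>s. pd ?l g (t(?l := s))) has_field_derivative 0) (at s)" if "t(?l := s) \<in> W" for s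
      using holo_wrt_field_derivative'[OF pl that lo(1)] that by simp
    obtain A B where "\<And>s. s \<in> S \<Longrightarrow> g (t(?l := s)) = A + B * s"
    proof (rule locally_affine_on_connected[of "{s. t(?l := s) \<in> W}" S "\<lambda>s. g (t(?l := s))" "\<lambda>s. pd ?l g (t(?l := s))"])
      show "((\<lambda>s. g (t(?l := s))) has_field_derivative pd ?l g (t(?l := s))) (at s)" if "s \<in> {s. t(?l := s) \<in> W}" for s
        using holo_wrt_field_derivative'[OF g _ lo(1)] that by blast
    qed (use open_upd[OF W(1)] S(1) sub[OF t] H in auto)
    then show ?thesis by blast
  qed
  \<comment> \<open>the value at \<open>0\<close> of the affine function of \<open>s\<close> with the given values at \<open>s\<close> and \<open>s'\<close>\<close>
  define \<Phi> where "\<Phi> = (\<lambda>s s' t. s' / (s' - s) * g (t(?l := s)) + - s / (s' - s) * g (t(?l := s')))"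
  have val: "\<Phi> s s' t = A" if "\<forall>s\<in>S. g (t(?l := s)) = A + B * s" "s \<in> S" "s' \<in> S" "s \<noteq> s'" for s s' t A B
  proof -
    have "\<Phi> s s' t = s' / (s' - s) * (A + B * s) + - s / (s' - s) * (A + B * s')" using that by (simp add: \<Phi>_def)
    also have "\<dots> = (s' * (A + B * s) - s * (A + B * s')) / (s' - s)" by (simp add: diff_divide_distrib)
    also have "s' * (A + B * s) - s * (A + B * s') = A * (s' - s)" by (simp add: algebra_simps)
    finally show ?thesis using that(4) by simp
  qed
  have p1: "pd \<beta> (\<Phi> s s') t = s' / (s' - s) * pd \<beta> g (t(?l := s)) + - s / (s' - s) * pd \<beta> g (t(?l := s'))"
    if "t(?l := s) \<in> W" "t(?l := s') \<in> W" "\<beta> \<in> locus_idx N k" for s s' t \<beta>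
    unfolding \<Phi>_def by (rule pd_linear[OF g g _ _ that(1,2)]) (use LI that in auto)
  have p2: "pd \<alpha> (pd \<beta> (\<Phi> s s')) t = s' / (s' - s) * trip_ext N k (t(?l := s)) \<alpha> \<beta> ?o + - s / (s' - s) * trip_ext N k (t(?l := s')) \<alpha> \<beta> ?o"
    if w: "t(?l := s) \<in> W" "t(?l := s') \<in> W" and \<alpha>: "\<alpha> \<in> locus_idx N k" and \<beta>: "\<beta> \<in> locus_idx N k" for s s' t \<alpha> \<beta>
  proof -
    have a: "\<alpha> \<noteq> ?l" "\<alpha> \<in> ?I" "\<beta> \<in> ?I" using LI \<alpha> \<beta> by auto
    have e: "\<forall>\<^sub>F u in nhds (t \<alpha>). (t(\<alpha> := u))(?l := s) \<in> W" if "t(?l := s) \<in> W" for s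
      using eventually_upd[OF W(1) that, of \<alpha>] a(1) by (simp add: fun_upd_twist)
    have b: "holo_wrt ?I W (pd \<beta> g)" by (rule holo_wrt_pd[OF W(1) g a(3)])
    have T: "pd \<alpha> (pd \<beta> g) (t(?l := s)) = trip_ext N k (t(?l := s)) \<alpha> \<beta> ?o" if "t(?l := s) \<in> W" for s
      unfolding g_def potential_pd[OF k0 ki pot that a(2,3) lo(2)]
      using tripf_eq_trip_ext[OF k0 ki _ \<alpha> a(3) lo(2)] that W(2) by blast
    have "pd \<alpha> (pd \<beta> (\<Phi> s s')) t = pd \<alpha> (\<lambda>t. s' / (s' - s) * pd \<beta> g (t(?l := s)) + - s / (s' - s) * pd \<beta> g (t(?l := s'))) t"
      by (rule pd_eventually_cong, use e[OF w(1)] e[OF w(2)] in eventually_elim) (rule p1[OF _ _ \<beta>])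
    also have "\<dots> = s' / (s' - s) * pd \<alpha> (pd \<beta> g) (t(?l := s)) + - s / (s' - s) * pd \<alpha> (pd \<beta> g) (t(?l := s'))"
      by (rule pd_linear[OF b b a(2,1) w])
    finally show ?thesis unfolding T[OF w(1)] T[OF w(2)] .
  qed
  have "infinite S" using S(2) islimpt_finite by blast
  then obtain s0 where "s0 \<in> S" by (metis finite.emptyI ex_in_conv)
  moreover obtain s1 where "s1 \<in> S - {s0}"
    using infinite_remove[OF \<open>infinite S\<close>, of s0] by (metis finite.emptyI ex_in_conv)
  ultimately have s: "s0 \<in> S" "s1 \<in> S" "s0 \<noteq> s1" by auto
  have nt: "at 0 within S \<noteq> bot" using S(2) by (simp add: trivial_limit_within)
  \<comment> \<open>Near \<open>t\<close> in \<open>D\<close> both extrapolations give the constant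
    term of the same affine function, so moving the second point does not change the
    derivatives.\<close>
  have indep: "pd \<alpha> (pd \<beta> (\<Phi> s0 s1)) t = pd \<alpha> (pd \<beta> (\<Phi> s0 s')) t"
    if t: "t \<in> D" and \<alpha>: "\<alpha> \<in> locus_idx N k" and \<beta>: "\<beta> \<in> locus_idx N k" and s': "s' \<in> S" "s' \<noteq> s0" for t \<alpha> \<beta> s'
  proof (rule pd_eventually_cong, use ev[OF t \<alpha>] in eventually_elim)
    case (elim u)
    show ?case
    proof (rule pd_eventually_cong, use ev[OF elim \<beta>] in eventually_elim)
      case (elim v)
      from line[OF this] obtain A B where AB: "\<forall>s\<in>S. g (t(\<alpha> := u, \<beta> := v, ?l := s)) = A + B * s" by blast
      show ?case using val[OF AB s] val[OF AB s(1) s'(1)] s'(2) by simp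
    qed
  qed
  show ?thesis
  proof (rule that[of "\<Phi> s0 s1"])
    show "restricts_to N k S D FL (\<Phi> s0 s1)"
      unfolding restricts_to_def g_def[symmetric]
    proof
      fix t assume "t \<in> D"
      from line[OF this] obtain A B where AB: "\<forall>s\<in>S. g (t(?l := s)) = A + B * s" by blast
      have "((\<lambda>s. A + B * s) \<longlongrightarrow> A + B * 0) (at 0 within S)" by (intro tendsto_intros)
      then have "((\<lambda>s. A + B * s) \<longlongrightarrow> \<Phi> s0 s1 t) (at 0 within S)" using val[OF AB s] by simp
      then show "((\<lambda>s. g (t(?l := s))) \<longlongrightarrow> \<Phi> s0 s1 t) (at 0 within S)"
        by (rule Lim_transform_eventually) (use AB in \<open>auto simp: eventually_at_filter\<close>)
    qed
    have h: "holo_wrt (locus_idx N k) D (\<lambda>t. g (t(?l := s)))" if "s \<in> S" for s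
      unfolding holo_wrt_def
    proof (intro conjI ballI)
      have "continuous_on D (g \<circ> (\<lambda>t. t(?l := s)))"
      proof (rule continuous_on_compose)
        show "continuous_on D (\<lambda>t. t(?l := s))" by (intro continuous_on_upd continuous_intros)
        show "continuous_on ((\<lambda>t. t(?l := s)) ` D) g"
          using g sub that by (auto simp: holo_wrt_def intro: continuous_on_subset)
      qed
      then show "continuous_on D (\<lambda>t. g (t(?l := s)))" by (simp add: comp_def)
      fix t x assume t: "t \<in> D" and x: "x \<in> locus_idx N k"
      have "(\<lambda>u. g ((t(?l := s))(x := u))) field_differentiable at ((t(?l := s)) x)"
        using g sub[OF t that] LI(1)[OF x] unfolding holo_wrt_def by blast
      then show "(\<lambda>u. g (t(x := u, ?l := s))) field_differentiable at (t x)"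
        using LI(2)[OF x] by (simp add: fun_upd_twist)
    qed
    show "holo_wrt (locus_idx N k) D (\<Phi> s0 s1)"
      unfolding \<Phi>_def by (intro holo_wrt_add holo_wrt_mult holo_wrt_const h s)
    fix t \<alpha> \<beta> assume t: "t \<in> D" and \<alpha>: "\<alpha> \<in> locus_idx N k" and \<beta>: "\<beta> \<in> locus_idx N k"
    have td: "t \<in> degen N k" "t \<in> nbhd N k" using t D by (auto simp: degen_def)
    have tl: "t(?l := 0) = t" using td(1) m by (auto simp: degen_def fun_upd_idem_iff)
    have s0: "s0 \<noteq> 0" using s S0 by auto
    \<comment> \<open>As the second point \<open>s\<close> tends to \<open>0\<close>, the weight of
      \<open>?T s0\<close> tends to \<open>0\<close> and that of \<open>?T s\<close> to
      \<open>1\<close>, while \<open>?T\<close> is continuous at \<open>0\<close> by the holomorphic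
      extension.\<close>
    let ?T = "\<lambda>s. trip_ext N k (t(?l := s)) \<alpha> \<beta> ?o"
    have "?T holomorphic_on UNIV"
      by (rule holo_wrt_holomorphic_on[OF holo_trip_ext[OF k0 ki \<alpha> LI(1)[OF \<beta>] lo(2)], of _ UNIV])
        (use nbhd_upd[OF td(2)] m in auto)
    from holomorphic_on_imp_continuous_on[OF this]
    have "(?T \<longlongrightarrow> ?T 0) (at 0 within UNIV)" unfolding continuous_on_def by blast
    then have T0: "(?T \<longlongrightarrow> ?T 0) (at 0 within S)" by (rule tendsto_within_subset) simp
    have "((\<lambda>s. s / (s - s0) * ?T s0 + - s0 / (s - s0) * ?T s) \<longlongrightarrow> 0 / (0 - s0) * ?T s0 + - s0 / (0 - s0) * ?T 0) (at 0 within S)"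
      using s0 by (intro tendsto_intros T0) auto
    then have "((\<lambda>s. s / (s - s0) * ?T s0 + - s0 / (s - s0) * ?T s) \<longlongrightarrow> open_trip N k t \<alpha> \<beta>) (at 0 within S)"
      using s0 m trip_ext_degen[OF td(1) _ \<alpha> \<beta> lo(2)] by (simp add: tl)
    moreover have "((\<lambda>s. s / (s - s0) * ?T s0 + - s0 / (s - s0) * ?T s) \<longlongrightarrow> pd \<alpha> (pd \<beta> (\<Phi> s0 s1)) t) (at 0 within S)"
    proof (rule Lim_transform_eventually[OF tendsto_const])
      have "\<forall>\<^sub>F s in at 0 within S. s \<in> S \<and> s \<noteq> s0"
        using s0 eventually_neq_at_within[of s0 0 S] by (auto simp: eventually_at_filter elim: eventually_mono)
      then show "\<forall>\<^sub>F s in at 0 within S. pd \<alpha> (pd \<beta> (\<Phi> s0 s1)) t = s / (s - s0) * ?T s0 + - s0 / (s - s0) * ?T s"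
        by eventually_elim (use indep[OF t \<alpha> \<beta>] p2[OF sub[OF t s(1)] sub[OF t] \<alpha> \<beta>] in auto)
    qed
    ultimately show "pd \<alpha> (pd \<beta> (\<Phi> s0 s1)) t = open_trip N k t \<alpha> \<beta>"
      using tendsto_unique[OF nt] by blast
  qed
qed

section \<open>The extended product and the open solution\<close>

lemma degen_closure:
  assumes t: "t \<in> degen N k" and kn: "k (Suc N) \<ge> 1"
  shows "t \<in> closure (hdom (Suc N) k)"
proof (rule ccontr)
  let ?l = "(Suc N, k (Suc N))" and ?U = "- closure (hdom (Suc N) k)"
  assume "t \<notin> closure (hdom (Suc N) k)"
  then have "\<forall>\<^sub>F s in nhds (t ?l). t(?l := s) \<in> ?U" by (intro eventually_upd) auto
  moreover have "t ?l = 0" using t kn by (simp add: degen_def)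
  ultimately have "\<forall>\<^sub>F s in at 0. s \<noteq> 0 \<and> t(?l := s) \<in> ?U"
    by (auto simp: eventually_at_filter elim: eventually_mono)
  then obtain s where s: "s \<noteq> 0" "t(?l := s) \<in> ?U" using eventually_happens by force
  have "t(?l := s) \<in> hdom (Suc N) k" using t kn s(1) by (intro nbhd_upd_hdom) (auto simp: degen_def)
  then show False using s(2) closure_subset by blast
qed

definition struct_const :: "nat \<Rightarrow> (nat \<Rightarrow> nat) \<Rightarrow> nat \<times> nat \<Rightarrow> nat \<times> nat \<Rightarrow> nat \<times> nat \<Rightarrow> point \<Rightarrow> complex" where
  "struct_const N k a b d t = (\<Sum>e\<in>idx (Suc N) k. trip_ext N k t a b e * ieta k e d)"

lemma locus_idx_subset: "locus_idx N k \<subseteq> idx (Suc N) k"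
  by (auto simp: locus_idx_def idx_def)

lemma dual_block: "fst (dual k x) = fst x"
  by (simp add: dual_def split: prod.splits)

context
  fixes N :: nat and k :: "nat \<Rightarrow> nat"
  assumes k0: "k 0 \<ge> 2" and ki: "\<forall>i\<in>{1..Suc N}. k i \<ge> 1"
begin

lemma struct_const_eq:
  assumes "d \<in> idx (Suc N) k"
  shows "struct_const N k a b d t = trip_ext N k t a b (dual k d) * ieta k (dual k d) d"
proof -
  have "struct_const N k a b d t = (\<Sum>e\<in>idx (Suc N) k. if e = dual k d then trip_ext N k t a b (dual k d) * ieta k (dual k d) d else 0)"
    unfolding struct_const_def
  proof (intro sum.cong refl)
    fix e assume e: "e \<in> idx (Suc N) k"
    show "trip_ext N k t a b e * ieta k e d = (if e = dual k d then trip_ext N k t a b (dual k d) * ieta k (dual k d) d else 0)"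
    proof (cases "e = dual k d")
      case False
      then have "d \<noteq> dual k e" using dual_dual[of k "Suc N", OF k0 ki e] by auto
      then show ?thesis using False by (simp add: ieta_def)
    qed simp
  qed
  then show ?thesis using dual_idx[of k "Suc N", OF k0 ki assms] by simp
qed

text \<open>Raising the index sends \<open>(Suc N, 1)\<close>, the only index of the new block with
  a nonzero triple, to \<open>(Suc N, 0)\<close>. Therefore products of tangent fields stay tangent
  to the locus.\<close>

lemma struct_const_degen:
  assumes t: "t \<in> degen N k" and a: "a \<in> locus_idx N k" and b: "b \<in> locus_idx N k" and d: "d \<in> idx (Suc N) k"
  shows "struct_const N k a b d t = (if d = (Suc N, 0) then open_trip N k t a b else if fst d = Suc N then 0
     else (\<Sum>e\<in>idx N k. (if a = (Suc N, 0) \<or> b = (Suc N, 0) then 0 else tripf N k t a b e) * ieta k e d))"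
proof -
  let ?e = "(Suc N, 0)"
  have kn: "k (Suc N) \<ge> 1" using ki by simp
  have dd: "dual k d \<in> idx (Suc N) k" by (rule dual_idx[of k "Suc N", OF k0 ki d])
  note T = trip_ext_degen[OF t kn a b]
  show ?thesis
  proof (cases "fst d = Suc N")
    case True
    then obtain \<delta> where d': "d = (Suc N, \<delta>)" "\<delta> \<le> k (Suc N)" using d by (cases d) (auto simp: idx_iff)
    have "snd (dual k d) = 1 \<longleftrightarrow> \<delta> = 0" using d' by (auto simp: dual_def)
    moreover have "ieta k (dual k ?e) ?e = 1" by (simp add: ieta_def dual_def eta0_def)
    ultimately show ?thesis unfolding struct_const_eq[OF d] T[OF dd] using True d' by (simp add: dual_block)
  next
    case False
    then have dN: "d \<in> idx N k" using d by (cases d) (auto simp: idx_iff split: if_splits)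
    have "struct_const N k a b d t = (\<Sum>e\<in>idx N k. trip_ext N k t a b e * ieta k e d)"
      unfolding struct_const_def
    proof (rule sum.mono_neutral_right[OF finite_idx])
      show "\<forall>e\<in>idx (Suc N) k - idx N k. trip_ext N k t a b e * ieta k e d = 0"
      proof
        fix e assume e: "e \<in> idx (Suc N) k - idx N k"
        then have "fst e = Suc N" by (cases e) (auto simp: idx_iff split: if_splits)
        then have "d \<noteq> dual k e" using False dual_block[of k e] by auto
        then show "trip_ext N k t a b e * ieta k e d = 0" by (simp add: ieta_def)
      qed
    qed (auto simp: idx_def)
    also have "\<dots> = (\<Sum>e\<in>idx N k. (if a = ?e \<or> b = ?e then 0 else tripf N k t a b e) * ieta k e d)"
    proof (intro sum.cong refl)
      fix e assume e: "e \<in> idx N k"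
      then have "fst e \<noteq> Suc N" "e \<in> idx (Suc N) k" by (auto simp: idx_def)
      then show "trip_ext N k t a b e * ieta k e d = (if a = ?e \<or> b = ?e then 0 else tripf N k t a b e) * ieta k e d"
        using T[of e] by simp
    qed
    finally show ?thesis using False by auto
  qed
qed

text \<open>The pairing is constant in flat coordinates, so it extends by the constants
  \<open>eta0\<close>; only the structure constants need the analysis at the new pole.\<close>

lemma extension: "locus_extension N k (nbhd N k) (\<lambda>a b t. eta0 k a b) (struct_const N k)"
proof -
  have ki': "\<forall>i\<in>{1..N}. k i \<ge> 1" using ki by auto
  note L = locus_eq_degen[of k N, OF k0 ki'] and F = flat_dom_eq[of k "Suc N", OF k0 ki]
  show ?thesis
    unfolding locus_extension_def L F
  proof (intro conjI ballI)
    show "degen N k \<subseteq> nbhd N k" by (auto simp: degen_def)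
    show "degen N k \<subseteq> closure (hdom (Suc N) k)" using degen_closure[of _ N k] ki by auto
  next
    fix a b t assume "a \<in> idx (Suc N) k" "b \<in> idx (Suc N) k" "t \<in> nbhd N k \<inter> hdom (Suc N) k"
    then show "eta0 k a b = flat_eta (Suc N) k a b t" using flat_eta_eq[of k "Suc N", OF k0 ki] by simp
  next
    fix a b d assume "a \<in> locus_idx N k" "b \<in> idx (Suc N) k" "d \<in> idx (Suc N) k"
    then show "holo_wrt (idx (Suc N) k) (nbhd N k) (struct_const N k a b d)"
      unfolding struct_const_def by (intro holo_wrt_sum holo_wrt_mult holo_wrt_const holo_trip_ext k0 ki)
  next
    fix a b t assume a: "a \<in> locus_idx N k" and b: "b \<in> idx (Suc N) k" and t: "t \<in> nbhd N k \<inter> hdom (Suc N) k"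
    have a': "a \<in> idx (Suc N) k" using a locus_idx_subset by blast
    have t': "t \<in> hdom (Suc N) k" using t by simp
    have "(\<Sum>e\<in>idx (Suc N) k. tripf (Suc N) k t a b e * ieta k e d) = struct_const N k a b d t" for d
      unfolding struct_const_def by (intro sum.cong refl) (simp add: tripf_eq_trip_ext[OF k0 ki t' a b])
    then show "hf_prod (Suc N) k (flat_pt (Suc N) k t) (flat_vec (Suc N) k a t) (flat_vec (Suc N) k b t)
           = (\<lambda>x. \<Sum>d\<in>idx (Suc N) k. struct_const N k a b d t * flat_vec (Suc N) k d t x)"
      unfolding hf_prod_eq[of k "Suc N", OF k0 ki t' a' b] by simp
  next
    fix a b d t assume "a \<in> locus_idx N k" "b \<in> locus_idx N k" and d: "d \<in> idx (Suc N) k - locus_idx N k" and "t \<in> degen N k"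
    moreover have "d \<noteq> (Suc N, 0)" "fst d = Suc N"
      using d by (cases d; auto simp: locus_idx_def idx_iff split: if_splits)+
    ultimately show "struct_const N k a b d t = 0" using struct_const_degen by simp
  qed (auto simp: open_nbhd holo_wrt_const)
qed

lemma open_solution:
  assumes m: "k (Suc N) \<ge> 2" and FK: "is_potential N k V FK" and FL: "is_potential (Suc N) k W FL"
    and S: "connected S" "0 islimpt S" and sub: "\<forall>t\<in>V \<inter> locus N k. \<forall>s\<in>S. t((Suc N, k (Suc N)) := s) \<in> W"
  obtains Fo where "restricts_to N k S (V \<inter> locus N k) FL Fo" "holo_wrt (locus_idx N k) (V \<inter> locus N k) Fo"
    "open_wdvv (idx N k) (Suc N, 0) (eta_inv N k) (V \<inter> locus N k) FK Fo"
    "\<forall>t\<in>V \<inter> locus N k. \<forall>a\<in>locus_idx N k. \<forall>b\<in>locus_idx N k. \<forall>d\<in>locus_idx N k.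
            struct_const N k a b d t = open_prod (idx N k) (Suc N, 0) (eta_inv N k) FK Fo a b d t"
proof -
  let ?D = "V \<inter> locus N k" and ?e = "(Suc N, 0)"
  have ki': "\<forall>i\<in>{1..N}. k i \<ge> 1" using ki by auto
  note L = locus_eq_degen[of k N, OF k0 ki']
  have V: "open V" using FK by (simp add: is_potential_def)
  obtain Fo where R: "restricts_to N k S ?D FL Fo" and H: "holo_wrt (locus_idx N k) ?D Fo"
    and O: "\<And>t \<alpha> \<beta>. t \<in> ?D \<Longrightarrow> \<alpha> \<in> locus_idx N k \<Longrightarrow> \<beta> \<in> locus_idx N k \<Longrightarrow> pd \<alpha> (pd \<beta> Fo) t = open_trip N k t \<alpha> \<beta>"
  proof (rule open_potential[OF k0 ki m FL S, of ?D])
    fix t \<alpha> assume "t \<in> ?D" "\<alpha> \<in> locus_idx N k"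
    then show "\<forall>\<^sub>F u in nhds (t \<alpha>). t(\<alpha> := u) \<in> ?D"
      using eventually_upd[OF V, of t \<alpha>] degen_upd_ev[of t N k \<alpha>] unfolding L by (auto elim: eventually_elim2)
  qed (use sub L in auto)
  have Dt: "t \<in> V" "t \<in> degen N k" "t \<in> hdom N k" "\<forall>i\<in>{1..N}. t ?e \<noteq> t (i, 0)" if "t \<in> ?D" for t
  proof -
    show t: "t \<in> V" "t \<in> degen N k" using that L by auto
    then show "t \<in> hdom N k" by (auto simp: degen_def intro: nbhd_hdom)
    show "\<forall>i\<in>{1..N}. t ?e \<noteq> t (i, 0)"
    proof
      fix i assume "i \<in> {1..N}"
      then show "t ?e \<noteq> t (i, 0)" using nbhd_neq[of t N k "Suc N" i] t(2) by (auto simp: degen_def)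
    qed
  qed
  note C = potential_pd_new[OF k0 ki' FK Dt(1)]
  have li: "x \<in> idx N k \<Longrightarrow> x \<in> locus_idx N k" "?e \<in> locus_idx N k" for x by (auto simp: locus_idx_def)
  have W: "open_wdvv (idx N k) ?e (eta_inv N k) ?D FK Fo"
    unfolding open_wdvv_def locus_idx_def[symmetric]
  proof (intro ballI)
    fix t \<alpha> \<beta> \<gamma> assume t: "t \<in> ?D" and abc: "\<alpha> \<in> locus_idx N k" "\<beta> \<in> locus_idx N k" "\<gamma> \<in> locus_idx N k"
    have side: "(\<Sum>\<mu>\<in>idx N k. \<Sum>\<nu>\<in>idx N k. pd \<alpha> (pd \<beta> (pd \<mu> FK)) t * eta_inv N k t \<mu> \<nu> * pd \<nu> (pd \<gamma> Fo) t)
          + pd \<alpha> (pd \<beta> Fo) t * pd ?e (pd \<gamma> Fo) t = wdvv_lhs N k t \<alpha> \<beta> \<gamma>"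
      if "\<alpha> \<in> locus_idx N k" "\<beta> \<in> locus_idx N k" "\<gamma> \<in> locus_idx N k" for \<alpha> \<beta> \<gamma>
      unfolding wdvv_lhs_def[of k N t, OF k0 ki' Dt(3,4)[OF t]] eta_inv_eq[of k N, OF k0 ki' Dt(3)[OF t]]
      using that by (intro arg_cong2[of _ _ _ _ "(+)"] arg_cong2[of _ _ _ _ "(*)"] sum.cong refl) (auto simp: C[OF t] O[OF t] li)
    show "(\<Sum>\<mu>\<in>idx N k. \<Sum>\<nu>\<in>idx N k. pd \<alpha> (pd \<beta> (pd \<mu> FK)) t * eta_inv N k t \<mu> \<nu> * pd \<nu> (pd \<gamma> Fo) t)
          + pd \<alpha> (pd \<beta> Fo) t * pd ?e (pd \<gamma> Fo) t =
        (\<Sum>\<mu>\<in>idx N k. \<Sum>\<nu>\<in>idx N k. pd \<gamma> (pd \<beta> (pd \<mu> FK)) t * eta_inv N k t \<mu> \<nu> * pd \<nu> (pd \<alpha> Fo) t)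
          + pd \<gamma> (pd \<beta> Fo) t * pd ?e (pd \<alpha> Fo) t"
      unfolding side[OF abc] side[OF abc(3,2,1)] by (rule open_wdvv_trip[of k N t, OF k0 ki' Dt(3,4)[OF t] abc])
  qed
  have P: "struct_const N k a b d t = open_prod (idx N k) ?e (eta_inv N k) FK Fo a b d t"
    if t: "t \<in> ?D" and ab: "a \<in> locus_idx N k" "b \<in> locus_idx N k" and d: "d \<in> locus_idx N k" for t a b d
  proof (cases "d = ?e")
    case True
    have "d \<in> idx (Suc N) k" using d locus_idx_subset by blast
    then show ?thesis using struct_const_degen[OF Dt(2)[OF t] ab] O[OF t ab] True by (simp add: open_prod_def)
  next
    case False
    then have dN: "d \<in> idx N k" using d by (auto simp: locus_idx_def)
    then have "d \<in> idx (Suc N) k" "fst d \<noteq> Suc N" by (auto simp: idx_def)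
    then have "struct_const N k a b d t = (\<Sum>e\<in>idx N k. (if a = ?e \<or> b = ?e then 0 else tripf N k t a b e) * ieta k e d)"
      using struct_const_degen[OF Dt(2)[OF t] ab] False by simp
    also have "\<dots> = (\<Sum>e\<in>idx N k. pd a (pd b (pd e FK)) t * eta_inv N k t e d)"
      unfolding eta_inv_eq[of k N, OF k0 ki' Dt(3)[OF t]]
      by (intro sum.cong refl) (simp add: C[OF t ab] dN)
    finally show ?thesis using False by (simp add: open_prod_def)
  qed
  show ?thesis by (rule that[OF R H W]) (use P in blast)
qed

end

theorem theorem1p1:
  fixes N :: nat and k :: "nat \<Rightarrow> nat"
  assumes "k 0 \<ge> 2" and "\<forall>i\<in>{1..Suc N}. k i \<ge> 1"
  shows "\<exists>U g c. locus_extension N k U g c \<and>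
    (k (Suc N) \<ge> 2 \<longrightarrow>
      (\<forall>V W S FK FL.
        is_potential N k V FK \<and> is_potential (Suc N) k W FL \<and>
        connected S \<and> 0 islimpt S \<and>
        (\<forall>t\<in>V \<inter> locus N k. \<forall>s\<in>S. t((Suc N, k (Suc N)) := s) \<in> W) \<longrightarrow>
        (\<exists>Fo. restricts_to N k S (V \<inter> locus N k) FL Fo \<and>
          holo_wrt (locus_idx N k) (V \<inter> locus N k) Fo \<and>
          open_wdvv (idx N k) (Suc N, 0) (eta_inv N k) (V \<inter> locus N k) FK Fo \<and>
          (\<forall>t\<in>V \<inter> locus N k. \<forall>a\<in>locus_idx N k. \<forall>b\<in>locus_idx N k. \<forall>d\<in>locus_idx N k.
            c a b d t = open_prod (idx N k) (Suc N, 0) (eta_inv N k) FK Fo a b d t))))"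
proof (rule exI[of _ "nbhd N k"], rule exI[of _ "\<lambda>a b t. eta0 k a b"], rule exI[of _ "struct_const N k"], intro conjI impI allI)
  show "locus_extension N k (nbhd N k) (\<lambda>a b t. eta0 k a b) (struct_const N k)"
    by (rule extension[OF assms])
  \<comment> \<open>The extension is fixed before the potentials, hence it is the same one for all
    their branches.\<close>
  fix V W S FK FL
  assume "k (Suc N) \<ge> 2" and "is_potential N k V FK \<and> is_potential (Suc N) k W FL \<and> connected S \<and> 0 islimpt S \<and>
        (\<forall>t\<in>V \<inter> locus N k. \<forall>s\<in>S. t((Suc N, k (Suc N)) := s) \<in> W)"
  then obtain Fo where "restricts_to N k S (V \<inter> locus N k) FL Fo" "holo_wrt (locus_idx N k) (V \<inter> locus N k) Fo"
    "open_wdvv (idx N k) (Suc N, 0) (eta_inv N k) (V \<inter> locus N k) FK Fo"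
    "\<forall>t\<in>V \<inter> locus N k. \<forall>a\<in>locus_idx N k. \<forall>b\<in>locus_idx N k. \<forall>d\<in>locus_idx N k.
            struct_const N k a b d t = open_prod (idx N k) (Suc N, 0) (eta_inv N k) FK Fo a b d t"
    using open_solution[of k N, OF assms] by metis
  then show "\<exists>Fo. restricts_to N k S (V \<inter> locus N k) FL Fo \<and>
          holo_wrt (locus_idx N k) (V \<inter> locus N k) Fo \<and>
          open_wdvv (idx N k) (Suc N, 0) (eta_inv N k) (V \<inter> locus N k) FK Fo \<and>
          (\<forall>t\<in>V \<inter> locus N k. \<forall>a\<in>locus_idx N k. \<forall>b\<in>locus_idx N k. \<forall>d\<in>locus_idx N k.
            struct_const N k a b d t = open_prod (idx N k) (Suc N, 0) (eta_inv N k) FK Fo a b d t)"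
    by blast
qed

end
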